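(* Let $x,w\in\mathfrak{S}_n$. Then $X_x$ is an irreducible component of the singular locus of the Schubert variety $X_w\subseteq SL_n(\mathbb{C})/B$ if and only if there are disjoint sequences $1\le \alpha_1<\cdots<\alpha_m\le n$ with $w(\alpha_1)>\cdots>w(\alpha_m)$ and $1\le\beta_1<\cdots<\beta_k\le n$ with $w(\beta_1)>\cdots>w(\beta_k)$ such that the following hold. (a) $x$ is obtained from $w$ by the cyclic rearrangement $$x(\alpha_1)=w(\beta_1),\quad x(\beta_j)=w(\beta_{j+1})\ (1\le j<k),\quad x(\beta_k)=w(\alpha_m),\quad x(\alpha_i)=w(\alpha_{i-1})\ (2\le i\le m),$$ and $x(i)=w(i)$ for all other $i$ (that is, $w=x\circ(\alpha_1,\ldots,\alpha_m,\beta_k,\ldots,\beta_1)$, where the cycle sends each listed entry to the next one). (b) One of the following cases holds: 1. (4231 case) $k,m\ge 2$; every one of $\beta_1,\ldots,\beta_{k-1}$ is greater than $\alpha_1$ and less than every one of $\alpha_2,\ldots,\alpha_m$; every one of $\alpha_2,\ldots,\alpha_m$ is less than $\beta_k$; and $w(\alpha_m)>w(\beta_1)$. 2. (3412 case) $k,m\ge 2$; every one of $\beta_1,\ldots,\beta_{k-1}$ is less than $\alpha_1$, $\alpha_1<\beta_k$, and $\beta_k$ is less than every one of $\alpha_2,\ldots,\alpha_m$; and $w(\alpha_{m-1})>w(\beta_1)>w(\alpha_m)>w(\beta_2)$. 3. (45312 case) $k=m=2$; $\beta_1<\alpha_1<\beta_2<\alpha_2$; $w(\alpha_1)>w(\beta_1)>w(\alpha_2)>w(\beta_2)$;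 and the entries of the permutation matrix of $w$ lying in the open rectangle $A=(\alpha_1,\beta_2)\times(w(\alpha_2),w(\beta_1))$ are in decreasing order (i.e. if $i<i'$ and $(i,w(i)),(i',w(i'))\in A$ then $w(i)>w(i')$). (c) The interior of the shaded region (defined in the context, depending on $x$, $w$ and on the case) contains no point $(i,w(i))$ with $i\notin\{\alpha_1,\ldots,\alpha_m,\beta_1,\ldots,\beta_k\}$.
   Context: $\mathfrak{S}_n$ is the symmetric group on $\{1,\dots,n\}$. $B\subset SL_n(\mathbb{C})$ is the subgroup of upper triangular matrices. For $w\in\mathfrak{S}_n$, $e_w$ is the corresponding torus-fixed point $wB$ of $SL_n(\mathbb{C})/B$, and $X_w$ is the closure of the $B$-orbit of $e_w$ (so $X_v\subseteq X_w$ iff $v\le w$ in Bruhat order). The permutation matrix of $w$ is viewed as the set of points $(i,w(i))$ in the plane. For real numbers $p,q$ put $r_w(p,q)=\#\{i\le p: w(i)\ge q\}$ and $d_{x,w}(p,q)=r_w(p,q)-r_x(p,q)$. Shaded region: in cases 1 and 2 it is $\{(p,q)\in\mathbb{R}^2: d_{x,w}(p,q)\ge 1\}$; in case 3 it is $\{(p,q)\in\mathbb{R}^2: d_{x,w}(p,q)\ge 1\}\setminus A$, where $A$ is the open rectangle named in case 3. *)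

theory Defs
  imports
    "HOL-Library.Function_Algebras"
    "HOL-Library.Extended_Nat"
    "HOL-Analysis.Elementary_Topology"
    "HOL-Analysis.Abstract_Topology"
    "HOL-Algebra.Coset"
    "HOL-Combinatorics.Permutations"
    "Jordan_Normal_Form.Determinant"
begin

section \<open>Topological notions\<close>

definition irreducible_subset :: "'a topology \<Rightarrow> 'a set \<Rightarrow> bool" where
  "irreducible_subset T S \<longleftrightarrow> S \<subseteq> topspace T \<and> S \<noteq> {} \<and>
     (\<forall>C D. closedin T C \<and> closedin T D \<and> S \<subseteq> C \<union> D \<longrightarrow> S \<subseteq> C \<or> S \<subseteq> D)"

definition irreducible_components :: "'a topology \<Rightarrow> 'a set \<Rightarrow> 'a set set" where
  "irreducible_components T S =
     {Z. Z \<subseteq> S \<and> irreducible_subset T Z \<and>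
         (\<forall>Z'. Z' \<subseteq> S \<and> irreducible_subset T Z' \<and> Z \<subseteq> Z' \<longrightarrow> Z' = Z)}"

definition krull_dim :: "'a topology \<Rightarrow> enat" where
  "krull_dim T = Sup {enat m | m. \<exists>Z :: nat \<Rightarrow> 'a set.
     (\<forall>i\<le>m. closedin T (Z i) \<and> irreducible_subset T (Z i)) \<and> (\<forall>i<m. Z i \<subset> Z (Suc i))}"

section \<open>Spaces with functions\<close>

text \<open>
  A topological space with a sheaf of complex-valued functions. The proposition
  \<open>regular_on S U f\<close> says that the restriction of \<open>f\<close> to the open set \<open>U\<close> is a section
  over \<open>U\<close>; the values of \<open>f\<close> outside \<open>U\<close> are irrelevant.
\<close>

record 'a fun_space =
  topo :: "'a topology"
  regular_on :: "'a set \<Rightarrow> ('a \<Rightarrow> complex) \<Rightarrow> bool"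

text \<open>The structure induced on a subset: regular functions extend locally to the ambient space.\<close>

definition subspace_on :: "'a fun_space \<Rightarrow> 'a set \<Rightarrow> 'a fun_space" where
  "subspace_on S X =
    \<lparr>topo = subtopology (topo S) X,
     regular_on = (\<lambda>U f. openin (subtopology (topo S) X) U \<and>
       (\<forall>a\<in>U. \<exists>V g. openin (topo S) V \<and> a \<in> V \<and> regular_on S V g \<and>
          (\<forall>b \<in> V \<inter> U. f b = g b)))\<rparr>"

text \<open>The quotient structure along \<open>h\<close>: the final topology, and \<open>f\<close> is regular iff \<open>f \<circ> h\<close> is.\<close>

definition quotient_space :: "'a fun_space \<Rightarrow> ('a \<Rightarrow> 'b) \<Rightarrow> 'b fun_space" where
  "quotient_space S h =
    (let T = topology (\<lambda>U. U \<subseteq> h ` topspace (topo S) \<and>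
                 openin (topo S) {a \<in> topspace (topo S). h a \<in> U})
     in \<lparr>topo = T,
         regular_on = (\<lambda>U f. openin T U \<and>
           regular_on S {a \<in> topspace (topo S). h a \<in> U} (f \<circ> h))\<rparr>)"

lemma openin_quotient_space:
  "openin (topo (quotient_space S h)) U \<longleftrightarrow>
     U \<subseteq> h ` topspace (topo S) \<and> openin (topo S) {a \<in> topspace (topo S). h a \<in> U}"
proof -
  let ?P = "\<lambda>U. {a \<in> topspace (topo S). h a \<in> U}"
  have inter: "?P (A \<inter> B) = ?P A \<inter> ?P B" for A B by auto
  have union: "?P (\<Union>\<K>) = \<Union>(?P ` \<K>)" for \<K> by auto
  have "istopology (\<lambda>U. U \<subseteq> h ` topspace (topo S) \<and> openin (topo S) (?P U))"
    unfolding istopology_def inter union by (blast intro: openin_Int openin_Union)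
  then show ?thesis
    by (simp add: quotient_space_def topology_inverse')
qed

lemma quotient_map_quotient_space:
  "quotient_map (topo S) (topo (quotient_space S h)) h"
proof -
  have "topspace (topo (quotient_space S h)) = h ` topspace (topo S)"
  proof
    show "topspace (topo (quotient_space S h)) \<subseteq> h ` topspace (topo S)"
      using openin_topspace[of "topo (quotient_space S h)"] by (simp only: openin_quotient_space)
    have "{a \<in> topspace (topo S). h a \<in> h ` topspace (topo S)} = topspace (topo S)" by auto
    then have "openin (topo (quotient_space S h)) (h ` topspace (topo S))"
      by (simp add: openin_quotient_space)
    then show "h ` topspace (topo S) \<subseteq> topspace (topo (quotient_space S h))"
      by (rule openin_subset)
  qed
  then show ?thesis by (auto simp: quotient_map_def openin_quotient_space)
qed

text \<open>
  The Zariski tangent space at \<open>p\<close>: the point derivations of the local ring at \<open>p\<close>. A derivation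
  is represented by a functional on functions defined near \<open>p\<close> that only depends on germs at \<open>p\<close>,
  normalised to vanish on functions that are not regular near \<open>p\<close>, so that distinct
  functionals correspond to distinct derivations.
\<close>

definition regular_at :: "'a fun_space \<Rightarrow> 'a \<Rightarrow> ('a \<Rightarrow> complex) \<Rightarrow> bool" where
  "regular_at S p f \<longleftrightarrow> (\<exists>U. openin (topo S) U \<and> p \<in> U \<and> regular_on S U f)"

definition tangent_space :: "'a fun_space \<Rightarrow> 'a \<Rightarrow> (('a \<Rightarrow> complex) \<Rightarrow> complex) set" where
  "tangent_space S p = {D.
     (\<forall>f g. regular_at S p f \<and> regular_at S p g \<longrightarrow>
        D (\<lambda>a. f a + g a) = D f + D g \<and>
        D (\<lambda>a. f a * g a) = f p * D g + D f * g p) \<and>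
     (\<forall>c f. regular_at S p f \<longrightarrow> D (\<lambda>a. c * f a) = c * D f) \<and>
     (\<forall>f g. regular_at S p f \<and> regular_at S p g \<and>
        (\<exists>U. openin (topo S) U \<and> p \<in> U \<and> (\<forall>a\<in>U. f a = g a)) \<longrightarrow> D f = D g) \<and>
     (\<forall>f. \<not> regular_at S p f \<longrightarrow> D f = 0)}"

abbreviation scale_functional ::
    "complex \<Rightarrow> (('a \<Rightarrow> complex) \<Rightarrow> complex) \<Rightarrow> ('a \<Rightarrow> complex) \<Rightarrow> complex" where
  "scale_functional \<equiv> (\<lambda>c D f. c * D f)"

lemma vector_space_scale_functional: "vector_space scale_functional"
  by unfold_locales (auto simp: fun_eq_iff algebra_simps)

lemma subspace_tangent_space: "module.subspace scale_functional (tangent_space S p)"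
proof -
  interpret vector_space "scale_functional :: complex \<Rightarrow> (('a \<Rightarrow> complex) \<Rightarrow> complex) \<Rightarrow> _"
    by (rule vector_space_scale_functional)
  show ?thesis
    unfolding subspace_def
  proof (intro conjI ballI allI)
    show "0 \<in> tangent_space S p" by (simp add: tangent_space_def)
  next
    fix D E assume "D \<in> tangent_space S p" "E \<in> tangent_space S p"
    then show "D + E \<in> tangent_space S p"
      unfolding tangent_space_def mem_Collect_eq plus_fun_apply
      apply (elim conjE)
      apply (intro conjI allI impI)
          apply (simp add: algebra_simps)
         apply (simp add: algebra_simps)
        apply (simp add: algebra_simps)
       apply (rule arg_cong2[where f = "(+)"]; blast)
      apply simp
      done
  next
    fix c D assume "D \<in> tangent_space S p"
    then show "scale_functional c D \<in> tangent_space S p"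
      unfolding tangent_space_def mem_Collect_eq
      apply (elim conjE)
      apply (intro conjI allI impI)
          apply (simp add: algebra_simps)
         apply (simp add: algebra_simps)
        apply (simp add: algebra_simps)
       apply (rule arg_cong[where f = "(*) c"]; blast)
      apply simp
      done
  qed
qed

text \<open>
  For an irreducible variety \<open>S\<close>, the point \<open>p\<close> is simple iff the dimension of the tangent space
  at \<open>p\<close> equals the dimension of \<open>S\<close>. This is only used for irreducible \<open>S\<close>; for a reducible variety
  the local dimension at \<open>p\<close> would have to be taken instead.
\<close>

definition singular_locus :: "'a fun_space \<Rightarrow> 'a set" where
  "singular_locus S = {p \<in> topspace (topo S).
     enat (vector_space.dim scale_functional (tangent_space S p)) \<noteq> krull_dim (topo S)}"

section \<open>The affine space of matrices\<close>

inductive_set poly_funs :: "nat \<Rightarrow> (complex mat \<Rightarrow> complex) set" for n :: nat where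
  const: "(\<lambda>A. c) \<in> poly_funs n"
| entry: "i < n \<Longrightarrow> j < n \<Longrightarrow> (\<lambda>A. A $$ (i, j)) \<in> poly_funs n"
| add: "f \<in> poly_funs n \<Longrightarrow> g \<in> poly_funs n \<Longrightarrow> (\<lambda>A. f A + g A) \<in> poly_funs n"
| mult: "f \<in> poly_funs n \<Longrightarrow> g \<in> poly_funs n \<Longrightarrow> (\<lambda>A. f A * g A) \<in> poly_funs n"

definition zariski_mat :: "nat \<Rightarrow> complex mat topology" where
  "zariski_mat n = topology (\<lambda>U. \<exists>F \<subseteq> poly_funs n. U = {A \<in> carrier_mat n n. \<exists>f\<in>F. f A \<noteq> 0})"

lemma openin_zariski_mat:
  "openin (zariski_mat n) U \<longleftrightarrow>
     (\<exists>F \<subseteq> poly_funs n. U = {A \<in> carrier_mat n n. \<exists>f\<in>F. f A \<noteq> 0})"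
proof -
  define D where "D F = {A \<in> carrier_mat n n. \<exists>f\<in>F. f A \<noteq> 0}" for F :: "(complex mat \<Rightarrow> complex) set"
  have D_I: "A \<in> D F" if "A \<in> carrier_mat n n" "f \<in> F" "f A \<noteq> 0" for A f F
    using that unfolding D_def by blast
  have D_E: thesis if "A \<in> D F" "\<And>f. A \<in> carrier_mat n n \<Longrightarrow> f \<in> F \<Longrightarrow> f A \<noteq> 0 \<Longrightarrow> thesis" for A F thesis
    using that unfolding D_def by blast
  have "istopology (\<lambda>U. \<exists>F \<subseteq> poly_funs n. U = D F)"
    unfolding istopology_def
  proof (intro conjI allI impI)
    fix U V assume "\<exists>F \<subseteq> poly_funs n. U = D F" "\<exists>F \<subseteq> poly_funs n. V = D F"
    then obtain F G where F: "F \<subseteq> poly_funs n" "U = D F" and G: "G \<subseteq> poly_funs n" "V = D G"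
      by (elim exE conjE)
    define H where "H = (\<lambda>(f, g). (\<lambda>A. f A * g A :: complex)) ` (F \<times> G)"
    have "U \<inter> V = D H"
    proof (rule equalityI; rule subsetI)
      fix A assume "A \<in> U \<inter> V"
      then have AF: "A \<in> D F" and AG: "A \<in> D G" by (simp_all add: F G)
      from AF obtain f where f: "A \<in> carrier_mat n n" "f \<in> F" "f A \<noteq> 0" by (rule D_E)
      from AG obtain g where g: "g \<in> G" "g A \<noteq> 0" by (rule D_E)
      have "(\<lambda>A. f A * g A) \<in> H"
        unfolding H_def by (rule image_eqI[where x = "(f, g)"]) (simp_all add: f g)
      with f(1) show "A \<in> D H" by (rule D_I) (simp add: f g)
    next
      fix A assume "A \<in> D H"
      then obtain h where h: "A \<in> carrier_mat n n" "h \<in> H" "h A \<noteq> 0" by (rule D_E)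
      from h(2) obtain f g where fg: "h = (\<lambda>A. f A * g A)" "f \<in> F" "g \<in> G"
        unfolding H_def by (elim imageE SigmaE) simp
      then have "f A \<noteq> 0" "g A \<noteq> 0" using h(3) by simp_all
      then have "A \<in> D F" "A \<in> D G" using D_I[OF h(1)] fg(2,3) by simp_all
      then show "A \<in> U \<inter> V" by (simp add: F G)
    qed
    moreover have "H \<subseteq> poly_funs n"
    proof
      fix h assume "h \<in> H"
      then obtain f g where fg: "h = (\<lambda>A. f A * g A)" "f \<in> F" "g \<in> G"
        unfolding H_def by (elim imageE SigmaE) simp
      show "h \<in> poly_funs n"
        unfolding fg(1)
        by (rule poly_funs.mult[OF subsetD[OF F(1) fg(2)] subsetD[OF G(1) fg(3)]])
    qed
    ultimately show "\<exists>F \<subseteq> poly_funs n. U \<inter> V = D F" by (intro exI[of _ H] conjI)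
  next
    fix \<K> assume "\<forall>K\<in>\<K>. \<exists>F \<subseteq> poly_funs n. K = D F"
    then obtain H where "\<forall>K\<in>\<K>. H K \<subseteq> poly_funs n \<and> K = D (H K)"
      unfolding bchoice_iff by (rule exE)
    then have H: "H K \<subseteq> poly_funs n" "K = D (H K)" if "K \<in> \<K>" for K
      using that by simp_all
    have "\<Union>\<K> = (\<Union>K\<in>\<K>. K)" by simp
    also have "\<dots> = (\<Union>K\<in>\<K>. D (H K))" by (rule SUP_cong[OF refl H(2)])
    also have "\<dots> = D (\<Union>(H ` \<K>))" by (auto simp: D_def)
    finally have "\<Union>\<K> = D (\<Union>(H ` \<K>))" .
    moreover have "\<Union>(H ` \<K>) \<subseteq> poly_funs n" by (rule UN_least) (rule H(1))
    ultimately show "\<exists>F \<subseteq> poly_funs n. \<Union>\<K> = D F" by (intro exI[of _ "\<Union>(H ` \<K>)"] conjI)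
  qed
  then show ?thesis by (simp add: zariski_mat_def topology_inverse' D_def)
qed

definition mat_space :: "nat \<Rightarrow> complex mat fun_space" where
  "mat_space n =
    \<lparr>topo = zariski_mat n,
     regular_on = (\<lambda>U f. openin (zariski_mat n) U \<and>
       (\<forall>A\<in>U. \<exists>V p q. openin (zariski_mat n) V \<and> A \<in> V \<and> p \<in> poly_funs n \<and> q \<in> poly_funs n \<and>
          (\<forall>C \<in> V \<inter> U. q C \<noteq> 0 \<and> f C = p C / q C)))\<rparr>"

section \<open>The flag variety and Schubert varieties\<close>

definition SL :: "nat \<Rightarrow> complex mat monoid" where
  "SL n = \<lparr>carrier = {A \<in> carrier_mat n n. det A = 1}, monoid.mult = (*), one = 1\<^sub>m n\<rparr>"

lemma group_SL: "group (SL n)"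
proof (rule groupI)
  fix A assume "A \<in> carrier (SL n)"
  then have A: "A \<in> carrier_mat n n" "det A = 1" by (auto simp: SL_def)
  have "adj_mat A \<in> carrier_mat n n" "adj_mat A * A = 1\<^sub>m n"
    using adj_mat[OF A(1)] A(2) by auto
  moreover from this have "det (adj_mat A) = 1"
    using det_mult[of "adj_mat A" n A] A by simp
  ultimately show "\<exists>C\<in>carrier (SL n). C \<otimes>\<^bsub>SL n\<^esub> A = \<one>\<^bsub>SL n\<^esub>"
    by (auto simp: SL_def)
qed (auto simp: SL_def det_mult)

definition borel_subgroup :: "nat \<Rightarrow> complex mat set" where
  "borel_subgroup n = {A \<in> carrier (SL n). upper_triangular A}"

abbreviation flag_proj :: "nat \<Rightarrow> complex mat \<Rightarrow> complex mat set" where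
  "flag_proj n g \<equiv> g <#\<^bsub>SL n\<^esub> borel_subgroup n"

definition flag_variety :: "nat \<Rightarrow> complex mat set fun_space" where
  "flag_variety n = quotient_space (subspace_on (mat_space n) (carrier (SL n))) (flag_proj n)"

text \<open>
  The permutation matrix sending the basis vector with index \<open>i\<close> to the one with index \<open>w i\<close>
  (matrix indices start at \<open>0\<close>), with its first column multiplied by \<open>sign w\<close> so that the
  determinant is \<open>1\<close>; the coset does not depend on this choice of signs.
\<close>

definition perm_rep :: "nat \<Rightarrow> (nat \<Rightarrow> nat) \<Rightarrow> complex mat" where
  "perm_rep n w = mat n n (\<lambda>(r, c).
     if Suc r = w (Suc c) then (if c = 0 then of_int (sign w) else 1) else 0)"

lemma perm_rep_SL:
  assumes w: "w permutes {1..n}"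
  shows "perm_rep n w \<in> carrier (SL n)"
proof -
  define v where "v = map_permutation {1..n} (\<lambda>i. i - 1) (inv_into UNIV w)"
  have iw: "inv_into UNIV w permutes {1..n}" using w by (rule permutes_inv)
  have inj: "inj_on (\<lambda>i::nat. i - 1) {1..n}" by (auto simp: inj_on_def)
  have img: "(\<lambda>i::nat. i - 1) ` {1..n} = {0..<n}"
  proof
    show "{0..<n} \<subseteq> (\<lambda>i::nat. i - 1) ` {1..n}"
    proof
      fix i assume "i \<in> {0..<n}"
      then have "i = Suc i - 1" "Suc i \<in> {1..n}" by auto
      then show "i \<in> (\<lambda>i::nat. i - 1) ` {1..n}" by blast
    qed
  qed auto
  have v: "v permutes {0..<n}" unfolding v_def
    by (rule map_permutation_permutes[OF _ iw]) (unfold bij_betw_def, intro conjI inj img)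
  have v_eq: "v r = inv_into UNIV w (Suc r) - 1" if "r < n" for r
  proof -
    have "v ((\<lambda>i. i - 1) (Suc r)) = (\<lambda>i. i - 1) (inv_into UNIV w (Suc r))"
      unfolding v_def using that inj
      by (subst map_permutation_apply) auto
    then show ?thesis by simp
  qed
  have "permutation w" using finite_atLeastAtMost w by (rule permutes_imp_permutation)
  then have sv: "sign v = sign w"
    unfolding v_def by (simp only: sign_map_permutation[OF inj iw finite_atLeastAtMost] sign_inverse)
  have supp: "perm_rep n w $$ (r, c) = (if c = v r then (if c = 0 then of_int (sign w) else 1) else 0)"
    if "r < n" "c < n" for r c
  proof -
    have "inv_into UNIV w (Suc r) \<in> {1..n}"
      unfolding permutes_in_image[OF iw] using that by simp
    then have "inv_into UNIV w (Suc r) - 1 = c \<longleftrightarrow> inv_into UNIV w (Suc r) = Suc c"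
      by (cases "inv_into UNIV w (Suc r)") simp_all
    also have "\<dots> \<longleftrightarrow> w (Suc c) = Suc r" by (rule permutes_inv_eq[OF w])
    finally have "Suc r = w (Suc c) \<longleftrightarrow> c = v r"
      unfolding v_eq[OF that(1)] by metis
    then show ?thesis using that by (simp add: perm_rep_def)
  qed
  have dim: "perm_rep n w \<in> carrier_mat n n" by (simp add: perm_rep_def)
  have "det (perm_rep n w) = (\<Sum>p \<in> {p. p permutes {0..<n}}.
          signof p * (\<Prod>r = 0..<n. perm_rep n w $$ (r, p r)))"
    using dim by (simp add: det_def')
  also have "\<dots> = (\<Sum>p \<in> {v}. signof p * (\<Prod>r = 0..<n. perm_rep n w $$ (r, p r)))"
  proof (rule sum.mono_neutral_right)
    show "\<forall>p \<in> {p. p permutes {0..<n}} - {v}.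
        signof p * (\<Prod>r = 0..<n. perm_rep n w $$ (r, p r)) = 0"
    proof
      fix p assume p: "p \<in> {p. p permutes {0..<n}} - {v}"
      then have pp: "p permutes {0..<n}" and "p \<noteq> v" by simp_all
      then obtain r where r: "p r \<noteq> v r" by (meson ext)
      have "r \<in> {0..<n}"
      proof (rule ccontr)
        assume "r \<notin> {0..<n}"
        then show False using r permutes_not_in[OF pp] permutes_not_in[OF v] by simp
      qed
      then have "r < n" by simp
      have "p r < n" using permutes_in_image[OF pp, of r] \<open>r < n\<close> by simp
      have "perm_rep n w $$ (r, p r) = 0"
        unfolding supp[OF \<open>r < n\<close> \<open>p r < n\<close>] using r by (rule if_not_P)
      then have "\<exists>r\<in>{0..<n}. perm_rep n w $$ (r, p r) = 0"
        using \<open>r \<in> {0..<n}\<close> by (rule bexI)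
      then have "(\<Prod>r = 0..<n. perm_rep n w $$ (r, p r)) = 0"
        by (rule prod_zero[OF finite_atLeastLessThan])
      then show "signof p * (\<Prod>r = 0..<n. perm_rep n w $$ (r, p r)) = 0" by simp
    qed
  next
    show "finite {p. p permutes {0..<n}}" by (rule finite_permutations) simp
    show "{v} \<subseteq> {p. p permutes {0..<n}}" using v by simp
  qed
  also have "(\<Prod>r = 0..<n. perm_rep n w $$ (r, v r)) =
      (\<Prod>r = 0..<n. if v r = 0 then of_int (sign w) else 1)"
  proof (rule prod.cong)
    fix r assume "r \<in> {0..<n}"
    moreover from this have "v r < n" using permutes_in_image[OF v, of r] by simp
    ultimately show "perm_rep n w $$ (r, v r) = (if v r = 0 then of_int (sign w) else 1)"
      using supp by simp
  qed simp
  then have "(\<Sum>p \<in> {v}. signof p * (\<Prod>r = 0..<n. perm_rep n w $$ (r, p r))) =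
      of_int (sign w) * (\<Prod>r = 0..<n. if v r = 0 then of_int (sign w) else (1 :: complex))"
    using sv by (simp add: sign_def)
  also have "(\<Prod>r = 0..<n. if v r = 0 then of_int (sign w) else (1 :: complex)) =
      (\<Prod>c = 0..<n. if c = 0 then of_int (sign w) else 1)"
    using prod.permute[OF v, of "\<lambda>c. if c = 0 then of_int (sign w) else (1 :: complex)"]
    by (simp add: comp_def)
  also have "\<dots> = (of_int (sign w) :: complex)"
  proof (cases "n = 0")
    case True
    then have "w = id" using w by simp
    then show ?thesis using True by simp
  qed (simp add: prod.delta)
  also have "of_int (sign w) * of_int (sign w) = (1 :: complex)"
    by (simp add: sign_def)
  finally show ?thesis using dim by (simp add: SL_def)
qed

definition schubert_cell :: "nat \<Rightarrow> (nat \<Rightarrow> nat) \<Rightarrow> complex mat set set" where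
  "schubert_cell n w = {flag_proj n (b * perm_rep n w) | b. b \<in> borel_subgroup n}"

definition schubert_variety :: "nat \<Rightarrow> (nat \<Rightarrow> nat) \<Rightarrow> complex mat set set" where
  "schubert_variety n w = topo (flag_variety n) closure_of schubert_cell n w"

section \<open>The shaded region\<close>

definition rank_fun :: "nat \<Rightarrow> (nat \<Rightarrow> nat) \<Rightarrow> real \<Rightarrow> real \<Rightarrow> nat" where
  "rank_fun n w p q = card {i \<in> {1..n}. real i \<le> p \<and> real (w i) \<ge> q}"

definition rank_diff :: "nat \<Rightarrow> (nat \<Rightarrow> nat) \<Rightarrow> (nat \<Rightarrow> nat) \<Rightarrow> real \<Rightarrow> real \<Rightarrow> int" where
  "rank_diff n x w p q = int (rank_fun n w p q) - int (rank_fun n x p q)"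

definition shaded_region :: "nat \<Rightarrow> (nat \<Rightarrow> nat) \<Rightarrow> (nat \<Rightarrow> nat) \<Rightarrow> (real \<times> real) set" where
  "shaded_region n x w = {(p, q). rank_diff n x w p q \<ge> 1}"

definition open_rectangle :: "nat \<Rightarrow> nat \<Rightarrow> nat \<Rightarrow> nat \<Rightarrow> (real \<times> real) set" where
  "open_rectangle a b c d = {real a<..<real b} \<times> {real c<..<real d}"

section \<open>The combinatorial conditions\<close>

text \<open>Sequences \<open>\<alpha>\<^sub>1, \<dots>, \<alpha>\<^sub>m\<close> are functions of which only the values on \<open>{1..m}\<close> matter.\<close>

definition increasing_positions_decreasing_values ::
    "nat \<Rightarrow> (nat \<Rightarrow> nat) \<Rightarrow> nat \<Rightarrow> (nat \<Rightarrow> nat) \<Rightarrow> bool" where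
  "increasing_positions_decreasing_values n w m \<alpha> \<longleftrightarrow>
     \<alpha> ` {1..m} \<subseteq> {1..n} \<and> strict_mono_on {1..m} \<alpha> \<and> strict_antimono_on {1..m} (w \<circ> \<alpha>)"

definition cyclic_rearrangement ::
    "nat \<Rightarrow> (nat \<Rightarrow> nat) \<Rightarrow> (nat \<Rightarrow> nat) \<Rightarrow> nat \<Rightarrow> (nat \<Rightarrow> nat) \<Rightarrow> nat \<Rightarrow> (nat \<Rightarrow> nat) \<Rightarrow> bool" where
  "cyclic_rearrangement n x w m \<alpha> k \<beta> \<longleftrightarrow>
     x (\<alpha> 1) = w (\<beta> 1) \<and>
     (\<forall>j. 1 \<le> j \<and> j < k \<longrightarrow> x (\<beta> j) = w (\<beta> (j + 1))) \<and>
     x (\<beta> k) = w (\<alpha> m) \<and>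
     (\<forall>i. 2 \<le> i \<and> i \<le> m \<longrightarrow> x (\<alpha> i) = w (\<alpha> (i - 1))) \<and>
     (\<forall>i \<in> {1..n} - (\<alpha> ` {1..m} \<union> \<beta> ` {1..k}). x i = w i)"

definition case_4231 :: "(nat \<Rightarrow> nat) \<Rightarrow> nat \<Rightarrow> (nat \<Rightarrow> nat) \<Rightarrow> nat \<Rightarrow> (nat \<Rightarrow> nat) \<Rightarrow> bool" where
  "case_4231 w m \<alpha> k \<beta> \<longleftrightarrow>
     k \<ge> 2 \<and> m \<ge> 2 \<and>
     (\<forall>j \<in> {1..k-1}. \<alpha> 1 < \<beta> j \<and> (\<forall>i \<in> {2..m}. \<beta> j < \<alpha> i)) \<and>
     (\<forall>i \<in> {2..m}. \<alpha> i < \<beta> k) \<and>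
     w (\<alpha> m) > w (\<beta> 1)"

definition case_3412 :: "(nat \<Rightarrow> nat) \<Rightarrow> nat \<Rightarrow> (nat \<Rightarrow> nat) \<Rightarrow> nat \<Rightarrow> (nat \<Rightarrow> nat) \<Rightarrow> bool" where
  "case_3412 w m \<alpha> k \<beta> \<longleftrightarrow>
     k \<ge> 2 \<and> m \<ge> 2 \<and>
     (\<forall>j \<in> {1..k-1}. \<beta> j < \<alpha> 1) \<and> \<alpha> 1 < \<beta> k \<and> (\<forall>i \<in> {2..m}. \<beta> k < \<alpha> i) \<and>
     w (\<alpha> (m - 1)) > w (\<beta> 1) \<and> w (\<beta> 1) > w (\<alpha> m) \<and> w (\<alpha> m) > w (\<beta> 2)"

abbreviation rectangle_45312 :: "(nat \<Rightarrow> nat) \<Rightarrow> (nat \<Rightarrow> nat) \<Rightarrow> (nat \<Rightarrow> nat) \<Rightarrow> (real \<times> real) set" where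
  "rectangle_45312 w \<alpha> \<beta> \<equiv> open_rectangle (\<alpha> 1) (\<beta> 2) (w (\<alpha> 2)) (w (\<beta> 1))"

definition case_45312 ::
    "nat \<Rightarrow> (nat \<Rightarrow> nat) \<Rightarrow> nat \<Rightarrow> (nat \<Rightarrow> nat) \<Rightarrow> nat \<Rightarrow> (nat \<Rightarrow> nat) \<Rightarrow> bool" where
  "case_45312 n w m \<alpha> k \<beta> \<longleftrightarrow>
     k = 2 \<and> m = 2 \<and>
     \<beta> 1 < \<alpha> 1 \<and> \<alpha> 1 < \<beta> 2 \<and> \<beta> 2 < \<alpha> 2 \<and>
     w (\<alpha> 1) > w (\<beta> 1) \<and> w (\<beta> 1) > w (\<alpha> 2) \<and> w (\<alpha> 2) > w (\<beta> 2) \<and>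
     (\<forall>i \<in> {1..n}. \<forall>i' \<in> {1..n}. i < i' \<and>
        (real i, real (w i)) \<in> rectangle_45312 w \<alpha> \<beta> \<and>
        (real i', real (w i')) \<in> rectangle_45312 w \<alpha> \<beta> \<longrightarrow> w i > w i')"

definition interior_avoids ::
    "nat \<Rightarrow> (nat \<Rightarrow> nat) \<Rightarrow> nat \<Rightarrow> (nat \<Rightarrow> nat) \<Rightarrow> nat \<Rightarrow> (nat \<Rightarrow> nat) \<Rightarrow> (real \<times> real) set \<Rightarrow> bool" where
  "interior_avoids n w m \<alpha> k \<beta> R \<longleftrightarrow>
     (\<forall>i \<in> {1..n} - (\<alpha> ` {1..m} \<union> \<beta> ` {1..k}). (real i, real (w i)) \<notin> interior R)"

end

theory Submission
  imports Defs
begin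

text \<open>
  Geometry first turns the statement into one about permutations. The flag variety is the disjoint union
  of the cells \<open>C\<^sub>v\<close>, and \<open>X\<^sub>w\<close> is the union of those with \<open>v \<le> w\<close>, where the Bruhat order is given by
  comparing ranks: minors that vanish on \<open>X\<^sub>w\<close> force the ranks of \<open>v\<close> below those of \<open>w\<close>, while a curve
  \<open>v (1 + s E\<^sub>j\<^sub>i)\<close> leads from a cell into every cell \<open>v t\<close> of a reflection \<open>t\<close> with \<open>v < v t\<close>
  (\<open>schubert_mono\<close>). At a point of \<open>C\<^sub>v\<close> the tangent space of \<open>X\<^sub>w\<close> has a basis indexed by the reflections
  \<open>t\<close> with \<open>v t \<le> w\<close>: such \<open>t\<close> give curves in \<open>X\<^sub>w\<close>, and for every other \<open>t\<close> one of the vanishing minors has a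
  nonzero derivative exactly in the direction of \<open>t\<close> (\<open>schubert_tangent_dim\<close>). The dimension of \<open>X\<^sub>w\<close> is
  the length of \<open>w\<close>: chains in the Bruhat order give the lower bound, and the upper bound follows by
  counting monomials (\<open>schubert_krull_dim\<close>). Writing \<open>tdim n v w\<close> for the number of reflections, \<open>X\<^sub>x\<close> is
  therefore a component of the singular locus iff \<open>x\<close> is maximal among the \<open>x \<le> w\<close> with
  \<open>tdim n x w \<noteq> len n w\<close> (\<open>schubert_component_iff\<close>).

  To find the maximal \<open>x\<close>, one compares \<open>tdim\<close> at \<open>x\<close> and at a cover \<open>x t\<close> below \<open>w\<close>. It decreases by the
  number of certain losses (\<open>tdim_cover\<close>), so it is antitone and at least \<open>len n w\<close>, and from a singular \<open>x\<close> one
  reaches \<open>w\<close> only through some loss. If the covers are always taken at the first position where the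
  permutations differ, a loss leaves a trace in \<open>w\<close> (\<open>loss_exits\<close>) from which the sequences \<open>\<alpha>\<close> and \<open>\<beta>\<close>
  are grown greedily, in such a way that their staircase \<open>region\<close> is shaded and avoids all other points of
  \<open>w\<close>, up to the decreasing centre of a 45312 shape (\<open>exit1_conf\<close>, \<open>exit2_conf\<close>). Conversely, the cyclic rearrangement along \<open>\<alpha>\<close> and \<open>\<beta>\<close> has
  the indicator function of the region as its rank difference (\<open>cyc_dif\<close>) and admits an explicit loss
  (\<open>conf_singular\<close>), and no region of a configuration contains the region of another one
  (\<open>conf_antichain\<close>). So the maximal singular permutations are exactly the rearrangements along such
  configurations.

  Finally, the shaded region of the statement lives in the real plane. At a point of \<open>w\<close> that is not moved,
  the rank difference agrees on all four adjacent unit cells, whence such a point is interior as soon as it is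
  shaded (\<open>interior_minus_iff\<close>), and condition (c) becomes the condition on integer points used above.
\<close>

section \<open>Rank differences and the Bruhat order\<close>

text \<open>
The function \<open>d\<close> at integer points, written as one signed sum so that it is additive along chains
of permutations.
\<close>

definition dif :: "(nat => nat) => (nat => nat) => nat => nat => int" where
 "dif x w p q = (\<Sum>i\<in>{1..p}. of_bool (q <= w i) - of_bool (q <= x i))"

text \<open>
The rank criterion serves as the definition; \<open>schubert_mono\<close> shows that this is the order given by
containment of Schubert varieties.
\<close>

definition bruhat_le :: "(nat => nat) => (nat => nat) => bool" where
 "bruhat_le x w \<longleftrightarrow> (\<forall>p q. 0 <= dif x w p q)"

text \<open>
Positions are half-open on the right and values on the left: this is exactly the set of points where
\<open>dif\<close> drops by one when the values \<open>q1 < q2\<close> at the positions \<open>p1 < p2\<close> are exchanged.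
\<close>

definition shaded :: "(nat => nat) => (nat => nat) => nat => nat => nat => nat => bool" where
 "shaded x w p1 p2 q1 q2 \<longleftrightarrow> (\<forall>p q. p1 <= p --> p < p2 --> q1 < q --> q <= q2 --> 1 <= dif x w p q)"

lemma shadedI: "(\<And>p q. p1 <= p ==> p < p2 ==> q1 < q ==> q <= q2 ==> 1 <= dif x w p q) ==> shaded x w p1 p2 q1 q2"
 by (auto simp: shaded_def)

lemma shadedD: "shaded x w p1 p2 q1 q2 ==> p1 <= p ==> p < p2 ==> q1 < q ==> q <= q2 ==> 1 <= dif x w p q"
 by (auto simp: shaded_def)

lemma shaded_split_position: "p1 <= p2 ==> p2 <= p3 ==>
  shaded x w p1 p3 q1 q2 \<longleftrightarrow> shaded x w p1 p2 q1 q2 & shaded x w p2 p3 q1 q2"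
 unfolding shaded_def by (meson le_trans less_le_trans not_le)

lemma shaded_split_value: "q1 <= q2 ==> q2 <= q3 ==>
  shaded x w p1 p2 q1 q3 \<longleftrightarrow> shaded x w p1 p2 q1 q2 & shaded x w p1 p2 q2 q3"
 unfolding shaded_def by (meson le_trans le_less_trans not_le)

lemma dif_0 [simp]: "dif x w 0 q = 0"
 by (simp add: dif_def)

lemma dif_Suc: "dif x w (Suc p) q = dif x w p q + of_bool (q <= w (Suc p)) - of_bool (q <= x (Suc p))"
 by (simp add: dif_def)

lemma dif_add: "dif x v p q + dif v w p q = dif x w p q"
 by (simp add: dif_def sum.distrib [symmetric])

lemma dif_self [simp]: "dif x x p q = 0"
 by (simp add: dif_def)

lemma bruhat_le_refl [simp]: "bruhat_le x x"
 by (simp add: bruhat_le_def)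

lemma bruhat_le_trans: "bruhat_le x v ==> bruhat_le v w ==> bruhat_le x w"
 unfolding bruhat_le_def by (metis dif_add add_nonneg_nonneg)

text \<open>
The alternating sum of a rank function over the corners of a rectangle counts the points inside.
All arguments that enlarge a shaded rectangle rest on this: without points of \<open>w\<close> inside, \<open>dif\<close> at one
corner is bounded below by the three others.
\<close>

lemma dif_rectangle:
 assumes "p <= p'" "q <= q'"
 shows "dif x w p' q + dif x w p q' + int (card {i\<in>{p<..p'}. q <= x i & x i < q'})
    = dif x w p q + dif x w p' q' + int (card {i\<in>{p<..p'}. q <= w i & w i < q'})"
proof -
 have S: "dif x w p' r = dif x w p r + (\<Sum>i\<in>{p<..p'}. of_bool (r <= w i) - of_bool (r <= x i))" for r
 proof -
  have "{1..p'} = {1..p} \<union> {p<..p'}" using assms by auto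
  then show ?thesis unfolding dif_def by (simp only:) (rule sum.union_disjoint; auto)
 qed
 have C: "int (card {i\<in>{p<..p'}. q <= f i & f i < q'}) = (\<Sum>i\<in>{p<..p'}. of_bool (q <= f i) - of_bool (q' <= f i))" for f :: "nat => nat"
 proof -
  have "int (card {i\<in>{p<..p'}. q <= f i & f i < q'}) = (\<Sum>i\<in>{p<..p'}. of_bool (q <= f i & f i < q'))"
   by (simp add: Int_def)
  also have "\<dots> = (\<Sum>i\<in>{p<..p'}. of_bool (q <= f i) - of_bool (q' <= f i))"
   using assms by (intro sum.cong) auto
  finally show ?thesis .
 qed
 show ?thesis unfolding S[of q] S[of q'] C by (simp add: sum_subtractf)
qed

lemma dif_rectangle_no_w:
 assumes "p <= p'" "q <= q'" "\<And>i. p < i ==> i <= p' ==> q <= w i ==> w i < q' ==> False"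
 shows "dif x w p' q + dif x w p q' <= dif x w p q + dif x w p' q'"
proof -
 have "{i\<in>{p<..p'}. q <= w i & w i < q'} = {}" using assms(3) by fastforce
 then have "card {i\<in>{p<..p'}. q <= w i & w i < q'} = 0" by simp
 then show ?thesis using dif_rectangle[OF assms(1,2), of x w] by linarith
qed

lemma dif_outside:
 assumes "x permutes {1..n}" "w permutes {1..n}" "n <= p"
 shows "dif x w p q = 0"
proof -
 have "(\<Sum>i\<in>{1..p}. of_bool (q <= f i) :: int) = (\<Sum>i\<in>{1..p}. of_bool (q <= i))" if "f permutes {1..n}" for f :: "nat => nat"
 proof -
  have "f permutes {1..p}" by (rule permutes_subset[OF that]) (use assms in auto)
  from sum.permute[OF this, of "%i. of_bool (q <= i) :: int"] show ?thesis by (simp add: o_def)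
 qed
 then show ?thesis using assms by (simp add: dif_def sum_subtractf)
qed

lemma permutes_le_iff: "x permutes {1..n} ==> x i \<in> {1..n} \<longleftrightarrow> i \<in> {1..(n::nat)}"
 by (rule permutes_in_image)

lemma dif_high:
 assumes "x permutes {1..n}" "w permutes {1..n}" "n < q"
 shows "dif x w p q = 0"
proof (cases "p <= n")
 case True
 have "x i < q" "w i < q" if "i \<in> {1..p}" for i
  using permutes_le_iff[OF assms(1), of i] permutes_le_iff[OF assms(2), of i] that True assms(3) by auto
 then have "of_bool (q <= w i) - of_bool (q <= x i) = (0::int)" if "i \<in> {1..p}" for i
  by (metis (full_types) diff_self not_le of_bool_eq(1) that)
 then show ?thesis unfolding dif_def by (rule sum.neutral[OF ballI])
next
 case False then show ?thesis using dif_outside assms by simp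
qed

lemma dif_transpose:
 assumes "1 <= a" "a < b" "x a < x b"
 shows "dif x (x \<circ> transpose a b) p q = of_bool (a <= p & p < b & x a < q & q <= x b)"
proof -
 define y where "y = x \<circ> transpose a b"
 have ya: "y a = x b" and yb: "y b = x a" and yi: "\<And>i. i ~= a ==> i ~= b ==> y i = x i"
  by (simp_all add: y_def transpose_def)
 have "dif x y p q = of_bool (a <= p & p < b & x a < q & q <= x b)"
 proof (induction p)
  case 0 then show ?case using assms by simp
 next
  case (Suc p)
  consider "Suc p = a" | "Suc p = b" | "Suc p ~= a" "Suc p ~= b" by blast
  then show ?case
  proof cases
   case 1 then show ?thesis using assms Suc ya by (auto simp: dif_Suc)
  next
   case 2 then show ?thesis using assms Suc yb by (auto simp: dif_Suc)
  next
   case 3 then show ?thesis using assms Suc yi[OF 3] by (auto simp: dif_Suc)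
  qed
 qed
 then show ?thesis by (simp add: y_def)
qed

lemma dif_transpose_left:
 assumes "1 <= a" "a < b" "x a < x b"
 shows "dif (x \<circ> transpose a b) w p q = dif x w p q - of_bool (a <= p & p < b & x a < q & q <= x b)"
 using dif_add[of x "x \<circ> transpose a b" p q w] dif_transpose[of a b x, OF assms, of p q] by simp

text \<open>The reflections that will span the tangent space of \<open>X\<^sub>w\<close> at the fixed point of \<open>x\<close>.\<close>

definition good :: "(nat => nat) => (nat => nat) => nat => nat => bool" where
 "good x w i j \<longleftrightarrow> bruhat_le (x \<circ> transpose i j) w"

lemma good_commute: "good x w i j \<longleftrightarrow> good x w j i"
 by (simp add: good_def transpose_commute)

lemma good_noninversion:
 assumes "bruhat_le x w" "1 <= a" "a < b" "x a < x b"
 shows "good x w a b \<longleftrightarrow> shaded x w a b (x a) (x b)"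
proof
 assume "good x w a b"
 then show "shaded x w a b (x a) (x b)"
  unfolding good_def bruhat_le_def dif_transpose_left[OF assms(2-4)] shaded_def
  by (smt (verit) of_bool_eq(2))
next
 assume "shaded x w a b (x a) (x b)"
 then show "good x w a b"
  using assms(1) unfolding good_def bruhat_le_def dif_transpose_left[OF assms(2-4)] shaded_def
  by (smt (verit) of_bool_def)
qed

lemma good_inversion:
 assumes "bruhat_le x w" "1 <= a" "a < b" "x b < x a"
 shows "good x w a b"
proof -
 let ?y = "x \<circ> transpose a b"
 have "dif ?y (?y \<circ> transpose a b) p q \<ge> 0" for p q
  using dif_transpose[of a b ?y p q] assms by simp
 moreover have "?y \<circ> transpose a b = x" by (simp add: o_assoc [symmetric] del: o_assoc)
 ultimately have "bruhat_le ?y x" by (simp add: bruhat_le_def)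
 then show ?thesis using assms(1) bruhat_le_trans unfolding good_def by blast
qed

lemma bruhat_le_antisym_aux:
 assumes "x permutes {1..n}" "w permutes {1..n}" "\<And>p q. dif x w p q = 0"
 shows "x = w"
proof
 fix i show "x i = w i"
 proof (cases "i \<ge> 1")
  case True
  then obtain p where p: "i = Suc p" by (cases i) auto
  have "of_bool (q <= w i) = (of_bool (q <= x i) :: int)" for q
   using dif_Suc[of x w p q] assms(3) p by simp
  then have "q <= w i \<longleftrightarrow> q <= x i" for q by (metis of_bool_eq_iff)
  then show ?thesis by (metis order_antisym order_refl)
 next
  case False then show ?thesis using assms(1,2) by (simp add: permutes_def)
 qed
qed

lemma bruhat_le_antisym:
 assumes "x permutes {1..n}" "w permutes {1..n}" "bruhat_le x w" "bruhat_le w x"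
 shows "x = w"
proof (rule bruhat_le_antisym_aux[OF assms(1,2)])
 fix p q
 have "dif x w p q + dif w x p q = 0" by (simp add: dif_add)
 then show "dif x w p q = 0" using assms(3,4) unfolding bruhat_le_def by (smt (verit))
qed

section \<open>Tangent directions lost at a cover\<close>

definition is_cover :: "(nat => nat) => nat => nat => bool" where
 "is_cover x a b \<longleftrightarrow> 1 <= a & a < b & x a < x b & (\<forall>i. a < i & i < b --> ~ (x a < x i & x i < x b))"

text \<open>
When \<open>x\<close> is replaced by a cover \<open>y = x \<circ> transpose a b\<close> below \<open>w\<close>, a tangent direction can
disappear in three ways: through a point \<open>i\<close> to the south-west of the point at \<open>a\<close>, through one to the
north-east of the point at \<open>b\<close>, or through a pair whose rectangle meets that of the cover in a point
where \<open>dif\<close> is only 1.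
\<close>

definition lossW where
 "lossW x w a b i \<longleftrightarrow> 1 <= i & i < a & x i < x a & shaded x w i a (x i) (x a) \<and>
   ~ shaded x w i a (x a) (x b) & ~ shaded x w a b (x i) (x a)"

definition lossE where
 "lossE x w a b i \<longleftrightarrow> b < i & x b < x i & shaded x w b i (x b) (x i) \<and>
   ~ shaded x w a b (x b) (x i) & ~ shaded x w b i (x a) (x b)"

definition lossX where
 "lossX x w a b i j \<longleftrightarrow> 1 <= i & i < j & i ~= a & i ~= b & j ~= a & j ~= b & x i < x j & shaded x w i j (x i) (x j) \<and>
   (\<exists>p q. a <= p & p < b & x a < q & q <= x b & i <= p & p < j & x i < q & q <= x j & dif x w p q = 1)"

context
 fixes x w y :: "nat => nat" and n a b :: nat
 assumes xp: "x permutes {1..n}" and c: "is_cover x a b" and bn: "b <= n"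
  and xw: "bruhat_le x w" and yw: "bruhat_le y w" and y: "y = x \<circ> transpose a b"
begin

private lemma a1: "1 <= a" and ab: "a < b" and xab: "x a < x b"
 and cover: "\<And>i. a < i ==> i < b ==> x a < x i ==> x i < x b ==> False"
 using c by (auto simp: is_cover_def)

private lemma ya: "y a = x b" and yb: "y b = x a" and yi: "\<And>i. i ~= a ==> i ~= b ==> y i = x i"
 by (simp_all add: y transpose_def)

private lemma dy: "dif y w p q = dif x w p q - of_bool (a <= p & p < b & x a < q & q <= x b)"
 unfolding y by (rule dif_transpose_left[OF a1 ab xab])

private lemma inj: "x i = x j \<longleftrightarrow> i = j"
 using permutes_inj[OF xp] by (simp add: inj_eq)

private lemma sab: "a <= p ==> p < b ==> x a < q ==> q <= x b ==> 1 <= dif x w p q"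
 using good_noninversion[OF xw a1 ab xab] yw unfolding good_def y shaded_def by blast

private lemma gx: "1 <= i ==> i < j ==> x i < x j ==> good x w i j \<longleftrightarrow> shaded x w i j (x i) (x j)"
 using good_noninversion[OF xw] .
private lemma gy: "1 <= i ==> i < j ==> y i < y j ==> good y w i j \<longleftrightarrow> shaded y w i j (y i) (y j)"
 using good_noninversion[OF yw] .
private lemma gxi: "1 <= i ==> i < j ==> x j < x i ==> good x w i j"
 using good_inversion[OF xw] .
private lemma gyi: "1 <= i ==> i < j ==> y j < y i ==> good y w i j"
 using good_inversion[OF yw] .

lemma good_disjoint:
 assumes "1 <= i" "i < j" "i ~= a" "i ~= b" "j ~= a" "j ~= b"
 shows "good x w i j \<longleftrightarrow> good y w i j \<or> lossX x w a b i j" "good y w i j ==> ~ lossX x w a b i j"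
proof -
 have yij: "y i = x i" "y j = x j" using yi assms by auto
 have "x i ~= x j" using inj assms by auto
 have "(good x w i j \<longleftrightarrow> good y w i j \<or> lossX x w a b i j) & (good y w i j --> ~ lossX x w a b i j)"
 proof (cases "x i < x j")
  case False
  then have "x j < x i" using \<open>x i ~= x j\<close> by simp
  then show ?thesis using gxi gyi assms yij False by (auto simp: lossX_def)
 next
  case True
  then have G: "good x w i j \<longleftrightarrow> shaded x w i j (x i) (x j)" "good y w i j \<longleftrightarrow> shaded y w i j (x i) (x j)"
   using gx gy assms yij by auto
  have 1: "shaded y w i j (x i) (x j) ==> shaded x w i j (x i) (x j)"
   unfolding shaded_def dy by (smt (verit) of_bool_def)
  have 2: "shaded y w i j (x i) (x j) ==> ~ lossX x w a b i j"
   unfolding shaded_def dy lossX_def by fastforce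
  have 3: "lossX x w a b i j" if s: "shaded x w i j (x i) (x j)" and ns: "~ shaded y w i j (x i) (x j)"
  proof -
   obtain p q where pq: "i <= p" "p < j" "x i < q" "q <= x j" "~ 1 <= dif y w p q"
    using ns unfolding shaded_def by blast
   have "1 <= dif x w p q" using s pq unfolding shaded_def by blast
   then have "dif x w p q = 1 & a <= p & p < b & x a < q & q <= x b"
    using pq(5) unfolding dy by (auto simp: of_bool_def split: if_splits)
   then show ?thesis unfolding lossX_def using assms True s pq by blast
  qed
  show ?thesis using G 1 2 3 lossX_def by blast
 qed
 then show "good x w i j \<longleftrightarrow> good y w i j \<or> lossX x w a b i j" "good y w i j ==> ~ lossX x w a b i j" by auto
qed

private lemma same: "p2 <= a \<or> b <= p1 \<or> q2 <= x a \<or> x b <= q1 ==> shaded y w p1 p2 q1 q2 \<longleftrightarrow> shaded x w p1 p2 q1 q2"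
 unfolding shaded_def dy by auto

private lemma inside: "a <= p1 ==> p2 <= b ==> x a <= q1 ==> q2 <= x b ==> shaded x w p1 p2 q1 q2"
 using sab unfolding shaded_def by auto

text \<open>
For a third position the two reflections with \<open>a\<close> and \<open>b\<close> are compared together. If \<open>i\<close> lies to the
south-west, let \<open>P\<close> be the rectangle between it and the point at \<open>a\<close>, and let \<open>Q\<close> (above \<open>P\<close>) and \<open>R\<close> (to
its right) complete \<open>P\<close> and the rectangle of the cover, which is shaded, to a rectangle. Then \<open>x\<close> counts
the shading of \<open>P\<close> and of \<open>P, Q, R\<close>, while \<open>y\<close> counts that of \<open>P, Q\<close> and of \<open>P, R\<close>; this differs
precisely if \<open>P\<close> is shaded but neither \<open>Q\<close> nor \<open>R\<close>. North-east is symmetric, and in all other cases the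
two conditions are exchanged.
\<close>

lemma good_third:
 assumes i: "1 <= i" "i ~= a" "i ~= b"
 shows "of_bool (good x w i a) + of_bool (good x w i b) =
  of_bool (good y w i a) + of_bool (good y w i b) + (of_bool (lossW x w a b i \<or> lossE x w a b i) :: nat)"
proof -
 have yii: "y i = x i" using yi i by auto
 have ne: "x i ~= x a" "x i ~= x b" using inj i by auto
 note pos = shaded_split_position[of _ _ _ x w] and val = shaded_split_value[of _ _ _ x w]
 consider "i < a" | "a < i" "i < b" | "b < i" using i by linarith
 then show ?thesis
 proof cases
  case 1
  have ib: "i < b" using 1 ab by simp
  note g = gx[OF i(1) 1] gx[OF i(1) ib] gy[OF i(1) 1] gy[OF i(1) ib] gxi[OF i(1) 1] gxi[OF i(1) ib] gyi[OF i(1) 1] gyi[OF i(1) ib]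
  have nE: "~ lossE x w a b i" using 1 ab by (simp add: lossE_def)
  consider "x b < x i" | "x a < x i" "x i < x b" | "x i < x a" using ne by linarith
  then show ?thesis
  proof cases
   case a: 1
   then show ?thesis using g nE xab by (simp add: ya yb yii lossW_def)
  next
   case a: 2
   have "shaded x w i b (x i) (x b) \<longleftrightarrow> shaded y w i a (x i) (x b)"
    using pos[of i a b] same[of a] inside[of a b "x i" "x b"] 1 ab a by simp
   then show ?thesis using g nE a by (simp add: ya yb yii lossW_def)
  next
   case a: 3
   have "shaded y w i a (x i) (x b) \<longleftrightarrow> shaded x w i a (x i) (x a) & shaded x w i a (x a) (x b)"
    using same[of a] val[of "x i" "x a" "x b"] a xab by simp
   moreover have "shaded y w i b (x i) (x a) \<longleftrightarrow> shaded x w i a (x i) (x a) & shaded x w a b (x i) (x a)"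
    using same[of b i "x a"] pos[of i a b] 1 ab by simp
   moreover have "shaded x w i b (x i) (x b) \<longleftrightarrow> shaded x w i a (x i) (x a) & shaded x w i a (x a) (x b) & shaded x w a b (x i) (x a)"
    using pos[of i a b] val[of "x i" "x a" "x b"] inside[of a b "x a" "x b"] 1 ab a xab by auto
   ultimately show ?thesis using g nE a xab i 1 by (auto simp: ya yb yii lossW_def)
  qed
 next
  case 2
  note g = gx[OF a1 2(1)] gx[OF i(1) 2(2)] gy[OF a1 2(1)] gy[OF i(1) 2(2)] gxi[OF a1 2(1)] gxi[OF i(1) 2(2)] gyi[OF a1 2(1)] gyi[OF i(1) 2(2)]
   good_commute[of x w i a] good_commute[of y w i a]
  have nL: "~ lossE x w a b i" "~ lossW x w a b i" using 2 by (simp_all add: lossE_def lossW_def)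
  consider "x b < x i" | "x i < x a" using ne cover 2 by (meson linorder_neqE_nat)
  then show ?thesis
  proof cases
   case a: 1
   have "shaded x w a i (x a) (x i) \<longleftrightarrow> shaded y w a i (x b) (x i)"
    using val[of "x a" "x b" "x i"] same[of i a "x i" "x b"] inside[of a i "x a" "x b"] 2 a xab by simp
   then show ?thesis using g nL a xab by (simp add: ya yb yii)
  next
   case a: 2
   have "shaded x w i b (x i) (x b) \<longleftrightarrow> shaded y w i b (x i) (x a)"
    using val[of "x i" "x a" "x b"] same[of b i "x a" "x i"] inside[of i b "x a" "x b"] 2 a xab by simp
   then show ?thesis using g nL a xab by (simp add: ya yb yii)
  qed
 next
  case 3
  have ai: "a < i" and b1: "1 <= b" using 3 ab a1 by auto
  note g = gx[OF a1 ai] gx[OF b1 3] gy[OF a1 ai] gy[OF b1 3] gxi[OF a1 ai] gxi[OF b1 3] gyi[OF a1 ai] gyi[OF b1 3]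
   good_commute[of x w i a] good_commute[of y w i a] good_commute[of x w i b] good_commute[of y w i b]
  have nW: "~ lossW x w a b i" using 3 ab by (simp add: lossW_def)
  consider "x i < x a" | "x a < x i" "x i < x b" | "x b < x i" using ne by linarith
  then show ?thesis
  proof cases
   case a: 1
   then show ?thesis using g nW xab by (simp add: ya yb yii lossE_def)
  next
   case a: 2
   have "shaded x w a i (x a) (x i) \<longleftrightarrow> shaded y w b i (x a) (x i)"
    using pos[of a b i] same[of i b] inside[of a b "x a" "x i"] 3 ab a by simp
   then show ?thesis using g nW a by (simp add: ya yb yii lossE_def)
  next
   case a: 3
   have "shaded y w a i (x b) (x i) \<longleftrightarrow> shaded x w b i (x b) (x i) & shaded x w a b (x b) (x i)"
    using same[of i a "x i" "x b"] pos[of a b i] 3 ab by auto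
   moreover have "shaded y w b i (x a) (x i) \<longleftrightarrow> shaded x w b i (x b) (x i) & shaded x w b i (x a) (x b)"
    using same[of i b] val[of "x a" "x b" "x i"] a xab by auto
   moreover have "shaded x w a i (x a) (x i) \<longleftrightarrow> shaded x w b i (x b) (x i) & shaded x w a b (x b) (x i) & shaded x w b i (x a) (x b)"
    using pos[of a b i] val[of "x a" "x b" "x i"] inside[of a b "x a" "x b"] 3 ab a xab by auto
   ultimately show ?thesis using g nW a xab i 3 by (auto simp: ya yb yii lossE_def)
  qed
 qed
qed

lemma good_ab: "good x w a b" "good y w a b"
proof -
 show "good x w a b" using yw by (simp add: good_def y)
 show "good y w a b" using gyi[OF a1 ab] xab by (simp add: ya yb)
qed

end

section \<open>Length, tangent count and climbing in the Bruhat order\<close>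

definition npairs :: "nat => (nat => nat => bool) => nat" where
 "npairs n P = card {(i, j). 1 <= i & i < j & j <= n & P i j}"

definition inversion :: "(nat => nat) => nat => nat => bool" where
 "inversion x i j \<longleftrightarrow> (i < j & x j < x i) \<or> (j < i & x i < x j)"

definition len :: "nat => (nat => nat) => nat" where
 "len n x = npairs n (inversion x)"

text \<open>By \<open>schubert_tangent_dim\<close> this is the dimension of the tangent space of \<open>X\<^sub>w\<close> along the cell of \<open>x\<close>.\<close>

definition tdim :: "nat => (nat => nat) => (nat => nat) => nat" where
 "tdim n x w = npairs n (good x w)"

lemma finite_pairs: "finite {(i, j). 1 <= i & i < j & j <= n & P i (j::nat)}"
 by (rule finite_subset[of _ "{..n} \<times> {..n}"]) auto

lemma npairs_cong: "(\<And>i j. 1 <= i ==> i < j ==> j <= n ==> P i j = Q i j) ==> npairs n P = npairs n Q"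
 unfolding npairs_def by (rule arg_cong[of _ _ card]) auto

lemma npairs_le: "npairs n P <= n * n"
proof -
 have "npairs n P <= card ({1..n} \<times> {1..n})"
  unfolding npairs_def by (rule card_mono) auto
 then show ?thesis by simp
qed

lemma sum_of_bool_card: "finite A ==> (\<Sum>i\<in>A. of_bool (P i)) = card {i\<in>A. P i}"
 by (simp add: Int_def)

text \<open>
Pairs are sorted by whether they contain none, one or both of \<open>a\<close> and \<open>b\<close>, because a transposition
treats these three classes differently.
\<close>

lemma npairs_split:
 assumes sym: "\<And>i j. P i j = P j i" and ab: "1 <= a" "a < b" "b <= n"
 shows "npairs n P = npairs n (%i j. i \<notin> {a,b} & j \<notin> {a,b} & P i j)
  + (\<Sum>i\<in>{1..n}-{a,b}. of_bool (P i a) + of_bool (P i b)) + of_bool (P a b)"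
proof -
 define S where "S Q = {(i, j). 1 <= i & i < j & j <= n & Q i j}" for Q :: "nat => nat => bool"
 have fin: "finite (S Q)" for Q unfolding S_def by (rule finite_pairs)
 let ?D = "%i j. i \<notin> {a,b} & j \<notin> {a,b} & P i j"
 define T where "T c = (%i. (min i c, max i c)) ` {i\<in>{1..n}-{a,b}. P i c}" for c
 define U where "U = (if P a b then {(a,b)} else {})"
 have "S P = S ?D \<union> (T a \<union> (T b \<union> U))"
 proof (rule Set.set_eqI, clarify)
  fix i j
  have T: "(i, j) \<in> T c \<longleftrightarrow> (i = c & j \<in> {1..n}-{a,b} & P j c & i < j) \<or> (j = c & i \<in> {1..n}-{a,b} & P i c & i < j)" if "c \<in> {a,b}" for c
  proof
   assume "(i, j) \<in> T c"
   then obtain k where k: "k \<in> {1..n}-{a,b}" "P k c" "i = min k c" "j = max k c" by (auto simp: T_def)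
   then have "k ~= c" using that by auto
   then show "(i = c & j \<in> {1..n}-{a,b} & P j c & i < j) \<or> (j = c & i \<in> {1..n}-{a,b} & P i c & i < j)"
    using k by (auto simp: min_def max_def)
  next
   assume "(i = c & j \<in> {1..n}-{a,b} & P j c & i < j) \<or> (j = c & i \<in> {1..n}-{a,b} & P i c & i < j)"
   then show "(i, j) \<in> T c" unfolding T_def
   proof (elim disjE conjE)
    assume "i = c" "j \<in> {1..n}-{a,b}" "P j c" "i < j"
    then show "(i, j) \<in> (%i. (min i c, max i c)) ` {i\<in>{1..n}-{a,b}. P i c}"
     by (intro image_eqI[of _ _ j]) auto
   next
    assume "j = c" "i \<in> {1..n}-{a,b}" "P i c" "i < j"
    then show "(i, j) \<in> (%i. (min i c, max i c)) ` {i\<in>{1..n}-{a,b}. P i c}"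
     by (intro image_eqI[of _ _ i]) auto
   qed
  qed
  show "(i, j) \<in> S P \<longleftrightarrow> (i, j) \<in> S ?D \<union> (T a \<union> (T b \<union> U))"
  proof -
   note TT = T[of a, OF insertI1] T[of b, OF insertI2[OF insertI1]]
   have U: "(i, j) \<in> U \<longleftrightarrow> i = a & j = b & P a b" by (simp add: U_def)
   have "a ~= b" using ab by simp
   then consider "i \<notin> {a,b}" "j \<notin> {a,b}" | "i \<in> {a,b}" "j \<in> {a,b}" | "i = a" "j \<notin> {a,b}" | "i = b" "j \<notin> {a,b}"
    | "i \<notin> {a,b}" "j = a" | "i \<notin> {a,b}" "j = b" by blast
   then show ?thesis
   proof cases
    case 1 then show ?thesis unfolding Un_iff TT U by (auto simp: S_def)
   next
    case 2 then show ?thesis unfolding Un_iff TT U using ab by (auto simp: S_def)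
   next
    case 3 then show ?thesis unfolding Un_iff TT U using ab sym[of a j] by (auto simp: S_def)
   next
    case 4 then show ?thesis unfolding Un_iff TT U using ab sym[of b j] by (auto simp: S_def)
   next
    case 5 then show ?thesis unfolding Un_iff TT U using ab by (auto simp: S_def)
   next
    case 6 then show ?thesis unfolding Un_iff TT U using ab by (auto simp: S_def)
   qed
  qed
 qed
 moreover have "S ?D \<inter> (T a \<union> (T b \<union> U)) = {}" "T a \<inter> (T b \<union> U) = {}" "T b \<inter> U = {}"
  using ab by (auto simp: S_def T_def U_def min_def max_def split: if_splits)
 moreover have finT: "finite (T c)" for c by (simp add: T_def)
 moreover have finU: "finite U" by (simp add: U_def)
 ultimately have "card (S P) = card (S ?D) + (card (T a) + (card (T b) + card U))"
  by (simp add: card_Un_disjoint fin)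
 moreover have "card (T c) = (\<Sum>i\<in>{1..n}-{a,b}. of_bool (P i c))" for c
 proof -
  have "inj_on (%i. (min i c, max i c)) X" for X
   by (auto simp: inj_on_def min_def max_def split: if_splits)
  then have "card (T c) = card {i\<in>{1..n}-{a,b}. P i c}" unfolding T_def by (rule card_image)
  also have "\<dots> = (\<Sum>i\<in>{1..n}-{a,b}. of_bool (P i c))" by (simp add: Int_def)
  finally show ?thesis .
 qed
 moreover have "card U = of_bool (P a b)" by (simp add: U_def)
 ultimately show ?thesis unfolding npairs_def S_def by (simp add: sum.distrib)
qed

lemma inversion_sym: "inversion x i j = inversion x j i" by (auto simp: inversion_def)

lemma len_le: "len n x <= n * n" unfolding len_def by (rule npairs_le)

text \<open>No non-inversion is good at the top, as \<open>dif w w\<close> vanishes.\<close>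

lemma tdim_self:
 assumes w: "w permutes {1..n}"
 shows "tdim n w w = len n w"
 unfolding tdim_def len_def
proof (rule npairs_cong)
 fix i j :: nat assume ij: "1 <= i" "i < j" "j <= n"
 have "w i ~= w j" using permutes_inj[OF w] ij by (auto dest: injD)
 then consider "w i < w j" | "w j < w i" by linarith
 then show "good w w i j = inversion w i j"
 proof cases
  case 1
  have "~ shaded w w i j (w i) (w j)"
   using 1 ij shadedD[of w w i j "w i" "w j" i "w j"] by auto
  then show ?thesis using good_noninversion[of w w i j] ij 1 by (simp add: inversion_def)
 next
  case 2 then show ?thesis using good_inversion[of w w i j] ij by (simp add: inversion_def)
 qed
qed

context
 fixes x w :: "nat => nat" and n a b :: nat
 assumes xp: "x permutes {1..n}" and c: "is_cover x a b" and bn: "b <= n"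
begin

private lemma ca1: "1 <= a" and cab: "a < b" and cxab: "x a < x b"
 and ccover: "\<And>i. a < i ==> i < b ==> x a < x i ==> x i < x b ==> False"
 using c by (auto simp: is_cover_def)

lemma len_cover: "len n (x \<circ> transpose a b) = len n x + 1"
proof -
 define y where "y = x \<circ> transpose a b"
 have ya: "y a = x b" and yb: "y b = x a" and yi: "\<And>i. i ~= a ==> i ~= b ==> y i = x i"
  by (simp_all add: y_def transpose_def)
 have D: "npairs n (%i j. i \<notin> {a, b} & j \<notin> {a, b} & inversion y i j) =
   npairs n (%i j. i \<notin> {a, b} & j \<notin> {a, b} & inversion x i j)"
  by (rule npairs_cong) (auto simp: inversion_def yi)
 have T: "of_bool (inversion y i a) + of_bool (inversion y i b) = (of_bool (inversion x i a) + of_bool (inversion x i b) :: nat)"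
  if i: "i \<in> {1..n} - {a,b}" for i
 proof -
  have ne: "x i ~= x a" "x i ~= x b" using permutes_inj[OF xp] i by (auto dest: injD)
  have yii: "y i = x i" using yi i by simp
  consider "i < a" | "a < i" "i < b" | "b < i" using i by fastforce
  then show ?thesis
  proof cases
   case 1 then show ?thesis using cab cxab ne by (auto simp: inversion_def ya yb yii)
  next
   case 2
   then have "x b < x i \<or> x i < x a" using ccover ne by (meson linorder_neqE_nat)
   then show ?thesis using cab cxab ne 2 by (auto simp: inversion_def ya yb yii)
  next
   case 3 then show ?thesis using cab cxab ne by (auto simp: inversion_def ya yb yii)
  qed
 qed
 have "len n y = len n x + 1"
  unfolding len_def npairs_split[OF inversion_sym ca1 cab bn, of y] npairs_split[OF inversion_sym ca1 cab bn, of x] D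
  using T cab cxab by (simp add: inversion_def ya yb)
 then show ?thesis by (simp add: y_def)
qed

context
 assumes xw: "bruhat_le x w" and yw: "bruhat_le (x \<circ> transpose a b) w"
begin

lemma tdim_cover:
 "tdim n x w = tdim n (x \<circ> transpose a b) w
   + npairs n (%i j. i \<notin> {a,b} & j \<notin> {a,b} & lossX x w a b i j)
   + card {i\<in>{1..n}-{a,b}. lossW x w a b i \<or> lossE x w a b i}"
proof -
 define y where "y = x \<circ> transpose a b"
 note asm = xp c bn xw yw[folded y_def] y_def
 let ?d = "%Q i j. i \<notin> {a,b} & j \<notin> {a,b} & Q i j"
 note gd = good_disjoint(1)[OF asm] good_disjoint(2)[OF asm]
 have eq: "{(i,j). 1 <= i & i < j & j <= n & ?d (good x w) i j} =
   {(i,j). 1 <= i & i < j & j <= n & ?d (good y w) i j} \<union> {(i,j). 1 <= i & i < j & j <= n & ?d (lossX x w a b) i j}"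
  (is "?S1 = ?S2 \<union> ?S3")
 proof (rule Set.set_eqI)
  fix z :: "nat \<times> nat" obtain i j where z: "z = (i, j)" by (cases z)
  show "z \<in> ?S1 \<longleftrightarrow> z \<in> ?S2 \<union> ?S3"
   unfolding z Un_iff mem_Collect_eq prod.case using gd(1)[of i j] by blast
 qed
 have disj: "?S2 \<inter> ?S3 = {}"
 proof (rule equals0I)
  fix z assume z: "z \<in> ?S2 \<inter> ?S3"
  obtain i j where "z = (i, j)" by (cases z)
  then show False using z gd(2)[of i j] by simp
 qed
 have "npairs n (?d (good x w)) = card (?S2 \<union> ?S3)"
  unfolding npairs_def eq ..
 also have "\<dots> = npairs n (?d (good y w)) + npairs n (?d (lossX x w a b))"
  unfolding npairs_def by (rule card_Un_disjoint[OF finite_pairs finite_pairs disj])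
 finally have D: "npairs n (?d (good x w)) = npairs n (?d (good y w)) + npairs n (?d (lossX x w a b))" .
 have "(\<Sum>i\<in>{1..n}-{a,b}. of_bool (good x w i a) + of_bool (good x w i b)) =
   (\<Sum>i\<in>{1..n}-{a,b}. of_bool (good y w i a) + of_bool (good y w i b) + (of_bool (lossW x w a b i \<or> lossE x w a b i) :: nat))"
 proof (rule sum.cong[OF refl])
  fix i assume "i \<in> {1..n}-{a,b}"
  then have "1 <= i" "i ~= a" "i ~= b" by auto
  from good_third[OF asm this] show "of_bool (good x w i a) + of_bool (good x w i b) =
   of_bool (good y w i a) + of_bool (good y w i b) + (of_bool (lossW x w a b i \<or> lossE x w a b i) :: nat)" .
 qed
 also have "\<dots> = (\<Sum>i\<in>{1..n}-{a,b}. of_bool (good y w i a) + of_bool (good y w i b)) + card {i\<in>{1..n}-{a,b}. lossW x w a b i \<or> lossE x w a b i}"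
  by (simp only: sum.distrib sum_of_bool_card[OF finite_Diff[OF finite_atLeastAtMost]])
 finally have T: "(\<Sum>i\<in>{1..n}-{a,b}. of_bool (good x w i a) + of_bool (good x w i b)) = \<dots>" .
 show ?thesis
  unfolding tdim_def npairs_split[OF good_commute ca1 cab bn] D T y_def [symmetric]
  using good_ab[OF asm] by simp
qed

lemma tdim_cover_le: "tdim n (x \<circ> transpose a b) w <= tdim n x w"
 using tdim_cover by simp

lemma tdim_cover_less_iff:
 "tdim n (x \<circ> transpose a b) w < tdim n x w \<longleftrightarrow>
   (\<exists>i j. j <= n & lossX x w a b i j) \<or> (\<exists>i\<le>n. lossW x w a b i \<or> lossE x w a b i)" (is "?L \<longleftrightarrow> ?R")
proof
 assume ?L
 then have "npairs n (%i j. i \<notin> {a,b} & j \<notin> {a,b} & lossX x w a b i j) ~= 0 \<or> card {i\<in>{1..n}-{a,b}. lossW x w a b i \<or> lossE x w a b i} ~= 0"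
  using tdim_cover by linarith
 then show ?R
 proof
  assume "npairs n (%i j. i \<notin> {a,b} & j \<notin> {a,b} & lossX x w a b i j) ~= 0"
  then have "{(i,j). 1 <= i & i < j & j <= n & i \<notin> {a,b} & j \<notin> {a,b} & lossX x w a b i j} ~= {}"
   unfolding npairs_def by (metis card.empty)
  then show ?R by auto
 next
  assume "card {i\<in>{1..n}-{a,b}. lossW x w a b i \<or> lossE x w a b i} ~= 0"
  then have "{i\<in>{1..n}-{a,b}. lossW x w a b i \<or> lossE x w a b i} ~= {}" by (metis card.empty)
  then show ?R by auto
 qed
next
 assume ?R
 then show ?L
 proof
  assume "\<exists>i j. j <= n & lossX x w a b i j"
  then obtain i j where ij: "j <= n" "lossX x w a b i j" by blast
  then have "(i, j) \<in> {(i,j). 1 <= i & i < j & j <= n & i \<notin> {a,b} & j \<notin> {a,b} & lossX x w a b i j}"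
   by (auto simp: lossX_def)
  then have "npairs n (%i j. i \<notin> {a,b} & j \<notin> {a,b} & lossX x w a b i j) > 0"
   unfolding npairs_def using finite_pairs[of n "%i j. i \<notin> {a,b} & j \<notin> {a,b} & lossX x w a b i j"] by (metis (no_types, lifting) card_gt_0_iff empty_iff)
  then show ?L using tdim_cover by linarith
 next
  assume "\<exists>i\<le>n. lossW x w a b i \<or> lossE x w a b i"
  then obtain i where "i <= n" "lossW x w a b i \<or> lossE x w a b i" by blast
  then have "i \<in> {i\<in>{1..n}-{a,b}. lossW x w a b i \<or> lossE x w a b i}"
   using cab ca1 bn by (auto simp: lossW_def lossE_def)
  then have "card {i\<in>{1..n}-{a,b}. lossW x w a b i \<or> lossE x w a b i} > 0"
   by (metis (no_types, lifting) card_gt_0_iff empty_iff finite_Diff finite_atLeastAtMost finite_Collect_conjI finite_subset mem_Collect_eq subsetI)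
  then show ?L using tdim_cover by linarith
 qed
qed

end
end

text \<open>
The leftmost possible step towards \<open>w\<close>. To the left of \<open>a\<close> all rank differences vanish, which
excludes losses of type \<open>lossW\<close> and gives a fixed edge from which shaded rectangles start.
\<close>

definition first_cover :: "(nat => nat) => (nat => nat) => nat => nat => bool" where
 "first_cover x w a b \<longleftrightarrow> 1 <= a & a < b & x a < x b & x b <= w a & (\<forall>i<a. x i = w i) \<and>
   (\<forall>i. a < i & i < b --> ~ (x a < x i & x i <= w a))"

lemma first_cover_is_cover: "first_cover x w a b ==> is_cover x a b"
 unfolding first_cover_def is_cover_def by (meson less_imp_le order_trans)

lemma first_cover_exists:
 assumes xp: "x permutes {1..n}" and wp: "w permutes {1..n}" and xw: "bruhat_le x w" and ne: "x ~= w"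
 obtains a b where "first_cover x w a b" "b <= n"
proof -
 define a where "a = (LEAST a. x a ~= w a)"
 have ex: "\<exists>a. x a ~= w a" using ne by auto
 then have xa: "x a ~= w a" unfolding a_def by (rule LeastI_ex)
 have lt: "x i = w i" if "i < a" for i using not_less_Least[of i "%a. x a ~= w a"] that a_def by auto
 have an: "a \<in> {1..n}" using xa permutes_not_in[OF xp, of a] permutes_not_in[OF wp, of a] by metis
 then obtain a' where a': "a = Suc a'" by (cases a) auto
 have "dif x w a' q = 0" for q unfolding dif_def using lt a' by (intro sum.neutral) auto
 then have "dif x w a (x a) = of_bool (x a <= w a) - 1" by (simp add: a' dif_Suc)
 moreover have "0 <= dif x w a (x a)" using xw by (simp add: bruhat_le_def)
 ultimately have "x a <= w a" by (cases "x a <= w a") auto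
 then have xwa: "x a < w a" using xa by simp
 obtain c where c: "x c = w a" using surjD[OF permutes_surj[OF xp], of "w a"] by auto
 have c1: "c > a"
 proof (rule ccontr)
  assume "~ c > a"
  then have "c < a \<or> c = a" by auto
  then show False
  proof
   assume "c < a" then have "w c = w a" using lt c by metis
   then have "c = a" by (rule injD[OF permutes_inj[OF wp]])
   then show False using \<open>c < a\<close> by simp
  qed (use c xa in auto)
 qed
 have "w a \<in> {1..n}" using an permutes_in_image[OF wp] by simp
 then have cn: "c <= n" using c permutes_in_image[OF xp, of c] by simp
 define b where "b = (LEAST b. a < b & x a < x b & x b <= w a)"
 have b: "a < b & x a < x b & x b <= w a" unfolding b_def by (rule LeastI[of _ c]) (use c c1 xwa in simp)
 have b2: "~ (x a < x i & x i <= w a)" if "a < i" "i < b" for i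
  using not_less_Least[of i "%b. a < b & x a < x b & x b <= w a"] that b_def by auto
 have "b <= c" unfolding b_def by (rule Least_le) (use c c1 xwa in simp)
 show ?thesis by (rule that[of a b]) (use b b2 an lt \<open>b \<le> c\<close> cn in \<open>auto simp: first_cover_def\<close>)
qed

text \<open>
Between \<open>a\<close> and \<open>b\<close> no point of \<open>x\<close> has a value in \<open>(x a, w a]\<close>, so the rectangle formula expresses
\<open>dif\<close> there through its values above row \<open>w a\<close> and a number of points of \<open>w\<close>.
\<close>

lemma first_cover_dif:
 assumes "first_cover x w a b" "a <= p" "p < b" "x a < q" "q <= w a"
 shows "dif x w p (Suc (w a)) + 1 + int (card {i\<in>{a<..p}. q <= w i & w i < Suc (w a)}) = dif x w p q"
proof -
 have 0: "dif x w a r = of_bool (r <= w a) - of_bool (r <= x a)" for r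
 proof -
  obtain a' where a': "a = Suc a'" using assms(1) by (cases a) (auto simp: first_cover_def)
  have "dif x w a' r = 0" unfolding dif_def using assms(1) a' by (intro sum.neutral) (auto simp: first_cover_def)
  then show ?thesis by (simp add: a' dif_Suc)
 qed
 have "{i\<in>{a<..p}. q <= x i & x i < Suc (w a)} = {}"
  using assms by (fastforce simp: first_cover_def)
 then have c: "card {i\<in>{a<..p}. q <= x i & x i < Suc (w a)} = 0" by simp
 have "dif x w a q = 1" "dif x w a (Suc (w a)) = 0"
  using 0[of q] 0[of "Suc (w a)"] assms by (auto simp: first_cover_def)
 moreover have "q <= Suc (w a)" using assms by simp
 ultimately show ?thesis using dif_rectangle[OF assms(2), of q "Suc (w a)" x w] c by linarith
qed

lemma first_cover_shaded:
 assumes "first_cover x w a b" "bruhat_le x w"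
 shows "shaded x w a b (x a) (w a)"
proof (rule shadedI)
 fix p q assume "a <= p" "p < b" "x a < q" "q <= w a"
 note first_cover_dif[OF assms(1) this]
 moreover have "0 <= dif x w p (Suc (w a))" using assms(2) by (simp add: bruhat_le_def)
 ultimately show "1 <= dif x w p q" by linarith
qed

lemma first_cover_good:
 assumes "first_cover x w a b" "bruhat_le x w"
 shows "bruhat_le (x \<circ> transpose a b) w"
proof -
 have "shaded x w a b (x a) (x b)"
  using first_cover_shaded[OF assms] assms(1) unfolding shaded_def first_cover_def by auto
 then show ?thesis using good_noninversion[OF assms(2), of a b] assms(1) by (simp add: good_def first_cover_def)
qed

lemma transpose_permutes:
 assumes "x permutes {1..n}" "1 <= a" "a < b" "b <= (n::nat)"
 shows "x \<circ> transpose a b permutes {1..n}"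
 by (rule permutes_compose[OF permutes_swap_id assms(1)]) (use assms in auto)

text \<open>Climbing to \<open>w\<close> by first covers ends because the length is bounded.\<close>

lemma bruhat_induct [consumes 3, case_names top cover]:
 assumes xp: "x permutes {1..n}" and wp: "w permutes {1..n}" and xw: "bruhat_le x w"
  and top: "P w"
  and step: "\<And>x a b. x permutes {1..n} ==> bruhat_le x w ==> x ~= w ==> first_cover x w a b ==> b <= n ==>
    x \<circ> transpose a b permutes {1..n} ==> bruhat_le (x \<circ> transpose a b) w ==> len n (x \<circ> transpose a b) = len n x + 1 ==>
    P (x \<circ> transpose a b) ==> P x"
 shows "P x"
 using xp xw
proof (induction "n * n - len n x" arbitrary: x rule: less_induct)
 case less
 show ?case
 proof (cases "x = w")
  case True then show ?thesis using top by simp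
 next
  case False
  then obtain a b where ab: "first_cover x w a b" "b <= n"
   using first_cover_exists[OF less.prems(1) wp less.prems(2)] by metis
  let ?y = "x \<circ> transpose a b"
  have y: "?y permutes {1..n}" by (rule transpose_permutes[OF less.prems(1)]) (use ab in \<open>auto simp: first_cover_def\<close>)
  have yw: "bruhat_le ?y w" by (rule first_cover_good[OF ab(1) less.prems(2)])
  have l: "len n ?y = len n x + 1"
   by (rule len_cover[OF less.prems(1) first_cover_is_cover[OF ab(1)] ab(2)])
  have "P ?y" by (rule less.hyps[OF _ y yw]) (use l len_le[of n ?y] in linarith)
  then show ?thesis using step[OF less.prems False ab y yw l] by blast
 qed
qed

lemma tdim_first_cover:
 assumes "x permutes {1..n}" "bruhat_le x w" "first_cover x w a b" "b <= n" "bruhat_le (x \<circ> transpose a b) w"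
 shows "tdim n (x \<circ> transpose a b) w <= tdim n x w"
 by (rule tdim_cover_le[OF assms(1) first_cover_is_cover[OF assms(3)] assms(4) assms(2,5)])

theorem len_le_tdim:
 assumes "x permutes {1..n}" "w permutes {1..n}" "bruhat_le x w"
 shows "len n w <= tdim n x w"
 using assms
proof (induction rule: bruhat_induct)
 case top then show ?case using tdim_self[OF assms(2)] by simp
next
 case (cover x a b) then show ?case using order_trans[OF cover(9) tdim_first_cover[OF cover(1,2,4,5,7)]] by blast
qed

theorem tdim_antimono:
 assumes "v permutes {1..n}" "x permutes {1..n}" "bruhat_le v x" "bruhat_le x w"
 shows "tdim n x w <= tdim n v w"
 using assms(1-3)
proof (induction rule: bruhat_induct)
 case top then show ?case by simp
next
 case (cover v a b)
 have "tdim n (v \<circ> transpose a b) w <= tdim n v w"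
  by (rule tdim_cover_le[OF cover(1) first_cover_is_cover[OF cover(4)] cover(5)])
   (use cover(2,7) assms(4) bruhat_le_trans in blast)+
 then show ?case using cover(9) by (rule order_trans[rotated])
qed

lemma bruhat_chain:
 assumes "x permutes {1..n}" "w permutes {1..n}" "bruhat_le x w"
 shows "len n x <= len n w & (\<exists>f. f 0 = x & f (len n w - len n x) = w & (\<forall>i \<le> len n w - len n x. f i permutes {1..n}) \<and>
   (\<forall>i < len n w - len n x. bruhat_le (f i) (f (Suc i)) & f i ~= f (Suc i)))"
 using assms
proof (induction rule: bruhat_induct)
 case top then show ?case using assms by (auto intro!: exI[of _ "%_. w"])
next
 case (cover x a b)
 let ?y = "x \<circ> transpose a b"
 obtain f where f: "f 0 = ?y" "f (len n w - len n ?y) = w" "\<forall>i \<le> len n w - len n ?y. f i permutes {1..n}"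
   "\<forall>i < len n w - len n ?y. bruhat_le (f i) (f (Suc i)) & f i ~= f (Suc i)" and l: "len n ?y <= len n w"
  using cover(9) by blast
 have e: "len n w - len n x = Suc (len n w - len n ?y)" using l cover(8) by linarith
 define g where "g i = (case i of 0 => x | Suc i => f i)" for i
 have xy: "bruhat_le x ?y"
  using dif_transpose[of a b x] cover(4) by (auto simp: bruhat_le_def first_cover_def)
 have ne: "x ~= ?y" using cover(8) by (metis Suc_eq_plus1 n_not_Suc_n)
 show ?case
 proof (intro conjI exI[of _ g] allI impI)
  show "len n x <= len n w" using l cover(8) by linarith
  show "g 0 = x" "g (len n w - len n x) = w" using f by (simp_all add: g_def e)
 next
  fix i assume "i <= len n w - len n x" then show "g i permutes {1..n}" using f cover(1) by (cases i) (simp_all add: g_def e)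
 next
  fix i assume i: "i < len n w - len n x"
  show "bruhat_le (g i) (g (Suc i))" using f xy i by (cases i) (simp_all add: g_def e del: o_apply)
  show "g i ~= g (Suc i)" using f ne i by (cases i) (simp_all add: g_def e del: o_apply)
 qed
qed

lemma bruhat_le_id:
 assumes wp: "w permutes {1..n}"
 shows "bruhat_le id w"
 unfolding bruhat_le_def
proof (intro allI)
 fix p q
 have "card {i\<in>{1..p}. w i < q} <= card {i\<in>{1..p}. i < q}"
 proof (cases "p < q")
  case True
  then have e: "{i\<in>{1..p}. i < q} = {1..p}" by auto
  show ?thesis unfolding e by (rule card_mono) auto
 next
  case False
  then have e: "{i\<in>{1..p}. i < q} = {1..<q}" by auto
  show ?thesis unfolding e
  proof (rule card_inj_on_le[of w])
   show "inj_on w {i\<in>{1..p}. w i < q}" using permutes_inj[OF wp] by (auto simp: inj_on_def inj_def)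
   show "w ` {i\<in>{1..p}. w i < q} \<subseteq> {1..<q}"
   proof clarsimp
    fix i assume "Suc 0 <= i" "w i < q"
    have "w 0 = 0" by (rule permutes_not_in[OF wp]) simp
    then have "w i ~= 0" using \<open>Suc 0 <= i\<close> injD[OF permutes_inj[OF wp], of i 0] by auto
    then show "Suc 0 <= w i" by simp
   qed
  qed simp
 qed
 moreover have "dif id w p q = (\<Sum>i\<in>{1..p}. of_bool (i < q) - of_bool (w i < q))"
  unfolding dif_def by (rule sum.cong) auto
 moreover have "\<dots> = int (card {i\<in>{1..p}. i < q}) - int (card {i\<in>{1..p}. w i < q})"
  by (simp add: sum_subtractf Int_def)
 ultimately show "0 <= dif id w p q" by simp
qed

lemma len_id: "len n id = 0"
proof -
 have "{(i, j). 1 <= i & i < j & j <= n & inversion id i j} = {}"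
  by (auto simp: inversion_def)
 then show ?thesis unfolding len_def npairs_def by (simp only: card.empty)
qed

section \<open>Configurations found in a singular situation\<close>

definition decr :: "(nat => nat) => nat set => bool" where
 "decr w S \<longleftrightarrow> (\<forall>i\<in>S. \<forall>j\<in>S. i < j --> w j < w i)"

text \<open>
The shaded set of the configuration with \<open>a1 = \<alpha>\<^sub>1\<close>, \<open>Am = {\<alpha>\<^sub>2, \<dots>, \<alpha>\<^sub>m}\<close>, \<open>Bm = {\<beta>\<^sub>1, \<dots>, \<beta>\<^sub>k\<^sub>-\<^sub>1}\<close> and
\<open>bk = \<beta>\<^sub>k\<close>. In row \<open>q\<close> it is one interval of positions: it starts at the last element of \<open>Bm\<close> with
value at least \<open>q\<close> (at \<open>a1\<close> if there is none) and ends before the first element of \<open>Am\<close> with value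
below \<open>q\<close> (before \<open>bk\<close> if there is none). Sets replace the sequences, as both are determined by the
order.
\<close>

definition region :: "(nat => nat) => nat => nat set => nat set => nat => nat => nat => bool" where
 "region w a1 Am Bm bk p q \<longleftrightarrow> w bk < q & q <= w a1 \<and>
   ((\<forall>b\<in>Bm. w b < q) --> a1 <= p) & (\<forall>b\<in>Bm. q <= w b --> b <= p) \<and>
   (\<forall>a\<in>Am. w a < q --> p < a) & ((\<forall>a\<in>Am. q <= w a) --> p < bk)"

definition avoids :: "nat => (nat => nat) => nat => nat set => nat set => nat => nat set => bool" where
 "avoids n w a1 Am Bm bk E \<longleftrightarrow>
   (\<forall>i\<in>{1..n} - (insert a1 Am \<union> insert bk Bm) - E. ~ region w a1 Am Bm bk i (w i))"

text \<open>
The 4231 shape; \<open>conf2\<close> is the 3412 shape, which with one element in \<open>Am\<close> and \<open>Bm\<close> is also the frame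
of the 45312 shape, the points in \<open>center\<close> being its remaining ones.
\<close>

definition conf1 :: "nat => (nat => nat) => nat => nat set => nat set => nat => bool" where
 "conf1 n w a1 Am Bm bk \<longleftrightarrow> Am ~= {} & Bm ~= {} & decr w Am & decr w Bm & 1 <= a1 & bk <= n \<and>
   (\<forall>b\<in>Bm. a1 < b & b < bk & w bk < w b) & (\<forall>a\<in>Am. a1 < a & a < bk & w a < w a1) \<and>
   (\<forall>b\<in>Bm. \<forall>a\<in>Am. b < a & w b < w a)"

definition conf2 :: "nat => (nat => nat) => nat => nat set => nat set => nat => nat => nat => bool" where
 "conf2 n w a1 Am Bm bk b1 am \<longleftrightarrow> am \<in> Am & b1 \<in> Bm & decr w Am & decr w Bm \<and>
   (\<forall>b\<in>Bm. 1 <= b & b < a1 & w bk < w b) & a1 < bk & (\<forall>a\<in>Am. bk < a & a <= n & w a < w a1) \<and>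
   w bk < w am & w am < w b1 & w b1 < w a1 & (\<forall>a\<in>Am - {am}. w b1 < w a) & (\<forall>b\<in>Bm - {b1}. w b < w am)"

definition center :: "(nat => nat) => nat => nat => nat => nat => nat set" where
 "center w a1 bk b1 am = {i. a1 < i & i < bk & w am < w i & w i < w b1}"

definition generic_conf :: "nat => (nat => nat) => nat => nat set => nat set => nat => bool" where
 "generic_conf n w a1 Am Bm bk \<longleftrightarrow> conf1 n w a1 Am Bm bk & avoids n w a1 Am Bm bk {} \<or>
   (\<exists>b1 am. conf2 n w a1 Am Bm bk b1 am & (avoids n w a1 Am Bm bk {} \<or>
    Am = {am} & Bm = {b1} & decr w (center w a1 bk b1 am) & avoids n w a1 Am Bm bk (center w a1 bk b1 am)))"

text \<open>
What a loss at a first cover with left end \<open>a\<close> leaves behind. Either an increasing pair of points of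
\<open>w\<close> occurs within a shaded rectangle starting at \<open>a\<close>, or the rectangle of height \<open>w a\<close> stops being
shaded in a column where the row above \<open>w a\<close> is still shaded.
\<close>

definition exit1 :: "nat => (nat => nat) => (nat => nat) => nat => nat => nat => bool" where
 "exit1 n x w a j e \<longleftrightarrow> a < j & j < e & e <= n & x a <= w j & w j < w e & shaded x w a (Suc e) (x a) (w e)"

definition exit2 :: "nat => (nat => nat) => (nat => nat) => nat => nat => bool" where
 "exit2 n x w a c \<longleftrightarrow> c <= n & shaded x w a c (x a) (w a) & (\<exists>q. x a < q & q <= w a & dif x w c q < 1) \<and>
   1 <= dif x w c (Suc (w a))"

lemma max_on:
 assumes "finite S" "S ~= {}"
 obtains m where "m \<in> S" "\<And>h. h \<in> S ==> (f h :: nat) <= f m"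
proof -
 have "Max (f ` S) \<in> f ` S" using assms by (intro Max_in) auto
 then obtain m where m: "m \<in> S" "f m = Max (f ` S)" by auto
 have "f h <= f m" if "h \<in> S" for h using m that assms by simp
 then show ?thesis using m that by blast
qed

lemma min_on:
 assumes "S ~= {}"
 obtains m where "m \<in> S" "\<And>h. h \<in> S ==> (f h :: nat) <= f m ==> f h = f m"
proof -
 obtain s where "s \<in> S" using assms by auto
 then obtain m where "m \<in> S" "\<forall>h. h \<in> S --> f m <= f h"
  using ex_has_least_nat[of "%m. m \<in> S" s f] by auto
 then show ?thesis using that by (meson le_antisym)
qed

text \<open>
Thinning out a set of points to its left-to-right minima, which form a decreasing sequence, loses
nothing: each point lies weakly to the north-east of one that is kept.
\<close>

lemma left_minimum:
 assumes "i \<in> S"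
 obtains g where "g \<in> S" "g <= (i::nat)" "w g <= (w i :: nat)" "\<forall>h\<in>S. h < g --> w g < w h"
proof -
 have "\<exists>g\<in>S. g <= i & w g <= w i & (\<forall>h\<in>S. h < g --> w g < w h)"
  using assms
 proof (induction i rule: less_induct)
  case (less i)
  show ?case
  proof (cases "\<forall>h\<in>S. h < i --> w i < w h")
   case False
   then obtain h where h: "h \<in> S" "h < i" "w h <= w i" by (auto simp: not_less)
   then show ?thesis using less.IH[OF h(2,1)] by (meson less_imp_le order_trans)
  qed (use less.prems in blast)
 qed
 then show ?thesis using that by blast
qed

lemma right_maximum:
 assumes "i \<in> S" "\<forall>h\<in>S. h < (N::nat)"
 obtains g where "g \<in> S" "i <= g" "(w i :: nat) <= w g" "\<forall>h\<in>S. g < h --> w h < w g"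
proof -
 have "\<exists>g\<in>S. i <= g & w i <= w g & (\<forall>h\<in>S. g < h --> w h < w g)"
  using assms(1)
 proof (induction "N - i" arbitrary: i rule: less_induct)
  case less
  show ?case
  proof (cases "\<forall>h\<in>S. i < h --> w h < w i")
   case False
   then obtain h where h: "h \<in> S" "i < h" "w i <= w h" by (auto simp: not_less)
   have "N - h < N - i" using h(2) bspec[OF assms(2) less.prems] by (rule diff_less_mono2)
   from less.hyps[OF this h(1)] h show ?thesis by (meson less_imp_le order_trans)
  qed (use less.prems in blast)
 qed
 then show ?thesis using that by blast
qed

lemma conf1_region:
 assumes c: "conf1 n w a1 Am Bm bk" and r: "region w a1 Am Bm bk p q"
 shows "a1 <= p & p < bk & w bk < q & q <= w a1 & (\<forall>b\<in>Bm. q <= w b --> b <= p) & (\<forall>a\<in>Am. w a < q --> p < a)"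
proof -
 have "a1 <= p"
 proof (cases "\<forall>b\<in>Bm. w b < q")
  case False
  then obtain b where b: "b \<in> Bm" "q <= w b" by (auto simp: not_less)
  then have "b <= p" "a1 < b" using r c by (auto simp: region_def conf1_def)
  then show ?thesis by simp
 qed (use r in \<open>simp add: region_def\<close>)
 moreover have "p < bk"
 proof (cases "\<forall>a\<in>Am. q <= w a")
  case False
  then obtain a where a: "a \<in> Am" "w a < q" by (auto simp: not_le)
  then have "p < a" "a < bk" using r c by (auto simp: region_def conf1_def)
  then show ?thesis by simp
 qed (use r in \<open>simp add: region_def\<close>)
 ultimately show ?thesis using r by (simp add: region_def)
qed

context
 fixes x w :: "nat => nat" and n a b :: nat
 assumes xp: "x permutes {1..n}" and wp: "w permutes {1..n}" and xw: "bruhat_le x w"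
  and fc: "first_cover x w a b" and bn: "b <= n"
begin

private lemma nn: "0 <= dif x w p q" using xw by (simp add: bruhat_le_def)
private lemma ea1: "1 <= a" and eab: "a < b" and exab: "x a < x b" and xbw: "x b <= w a"
 and noc: "\<And>i. a < i ==> i < b ==> x a < x i ==> x i <= w a ==> False"
 and before: "\<And>i. i < a ==> x i = w i"
 using fc by (auto simp: first_cover_def)
private lemma injx: "x i = x j \<longleftrightarrow> i = j" using permutes_inj[OF xp] by (simp add: inj_eq)
private lemma injw: "w i = w j \<longleftrightarrow> i = j" using permutes_inj[OF wp] by (simp add: inj_eq)
private lemma d_before: "p < a ==> dif x w p q = 0"
 unfolding dif_def using before by (intro sum.neutral) auto
private lemma d_a: "dif x w a q = of_bool (q <= w a) - of_bool (q <= x a)"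
proof -
 obtain a' where a': "a = Suc a'" using ea1 by (cases a) auto
 then show ?thesis using d_before[of a'] by (simp add: dif_Suc)
qed
private lemma d_n: "dif x w n q = 0" by (rule dif_outside[OF xp wp]) simp
private lemma sh_b: "shaded x w a b (x a) (w a)" by (rule first_cover_shaded[OF fc xw])
private lemma xwa: "x a < w a" using exab xbw by simp

text \<open>
Let \<open>c\<close> be the first column where the rectangle of height \<open>w a\<close> stops being shaded. If the row above
\<open>w a\<close> is shaded there, this is the second exit; a loss of type \<open>lossE\<close> forces it. For a loss of type
\<open>lossX\<close> the point where \<open>dif\<close> is 1 severely limits the points of \<open>w\<close> nearby: there is one low point
before it, and either a later higher one forms an increasing pair with it, or counting points of \<open>x\<close> in
the rectangle up to column \<open>c\<close> shows again that the row above \<open>w a\<close> is shaded.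
\<close>

lemma loss_exits:
 assumes loss: "(\<exists>i j. j <= n & lossX x w a b i j) \<or> (\<exists>i\<le>n. lossW x w a b i \<or> lossE x w a b i)"
 shows "(\<exists>j e. exit1 n x w a j e) \<or> (\<exists>c. exit2 n x w a c)"
proof -
 define Z where "Z c \<longleftrightarrow> a <= c & (\<exists>q. x a < q & q <= w a & dif x w c q < 1)" for c
 define c where "c = (LEAST c. Z c)"
 have Zn: "Z n" unfolding Z_def using d_n xwa eab bn by auto
 then have Zc: "Z c" unfolding c_def by (rule LeastI)
 have cn: "c <= n" unfolding c_def using Zn by (rule Least_le)
 have shc: "shaded x w a c (x a) (w a)"
 proof (rule shadedI)
  fix p q assume pq: "a <= p" "p < c" "x a < q" "q <= w a"
  then have "~ Z p" using not_less_Least[of p Z] c_def by simp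
  then show "1 <= dif x w p q" using pq unfolding Z_def by auto
 qed
 have bc: "b <= c"
 proof (rule ccontr)
  assume "~ b <= c"
  then show False using Zc shadedD[OF sh_b, of c] unfolding Z_def by fastforce
 qed
 have exit2: "exit2 n x w a c" if "1 <= dif x w c (Suc (w a))"
  unfolding exit2_def using cn shc Zc that unfolding Z_def by blast
 have noW: "~ lossW x w a b i" for i
 proof
  assume "lossW x w a b i"
  then have "i < a" "x i < x a" "shaded x w i a (x i) (x a)" by (auto simp: lossW_def)
  then show False using shadedD[of x w i a "x i" "x a" i "x a"] d_before[of i] by simp
 qed
 from loss noW consider (E) i where "i <= n" "lossE x w a b i" | (X) i j where "j <= n" "lossX x w a b i j" by blast
 then show ?thesis
 proof cases
  case E
  then have i: "b < i" "x b < x i" and P: "shaded x w b i (x b) (x i)" and Q: "~ shaded x w a b (x b) (x i)"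
   and R: "~ shaded x w b i (x a) (x b)" by (auto simp: lossE_def)
  obtain p1 q1 where pq1: "b <= p1" "p1 < i" "x a < q1" "q1 <= x b" "dif x w p1 q1 < 1"
   using R unfolding shaded_def by (metis not_le)
  have "Z p1" unfolding Z_def using pq1 eab xbw by (meson le_trans less_imp_le)
  then have "c <= p1" unfolding c_def by (rule Least_le)
  then have ci: "c < i" using pq1 by simp
  have "w a < x i"
  proof (rule ccontr)
   assume "~ w a < x i"
   then have "shaded x w a b (x b) (x i)" using sh_b exab unfolding shaded_def by auto
   then show False using Q by simp
  qed
  then have "1 <= dif x w c (Suc (w a))"
   using shadedD[OF P bc ci, of "Suc (w a)"] xbw by simp
  then show ?thesis using exit2 by blast
 next
  case X
  then obtain p q where i1: "1 <= i" and ij: "i < j" and ne: "i ~= a" "i ~= b" "j ~= a" "j ~= b" and xij: "x i < x j"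
   and sij: "shaded x w i j (x i) (x j)" and pq: "a <= p" "p < b" "x a < q" "q <= x b" "i <= p" "p < j" "x i < q" "q <= x j"
   and d1: "dif x w p q = 1" unfolding lossX_def by blast
  have ai: "a < i"
  proof (rule ccontr)
   assume "~ a < i"
   then have "i < a" using ne by simp
   then show False using shadedD[OF sij, of i q] ij pq d_before[of i q] by simp
  qed
  have qwa: "q <= w a" using pq xbw by simp
  note fd = first_cover_dif[OF fc pq(1-3) qwa]
  have dpw: "dif x w p (Suc (w a)) = 0" using fd d1 nn[of p "Suc (w a)"] by linarith
  then have c0: "card {i \<in> {a<..p}. q <= w i & w i < Suc (w a)} = 0" using fd d1 by linarith
  have now1: "~ (q <= w k & w k <= w a)" if "a < k" "k <= p" for k
   using c0 that by auto
  have xj: "x j <= w a"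
  proof (rule ccontr)
   assume "~ x j <= w a"
   then have "1 <= dif x w p (Suc (w a))" using shadedD[OF sij, of p "Suc (w a)"] pq qwa by simp
   then show False using dpw by simp
  qed
  have bj: "b < j"
  proof (rule ccontr)
   assume "~ b < j"
   then show False using noc[of j] ai ij xj pq ne by simp
  qed
  have "x i ~= x a" using injx ne by simp
  moreover have "~ x a < x i" using noc[of i] ai pq qwa by fastforce
  ultimately have xia: "x i < x a" by linarith
  have "\<exists>k. a < k & k <= p & x a <= w k & w k < q"
  proof (rule ccontr)
   assume "~ ?thesis"
   then have "dif x w p (x a) + dif x w a q <= dif x w a (x a) + dif x w p q"
    by (intro dif_rectangle_no_w) (use pq in auto)
   moreover have "dif x w a q = 1" "dif x w a (x a) = 0" using d_a qwa pq xwa by auto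
   moreover have "1 <= dif x w p (x a)" using shadedD[OF sij, of p "x a"] pq xia by simp
   ultimately show False using d1 by linarith
  qed
  then obtain k where k: "a < k" "k <= p" "x a <= w k" "w k < q" by blast
  show ?thesis
  proof (cases "\<exists>e. p < e & e <= c & q <= w e & w e <= w a")
   case True
   then obtain e where e: "p < e" "e <= c" "q <= w e" "w e <= w a" by blast
   have "shaded x w a (Suc e) (x a) (w e)"
   proof (rule shadedI)
    fix p' q' assume pq': "a <= p'" "p' < Suc e" "x a < q'" "q' <= w e"
    show "1 <= dif x w p' q'"
    proof (cases "p' < e")
     case True then show ?thesis using shadedD[OF shc, of p' q'] pq' e by simp
    next
     case False
     then have "p' = e" using pq' by simp
     obtain e' where e': "e = Suc e'" using e by (cases e) auto
     have "1 <= dif x w e' q'" using shadedD[OF shc, of e' q'] pq' e e' k by simp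
     then show ?thesis using \<open>p' = e\<close> e' pq' by (simp add: dif_Suc)
    qed
   qed
   then have "exit1 n x w a k e" unfolding exit1_def using k e cn by auto
   then show ?thesis by blast
  next
   case False
   have "p <= c" using pq bc by simp
   have "{i \<in> {p<..c}. q <= w i & w i < Suc (w a)} = {}" using False by auto
   then have cw: "card {i \<in> {p<..c}. q <= w i & w i < Suc (w a)} = 0" by simp
   let ?X = "{i \<in> {p<..c}. q <= x i & x i < Suc (w a)}"
   have R: "dif x w c q + dif x w p (Suc (w a)) + int (card ?X) = dif x w p q + dif x w c (Suc (w a))"
    using dif_rectangle[OF \<open>p \<le> c\<close>, of q "Suc (w a)" x w] cw qwa by simp
   have bX: "b \<in> ?X" using pq bc xbw by simp
   have "1 <= dif x w c (Suc (w a))"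
   proof (cases "j <= c")
    case True
    then have "j \<in> ?X" using pq xj by simp
    then have "card {b, j} <= card ?X" using bX by (intro card_mono) auto
    then have "2 <= card ?X" using bj by simp
    then show ?thesis using R dpw d1 nn[of c q] by linarith
   next
    case False
    have "card {b} <= card ?X" using bX by (intro card_mono) auto
    moreover have "1 <= dif x w c q" using shadedD[OF sij, of c q] False pq bc by simp
    ultimately show ?thesis using R dpw d1 by simp
   qed
   then show ?thesis using exit2 by blast
  qed
 qed
qed

text \<open>
A 4231 configuration is grown greedily around an increasing pair. Its \<open>\<alpha>\<^sub>1\<close> is the lowest point above
the row of \<open>e\<close> to the left of \<open>e\<close>; \<open>Bm\<close> consists of right-to-left maxima between \<open>\<alpha>\<^sub>1\<close> and \<open>e\<close>, and
\<open>Am\<close> of left-to-right minima from \<open>e\<close> on. The last point \<open>\<beta>\<^sub>k\<close> is looked for up to the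
first column \<open>F\<close> where the shading ends or a point in rows \<open>x a\<close> to \<open>w jm\<close> occurs. Every choice being
extremal, another point of \<open>w\<close> in the region would have been chosen instead.
\<close>

lemma exit1_conf:
 assumes ex: "exit1 n x w a j0 e0"
 shows "\<exists>A1 Am Bm bk. generic_conf n w A1 Am Bm bk & (\<forall>p q. region w A1 Am Bm bk p q --> 1 <= dif x w p q)"
proof -
 \<comment> \<open>Minimality of \<open>e\<close> puts all low points after \<open>\<alpha>\<^sub>1\<close>: an earlier one would form an increasing pair with
  \<open>\<alpha>\<^sub>1\<close>.\<close>
 define e where "e = (LEAST e. \<exists>j. exit1 n x w a j e)"
 have "\<exists>j. exit1 n x w a j e" unfolding e_def by (rule LeastI_ex) (use ex in blast)
 then obtain j where j: "a < j" "j < e" "x a <= w j" "w j < w e" and en: "e <= n"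
  and she: "shaded x w a (Suc e) (x a) (w e)" by (auto simp: exit1_def)
 have emin: "e' < e ==> ~ exit1 n x w a j' e'" for e' j'
  using not_less_Least[of e' "%e. \<exists>j. exit1 n x w a j e"] e_def by blast
 have ae: "a < e" using j by simp
 have "1 <= dif x w a (w e)" using shadedD[OF she, of a "w e"] j by simp
 moreover have "dif x w a (w e) <= of_bool (w e <= w a)" using d_a[of "w e"] by simp
 ultimately have "w e <= w a" by (cases "w e <= w a") auto
 then have wea: "w e < w a" using injw[of e a] ae by (simp add: le_less)
 define V where "V v \<longleftrightarrow> w e < v & (\<exists>i. a <= i & i < e & w i = v)" for v
 define v where "v = (LEAST v. V v)"
 have "V (w a)" using wea ae by (auto simp: V_def)
 then have "V v" unfolding v_def by (rule LeastI)
 then obtain i1 where i1: "a <= i1" "i1 < e" "w i1 = v" and ev: "w e < v" by (auto simp: V_def)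
 have vmin: "~ (w e < w i & w i < v)" if "a <= i" "i < e" for i
  using not_less_Least[of "w i" V] that v_def by (auto simp: V_def)
 have T1: "1 <= dif x w p q" if "a <= p" "p < e" "x a < q" "q <= v" for p q
 proof (cases "q <= w e")
  case True then show ?thesis using shadedD[OF she, of p q] that by simp
 next
  case False
  have "dif x w p (w e) + dif x w (a - 1) q <= dif x w (a - 1) (w e) + dif x w p q"
  proof (rule dif_rectangle_no_w)
   fix i assume i: "a - 1 < i" "i <= p" "w e <= w i" "w i < q"
   then have "i ~= e" using that by simp
   then have "w i ~= w e" using injw by simp
   moreover have "a <= i" using i ea1 by linarith
   ultimately show False using vmin[of i] i that by auto
  qed (use False that in auto)
  moreover have "dif x w (a - 1) r = 0" for r using d_before ea1 by simp
  moreover have "1 <= dif x w p (w e)" using shadedD[OF she, of p "w e"] that j by simp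
  ultimately show ?thesis by simp
 qed
 have i1j: "i1 < k" if "a < k" "k < e" "x a <= w k" "w k < w e" for k
 proof (rule ccontr)
  assume "~ i1 < k"
  moreover have "k ~= i1" using that i1 ev by auto
  ultimately have "k < i1" by simp
  have "exit1 n x w a k i1" unfolding exit1_def
   using that \<open>k < i1\<close> i1 ev en T1 by (auto simp: shaded_def)
  then show False using emin i1 by blast
 qed
 define J where "J = {k. i1 < k & k < e & x a <= w k & w k < w e}"
 have "finite J" unfolding J_def by (rule finite_subset[of _ "{..e}"]) auto
 moreover have "j \<in> J" using j i1j by (simp add: J_def)
 ultimately obtain jm where jm: "jm \<in> J" and jmax: "\<And>h. h \<in> J ==> w h <= w jm"
  using max_on[of J w] by blast
 have jm': "i1 < jm" "jm < e" "x a <= w jm" "w jm < w e" using jm by (auto simp: J_def)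
 define OK where "OK p \<longleftrightarrow> (\<forall>q. x a < q --> q <= w e --> (\<forall>g. e <= g & g <= p & w jm < w g --> q <= w g) --> 1 <= dif x w p q)" for p
 define St where "St f \<longleftrightarrow> e < f & (~ OK f \<or> (x a <= w f & w f < w jm))" for f
 have OKe: "OK e" unfolding OK_def using shadedD[OF she] ae by simp
 have nOKn: "~ OK n"
 proof
  assume "OK n"
  then have "1 <= dif x w n (Suc (x a))" unfolding OK_def using jm' by fastforce
  then show False using d_n by simp
 qed
 have "e ~= n" using OKe nOKn by auto
 then have "St n" using en nOKn by (simp add: St_def)
 define F where "F = (LEAST f. St f)"
 have StF: "St F" unfolding F_def using \<open>St n\<close> by (rule LeastI)
 have Fn: "F <= n" unfolding F_def using \<open>St n\<close> by (rule Least_le)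
 have Fmin: "~ St f" if "f < F" for f using not_less_Least[of f St] that F_def by simp
 have eF: "e < F" using StF by (simp add: St_def)
 have OKp: "OK p" if "e <= p" "p < F" for p
  using Fmin[of p] OKe that by (cases "p = e") (auto simp: St_def)
 have skip: "~ (x a <= w g & w g < w jm)" if "e < g" "g < F" for g
  using Fmin[of g] that by (auto simp: St_def)
 \<comment> \<open>If the shading ends at \<open>F\<close> without a point of \<open>w\<close> in rows \<open>x a\<close> to \<open>w jm\<close>, then \<open>\<beta>\<^sub>k\<close> is the highest point below
  row \<open>x a\<close>; the row \<open>q'\<close> is one that is not shaded at \<open>F\<close>.\<close>
 have "\<exists>bk. e < bk & bk <= F & w bk < w jm & (x a <= w bk & bk = F \<or>
   w bk < x a & (\<forall>g. e < g & g <= F & w g < x a --> w g <= w bk) & w F < x a \<and>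
   (\<exists>q'. x a < q' & q' <= w e & (\<forall>g. e <= g & g <= F & w jm < w g --> q' <= w g) & dif x w F q' <= 0))"
 proof (cases "x a <= w F & w F < w jm")
  case True then show ?thesis using eF by (intro exI[of _ F]) auto
 next
  case nF: False
  then have "~ OK F" using StF by (auto simp: St_def)
  then obtain q' where q': "x a < q'" "q' <= w e" "\<And>g. e <= g ==> g <= F ==> w jm < w g ==> q' <= w g" "~ 1 <= dif x w F q'"
   unfolding OK_def by blast
  obtain F' where F': "F = Suc F'" using eF by (cases F) auto
  have "1 <= dif x w F' q'" using OKp[of F'] F' eF q' unfolding OK_def by auto
  then have "w F < q'" using q'(4) unfolding F' dif_Suc by (cases "q' <= w (Suc F')"; cases "q' <= x (Suc F')") auto
  moreover have "w F ~= w jm" using injw jm' eF by auto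
  ultimately have "w F < w jm" using q'(3)[of F] eF by fastforce
  then have wF: "w F < x a" using nF by auto
  define S where "S = {g. e < g & g <= F & w g < x a}"
  have "finite S" unfolding S_def by (rule finite_subset[of _ "{..F}"]) auto
  moreover have "F \<in> S" using eF wF by (simp add: S_def)
  ultimately obtain m where m: "m \<in> S" "\<And>h. h \<in> S ==> w h <= w m" using max_on[of S w] by blast
  then have "e < m" "m <= F" "w m < w jm" "w m < x a" "\<forall>g. e < g & g <= F & w g < x a --> w g <= w m"
   using jm' by (auto simp: S_def)
  moreover have "\<exists>q'. x a < q' & q' <= w e & (\<forall>g. e <= g & g <= F & w jm < w g --> q' <= w g) & dif x w F q' <= 0"
   by (rule exI[of _ q']) (use q' in auto)
  ultimately show ?thesis using wF by blast
 qed
 then obtain bk where bk: "e < bk" "bk <= F" "w bk < w jm" and bk': "x a <= w bk & bk = F \<or>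
   w bk < x a & (\<forall>g. e < g & g <= F & w g < x a --> w g <= w bk) & w F < x a \<and>
   (\<exists>q'. x a < q' & q' <= w e & (\<forall>g. e <= g & g <= F & w jm < w g --> q' <= w g) & dif x w F q' <= 0)" by blast
 define Am where "Am = {g. e <= g & g < bk & w jm < w g & (\<forall>h. e <= h & h < g & w jm < w h --> w g < w h)}"
 define Bm where "Bm = {g. i1 < g & g < e & w bk < w g & w g < w e & (\<forall>h. g < h & h < e & w h < w e --> w h < w g)}"
 have eA: "e \<in> Am" using bk jm' by (auto simp: Am_def)
 have AmI: "\<exists>g\<in>Am. g <= i & w g <= w i" if "e <= i" "i < bk" "w jm < w i" for i
  by (rule left_minimum[of i "{h. e <= h & w jm < w h}" w]) (use that in \<open>auto simp: Am_def intro!: bexI\<close>)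
 have BmI: "\<exists>g\<in>Bm. i <= g & w i <= w g" if "i1 < i" "i < e" "w bk < w i" "w i < w e" for i
 proof -
  note h0 = that
  obtain g where g: "g \<in> {h. h < e & w h < w e}" "i <= g" "w i <= w g" "\<forall>h\<in>{h. h < e & w h < w e}. g < h --> w h < w g"
   by (rule right_maximum[of i "{h. h < e & w h < w e}" e w]) (use h0 in auto)
  then have "g \<in> Bm" using that by (auto simp: Bm_def)
  then show ?thesis using g by blast
 qed
 have Bjm: "w g <= w jm" if "g \<in> Bm" for g
  using jmax[of g] that jm' by (cases "x a <= w g") (auto simp: Bm_def J_def)
 have jmB: "jm \<in> Bm"
 proof -
  have "w h < w jm" if "jm < h" "h < e" "w h < w e" for h
  proof (cases "x a <= w h")
   case True
   then have "w h <= w jm" using jmax[of h] that jm' by (simp add: J_def)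
   then show ?thesis using injw[of h jm] that by (simp add: le_less)
  qed (use jm' in simp)
  then show ?thesis using jm' bk by (auto simp: Bm_def)
 qed
 have dA: "decr w Am" unfolding decr_def Am_def by auto
 have dB: "decr w Bm" unfolding decr_def Bm_def by auto
 have Ae: "w g <= w e" if "g \<in> Am" for g
  using that jm' by (cases "g = e") (auto simp: Am_def)
 have c1: "conf1 n w i1 Am Bm bk"
  unfolding conf1_def
 proof (intro conjI ballI)
  show "Am ~= {}" "Bm ~= {}" using eA jmB by auto
  show "1 <= i1" "bk <= n" using i1 ea1 bk Fn by auto
  show "decr w Am" "decr w Bm" by fact+
  fix g assume "g \<in> Bm" then show "i1 < g" "g < bk" "w bk < w g" using bk by (auto simp: Bm_def)
  fix h assume "h \<in> Am" then show "g < h" using \<open>g \<in> Bm\<close> by (auto simp: Bm_def Am_def)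
  show "w g < w h" using Bjm[OF \<open>g \<in> Bm\<close>] \<open>h \<in> Am\<close> by (auto simp: Am_def)
 next
  fix g assume "g \<in> Am" then show "i1 < g" "g < bk" using i1 by (auto simp: Am_def)
  show "w g < w i1" using Ae[OF \<open>g \<in> Am\<close>] ev i1 by simp
 qed
 note reg = conf1_region[OF c1, unfolded i1(3)]
 have "avoids n w i1 Am Bm bk {}"
  unfolding avoids_def
 proof (intro ballI notI)
  fix i assume i: "i \<in> {1..n} - (insert i1 Am \<union> insert bk Bm) - {}" and r: "region w i1 Am Bm bk i (w i)"
  note R = reg[OF r]
  show False
  proof (cases "i < e")
   case True
   have "i ~= i1" "w i ~= v" "i ~= e" using i injw[of i i1] i1 True by auto
   then have "i1 < i" "w i < w e" using R vmin[of i] injw[of i e] i1 True by auto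
   then obtain g where "g \<in> Bm" "i <= g" "w i <= w g" using BmI[of i] True R by blast
   then have "g = i" using R by auto
   then show False using \<open>g \<in> Bm\<close> i by auto
  next
   case False
   have ie: "i ~= e" using i eA by auto
   show False
   proof (cases "w jm < w i")
    case True
    then obtain g where g: "g \<in> Am" "g <= i" "w g <= w i" using AmI[of i] False R by auto
    then have "w g < w i" using injw[of g i] i by (auto simp: le_less)
    then show False using R g by auto
   next
    case F2: False
    have "w i ~= w jm" using injw[of i jm] False jm' by auto
    then have "w i < w jm" using F2 by simp
    then have wixa: "w i < x a" using skip[of i] False ie R bk by auto
    have ei: "e < i" "i <= F" "w bk < w i" using R bk ie False by auto
    show False
    proof (cases "x a <= w bk")
     case True then show False using ei wixa by simp
    next
     case False
     then have "w i <= w bk" using bk' ei(1,2) wixa by blast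
     then show False using ei by simp
    qed
   qed
  qed
 qed
 moreover have "1 <= dif x w p q" if r: "region w i1 Am Bm bk p q" for p q
 proof (cases "x a < q")
  case True
  show ?thesis
  proof (cases "p < e")
   case T2: True
   then show ?thesis using T1[of p q] reg[OF r] True i1 by auto
  next
   case False
   have "q <= w e" using reg[OF r] eA False by auto
   moreover have "q <= w g" if g: "e <= g & g <= p & w jm < w g" for g
   proof (rule ccontr)
    assume "~ q <= w g"
    then have "w g < q" by simp
    moreover obtain g' where "g' \<in> Am" "g' <= g" "w g' <= w g" using AmI[of g] g reg[OF r] by auto
    ultimately show False using reg[OF r] g by fastforce
   qed
   ultimately show ?thesis using OKp[of p] False reg[OF r] bk True unfolding OK_def by auto
  qed
 next
  case False
  then have qx: "q <= x a" by simp
  then have "w bk < x a" using reg[OF r] by auto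
  then obtain q' where bmax: "\<And>g. e < g ==> g <= F ==> w g < x a ==> w g <= w bk" and wF: "w F < x a"
   and q': "x a < q'" "q' <= w e" "\<And>g. e <= g ==> g <= F ==> w jm < w g ==> q' <= w g" "dif x w F q' <= 0"
   using bk' by auto
  have pF: "p < F" using reg[OF r] bk by auto
  have "dif x w F q + dif x w p q' <= dif x w p q + dif x w F q'"
  proof (rule dif_rectangle_no_w)
   fix g assume g: "p < g" "g <= F" "q <= w g" "w g < q'"
   show False
   proof (cases "g < e")
    case True
    then obtain h where h: "h \<in> Bm" "g <= h" "w g <= w h" using BmI[of g] g reg[OF r] q' by auto
    then show False using reg[OF r] g by fastforce
   next
    case F1: False
    have ge: "g ~= e" using g q' by auto
    have "~ w jm < w g" using q'(3)[of g] g F1 by auto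
    moreover have "w g ~= w jm" using injw[of g jm] F1 jm' by auto
    ultimately have "w g < w jm" by simp
    then have "w g < x a" using skip[of g] g F1 ge wF by (cases "g = F") auto
    then have "w g <= w bk" using bmax[of g] g F1 ge by simp
    then show False using g reg[OF r] by auto
   qed
  qed (use pF qx q' in auto)
  moreover have "1 <= dif x w p q'"
  proof (cases "p < e")
   case True then show ?thesis using T1[of p q'] reg[OF r] i1 q' ev by auto
  next
   case False then show ?thesis using OKp[of p] pF q' unfolding OK_def by auto
  qed
  ultimately show ?thesis using q'(4) nn[of F q] by linarith
 qed
 ultimately show ?thesis using c1 unfolding generic_conf_def by blast
qed

text \<open>
Here \<open>\<alpha>\<^sub>1\<close> is the lowest point \<open>u\<close> above row \<open>w a\<close> in the columns where the row above \<open>w a\<close> is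
shaded, \<open>\<alpha>\<^sub>m\<close> ends the shading on the right, and \<open>\<beta>\<^sub>1\<close> is the last point before \<open>u\<close> between the rows of
\<open>\<alpha>\<^sub>m\<close> and \<open>a\<close>. Points \<open>G\<close> in the central rectangle decide the shape: together with further upper
points \<open>A'\<close> they make a 4231 configuration, on their own a 45312 one, and without them the shape is
3412.
\<close>

lemma exit2_conf:
 assumes no1: "\<And>j e. ~ exit1 n x w a j e" and ex: "exit2 n x w a c"
 shows "\<exists>A1 Am Bm bk. generic_conf n w A1 Am Bm bk & (\<forall>p q. region w A1 Am Bm bk p q --> 1 <= dif x w p q)"
proof -
 have cn: "c <= n" and shc: "shaded x w a c (x a) (w a)" and dcw: "1 <= dif x w c (Suc (w a))"
  using ex by (auto simp: exit2_def)
 obtain q0 where q0: "x a < q0" "q0 <= w a" "dif x w c q0 < 1" using ex by (auto simp: exit2_def)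
 have "~ c < a" using d_before[of c] dcw by auto
 moreover have "c ~= a" using q0 d_a[of q0] by auto
 ultimately have ac: "a < c" by simp
 have cln: "c < n" using cn dcw d_n by (cases "c = n") auto
 obtain q1 where q1: "x a < q1" "q1 <= w a" "dif x w c q1 <= 0" and q1max: "\<And>q. q1 < q ==> q <= w a ==> 1 <= dif x w c q"
 proof -
  have "finite {q. x a < q & q <= w a & dif x w c q < 1}" by (rule finite_subset[of _ "{..w a}"]) auto
  moreover have "q0 \<in> {q. x a < q & q <= w a & dif x w c q < 1}" using q0 by simp
  ultimately obtain m where m: "m \<in> {q. x a < q & q <= w a & dif x w c q < 1}"
   "\<And>h. h \<in> {q. x a < q & q <= w a & dif x w c q < 1} ==> h <= m"
   using max_on[of "{q. x a < q & q <= w a & dif x w c q < 1}" "%q. q"] by blast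
  have "1 <= dif x w c q" if "m < q" "q <= w a" for q
  proof (rule ccontr)
   assume "~ 1 <= dif x w c q"
   then have "q \<in> {q. x a < q & q <= w a & dif x w c q < 1}" using that m(1) by auto
   then show False using m(2)[of q] that by simp
  qed
  then show ?thesis using that[of m] m(1) by auto
 qed
 obtain c' where c': "c = Suc c'" using ac by (cases c) auto
 have wc: "w c < q1"
 proof -
  have "1 <= dif x w c' q1" using shadedD[OF shc, of c' q1] q1 c' ac by simp
  then show ?thesis using q1(3) unfolding c' dif_Suc by (cases "q1 <= w (Suc c')"; cases "q1 <= x (Suc c')") auto
 qed
 \<comment> \<open>Failure of the first exit in usable form.\<close>
 have N: False if "a < j" "j < e" "e <= c" "x a <= w j" "w j < w e" "w e < w a" for j e
 proof -
  have "shaded x w a (Suc e) (x a) (w e)"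
  proof (rule shadedI)
   fix p q assume pq: "a <= p" "p < Suc e" "x a < q" "q <= w e"
   show "1 <= dif x w p q"
   proof (cases "p < c")
    case True then show ?thesis using shadedD[OF shc, of p q] pq that by simp
   next
    case False
    then have "p = c" "e = c" using pq that by auto
    have "1 <= dif x w c' q" using shadedD[OF shc, of c' q] pq that c' ac by simp
    then show ?thesis using \<open>p = c\<close> \<open>e = c\<close> c' pq by (simp add: dif_Suc)
   qed
  qed
  then have "exit1 n x w a j e" unfolding exit1_def using that cn by auto
  then show False using no1 by blast
 qed
 \<comment> \<open>\<open>z\<close> is the last column before \<open>c\<close> where the row above \<open>w a\<close> is not shaded, so a point of \<open>w\<close> above
  row \<open>w a\<close> occurs between \<open>z\<close> and \<open>c\<close>; the lowest such point \<open>u\<close> becomes \<open>\<alpha>\<^sub>1\<close>.\<close>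
 obtain z where z: "a <= z" "z < c" "dif x w z (Suc (w a)) <= 0" and zmax: "\<And>p. z < p ==> p <= c ==> 1 <= dif x w p (Suc (w a))"
 proof -
  let ?S = "{p. p <= c & dif x w p (Suc (w a)) < 1}"
  have "finite ?S" by (rule finite_subset[of _ "{..c}"]) auto
  moreover have aS: "a \<in> ?S" using ac d_a[of "Suc (w a)"] by simp
  ultimately obtain m where m: "m \<in> ?S" "\<And>h. h \<in> ?S ==> h <= m"
   using max_on[of ?S "%q. q"] by blast
  have "m ~= c" using m(1) dcw by auto
  moreover have "1 <= dif x w p (Suc (w a))" if "m < p" "p <= c" for p
   using m(2)[of p] that by (cases "dif x w p (Suc (w a)) < 1") auto
  ultimately show ?thesis using that[of m] m aS by auto
 qed
 define V where "V v \<longleftrightarrow> w a < v & (\<exists>i. z < i & i <= c & w i = v)" for v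
 have "\<exists>v. V v"
 proof (rule ccontr)
  assume nV: "~ ?thesis"
  have "dif x w c (Suc (w a)) + dif x w z (Suc n + Suc (w a)) <= dif x w z (Suc (w a)) + dif x w c (Suc n + Suc (w a))"
  proof (rule dif_rectangle_no_w)
   fix i assume "z < i" "i <= c" "Suc (w a) <= w i"
   then have "V (w i)" by (auto simp: V_def)
   then show False using nV by blast
  qed (use z in auto)
  moreover have "dif x w p (Suc n + Suc (w a)) = 0" for p by (rule dif_high[OF xp wp]) simp
  ultimately show False using z dcw by simp
 qed
 define v where "v = (LEAST v. V v)"
 have "V v" unfolding v_def using \<open>\<exists>v. V v\<close> by (rule LeastI_ex)
 then obtain u where u: "z < u" "u <= c" "w u = v" and av: "w a < v" by (auto simp: V_def)
 have vmin: "~ (w a < w i & w i < v)" if "z < i" "i <= c" for i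
  using not_less_Least[of "w i" V] that v_def by (auto simp: V_def)
 have T2: "1 <= dif x w p q" if "z < p" "p <= c" "w a < q" "q <= v" for p q
 proof -
  have "dif x w p (Suc (w a)) + dif x w z q <= dif x w z (Suc (w a)) + dif x w p q"
  proof (rule dif_rectangle_no_w)
   fix i assume "z < i" "i <= p" "Suc (w a) <= w i" "w i < q"
   then show False using vmin[of i] that by simp
  qed (use that in auto)
  then show ?thesis using zmax[of p] that nn[of z q] z(3) by linarith
 qed
 have uc: "u < c" using u wc q1 av by (cases "u = c") auto
 have au: "a < u" using u z by simp
 \<comment> \<open>\<open>am\<close> is the first column after \<open>c\<close> where the shading above row \<open>q1\<close>, cut down by the points passed, ends or
  a point in rows \<open>q1\<close> to \<open>w a\<close> occurs.\<close>
 define OK where "OK p \<longleftrightarrow> (\<forall>q. q1 < q --> q <= v --> (\<forall>g. c < g & g <= p & q1 <= w g --> q <= w g) --> 1 <= dif x w p q)" for p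
 define St where "St f \<longleftrightarrow> c < f & (~ OK f \<or> (q1 <= w f & w f < w a))" for f
 have OKc: "OK c" unfolding OK_def
 proof (intro allI impI)
  fix q assume "q1 < q" "q <= v"
  then show "1 <= dif x w c q" using q1max[of q] T2[of c q] z by (cases "q <= w a") auto
 qed
 have "\<exists>f\<le>n. St f"
 proof (cases "\<exists>f. c < f & f <= n & q1 <= w f & w f < w a")
  case True then show ?thesis by (auto simp: St_def)
 next
  case False
  have "Suc q1 <= w g" if "c < g" "g <= n" "q1 <= w g" for g
  proof -
   have "g ~= a" using ac that by simp
   then have "w g ~= w a" using injw by simp
   then show ?thesis using False that q1 by auto
  qed
  then have "~ OK n" unfolding OK_def using d_n q1 av by fastforce
  then show ?thesis using cln by (auto simp: St_def)
 qed
 then obtain f0 where f0: "f0 <= n" "St f0" by blast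
 define am where "am = (LEAST f. St f)"
 have Stam: "St am" unfolding am_def by (rule LeastI[of St f0, OF f0(2)])
 have amn: "am <= n" unfolding am_def using Least_le[of St f0, OF f0(2)] f0(1) by simp
 have ammin: "~ St f" if "f < am" for f using not_less_Least[of f St] that am_def by simp
 have cam: "c < am" using Stam by (simp add: St_def)
 have OKp: "OK p" if "c <= p" "p < am" for p
  using ammin[of p] OKc that by (cases "p = c") (auto simp: St_def)
 have skip: "~ (q1 <= w g & w g < w a)" if "c < g" "g < am" for g
  using ammin[of g] that by (auto simp: St_def)
 have am: "q1 <= w am" "w am < w a"
 proof -
  have "q1 <= w am & w am < w a"
  proof (rule ccontr)
   assume "~ ?thesis"
   then have "~ OK am" using Stam by (auto simp: St_def)
   then obtain q' where q': "q1 < q'" "q' <= v" "\<And>g. c < g ==> g <= am ==> q1 <= w g ==> q' <= w g" "~ 1 <= dif x w am q'"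
    unfolding OK_def by blast
   have "dif x w am q1 + dif x w c q' <= dif x w c q1 + dif x w am q'"
    by (rule dif_rectangle_no_w) (use q' cam in \<open>auto simp: not_less [symmetric]\<close>)
   moreover have "1 <= dif x w c q'" using q1max[of q'] T2[of c q'] q' z by (cases "q' <= w a") auto
   ultimately show False using q'(4) q1(3) nn[of am q1] by linarith
  qed
  then show "q1 <= w am" "w am < w a" by auto
 qed
 define A' where "A' = {g. c < g & g < am & w a < w g & w g < v & (\<forall>h. c < h & h < g & w a < w h --> w g < w h)}"
 have A'I: "\<exists>g\<in>A'. g <= i & w g <= w i" if "c < i" "i < am" "w a < w i" "w i < v" for i
  by (rule left_minimum[of i "{h. c < h & w a < w h}" w]) (use that in \<open>auto simp: A'_def intro!: bexI\<close>)
 have dA': "decr w (insert am A')" using am by (auto simp: decr_def A'_def)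
 have right: "1 <= dif x w p q" if rp: "u <= p" "p < am" "w a < q" "q <= v" "\<And>g. g \<in> A' ==> w g < q ==> p < g" for p q
 proof (cases "p <= c")
  case True then show ?thesis using T2[of p q] that u by simp
 next
  case False
  have "q <= w g" if g: "c < g & g <= p & q1 <= w g" for g
  proof (rule ccontr)
   assume nq: "~ q <= w g"
   have "w g ~= w a" using injw[of g a] g ac by auto
   moreover have "~ w g < w a" using skip[of g] g rp by auto
   ultimately have "w a < w g" by simp
   then obtain g' where "g' \<in> A'" "g' <= g" "w g' <= w g" using A'I[of g] g nq rp by auto
   then show False using rp(5)[of g'] nq g by auto
  qed
  then show ?thesis using OKp[of p] False that am q1 unfolding OK_def by auto
 qed
 have middle: "1 <= dif x w p q" if mp: "a <= p" "p < am" "w am < q" "q <= w a" for p q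
 proof (cases "p < c")
  case True then show ?thesis using shadedD[OF shc, of p q] that am q1 by auto
 next
  case False
  have "q <= w g" if "c < g & g <= p & q1 <= w g" for g
   using skip[of g] that mp by auto
  then show ?thesis using OKp[of p] False that am av unfolding OK_def by auto
 qed
 \<comment> \<open>The position \<open>a\<close> itself satisfies the bounds, so a last one exists.\<close>
 obtain b1 where b1: "a <= b1" "b1 < u" "w am < w b1" "w b1 <= w a" and b1max: "\<And>g. b1 < g ==> g < u ==> ~ (w am < w g & w g <= w a)"
 proof -
  let ?S = "{g. a <= g & g < u & w am < w g & w g <= w a}"
  have "finite ?S" by (rule finite_subset[of _ "{..u}"]) auto
  moreover have "a \<in> ?S" using au am by simp
  ultimately obtain m where m: "m \<in> ?S" "\<And>h. h \<in> ?S ==> h <= m"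
   using max_on[of ?S "%q. q"] by blast
  have "~ (w am < w g & w g <= w a)" if "m < g" "g < u" for g
   using m(2)[of g] m(1) that by auto
  then show ?thesis using that[of m] m(1) by auto
 qed
 \<comment> \<open>\<open>\<beta>\<^sub>k\<close> is the first point after \<open>u\<close> in rows \<open>x a\<close> to \<open>w am\<close>, or else the highest point below row \<open>x a\<close>.\<close>
 define L where "L = {g. u < g & g <= c & x a <= w g & w g < w am}"
 obtain j0 where j0: "a < j0" "j0 <= c" "x a <= w j0" "w j0 < q1"
 proof -
  have "\<exists>j. a < j & j <= c & x a <= w j & w j < q1"
  proof (rule ccontr)
   assume "~ ?thesis"
   then have "dif x w c (x a) + dif x w a q1 <= dif x w a (x a) + dif x w c q1"
    by (intro dif_rectangle_no_w) (use ac q1 in auto)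
   moreover have "dif x w a q1 = 1" "dif x w a (x a) = 0" using d_a q1 xwa by auto
   ultimately show False using q1(3) nn[of c "x a"] by linarith
  qed
  then show ?thesis using that by blast
 qed
 have j0u: "j0 < u" if "L = {}"
 proof (rule ccontr)
  assume "~ j0 < u"
  moreover have "j0 ~= u" using j0 u av q1 by auto
  ultimately have "j0 \<in> L" using j0 am by (auto simp: L_def)
  then show False using that by simp
 qed
 have "\<exists>bk. u < bk & bk <= c & w bk < w am & ((x a <= w bk & bk \<in> L & (\<forall>g\<in>L. bk <= g)) \<or>
   (w bk < x a & L = {} & (\<forall>g. u < g & g <= c & w g < x a --> w g <= w bk)))"
 proof (cases "L = {}")
  case False
  then obtain m where m: "m \<in> L" "\<And>h. h \<in> L ==> h <= m ==> h = m" using min_on[of L "%q. q"] by blast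
  have "m <= g" if "g \<in> L" for g using m(2)[of g] that by (cases "g <= m") auto
  then show ?thesis using m(1) by (intro exI[of _ m]) (auto simp: L_def)
 next
  case True
  let ?S = "{g. u < g & g <= c & w g < x a}"
  have "finite ?S" by (rule finite_subset[of _ "{..c}"]) auto
  moreover have "c \<in> ?S"
  proof -
   have "c \<notin> L" using True by simp
   then show ?thesis using uc wc am by (auto simp: L_def)
  qed
  ultimately obtain m where m: "m \<in> ?S" "\<And>h. h \<in> ?S ==> w h <= w m"
   using max_on[of ?S w] by blast
  then show ?thesis using True am q1 by (intro exI[of _ m]) auto
 qed
 then obtain bk where bk: "u < bk" "bk <= c" "w bk < w am" and bk': "(x a <= w bk & bk \<in> L & (\<forall>g\<in>L. bk <= g)) \<or>
   (w bk < x a & L = {} & (\<forall>g. u < g & g <= c & w g < x a --> w g <= w bk))" by blast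
 define G where "G = {g. u < g & g < bk & w am < w g & w g < w a}"
 have xam: "x a < w am" using q1 am by simp
 show ?thesis
 proof (cases "G ~= {} & A' ~= {}")
  case True
  define B where "B = {g. u < g & g <= c & w am < w g & w g < w a}"
  have "G \<subseteq> B" using bk by (auto simp: G_def B_def)
  then have Bne: "B ~= {}" using True by auto
  have dB: "decr w B" unfolding decr_def
  proof (intro ballI impI)
   fix i j assume ij: "i \<in> B" "j \<in> B" "i < j"
   then have "~ w i < w j" using N[of i j] au xam by (auto simp: B_def)
   moreover have "w i ~= w j" using injw[of i j] ij by auto
   ultimately show "w j < w i" by simp
  qed
  have dA: "decr w A'" using dA' by (auto simp: decr_def)
  have c1: "conf1 n w u A' B am"
   unfolding conf1_def
  proof (intro conjI ballI)
   show "A' ~= {}" "B ~= {}" using True Bne by auto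
   show "1 <= u" "am <= n" using au amn by auto
   show "decr w A'" "decr w B" by fact+
   fix g assume "g \<in> B" then show "u < g" "g < am" "w am < w g" using cam by (auto simp: B_def)
   fix h assume "h \<in> A'" then show "g < h" "w g < w h" using \<open>g \<in> B\<close> by (auto simp: B_def A'_def)
  next
   fix g assume "g \<in> A'" then show "u < g" "g < am" "w g < w u" using uc u by (auto simp: A'_def)
  qed
  note reg = conf1_region[OF c1, unfolded u(3)]
  have "1 <= dif x w p q" if r: "region w u A' B am p q" for p q
   using right[of p q] middle[of p q] reg[OF r] au by (cases "q <= w a") auto
  moreover have "avoids n w u A' B am {}"
   unfolding avoids_def
  proof (intro ballI notI)
   fix i assume i: "i \<in> {1..n} - (insert u A' \<union> insert am B) - {}" and r: "region w u A' B am i (w i)"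
   note R = reg[OF r]
   have ui: "u < i" using R i by auto
   have wiv: "w i < v" using R injw[of i u] i u by (auto simp: le_less)
   have wia: "w i ~= w a" using injw[of i a] ui au by auto
   show False
   proof (cases "w a < w i")
    case True
    show False
    proof (cases "i <= c")
     case T: True then show False using vmin[of i] ui u True wiv by simp
    next
     case False
     then obtain g where g: "g \<in> A'" "g <= i" "w g <= w i" using A'I[of i] R True wiv by auto
     then have "w g < w i" using injw[of g i] i by (auto simp: le_less)
     then show False using R g by auto
    qed
   next
    case False
    then have "w i < w a" using wia by simp
    then show False using skip[of i] R am i ui by (cases "i <= c") (auto simp: B_def)
   qed
  qed
  ultimately show ?thesis using c1 unfolding generic_conf_def by blast
 next
  case GA: False
  define B' where "B' = {g. b1 < g & g < u & w bk < w g & w g < w am & (\<forall>h. g < h & h < u & w h < w am --> w h < w g)}"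
  have B'I: "\<exists>g\<in>B'. i <= g & w i <= w g" if "b1 < i" "i < u" "w bk < w i" "w i < w am" for i
  proof -
   note h0 = that
   obtain g where g: "g \<in> {h. h < u & w h < w am}" "i <= g" "w i <= w g" "\<forall>h\<in>{h. h < u & w h < w am}. g < h --> w h < w g"
    by (rule right_maximum[of i "{h. h < u & w h < w am}" u w]) (use h0 in auto)
   then have "g \<in> B'" using that by (auto simp: B'_def)
   then show ?thesis using g by blast
  qed
  have dB: "decr w (insert b1 B')" using b1 by (auto simp: decr_def B'_def)
  let ?A = "insert am A'" and ?B = "insert b1 B'"
  have c2: "conf2 n w u ?A ?B bk b1 am"
   unfolding conf2_def
  proof (intro conjI ballI)
   show "decr w ?A" "decr w ?B" by fact+
   show "u < bk" "w bk < w am" "w am < w b1" "w b1 < w u" using bk b1 u av by auto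
   fix g assume "g \<in> ?B" then show "1 <= g" "g < u" "w bk < w g" using b1 ea1 bk by (auto simp: B'_def)
  next
   fix g assume "g \<in> ?A" then show "bk < g" "g <= n" "w g < w u" using bk cam amn am av u by (auto simp: A'_def)
  next
   fix g assume "g \<in> ?A - {am}" then show "w b1 < w g" using b1 by (auto simp: A'_def)
  next
   fix g assume "g \<in> ?B - {b1}" then show "w g < w am" by (auto simp: B'_def)
  qed auto
  have reg: "b1 <= p & p < am & (w b1 < q --> u <= p) & (q <= w am --> p < bk) & w bk < q & q <= v \<and>
    (\<forall>g\<in>A'. w g < q --> p < g) & (\<forall>b\<in>B'. q <= w b --> b <= p)" if r: "region w u ?A ?B bk p q" for p q
  proof -
   have up: "u <= p" if "w b1 < q"
   proof -
    have "\<forall>b\<in>?B. w b < q" using that b1 by (auto simp: B'_def)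
    then show ?thesis using r by (auto simp: region_def)
   qed
   have "b1 <= p"
   proof (cases "w b1 < q")
    case True then show ?thesis using up b1 by simp
   next
    case False then show ?thesis using r by (auto simp: region_def)
   qed
   moreover have pbk: "p < bk" if "q <= w am"
   proof -
    have "\<forall>a\<in>?A. q <= w a" using that am by (auto simp: A'_def)
    then show ?thesis using r by (auto simp: region_def)
   qed
   moreover have "p < am"
   proof (cases "q <= w am")
    case True then show ?thesis using pbk bk cam by simp
   next
    case False then show ?thesis using r by (auto simp: region_def)
   qed
   ultimately show ?thesis using up r u by (auto simp: region_def)
  qed
  have shade: "1 <= dif x w p q" if r: "region w u ?A ?B bk p q" for p q
  proof -
   note R = reg[OF r]
   consider "w a < q" | "w am < q" "q <= w a" | "q <= w am" by linarith
   then show ?thesis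
   proof cases
    case 1 then show ?thesis using right[of p q] R b1 by auto
   next
    case 2 then show ?thesis using middle[of p q] R b1 by auto
   next
    case 3
    then have pb: "p < bk" using R by simp
    show ?thesis
    proof (cases "x a < q")
     case True then show ?thesis using shadedD[OF shc, of p q] R b1 pb bk 3 am by auto
    next
     case False
     then have "w bk < x a" using R by simp
     then have L: "L = {}" "\<And>g. u < g ==> g <= c ==> w g < x a ==> w g <= w bk" using bk' by auto
     have "dif x w c q + dif x w p q1 <= dif x w p q + dif x w c q1"
     proof (rule dif_rectangle_no_w)
      fix g assume g: "p < g" "g <= c" "q <= w g" "w g < q1"
      have "g ~= u" using g u av q1 by auto
      then consider "g < u" | "u < g" by linarith
      then show False
      proof cases
       case 1
       then obtain h where "h \<in> B'" "g <= h" "w g <= w h" using B'I[of g] g R am by auto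
       then show False using R g by fastforce
      next
       case 2
       have "g \<notin> L" using L(1) by simp
       then have "w g < x a" using 2 g am by (auto simp: L_def)
       then show False using L(2)[of g] 2 g R by auto
      qed
     qed (use False q1 pb bk in auto)
     moreover have "1 <= dif x w p q1" using shadedD[OF shc, of p q1] R b1 pb bk q1 by auto
     ultimately show ?thesis using q1(3) nn[of c q] by linarith
    qed
   qed
  qed
  have inter: "i \<in> center w u bk b1 am & i \<in> G" if i: "i \<in> {1..n} - (insert u ?A \<union> insert bk ?B)" and r: "region w u ?A ?B bk i (w i)" for i
  proof -
   note R = reg[OF r]
   have b1i: "b1 < i" using R i by auto
   have wia: "w i ~= w a" using injw[of i a] b1i b1 by auto
   have wiam: "w i ~= w am" using injw[of i am] i by auto
   consider "w a < w i" | "w am < w i" "w i < w a" | "w i < w am" using wia wiam by linarith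
   then show ?thesis
   proof cases
    case 1
    then have ui: "u < i" using R b1 i by (auto simp: le_less)
    have wiv: "w i < v" using R injw[of i u] i u by (auto simp: le_less)
    have False
    proof (cases "i <= c")
     case True then show False using vmin[of i] ui u 1 wiv by simp
    next
     case False
     then obtain g where g: "g \<in> A'" "g <= i" "w g <= w i" using A'I[of i] R 1 wiv by auto
     then have "w g < w i" using injw[of g i] i by (auto simp: le_less)
     then show False using R g by auto
    qed
    then show ?thesis ..
   next
    case 2
    have "~ i < u" using b1max[of i] b1i 2 by auto
    then have ui: "u < i" using i by auto
    have ic: "i <= c" using skip[of i] R 2 am by (cases "i <= c") auto
    have ib: "i < bk"
    proof (rule ccontr)
     assume "~ i < bk"
     then have bi: "bk < i" using i by auto
     show False
     proof (cases "L = {}")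
      case True
      then show False using N[of j0 i] j0 j0u ui ic 2 am by auto
     next
      case False
      then have "x a <= w bk" using bk' by auto
      then show False using N[of bk i] bk au bi ic 2 by auto
     qed
    qed
    have "w i < w b1"
    proof (rule ccontr)
     assume "~ w i < w b1"
     then have lt: "w b1 < w i" using injw[of i b1] b1i by auto
     then have "b1 ~= a" using 2 by auto
     then show False using N[of b1 i] b1 b1i ic lt 2 xam by auto
    qed
    then show ?thesis using ui ib 2 by (auto simp: center_def G_def)
   next
    case 3
    have ib: "i < bk" using R 3 by simp
    have False
    proof (cases "i < u")
     case True
     then obtain g where "g \<in> B'" "i <= g" "w i <= w g" using B'I[of i] b1i R 3 by auto
     then have "g = i" using R by auto
     then show False using \<open>g \<in> B'\<close> i by auto
    next
     case False
     then have ui: "u < i" using i by auto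
     show False
     proof (cases "L = {}")
      case True
      then have "i \<notin> L" by simp
      then have "w i < x a" using ui ib bk 3 by (auto simp: L_def)
      then show False using True bk' ui ib bk R by auto
     next
      case F: False
      then have "i \<in> L" using bk' R ui ib bk 3 by (auto simp: L_def)
      then show False using F bk' ib by auto
     qed
    qed
    then show ?thesis ..
   qed
  qed
  show ?thesis
  proof (cases "G = {}")
   case True
   then have "avoids n w u ?A ?B bk {}" using inter unfolding avoids_def by blast
   then show ?thesis using c2 shade unfolding generic_conf_def by blast
  next
   case False
   then obtain g0 where g0: "g0 \<in> G" by auto
   have "A' = {}" using GA False by simp
   moreover have "B' = {}"
   proof (rule ccontr)
    assume "B' ~= {}"
    then obtain g where g: "g \<in> B'" by auto
    show False
    proof (cases "x a <= w g")
     case True then show False using N[of g g0] g g0 b1 bk by (auto simp: B'_def G_def)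
    next
     case F: False
     then have "L = {}" using bk' g by (auto simp: B'_def)
     then show False using N[of j0 g0] j0 j0u g0 bk am by (auto simp: G_def)
    qed
   qed
   moreover have "decr w (center w u bk b1 am)" unfolding decr_def
   proof (intro ballI impI)
    fix i j assume ij: "i \<in> center w u bk b1 am" "j \<in> center w u bk b1 am" "i < j"
    then have "~ w i < w j" using N[of i j] au xam b1 bk by (auto simp: center_def)
    moreover have "w i ~= w j" using injw[of i j] ij by auto
    ultimately show "w j < w i" by simp
   qed
   moreover have "avoids n w u ?A ?B bk (center w u bk b1 am)" using inter unfolding avoids_def by blast
   ultimately show ?thesis using c2 shade unfolding generic_conf_def by (metis insert_absorb2)
  qed
 qed
qed

end

text \<open>
While climbing from \<open>x\<close> to \<open>w\<close> the tangent count has to fall to the length; at the last singular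
permutation it does so by a loss. The shading of that permutation is contained in the shading of \<open>x\<close>.
\<close>

theorem singular_conf:
 assumes xp: "x permutes {1..n}" and wp: "w permutes {1..n}" and xw: "bruhat_le x w"
  and sing: "tdim n x w ~= len n w"
 shows "\<exists>A1 Am Bm bk. generic_conf n w A1 Am Bm bk & (\<forall>p q. region w A1 Am Bm bk p q --> 1 <= dif x w p q)"
 using xp wp xw sing
proof (induction rule: bruhat_induct)
 case top
 then show ?case using tdim_self[OF wp] by simp
next
 case (cover x a b)
 let ?y = "x \<circ> transpose a b"
 show ?case
 proof (cases "tdim n ?y w = len n w")
  case False
  then obtain A1 Am Bm bk where *: "generic_conf n w A1 Am Bm bk" "\<And>p q. region w A1 Am Bm bk p q ==> 1 <= dif ?y w p q"
   using cover(9) by blast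
  have "dif ?y w p q <= dif x w p q" for p q
   using dif_transpose_left[of a b x w p q] cover(4) by (simp add: first_cover_def)
  then show ?thesis using * order_trans by blast
 next
  case True
  have "len n w <= tdim n x w" by (rule len_le_tdim[OF cover(1) wp cover(2)])
  then have "tdim n ?y w < tdim n x w" using True cover(10) by linarith
  then have "(\<exists>i j. j <= n & lossX x w a b i j) \<or> (\<exists>i\<le>n. lossW x w a b i \<or> lossE x w a b i)"
   using tdim_cover_less_iff[OF cover(1) first_cover_is_cover[OF cover(4)] cover(5,2,7)] by blast
  then have ex: "(\<exists>j e. exit1 n x w a j e) \<or> (\<exists>c. exit2 n x w a c)"
   by (rule loss_exits[OF cover(1) wp cover(2,4,5)])
  show ?thesis
  proof (cases "\<exists>j e. exit1 n x w a j e")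
   case True
   then show ?thesis using exit1_conf[OF cover(1) wp cover(2,4,5)] by blast
  next
   case False
   then obtain c where "exit2 n x w a c" using ex by blast
   then show ?thesis using exit2_conf[OF cover(1) wp cover(2,4,5), of c] False by blast
  qed
 qed
qed

section \<open>Cyclic rearrangements\<close>

text \<open>
The common part of the two shapes, which suffices to determine the rank difference of the rearranged
permutation.
\<close>

definition conf0 :: "nat => (nat => nat) => nat => nat set => nat set => nat => bool" where
 "conf0 n w a1 Am Bm bk \<longleftrightarrow> Am ~= {} & Bm ~= {} & decr w Am & decr w Bm & 1 <= a1 & bk <= n & a1 < bk \<and>
   (\<forall>b\<in>Bm. 1 <= b & b < bk & w bk < w b & w b < w a1) \<and>
   (\<forall>a\<in>Am. a1 < a & a <= n & w a < w a1 & w bk < w a) & (\<forall>b\<in>Bm. \<forall>a\<in>Am. b < a)"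

lemma conf1_conf0:
 assumes "conf1 n w a1 Am Bm bk" shows "conf0 n w a1 Am Bm bk"
proof -
 from assms have c: "Am ~= {}" "Bm ~= {}" "decr w Am" "decr w Bm" "1 <= a1" "bk <= n"
   "\<And>b. b\<in>Bm ==> a1 < b & b < bk & w bk < w b" "\<And>a. a\<in>Am ==> a1 < a & a < bk & w a < w a1"
   "\<And>a b. a \<in> Am ==> b \<in> Bm ==> b < a & w b < w a" by (auto simp: conf1_def)
 obtain a b where ab: "a \<in> Am" "b \<in> Bm" using c(1,2) by auto
 have "a1 < bk" using c(7)[OF ab(2)] by simp
 moreover have "1 <= b' & b' < bk & w bk < w b' & w b' < w a1" if "b' \<in> Bm" for b'
  using c(7)[OF that] c(9)[OF ab(1) that] c(8)[OF ab(1)] c(5) by linarith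
 moreover have "a1 < a' & a' <= n & w a' < w a1 & w bk < w a'" if "a' \<in> Am" for a'
  using c(8)[OF that] c(9)[OF that ab(2)] c(7)[OF ab(2)] c(6) by linarith
 ultimately show ?thesis unfolding conf0_def using c by auto
qed

lemma conf2D:
 assumes "conf2 n w a1 Am Bm bk b1 am"
 shows "am \<in> Am" "b1 \<in> Bm" "decr w Am" "decr w Bm" "a1 < bk" "w bk < w am" "w am < w b1" "w b1 < w a1"
  "\<And>b. b \<in> Bm ==> 1 <= b & b < a1 & w bk < w b & w b <= w b1 & b1 <= b & (b = b1 \<or> w b < w am)"
  "\<And>a. a \<in> Am ==> bk < a & a <= n & w a < w a1 & w am <= w a & a <= am & (a = am \<or> w b1 < w a)"
proof -
 from assms show c: "am \<in> Am" "b1 \<in> Bm" "decr w Am" "decr w Bm" "a1 < bk" "w bk < w am" "w am < w b1" "w b1 < w a1"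
  by (auto simp: conf2_def)
 show "1 <= b & b < a1 & w bk < w b & w b <= w b1 & b1 <= b & (b = b1 \<or> w b < w am)" if b: "b \<in> Bm" for b
 proof -
  have 1: "1 <= b & b < a1 & w bk < w b" using assms b by (auto simp: conf2_def)
  have 2: "b = b1 \<or> w b < w am" using assms b by (auto simp: conf2_def)
  have "b1 <= b"
  proof (rule ccontr)
   assume "~ b1 <= b"
   then show False using c(4,2,7) b 2 unfolding decr_def by fastforce
  qed
  then show ?thesis using 1 2 c(7) by auto
 qed
 show "bk < a & a <= n & w a < w a1 & w am <= w a & a <= am & (a = am \<or> w b1 < w a)" if a: "a \<in> Am" for a
 proof -
  have 1: "bk < a & a <= n & w a < w a1" using assms a by (auto simp: conf2_def)
  have 2: "a = am \<or> w b1 < w a" using assms a by (auto simp: conf2_def)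
  have "a <= am"
  proof (rule ccontr)
   assume "~ a <= am"
   then show False using c(3,1,7) a 2 unfolding decr_def by fastforce
  qed
  then show ?thesis using 1 2 c(7) by auto
 qed
qed

lemma conf2_conf0:
 assumes "conf2 n w a1 Am Bm bk b1 am"
 shows "conf0 n w a1 Am Bm bk"
proof -
 note c = conf2D[OF assms]
 have "1 <= a1" using c(9)[OF c(2)] by simp
 moreover have "bk <= n" using c(10)[OF c(1)] by simp
 moreover have "1 <= b' & b' < bk & w bk < w b' & w b' < w a1" if "b' \<in> Bm" for b'
  using c(9)[OF that] c(5,8) by linarith
 moreover have "a1 < a' & a' <= n & w a' < w a1 & w bk < w a'" if "a' \<in> Am" for a'
  using c(10)[OF that] c(5,6) by linarith
 moreover have "b < a" if "b \<in> Bm" "a \<in> Am" for a b using c(9)[OF that(1)] c(10)[OF that(2)] c(5) by linarith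
 ultimately show ?thesis unfolding conf0_def using c(1-5) by auto
qed

lemma conf0D:
 assumes "conf0 n w a1 Am Bm bk"
 shows "Am ~= {}" "Bm ~= {}" "decr w Am" "decr w Bm" "1 <= a1" "bk <= n" "a1 < bk"
  "\<And>b. b \<in> Bm ==> 1 <= b & b < bk & w bk < w b & w b < w a1"
  "\<And>a. a \<in> Am ==> a1 < a & a <= n & w a < w a1 & w bk < w a"
  "\<And>a b. b \<in> Bm ==> a \<in> Am ==> b < a"
  "w bk < w a1" "a1 <= n" "1 <= bk"
 using assms unfolding conf0_def by (auto intro: less_trans)

lemma conf0_support:
 assumes "conf0 n w a1 Am Bm bk"
 shows "insert a1 Am \<union> insert bk Bm \<subseteq> {1..n}" "insert a1 Am \<inter> insert bk Bm = {}"
proof -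
 note c = conf0D[OF assms]
 have "Am \<subseteq> {1..n}" using c(9) c(5) by fastforce
 moreover have "Bm \<subseteq> {1..n}" using c(8) c(6) by fastforce
 ultimately show "insert a1 Am \<union> insert bk Bm \<subseteq> {1..n}" using c(5-7,12,13) by auto
 show "insert a1 Am \<inter> insert bk Bm = {}" using c(7,10) c(8)[of a1] c(9)[of bk] by auto
qed

lemma generic_conf_conf0: "generic_conf n w a1 Am Bm bk ==> conf0 n w a1 Am Bm bk"
 using conf1_conf0 conf2_conf0 unfolding generic_conf_def by blast

lemma generic_conf_cases:
 assumes "generic_conf n w a1 Am Bm bk"
 obtains "conf1 n w a1 Am Bm bk" "avoids n w a1 Am Bm bk {}"
  | b1 am where "conf2 n w a1 Am Bm bk b1 am" "avoids n w a1 Am Bm bk (center w a1 bk b1 am)"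
proof -
 have "avoids n w a1 Am Bm bk {} ==> avoids n w a1 Am Bm bk E" for E by (auto simp: avoids_def)
 then show ?thesis using assms that unfolding generic_conf_def by blast
qed


definition cyc_data :: "nat => (nat => nat) => nat => nat set => nat set => nat => nat => (nat => nat) => nat => (nat => nat) => bool" where
 "cyc_data n w a1 Am Bm bk m \<alpha> k \<beta> \<longleftrightarrow> 2 <= m & 2 <= k & \<alpha> 1 = a1 & \<beta> k = bk & \<alpha> ` {2..m} = Am & \<beta> ` {1..k-1} = Bm \<and>
   strict_mono_on {1..m} \<alpha> & strict_mono_on {1..k} \<beta>"

lemma updown_dif:
 assumes "\<And>i. 1 <= i ==> x i < q & q <= w i \<longleftrightarrow> i = u" "\<And>i. 1 <= i ==> w i < q & q <= x i \<longleftrightarrow> i = d" "1 <= u" "1 <= d"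
 shows "dif x w p q = of_bool (u <= p) - of_bool (d <= p)"
proof (induction p)
 case 0 then show ?case using assms by simp
next
 case (Suc p)
 have "(of_bool (q <= w (Suc p)) :: int) - of_bool (q <= x (Suc p)) = of_bool (Suc p = u) - of_bool (Suc p = d)"
  using assms(1)[of "Suc p"] assms(2)[of "Suc p"] by (auto simp: of_bool_def)
 moreover have "(of_bool (u <= Suc p) :: int) = of_bool (u <= p) + of_bool (Suc p = u)" "(of_bool (d <= Suc p) :: int) = of_bool (d <= p) + of_bool (Suc p = d)"
  by (auto simp: of_bool_def)
 ultimately show ?case using Suc by (simp add: dif_Suc)
qed

lemma cyc_data_sets:
 assumes "cyc_data n w a1 Am Bm bk m \<alpha> k \<beta>"
 shows "\<alpha> ` {1..m} = insert a1 Am" "\<beta> ` {1..k} = insert bk Bm"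
proof -
 have D: "2 <= m" "2 <= k" "\<alpha> 1 = a1" "\<beta> k = bk" "\<alpha> ` {2..m} = Am" "\<beta> ` {1..k-1} = Bm"
  using assms by (auto simp: cyc_data_def)
 have "{1..m} = insert 1 {2..m}" "{1..k} = insert k {1..k-1}" using D(1,2) by auto
 then show "\<alpha> ` {1..m} = insert a1 Am" "\<beta> ` {1..k} = insert bk Bm" using D by (simp_all only: image_insert)
qed

lemma crossing:
 fixes y :: "nat => nat"
 assumes dec: "\<forall>i<r. y (Suc i) < y i" and q: "y r < q" "q <= y 0"
 obtains t where "t < r" "\<forall>s\<le>r. q <= y s \<longleftrightarrow> s <= t"
proof -
 have anti: "y s' <= y s" if "s <= s'" "s' <= r" for s s'
  using that
 proof (induction s' rule: dec_induct)
  case (step i) then show ?case using dec by (meson Suc_le_lessD less_imp_le order_trans)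
 qed simp
 define S where "S = (LEAST s. y s < q)"
 have S: "y S < q" unfolding S_def using q(1) by (rule LeastI)
 have Sr: "S <= r" unfolding S_def using q(1) by (rule Least_le)
 have S0: "S ~= 0" using S q(2) by (cases S) auto
 show ?thesis
 proof (rule that[of "S - 1"])
  show "S - 1 < r" using S0 Sr by simp
  show "\<forall>s\<le>r. q <= y s \<longleftrightarrow> s <= S - 1"
  proof (intro allI impI iffI)
   fix s assume "s <= r" "q <= y s"
   then show "s <= S - 1" using anti[of S s] S by (cases "s < S") auto
  next
   fix s assume "s <= S - 1"
   then have "s < S" using S0 by simp
   then show "q <= y s" using not_less_Least[of s "%s. y s < q"] unfolding S_def by simp
  qed
 qed
qed

text \<open>
Under \<open>w\<close> the sequences \<open>U = (\<alpha>\<^sub>1, \<beta>\<^sub>1, \<dots>, \<beta>\<^sub>k)\<close> and \<open>V = (\<alpha>\<^sub>1, \<dots>, \<alpha>\<^sub>m, \<beta>\<^sub>k)\<close> both descend from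
\<open>w \<alpha>\<^sub>1\<close> to \<open>w \<beta>\<^sub>k\<close>. The permutation \<open>x\<close> takes each \<open>U\<^sub>j\<close> down to the value of the next one and each
\<open>V\<^sub>i\<^sub>+\<^sub>1\<close> up to the value of the previous one, so in a row between these levels exactly one position raises
\<open>dif\<close>, and exactly one, further to the right, lowers it again.
\<close>

lemma cyc_dif:
 assumes c0: "conf0 n w a1 Am Bm bk" and cd: "cyc_data n w a1 Am Bm bk m \<alpha> k \<beta>"
  and cr: "cyclic_rearrangement n x w m \<alpha> k \<beta>"
  and xp: "x permutes {1..n}" and wp: "w permutes {1..n}"
 shows "dif x w p q = of_bool (region w a1 Am Bm bk p q)"
proof -
 note c = conf0D[OF c0]
 have D: "2 <= m" "2 <= k" "\<alpha> 1 = a1" "\<beta> k = bk" "\<alpha> ` {2..m} = Am" "\<beta> ` {1..k-1} = Bm"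
  and mA: "\<And>i j. 1 <= i ==> i < j ==> j <= m ==> \<alpha> i < \<alpha> j" and mB: "\<And>i j. 1 <= i ==> i < j ==> j <= k ==> \<beta> i < \<beta> j"
  using cd by (auto simp: cyc_data_def strict_mono_on_def)
 define U where "U j = (if j = 0 then a1 else \<beta> j)" for j
 define V where "V i = (if i < m then \<alpha> (Suc i) else bk)" for i
 have U0: "U 0 = a1" "U k = bk" and V0: "V 0 = a1" "V m = bk" using D by (auto simp: U_def V_def)
 have UB: "U j \<in> Bm" if "1 <= j" "j < k" for j using D(6) that by (auto simp: U_def)
 have VA: "V i \<in> Am" if "1 <= i" "i < m" for i using D(5) that by (auto simp: V_def)
 have BU: "\<exists>j. 1 <= j & j < k & b = U j" if "b \<in> Bm" for b
 proof -
  from that obtain j where "j \<in> {1..k-1}" "b = \<beta> j" unfolding D(6)[symmetric] by blast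
  then show ?thesis using D(2) by (intro exI[of _ j]) (auto simp: U_def)
 qed
 have AV: "\<exists>i. 1 <= i & i < m & a = V i" if "a \<in> Am" for a
 proof -
  from that obtain i where "i \<in> {2..m}" "a = \<alpha> i" unfolding D(5)[symmetric] by blast
  then show ?thesis by (intro exI[of _ "i - 1"]) (auto simp: V_def)
 qed
 have mU: "U i < U j" if "1 <= i" "i < j" "j < k" for i j using mB[of i j] that by (simp add: U_def)
 have mV: "V i < V j" if "1 <= i" "i < j" "j < m" for i j using mA[of "Suc i" "Suc j"] that by (simp add: V_def)
 have xU: "x (U j) = w (U (Suc j))" if "j < k" for j using cr that D by (auto simp: cyclic_rearrangement_def U_def)
 have xV: "x (V (Suc i)) = w (V i)" if "i < m" for i
 proof (cases "Suc i < m")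
  case True
  have "x (\<alpha> (Suc (Suc i))) = w (\<alpha> (Suc (Suc i) - 1))" using cr True unfolding cyclic_rearrangement_def by simp
  then show ?thesis using True by (simp add: V_def)
 next
  case False
  then have "Suc i = m" using that by simp
  then show ?thesis using cr D(4) by (auto simp: cyclic_rearrangement_def V_def)
 qed
 have wU: "w (U (Suc j)) < w (U j)" if "j < k" for j
 proof (cases "j = 0 \<or> Suc j = k")
  case True
  then show ?thesis using c(8)[OF UB[of j]] c(8)[OF UB[of 1]] U0 D(2) that by auto
 next
  case False then show ?thesis using c(4) UB[of j] UB[of "Suc j"] mU[of j "Suc j"] that by (auto simp: decr_def)
 qed
 have wV: "w (V (Suc j)) < w (V j)" if "j < m" for j
 proof (cases "j = 0 \<or> Suc j = m")
  case True
  then show ?thesis using c(9)[OF VA[of j]] c(9)[OF VA[of 1]] V0 D(1) that by auto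
 next
  case False then show ?thesis using c(3) VA[of j] VA[of "Suc j"] mV[of j "Suc j"] that by (auto simp: decr_def)
 qed
 have moved: "(\<exists>j<k. i = U j) \<or> (\<exists>j<m. i = V (Suc j)) \<or> x i = w i" for i
 proof -
  note s = cyc_data_sets[OF cd]
  consider "i = a1" | "i \<in> Bm" | "i = bk" | "i \<in> Am" | "i \<notin> \<alpha> ` {1..m} \<union> \<beta> ` {1..k}" unfolding s by blast
  then show ?thesis
  proof cases
   case 1 then show ?thesis using U0 D(2) by (intro disjI1 exI[of _ 0]) simp
  next
   case 2 then show ?thesis using BU by blast
  next
   case 3 then show ?thesis using V0 D(1) by (intro disjI2 disjI1 exI[of _ "m - 1"]) simp
  next
   case 4
   then obtain l where "1 <= l" "l < m" "i = V l" using AV by blast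
   then show ?thesis by (intro disjI2 disjI1 exI[of _ "l - 1"]) simp
  next
   case 5
   have "x i = w i"
   proof (cases "i \<in> {1..n}")
    case True then show ?thesis using cr 5 unfolding cyclic_rearrangement_def by blast
   next
    case False then show ?thesis using permutes_not_in[OF xp False] permutes_not_in[OF wp False] by simp
   qed
   then show ?thesis by simp
  qed
 qed
 show ?thesis
 proof (cases "w bk < q & q <= w a1")
  case False
  have rU: "w bk <= w (U j) & w (U j) <= w a1" if "j <= k" for j
   using c(8)[OF UB[of j]] c(11) U0 that by (cases "j = 0 \<or> j = k") auto
  have rV: "w bk <= w (V j) & w (V j) <= w a1" if "j <= m" for j
   using c(9)[OF VA[of j]] c(11) V0 that by (cases "j = 0 \<or> j = m") auto
  have "q <= w i \<longleftrightarrow> q <= x i" for i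
   using moved[of i]
  proof (elim disjE exE conjE)
   fix j assume "j < k" "i = U j" then show ?thesis using rU[of j] rU[of "Suc j"] xU False by auto
  next
   fix j assume "j < m" "i = V (Suc j)" then show ?thesis using rV[of j] rV[of "Suc j"] xV False by auto
  qed simp
  then have "dif x w p q = 0" by (simp add: dif_def)
  then show ?thesis using False by (auto simp: region_def)
 next
  case q: True
  obtain t where t: "t < k" "\<forall>s\<le>k. q <= w (U s) \<longleftrightarrow> s <= t"
   by (rule crossing[of k "%j. w (U j)" q]) (use wU q U0 in auto)
  obtain s where s: "s < m" "\<forall>i\<le>m. q <= w (V i) \<longleftrightarrow> i <= s"
   by (rule crossing[of m "%j. w (V j)" q]) (use wV q V0 in auto)
  define u d where "u = U t" and "d = V (Suc s)"
  have u: "x i < q & q <= w i \<longleftrightarrow> i = u" for i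
  proof
   assume h: "x i < q & q <= w i"
   from moved[of i] show "i = u"
   proof (elim disjE exE conjE)
    fix j assume j: "j < k" "i = U j"
    then have "j <= t" "~ Suc j <= t" using spec[OF t(2), of j] spec[OF t(2), of "Suc j"] h xU[of j] by auto
    then have "j = t" by simp
    then show ?thesis using j by (simp add: u_def)
   next
    fix j assume "j < m" "i = V (Suc j)" then show ?thesis using h xV[of j] wV[of j] by simp
   qed (use h in simp)
  qed (use t(1) xU[of t] spec[OF t(2), of t] spec[OF t(2), of "Suc t"] in \<open>auto simp: u_def\<close>)
  have d: "w i < q & q <= x i \<longleftrightarrow> i = d" for i
  proof
   assume h: "w i < q & q <= x i"
   from moved[of i] show "i = d"
   proof (elim disjE exE conjE)
    fix j assume j: "j < m" "i = V (Suc j)"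
    then have "j <= s" "~ Suc j <= s" using spec[OF s(2), of j] spec[OF s(2), of "Suc j"] h xV[of j] by auto
    then have "j = s" by simp
    then show ?thesis using j by (simp add: d_def)
   next
    fix j assume "j < k" "i = U j" then show ?thesis using h xU[of j] wU[of j] by simp
   qed (use h in simp)
  qed (use s(1) xV[of s] spec[OF s(2), of s] spec[OF s(2), of "Suc s"] in \<open>auto simp: d_def\<close>)
  have ud: "1 <= u" "u < d"
  proof -
   have "u = a1 \<or> u \<in> Bm" using U0 UB[of t] t(1) by (cases "t = 0") (auto simp: u_def)
   moreover have "d = bk \<or> d \<in> Am" using V0 VA[of "Suc s"] s(1) by (cases "Suc s = m") (auto simp: d_def)
   ultimately show "1 <= u" "u < d" using c(5,7) c(8)[of u] c(9)[of d] c(10)[of u d] by auto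
  qed
  have up: "u <= p \<longleftrightarrow> ((\<forall>b\<in>Bm. w b < q) --> a1 <= p) & (\<forall>b\<in>Bm. q <= w b --> b <= p)"
  proof -
   have B: "q <= w b \<longleftrightarrow> (\<exists>j. 1 <= j & j <= t & b = U j)" if "b \<in> Bm" for b
   proof -
    obtain j where "1 <= j" "j < k" "b = U j" using BU[OF \<open>b \<in> Bm\<close>] by blast
    then show ?thesis using t by (metis less_imp_le order_le_less_trans)
   qed
   show ?thesis
   proof (cases "t = 0")
    case True
    then have "w b < q" if "b \<in> Bm" for b using B[OF that] by auto
    then show ?thesis using True U0 by (auto simp: u_def dest: leD)
   next
    case False
    then have uB: "u \<in> Bm" "q <= w u" using UB t by (auto simp: u_def)
    have "b <= u" if "b \<in> Bm" "q <= w b" for b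
    proof -
     obtain j where "1 <= j" "j <= t" "b = U j" using B[OF \<open>b \<in> Bm\<close>] \<open>q \<le> w b\<close> by blast
     then show ?thesis using mU[of j t] t(1) by (cases "j = t") (auto simp: u_def)
    qed
    then show ?thesis using uB by (meson leD le_trans)
   qed
  qed
  have dp: "p < d \<longleftrightarrow> (\<forall>a\<in>Am. w a < q --> p < a) & ((\<forall>a\<in>Am. q <= w a) --> p < bk)"
  proof -
   have A: "w a < q \<longleftrightarrow> (\<exists>j. s < j & j < m & a = V j)" if "a \<in> Am" for a
   proof -
    obtain j where "1 <= j" "j < m" "a = V j" using AV[OF \<open>a \<in> Am\<close>] by blast
    then show ?thesis using s by (metis less_imp_le not_le)
   qed
   show ?thesis
   proof (cases "Suc s = m")
    case True
    then have "q <= w a" if "a \<in> Am" for a using A[OF that] by (auto simp: not_less)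
    then show ?thesis using True V0 by (auto simp: d_def dest: leD)
   next
    case False
    then have dA: "d \<in> Am" "w d < q" using VA[of "Suc s"] s d[of d] by (auto simp: d_def)
    have "d <= a" if "a \<in> Am" "w a < q" for a
    proof -
     obtain j where "s < j" "j < m" "a = V j" using A[OF \<open>a \<in> Am\<close>] \<open>w a < q\<close> by blast
     then show ?thesis using mV[of "Suc s" j] by (cases "j = Suc s") (auto simp: d_def)
    qed
    then show ?thesis using dA by (meson leD order_less_le_trans)
   qed
  qed
  have "dif x w p q = of_bool (u <= p) - of_bool (d <= p)"
   by (rule updown_dif[OF u d]) (use ud in auto)
  also have "\<dots> = of_bool (u <= p & p < d)" using ud by (auto simp: of_bool_def)
  also have "u <= p & p < d \<longleftrightarrow> region w a1 Am Bm bk p q"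
   unfolding up dp region_def using q by blast
  finally show ?thesis .
 qed
qed

lemma enumerate_set:
 assumes "finite (S :: nat set)"
 obtains f where "strict_mono_on {1..card S} f" "f ` {1..card S} = S"
proof -
 define l where "l = sorted_list_of_set S"
 have l: "length l = card S" "set l = S" "sorted_wrt (<) l" using assms by (auto simp: l_def)
 show ?thesis
 proof (rule that[of "%i. l ! (i - 1)"])
  show "strict_mono_on {1..card S} (%i. l ! (i - 1))"
   unfolding strict_mono_on_def
  proof (intro allI impI)
   fix i j assume "i \<in> {1..card S} & j \<in> {1..card S} & i < j"
   then show "l ! (i - 1) < l ! (j - 1)" using sorted_wrt_nth_less[OF l(3), of "i - 1" "j - 1"] l(1) by auto
  qed
  have "(%i. l ! (i - 1)) ` {1..card S} = (%i. l ! i) ` {0..<length l}"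
  proof -
   have e: "{1..card S} = Suc ` {0..<length l}"
    by (simp add: l(1) image_Suc_atLeastLessThan atLeastLessThanSuc_atLeastAtMost)
   show ?thesis unfolding e image_image by simp
  qed
  also have "\<dots> = S" using l(2) by (auto simp: set_conv_nth)
  finally show "(%i. l ! (i - 1)) ` {1..card S} = S" .
 qed
qed

lemma conf0_finite: assumes "conf0 n w a1 Am Bm bk" shows "finite Am" "finite Bm"
proof -
 have "Am \<subseteq> {..n}" "Bm \<subseteq> {..bk}" using conf0D(9,8)[OF assms] by (auto dest: less_imp_le)
 then show "finite Am" "finite Bm" by (auto intro: finite_subset)
qed

lemma conf0_cyc_data:
 assumes c0: "conf0 n w a1 Am Bm bk"
 obtains m \<alpha> k \<beta> where "cyc_data n w a1 Am Bm bk m \<alpha> k \<beta>"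
proof -
 note c = conf0D[OF c0]
 note fin = conf0_finite[OF c0]
 have nA: "a1 \<notin> Am" and nB: "bk \<notin> Bm" using c(8,9) by auto
 define m where "m = card (insert a1 Am)"
 define k where "k = card (insert bk Bm)"
 obtain \<alpha> where \<alpha>: "strict_mono_on {1..m} \<alpha>" "\<alpha> ` {1..m} = insert a1 Am"
  unfolding m_def using enumerate_set[of "insert a1 Am"] fin by auto
 obtain \<beta> where \<beta>: "strict_mono_on {1..k} \<beta>" "\<beta> ` {1..k} = insert bk Bm"
  unfolding k_def using enumerate_set[of "insert bk Bm"] fin by auto
 have m2: "2 <= m" and k2: "2 <= k" using c(1,2) fin nA nB by (auto simp: m_def k_def Suc_le_eq card_gt_0_iff)
 have ai: "inj_on \<alpha> {1..m}" and bi: "inj_on \<beta> {1..k}"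
  using \<alpha>(1) \<beta>(1) strict_mono_on_imp_inj_on by blast+
 have a1: "\<alpha> 1 = a1"
 proof -
  have "a1 \<in> \<alpha> ` {1..m}" using \<alpha>(2)  by simp
  then obtain i where i: "i \<in> {1..m}" "\<alpha> i = a1" by auto
  have "\<alpha> 1 \<in> insert a1 Am" unfolding \<alpha>(2)[symmetric] using m2  by auto
  moreover have "\<alpha> 1 <= \<alpha> i" using \<alpha>(1) i m2  strict_mono_on_leD[of "{1..m}" \<alpha> 1 i] by auto
  ultimately show ?thesis using c(9)[of "\<alpha> 1"] i by auto
 qed
 have bk: "\<beta> k = bk"
 proof -
  have "bk \<in> \<beta> ` {1..k}" using \<beta>(2)  by simp
  then obtain i where i: "i \<in> {1..k}" "\<beta> i = bk" by auto
  have "\<beta> k \<in> insert bk Bm" unfolding \<beta>(2)[symmetric] using k2  by auto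
  moreover have "\<beta> i <= \<beta> k" using \<beta>(1) i k2  strict_mono_on_leD[of "{1..k}" \<beta> i k] by auto
  ultimately show ?thesis using c(8)[of "\<beta> k"] i by auto
 qed
 have "\<alpha> ` {2..m} = Am"
 proof -
  have "{2..m} = {1..m} - {1}" by auto
  then have "\<alpha> ` {2..m} = \<alpha> ` {1..m} - {\<alpha> 1}" using inj_on_image_set_diff[OF ai, of "{1..m}" "{1}"] m2 by simp
  then show ?thesis using \<alpha>(2)  a1 nA by auto
 qed
 moreover have "\<beta> ` {1..k-1} = Bm"
 proof -
  have "{1..k-1} = {1..k} - {k}" using k2 by auto
  then have "\<beta> ` {1..k-1} = \<beta> ` {1..k} - {\<beta> k}" using inj_on_image_set_diff[OF bi, of "{1..k}" "{k}"] k2 by simp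
  then show ?thesis using \<beta>(2)  bk nB by auto
 qed
 ultimately have "cyc_data n w a1 Am Bm bk m \<alpha> k \<beta>"
  unfolding cyc_data_def using m2 k2 a1 bk \<alpha>(1) \<beta>(1)   by auto
 then show ?thesis by (rule that)
qed

text \<open>
The cycle is listed as \<open>\<beta>\<^sub>1, \<dots>, \<beta>\<^sub>k, \<alpha>\<^sub>m, \<dots>, \<alpha>\<^sub>1\<close> by an enumeration \<open>\<gamma>\<close> starting at 0, and \<open>\<pi>\<close> moves every
element to its successor.
\<close>

lemma cyc_perm:
 assumes c0: "conf0 n w a1 Am Bm bk" and cd: "cyc_data n w a1 Am Bm bk m \<alpha> k \<beta>" and wp: "w permutes {1..n}"
 obtains y where "y permutes {1..n}" "cyclic_rearrangement n y w m \<alpha> k \<beta>"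
proof -
 note c = conf0D[OF c0]
 have D: "2 <= m" "2 <= k" "\<alpha> 1 = a1" "\<beta> k = bk" "\<alpha> ` {2..m} = Am" "\<beta> ` {1..k-1} = Bm"
  and mA: "strict_mono_on {1..m} \<alpha>" and mB: "strict_mono_on {1..k} \<beta>"
  using cd by (auto simp: cyc_data_def)
 note S = cyc_data_sets[OF cd]
 define N where "N = m + k"
 define \<gamma> where "\<gamma> i = (if i < k then \<beta> (i + 1) else \<alpha> (N - i))" for i
 define s where "s i = (if Suc i = N then 0 else Suc i)" for i
 have ai: "inj_on \<alpha> {1..m}" and bi: "inj_on \<beta> {1..k}"
  using mA mB strict_mono_on_imp_inj_on by auto
 note disj = conf0_support(2)[OF c0]
 have B: "\<gamma> i \<in> insert bk Bm" if "i < k" for i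
 proof -
  have "i + 1 \<in> {1..k}" using that by auto
  then have "\<beta> (i + 1) \<in> \<beta> ` {1..k}" by (rule imageI)
  then show ?thesis using that unfolding S(2) \<gamma>_def by simp
 qed
 have A: "\<gamma> i \<in> insert a1 Am" if "~ i < k" "i < N" for i
 proof -
  have "N - i \<in> {1..m}" using that by (auto simp: N_def)
  then have "\<alpha> (N - i) \<in> \<alpha> ` {1..m}" by (rule imageI)
  then show ?thesis using that unfolding S(1) \<gamma>_def by simp
 qed
 have gi: "inj_on \<gamma> {..<N}"
 proof (rule inj_onI)
  fix i j assume ij: "i \<in> {..<N}" "j \<in> {..<N}" "\<gamma> i = \<gamma> j"
  consider "i < k" "j < k" | "~ i < k" "~ j < k" | "i < k" "~ j < k" | "~ i < k" "j < k" by blast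
  then show "i = j"
  proof cases
   case 1 then show ?thesis using inj_onD[OF bi, of "i+1" "j+1"] ij by (auto simp: \<gamma>_def)
  next
   case 2
   then have "N - i \<in> {1..m}" "N - j \<in> {1..m}" using ij by (auto simp: N_def)
   moreover have "\<alpha> (N - i) = \<alpha> (N - j)" using ij 2 by (simp add: \<gamma>_def)
   ultimately have "N - i = N - j" using inj_onD[OF ai] by blast
   then show ?thesis using ij by auto
  next
   case 3 then show ?thesis using A[of j] B[of i] ij disj by auto
  next
   case 4 then show ?thesis using A[of i] B[of j] ij disj by auto
  qed
 qed
 define T where "T = \<gamma> ` {..<N}"
 have bg: "bij_betw \<gamma> {..<N} T" using gi by (simp add: T_def bij_betw_def)
 have "inj_on s {..<N}" by (auto simp: inj_on_def s_def split: if_splits)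
 moreover have "s ` {..<N} \<subseteq> {..<N}" using D by (auto simp: s_def N_def)
 ultimately have bs: "bij_betw s {..<N} {..<N}" by (simp add: bij_betw_def endo_inj_surj)
 define \<pi> where "\<pi> p = (if p \<in> T then \<gamma> (s (inv_into {..<N} \<gamma> p)) else p)" for p
 have "bij_betw (\<gamma> \<circ> (s \<circ> inv_into {..<N} \<gamma>)) T T"
  by (rule bij_betw_trans[OF bij_betw_trans[OF bij_betw_inv_into[OF bg] bs] bg])
 then have "bij_betw \<pi> T T" by (rule bij_betw_cong[THEN iffD1, rotated]) (simp add: \<pi>_def)
 then have "\<pi> permutes T" by (rule bij_imp_permutes) (simp add: \<pi>_def)
 moreover have "T \<subseteq> {1..n}"
 proof -
  have "T \<subseteq> insert a1 Am \<union> insert bk Bm"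
   using A B unfolding T_def by blast
  also have "\<dots> \<subseteq> {1..n}" by (rule conf0_support(1)[OF c0])
  finally show ?thesis .
 qed
 ultimately have pp: "\<pi> permutes {1..n}" by (rule permutes_subset)
 have pg: "\<pi> (\<gamma> i) = \<gamma> (s i)" if "i < N" for i
  using that gi by (simp add: \<pi>_def T_def inv_into_f_f)
 define y where "y = w \<circ> \<pi>"
 have "y permutes {1..n}" unfolding y_def by (rule permutes_compose[OF pp wp])
 moreover have "cyclic_rearrangement n y w m \<alpha> k \<beta>"
  unfolding cyclic_rearrangement_def
 proof (intro conjI allI impI ballI)
  have N1: "~ N - 1 < k" "N - (N - 1) = 1" "Suc (N - 1) = N" "N - 1 < N" "0 < k" using D by (auto simp: N_def)
  have "\<alpha> 1 = \<gamma> (N - 1)" unfolding \<gamma>_def if_not_P[OF N1(1)] N1(2) ..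
  moreover have "\<gamma> (s (N - 1)) = \<beta> 1" using N1 by (simp add: \<gamma>_def s_def)
  ultimately show "y (\<alpha> 1) = w (\<beta> 1)" using pg[OF N1(4)] by (simp add: y_def)
 next
  fix j assume j: "1 <= j & j < k"
  then have N1: "j - 1 < k" "j < k" "Suc (j - 1) = j" "j ~= N" "j - 1 < N" by (auto simp: N_def)
  then have "\<beta> j = \<gamma> (j - 1)" "\<gamma> (s (j - 1)) = \<beta> (j + 1)" by (simp_all add: \<gamma>_def s_def)
  then show "y (\<beta> j) = w (\<beta> (j + 1))" using pg[OF N1(5)] by (simp add: y_def)
 next
  have N1: "k - 1 < k" "Suc (k - 1) = k" "k ~= N" "N - k = m" "k - 1 < N" using D by (auto simp: N_def)
  then have "\<beta> k = \<gamma> (k - 1)" "\<gamma> (s (k - 1)) = \<alpha> m" by (simp_all add: \<gamma>_def s_def)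
  then show "y (\<beta> k) = w (\<alpha> m)" using pg[OF N1(5)] by (simp add: y_def)
 next
  fix i assume i: "2 <= i & i <= m"
  then have N1: "~ N - i < k" "N - (N - i) = i" "Suc (N - i) ~= N" "~ Suc (N - i) < k" "N - Suc (N - i) = i - 1" "N - i < N"
   by (auto simp: N_def)
  have "\<alpha> i = \<gamma> (N - i)" unfolding \<gamma>_def if_not_P[OF N1(1)] N1(2) ..
  moreover have "\<gamma> (s (N - i)) = \<alpha> (i - 1)"
   unfolding s_def if_not_P[OF N1(3)] \<gamma>_def if_not_P[OF N1(4)] N1(5) ..
  ultimately show "y (\<alpha> i) = w (\<alpha> (i - 1))" using pg[OF N1(6)] by (simp add: y_def)
 next
  fix i assume i: "i \<in> {1..n} - (\<alpha> ` {1..m} \<union> \<beta> ` {1..k})"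
  have "T \<subseteq> \<alpha> ` {1..m} \<union> \<beta> ` {1..k}" unfolding S T_def using A B by blast
  then have "i \<notin> T" using i by blast
  then show "y i = w i" by (simp add: y_def \<pi>_def)
 qed
 ultimately show ?thesis by (rule that)
qed

section \<open>Rearranged permutations are singular\<close>

lemma dif_region_bruhat_le:
 assumes "\<And>p q. dif x w p q = of_bool (region w a1 Am Bm bk p q)"
 shows "bruhat_le x w"
 using assms by (simp add: bruhat_le_def)

text \<open>
A cover whose rectangle lies in the region loses a tangent direction, and all permutations below \<open>w\<close>
have a tangent count of at least the length of \<open>w\<close>. In the first shape one transposes \<open>\<beta>\<^sub>k\<^sub>-\<^sub>1\<close> and \<open>\<alpha>\<^sub>2\<close>
and loses the pair \<open>\<alpha>\<^sub>1, \<beta>\<^sub>k\<close>; in the second one \<open>\<beta>\<^sub>k\<^sub>-\<^sub>1\<close> and \<open>\<alpha>\<^sub>1\<close>, losing a direction at \<open>\<alpha>\<^sub>2\<close>.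
\<close>

lemma conf_singular:
 assumes gc: "generic_conf n w a1 Am Bm bk" and cd: "cyc_data n w a1 Am Bm bk m \<alpha> k \<beta>"
  and cr: "cyclic_rearrangement n x w m \<alpha> k \<beta>" and xp: "x permutes {1..n}" and wp: "w permutes {1..n}"
 shows "len n w < tdim n x w"
proof -
 have D: "2 <= m" "2 <= k" "\<alpha> 1 = a1" "\<beta> k = bk" "\<alpha> ` {2..m} = Am" "\<beta> ` {1..k-1} = Bm"
  and mA: "strict_mono_on {1..m} \<alpha>" and mB: "strict_mono_on {1..k} \<beta>"
  using cd by (auto simp: cyc_data_def)
 note S = cyc_data_sets[OF cd]
 define b0 where "b0 = \<beta> (k - 1)"
 define a2 where "a2 = \<alpha> 2"
 have b0: "b0 \<in> Bm" unfolding D(6)[symmetric] b0_def using D(2) by auto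
 have a2: "a2 \<in> Am" unfolding D(5)[symmetric] a2_def using D(1) by auto
 have b0max: "b <= b0" if "b \<in> Bm" for b
 proof -
  from that obtain j where "j \<in> {1..k-1}" "b = \<beta> j" unfolding D(6)[symmetric] by blast
  then show ?thesis unfolding b0_def using strict_mono_on_leD[OF mB, of j "k-1"] D(2) by auto
 qed
 have a2min: "a2 <= a" if "a \<in> Am" for a
 proof -
  from that obtain j where "j \<in> {2..m}" "a = \<alpha> j" unfolding D(5)[symmetric] by blast
  then show ?thesis unfolding a2_def using strict_mono_on_leD[OF mA, of 2 j] D(1) by auto
 qed
 have xb0: "x b0 = w bk"
 proof -
  have "1 <= k - 1 & k - 1 < k" "k - 1 + 1 = k" using D(2) by auto
  then show ?thesis using cr D(4) unfolding cyclic_rearrangement_def b0_def by metis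
 qed
 have xa2: "x a2 = w a1" using cr D(1,3) unfolding cyclic_rearrangement_def a2_def by (metis diff_add_inverse2 one_add_one order_refl)
 have xa1: "x a1 = w (\<beta> 1)" and xbk: "x bk = w (\<alpha> m)" using cr D(3,4) unfolding cyclic_rearrangement_def by auto
 have xo: "x i = w i" if "i \<in> {1..n}" "i \<notin> insert a1 Am \<union> insert bk Bm" for i
  using cr that S unfolding cyclic_rearrangement_def by auto
 have b1B: "\<beta> 1 \<in> Bm" unfolding D(6)[symmetric] using D(2) by auto
 have amA: "\<alpha> m \<in> Am" unfolding D(5)[symmetric] using D(1) by auto
 have c0: "conf0 n w a1 Am Bm bk" by (rule generic_conf_conf0[OF gc])
 note c = conf0D[OF c0]
 have dif: "dif x w p q = of_bool (region w a1 Am Bm bk p q)" for p q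
  by (rule cyc_dif[OF c0 cd cr xp wp])
 have shI: "shaded x w p1 p2 q1 q2" if "\<And>p q. p1 <= p ==> p < p2 ==> q1 < q ==> q <= q2 ==> region w a1 Am Bm bk p q" for p1 p2 q1 q2
  by (rule shadedI) (simp add: dif that)
 have xw: "bruhat_le x w" using dif by (rule dif_region_bruhat_le)
 have b1top: "w b <= w (\<beta> 1)" if "b \<in> Bm" for b
 proof -
  from that obtain j where j: "j \<in> {1..k-1}" "b = \<beta> j" unfolding D(6)[symmetric] by blast
  show ?thesis
  proof (cases "j = 1")
   case False
   then have "\<beta> 1 < \<beta> j" using mB j D(2) by (auto simp: strict_mono_on_def)
   then show ?thesis using c(4) b1B that j unfolding decr_def by (metis less_imp_le)
  qed (use j in simp)
 qed
 have amlow: "w (\<alpha> m) <= w a" if "a \<in> Am" for a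
 proof -
  from that obtain j where j: "j \<in> {2..m}" "a = \<alpha> j" unfolding D(5)[symmetric] by blast
  show ?thesis
  proof (cases "j = m")
   case False
   then have "\<alpha> j < \<alpha> m" using mA j D(1) by (auto simp: strict_mono_on_def)
   then show ?thesis using c(3) amA that j unfolding decr_def by (metis less_imp_le)
  qed (use j in simp)
 qed
 from gc show ?thesis
 proof (cases rule: generic_conf_cases)
  case 1
  have C: "\<And>b. b\<in>Bm ==> a1 < b & b < bk & w bk < w b" "\<And>a. a\<in>Am ==> a1 < a & a < bk & w a < w a1"
   "\<And>a b. a \<in> Am ==> b \<in> Bm ==> b < a & w b < w a" using 1(1) by (auto simp: conf1_def)
  have reg: "region w a1 Am Bm bk p q" if "b0 <= p" "p < a2" "w bk < q" "q <= w a1" for p q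
   using that b0max a2min C(1)[OF b0] C(2)[OF a2] unfolding region_def by fastforce
  have cov: "is_cover x b0 a2"
   unfolding is_cover_def
  proof (intro conjI allI impI)
   show "1 <= b0" using c(8)[OF b0] by simp
   show "b0 < a2" using C(3)[OF a2 b0] by simp
   show "x b0 < x a2" using xb0 xa2 c(11) by simp
   fix i assume i: "b0 < i & i < a2"
   show "~ (x b0 < x i & x i < x a2)"
   proof
    assume h: "x b0 < x i & x i < x a2"
    have iS: "i \<notin> insert a1 Am \<union> insert bk Bm" using i b0max[of i] a2min[of i] C(1)[OF b0] C(2)[OF a2] by auto
    have "i \<in> {1..n}" using i c(9)[OF a2] by auto
    then have "~ region w a1 Am Bm bk i (w i)" using 1(2) iS by (auto simp: avoids_def)
    moreover have "x i = w i" using xo[OF \<open>i \<in> {1..n}\<close> iS] .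
    ultimately show False using reg[of i "w i"] h xb0 xa2 i by auto
   qed
  qed
  have a2n: "a2 <= n" using c(9)[OF a2] by simp
  have yw: "bruhat_le (x \<circ> transpose b0 a2) w"
   using good_noninversion[OF xw, of b0 a2] cov shI[of b0 a2 "w bk" "w a1"] reg xb0 xa2 by (simp add: good_def is_cover_def)
  have "lossX x w b0 a2 a1 bk"
   unfolding lossX_def
  proof (intro conjI)
   show "1 <= a1" "a1 < bk" "x a1 < x bk" using c(5,7) xa1 xbk C(3)[OF amA b1B] by auto
   show "a1 ~= b0" "a1 ~= a2" "bk ~= b0" "bk ~= a2" using C(1)[OF b0] C(2)[OF a2] by auto
   have r2: "region w a1 Am Bm bk p q" if "a1 <= p" "p < bk" "w (\<beta> 1) < q" "q <= w (\<alpha> m)" for p q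
   proof -
    have "w b < q" if "b \<in> Bm" for b using b1top[OF that] \<open>w (\<beta> 1) < q\<close> by simp
    moreover have "q <= w a" if "a \<in> Am" for a using amlow[OF that] \<open>q \<le> w (\<alpha> m)\<close> by simp
    moreover have "w bk < q" "q <= w a1" using that C(1)[OF b1B] C(2)[OF amA] by auto
    ultimately show ?thesis using that unfolding region_def by (auto dest: leD)
   qed
   then show "shaded x w a1 bk (x a1) (x bk)" unfolding xa1 xbk by (intro shI) auto
   show "\<exists>p q. b0 <= p & p < a2 & x b0 < q & q <= x a2 & a1 <= p & p < bk & x a1 < q & q <= x bk & dif x w p q = 1"
   proof (intro exI conjI)
    show "b0 <= b0" "b0 < a2" "a1 <= b0" "b0 < bk" using C(1)[OF b0] C(3)[OF a2 b0] by auto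
    show "x b0 < w (\<alpha> m)" "w (\<alpha> m) <= x a2" "x a1 < w (\<alpha> m)" "w (\<alpha> m) <= x bk"
     using xb0 xa2 xa1 xbk c(9)[OF amA] C(3)[OF amA b1B] by auto
    show "dif x w b0 (w (\<alpha> m)) = 1"
     using reg[of b0 "w (\<alpha> m)"] c(9)[OF amA] C(3)[OF a2 b0] by (simp add: dif)
   qed
  qed
  then have "tdim n (x \<circ> transpose b0 a2) w < tdim n x w"
   using tdim_cover_less_iff[OF xp cov a2n xw yw] c(6) by blast
  moreover have "len n w <= tdim n (x \<circ> transpose b0 a2) w"
   by (rule len_le_tdim[OF transpose_permutes[OF xp _ _ a2n] wp yw]) (use cov in \<open>auto simp: is_cover_def\<close>)
  ultimately show ?thesis by simp
 next
  case (2 b1 am)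
  note C = conf2D[OF 2(1)]
  have b1: "b1 = \<beta> 1" using b1top[OF C(2)] C(9)[OF b1B] C(7) by auto
  have xa1': "x a1 = w b1" using xa1 b1 by simp
  have reg: "region w a1 Am Bm bk p q" if "b0 <= p" "p < a1" "w bk < q" "q <= w b1" for p q
   unfolding region_def
  proof (intro conjI ballI impI)
   show "w bk < q" "q <= w a1" using that C(8) by auto
   assume "\<forall>b\<in>Bm. w b < q" then show "a1 <= p" using C(2) that by auto
  next
   fix b assume "b \<in> Bm" then show "b <= p" using b0max that by (meson le_trans)
  next
   fix a assume "a \<in> Am" then show "p < a" using C(10)[of a] C(5) that by auto
  next
   show "p < bk" using C(5) that by simp
  qed
  have cov: "is_cover x b0 a1"
   unfolding is_cover_def
  proof (intro conjI allI impI)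
   show "1 <= b0" "b0 < a1" using C(9)[OF b0] by auto
   show "x b0 < x a1" using xb0 xa1' C(6,7) by simp
   fix i assume i: "b0 < i & i < a1"
   show "~ (x b0 < x i & x i < x a1)"
   proof
    assume h: "x b0 < x i & x i < x a1"
    have iS: "i \<notin> insert a1 Am \<union> insert bk Bm" using i b0max[of i] C(5) C(10)[of i] by auto
    have "i \<in> {1..n}" using i c(12) by auto
    then have "~ region w a1 Am Bm bk i (w i)" using 2(2) iS i by (auto simp: avoids_def center_def)
    moreover have "x i = w i" using xo[OF \<open>i \<in> {1..n}\<close> iS] .
    ultimately show False using reg[of i "w i"] h xb0 xa1' i by auto
   qed
  qed
  have yw: "bruhat_le (x \<circ> transpose b0 a1) w"
   using good_noninversion[OF xw, of b0 a1] cov shI[of b0 a1 "w bk" "w b1"] reg xb0 xa1' by (simp add: good_def is_cover_def)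
  have "lossE x w b0 a1 a2"
   unfolding lossE_def xb0 xa1' xa2
  proof (intro conjI)
   show "a1 < a2" "w b1 < w a1" using C(10)[OF a2] C(5,8) by auto
   show "shaded x w a1 a2 (w b1) (w a1)"
   proof (rule shI)
    fix p q assume pq: "a1 <= p" "p < a2" "w b1 < q" "q <= w a1"
    show "region w a1 Am Bm bk p q"
     unfolding region_def
    proof (intro conjI ballI impI)
     show "w bk < q" "q <= w a1" "a1 <= p" using pq C(6,7) by auto
    next
     fix b assume "b \<in> Bm" "q <= w b" then show "b <= p" using C(9)[of b] pq by auto
    next
     fix a assume "a \<in> Am" then show "p < a" using a2min[of a] pq by auto
    next
     assume "\<forall>a\<in>Am. q <= w a" then show "p < bk" using C(1,7) pq by auto
    qed
   qed
   show "~ shaded x w b0 a1 (w b1) (w a1)"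
   proof
    assume "shaded x w b0 a1 (w b1) (w a1)"
    then have "1 <= dif x w b0 (Suc (w b1))" using shadedD C(8) C(9)[OF b0] by auto
    then have "region w a1 Am Bm bk b0 (Suc (w b1))" by (cases "region w a1 Am Bm bk b0 (Suc (w b1))") (auto simp: dif)
    moreover have "\<forall>b\<in>Bm. w b < Suc (w b1)" using C(9) by (auto simp: less_Suc_eq_le)
    ultimately show False using C(9)[OF b0] by (auto simp: region_def)
   qed
   show "~ shaded x w a1 a2 (w bk) (w b1)"
   proof
    assume "shaded x w a1 a2 (w bk) (w b1)"
    then have "1 <= dif x w bk (Suc (w bk))" using shadedD C(5,6,7) C(10)[OF a2] by auto
    then have "region w a1 Am Bm bk bk (Suc (w bk))" by (cases "region w a1 Am Bm bk bk (Suc (w bk))") (auto simp: dif)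
    moreover have "\<forall>a\<in>Am. Suc (w bk) <= w a" using c(9) by (auto simp: Suc_le_eq)
    ultimately show False by (auto simp: region_def)
   qed
  qed
  then have "tdim n (x \<circ> transpose b0 a1) w < tdim n x w"
   using tdim_cover_less_iff[OF xp cov c(12) xw yw] c(9)[OF a2] by blast
  moreover have "len n w <= tdim n (x \<circ> transpose b0 a1) w"
   by (rule len_le_tdim[OF transpose_permutes[OF xp _ _ c(12)] wp yw]) (use cov in \<open>auto simp: is_cover_def\<close>)
  ultimately show ?thesis by simp
 qed
qed

section \<open>Maximal singular permutations\<close>

lemma region_corners:
 assumes c0: "conf0 n w a1 Am Bm bk"
 shows "region w a1 Am Bm bk a1 (w a1)" "\<And>b. b \<in> Bm ==> region w a1 Am Bm bk b (w b)"
  "\<And>a. a \<in> Am ==> region w a1 Am Bm bk (a - 1) (Suc (w a))" "region w a1 Am Bm bk (bk - 1) (Suc (w bk))"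
proof -
 note c = conf0D[OF c0]
 obtain a' where a': "a' \<in> Am" using c(1) by auto
 obtain b' where b': "b' \<in> Bm" using c(2) by auto
 show "region w a1 Am Bm bk a1 (w a1)"
  unfolding region_def using c(7,11) c(8) c(9) a' by (auto dest: leD)
 show "region w a1 Am Bm bk b (w b)" if b: "b \<in> Bm" for b
  unfolding region_def
 proof (intro conjI ballI impI)
  show "w bk < w b" "w b <= w a1" "b < bk" using c(8)[OF b] by auto
  assume "\<forall>b'\<in>Bm. w b' < w b" then show "a1 <= b" using b by auto
 next
  fix g assume g: "g \<in> Bm" "w b <= w g"
  show "g <= b"
  proof (rule ccontr)
   assume "~ g <= b" then show False using c(4) g b unfolding decr_def by (meson leD not_le)
  qed
 next
  fix a assume "a \<in> Am" then show "b < a" using c(10) b by simp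
 qed
 show "region w a1 Am Bm bk (a - 1) (Suc (w a))" if a: "a \<in> Am" for a
  unfolding region_def
 proof (intro conjI ballI impI)
  show "w bk < Suc (w a)" "Suc (w a) <= w a1" "a1 <= a - 1" using c(9)[OF a] by auto
 next
  fix g assume g: "g \<in> Bm" show "g <= a - 1" using c(10)[OF g a] by simp
 next
  fix g assume g: "g \<in> Am" "w g < Suc (w a)"
  have "a <= g"
  proof (rule ccontr)
   assume "~ a <= g" then show False using c(3) g a unfolding decr_def by (meson leD less_Suc_eq_le not_le)
  qed
  then show "a - 1 < g" using c(9)[OF a] by (cases a) auto
 next
  assume "\<forall>g\<in>Am. Suc (w a) <= w g" then show "a - 1 < bk" using a by auto
 qed
 show "region w a1 Am Bm bk (bk - 1) (Suc (w bk))"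
  unfolding region_def
 proof (intro conjI ballI impI)
  show "w bk < Suc (w bk)" "Suc (w bk) <= w a1" "a1 <= bk - 1" "bk - 1 < bk" using c(7,11,13) by auto
 next
  fix g assume g: "g \<in> Bm" show "g <= bk - 1" using c(8)[OF g] by (cases bk) auto
 next
  fix g assume g: "g \<in> Am" "w g < Suc (w bk)" then show "bk - 1 < g" using c(9)[OF g(1)] by auto
 qed
qed

text \<open>
Around a point of both permutations \<open>dif\<close> is the same in all four adjacent cells. Hence a corner of a
region next to such a point puts the point itself into the region.
\<close>

lemma dif_common_point:
 assumes "x permutes {1..n}" "w permutes {1..n}" "1 <= s" "x s = w s"
 shows "dif x w (s - 1) (Suc (w s)) = dif x w s (w s)" "dif x w (s - 1) q = dif x w s q"
proof -
 obtain s' where s': "s = Suc s'" using assms(3) by (cases s) auto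
 have 1: "dif x w s' q = dif x w s q" for q using assms(4) s' by (simp add: dif_Suc)
 show "dif x w (s - 1) q = dif x w s q" using 1 s' by simp
 have ne: "{i\<in>{0<..s'}. f s <= f i & f i < Suc (f s)} = {}" if "f permutes {1..n}" for f
 proof (rule equals0I)
  fix i assume "i \<in> {i\<in>{0<..s'}. f s <= f i & f i < Suc (f s)}"
  then have "f i = f s" "i <= s'" by auto
  moreover from this(1) have "i = s" by (rule injD[OF permutes_inj[OF that]])
  ultimately show False using s' by simp
 qed
 have e: "{i\<in>{0<..s'}. w s <= x i & x i < Suc (w s)} = {}" "{i\<in>{0<..s'}. w s <= w i & w i < Suc (w s)} = {}"
  using ne[OF assms(1)] ne[OF assms(2)] unfolding assms(4) by auto
 have "dif x w s' (w s) = dif x w s' (Suc (w s))"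
  using dif_rectangle[of 0 s' "w s" "Suc (w s)" x w] unfolding e by simp
 then show "dif x w (s - 1) (Suc (w s)) = dif x w s (w s)" using 1[of "w s"] s' by simp
qed

lemma conf1D:
 assumes "conf1 n w a1 Am Bm bk"
 shows "\<And>b. b\<in>Bm ==> a1 < b & b < bk & w bk < w b & w b < w a1"
  "\<And>a. a\<in>Am ==> a1 < a & a < bk & w a < w a1 & w bk < w a"
  "\<And>a b. b \<in> Bm ==> a \<in> Am ==> b < a & w b < w a" "decr w Am" "decr w Bm" "Am ~= {}" "Bm ~= {}" "a1 < bk" "w bk < w a1"
proof -
 note c = conf0D[OF conf1_conf0[OF assms]]
 show "\<And>b. b\<in>Bm ==> a1 < b & b < bk & w bk < w b & w b < w a1"
  using assms c(8) unfolding conf1_def by blast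
 show "\<And>a. a\<in>Am ==> a1 < a & a < bk & w a < w a1 & w bk < w a"
  using assms c(9) unfolding conf1_def by blast
 show "\<And>a b. b \<in> Bm ==> a \<in> Am ==> b < a & w b < w a" using assms unfolding conf1_def by blast
 show "decr w Am" "decr w Bm" "Am ~= {}" "Bm ~= {}" "a1 < bk" "w bk < w a1" using c by auto
qed

lemma decrD: "decr w S ==> i \<in> S ==> j \<in> S ==> i < j ==> w j < w i"
 by (auto simp: decr_def)

lemma conf1_pair:
 assumes c1: "conf1 n w a1 Am Bm bk" and s: "s \<in> insert a1 Am \<union> insert bk Bm" and t: "t \<in> insert a1 Am \<union> insert bk Bm"
  and st: "s < t" "w s < w t"
 shows "s \<in> Bm & t \<in> Am"
proof -
 note c = conf1D[OF c1]
 have "s ~= a1" using t st c(1)[of t] c(2)[of t] c(9) by auto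
 moreover have "s ~= bk" using t st c(1)[of t] c(2)[of t] c(8) by auto
 moreover have "t ~= a1" using s st c(1)[of s] c(2)[of s] c(8) by auto
 moreover have "t ~= bk" using s st c(1)[of s] c(2)[of s] c(9) by auto
 moreover have "~ (s \<in> Am & t \<in> Am)" using decrD[OF c(4), of s t] st by auto
 moreover have "~ (s \<in> Bm & t \<in> Bm)" using decrD[OF c(5), of s t] st by auto
 moreover have "~ (s \<in> Am & t \<in> Bm)" using c(3)[of t s] st by auto
 ultimately show ?thesis using s t by auto
qed

lemma conf2_pair:
 assumes c2: "conf2 n w a1 Am Bm bk b1 am"
  and E: "E = {} \<or> (Am = {am} & Bm = {b1} & decr w (center w a1 bk b1 am) & E = center w a1 bk b1 am)"
  and s: "s \<in> insert a1 Am \<union> insert bk Bm \<union> E" and t: "t \<in> insert a1 Am \<union> insert bk Bm \<union> E"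
  and st: "s < t" "w s < w t"
 shows "(s \<in> Bm & (t = a1 \<or> t \<in> Am)) \<or> (s = bk & t \<in> Am)"
proof -
 note c = conf2D[OF c2]
 have EE: "a1 < g & g < bk & w am < w g & w g < w b1" if "g \<in> E" for g using E that by (auto simp: center_def)
 have EA: "Am = {am} & Bm = {b1}" if "g \<in> E" for g using E that by auto
 have sa: "s ~= a1"
  using t st c(9)[of t] c(10)[of t] EE[of t] c(5-8) by auto
 have sA: "s \<notin> Am"
 proof
  assume "s \<in> Am"
  then show False using t st c(9)[of t] c(10)[of s] EE[of t] c(5) decrD[OF c(3), of s t] by auto
 qed
 have sE: "s \<notin> E"
 proof
  assume sE: "s \<in> E"
  have "t \<notin> E"
  proof
   assume "t \<in> E"
   then have "decr w E" using E by auto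
   then show False using decrD[of w E s t] sE \<open>t \<in> E\<close> st by auto
  qed
  then show False using t st EE[OF sE] EA[OF sE] c(9)[of t] c(5-8) by auto
 qed
 have tb: "t \<notin> Bm"
  using s st c(9)[of t] c(9)[of s] decrD[OF c(4), of s t] c(5) sa sA sE by auto
 have tbk: "t ~= bk"
  using s st c(9)[of s] sa sA sE by auto
 have tE: "t \<notin> E"
 proof
  assume tE: "t \<in> E"
  then show False using s sa sA sE st EE[OF tE] EA[OF tE] by auto
 qed
 have "~ (s = bk & t = a1)" using st c(5) by auto
 then show ?thesis using s t sa sA sE tb tbk tE by auto
qed

text \<open>
A point missing in a smaller configuration with the same \<open>\<alpha>\<^sub>1\<close> and \<open>\<beta>\<^sub>k\<close> lies in its region, contrary
to the condition that the region avoids other points.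
\<close>

lemma missing_alpha:
 assumes "conf0 n w a1 Am Bm bk" "Am' \<subseteq> Am" "Bm' \<subseteq> Bm" "s \<in> Am" "s \<notin> Am'" "s < bk \<or> (\<exists>a\<in>Am'. w a < w s)"
 shows "region w a1 Am' Bm' bk s (w s)"
proof -
 note c = conf0D[OF assms(1)]
 have "s < a" if "a \<in> Am'" "w a < w s" for a
  using decrD[OF c(3), of a s] assms that by (cases a s rule: linorder_cases) auto
 moreover have "b <= s" if "b \<in> Bm'" for b using c(10)[of b s] assms that by auto
 ultimately show ?thesis using c(9)[of s] assms unfolding region_def by (auto dest: leD)
qed

lemma missing_beta:
 assumes "conf0 n w a1 Am Bm bk" "Am' \<subseteq> Am" "Bm' \<subseteq> Bm" "s \<in> Bm" "s \<notin> Bm'" "a1 <= s \<or> (\<exists>b\<in>Bm'. w s < w b)"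
 shows "region w a1 Am' Bm' bk s (w s)"
proof -
 note c = conf0D[OF assms(1)]
 have "b <= s" if "b \<in> Bm'" "w s <= w b" for b
  using decrD[OF c(4), of s b] assms that by (cases s b rule: linorder_cases) auto
 moreover have "s < a" if "a \<in> Am'" for a using c(10)[of s a] assms that by auto
 ultimately show ?thesis using c(8)[of s] assms unfolding region_def by (auto dest: less_asym)
qed

text \<open>
Each point of the inner configuration is next to a corner of the inner region, hence lies in the outer
region unless it belongs to the outer configuration; as the outer region avoids all points not in its
centre, it belongs to the outer configuration or its centre.
The increasing pairs among these points then identify their roles: a pair of the inner shape must be a
pair of the outer one, which also excludes two different shapes.
\<close>

lemma conf_antichain:
 assumes xp: "x permutes {1..n}" and wp: "w permutes {1..n}"
  and g: "generic_conf n w a1 Am Bm bk" and g': "generic_conf n w a1' Am' Bm' bk'"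
  and xS: "\<And>i. i \<in> {1..n} ==> i \<notin> insert a1 Am \<union> insert bk Bm ==> x i = w i"
  and dx: "\<And>p q. dif x w p q = of_bool (region w a1 Am Bm bk p q)"
  and sub: "\<And>p q. region w a1' Am' Bm' bk' p q ==> region w a1 Am Bm bk p q"
 shows "a1' = a1 & Am' = Am & Bm' = Bm & bk' = bk"
proof -
 let ?S = "insert a1 Am \<union> insert bk Bm" and ?S' = "insert a1' Am' \<union> insert bk' Bm'"
 note c0 = generic_conf_conf0[OF g] and c0' = generic_conf_conf0[OF g']
 note S'n = conf0_support(1)[OF c0'] and Sn = conf0_support(1)[OF c0]
 have corner: "region w a1 Am Bm bk s (w s)" if s: "s \<in> ?S'" "s \<notin> ?S" for s
 proof -
  have sn: "s \<in> {1..n}" using S'n s by blast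
  have xs: "x s = w s" using xS[OF sn] s by simp
  have "region w a1' Am' Bm' bk' s (w s) \<or> region w a1' Am' Bm' bk' (s - 1) (Suc (w s))"
   using region_corners[OF c0'] s by auto
  then have "region w a1 Am Bm bk s (w s) \<or> region w a1 Am Bm bk (s - 1) (Suc (w s))" using sub by blast
  moreover have "dif x w (s - 1) (Suc (w s)) = dif x w s (w s)"
   by (rule dif_common_point(1)[OF xp wp _ xs]) (use sn in simp)
  ultimately show ?thesis using dx by (metis of_bool_eq_iff)
 qed
 from g consider (A) "conf1 n w a1 Am Bm bk" "avoids n w a1 Am Bm bk {}"
  | (B) b1 am E where "conf2 n w a1 Am Bm bk b1 am" "avoids n w a1 Am Bm bk E"
    "E = {} \<or> (Am = {am} & Bm = {b1} & decr w (center w a1 bk b1 am) & E = center w a1 bk b1 am)"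
  unfolding generic_conf_def by blast
 then show ?thesis
 proof cases
  case A
  note c = conf1D[OF A(1)]
  have S'S: "s \<in> ?S" if "s \<in> ?S'" for s
   using corner[OF that] A(2) S'n that unfolding avoids_def by blast
  have pair: "s \<in> Bm & t \<in> Am" if "s \<in> ?S'" "t \<in> ?S'" "s < t" "w s < w t" for s t
   by (rule conf1_pair[OF A(1) S'S[OF that(1)] S'S[OF that(2)] that(3,4)])
  from g' show ?thesis
  proof (cases rule: generic_conf_cases)
   case 1
   note c' = conf1D[OF 1(1)]
   obtain a' b' where ab: "a' \<in> Am'" "b' \<in> Bm'" using c'(6,7) by auto
   have AmB: "Am' \<subseteq> Am" "Bm' \<subseteq> Bm" using pair c'(3) ab by blast+
   have a1: "a1' = a1"
    using S'S[of a1'] c(1)[of a1'] c(2)[of a1'] c(3)[of b' a1'] c(3)[of a1' a'] c'(1)[OF ab(2)] c'(2)[OF ab(1)] AmB ab c(2)[of a'] c(8) by auto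
   have bk: "bk' = bk"
    using S'S[of bk'] c(3)[of b' bk'] c(3)[of bk' a'] c'(1)[OF ab(2)] c'(2)[OF ab(1)] AmB ab c(1)[of b'] c(2)[of a'] a1 c'(8) by auto
   have "Am \<subseteq> Am'"
   proof
    fix s assume s: "s \<in> Am"
    show "s \<in> Am'"
    proof (rule ccontr)
     assume n: "s \<notin> Am'"
     have "s \<notin> ?S'" using s n a1 bk c(2)[OF s] AmB c(3)[of s s] by auto
     then have "~ region w a1' Am' Bm' bk' s (w s)" using 1(2) s Sn by (auto simp: avoids_def)
     moreover have "region w a1' Am' Bm' bk' s (w s)"
      unfolding a1 bk by (rule missing_alpha[OF c0]) (use AmB s n c(2)[OF s] in auto)
     ultimately show False by simp
    qed
   qed
   moreover have "Bm \<subseteq> Bm'"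
   proof
    fix s assume s: "s \<in> Bm"
    show "s \<in> Bm'"
    proof (rule ccontr)
     assume n: "s \<notin> Bm'"
     have "s \<notin> ?S'" using s n a1 bk c(1)[OF s] AmB c(3)[of s s] by auto
     then have "~ region w a1' Am' Bm' bk' s (w s)" using 1(2) s Sn by (auto simp: avoids_def)
     moreover have "region w a1' Am' Bm' bk' s (w s)"
      unfolding a1 bk by (rule missing_beta[OF c0]) (use AmB s n c(1)[OF s] in auto)
     ultimately show False by simp
    qed
   qed
   ultimately show ?thesis using AmB a1 bk by auto
  next
   case (2 b1' am')
   note c' = conf2D[OF 2(1)]
   have "a1' \<in> Am" using pair[of b1' a1'] c'(2,8) c'(9)[OF c'(2)] by auto
   moreover have "bk' \<in> Bm" using pair[of bk' am'] c'(1,6) c'(10)[OF c'(1)] by auto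
   ultimately have "bk' < a1'" using c(3) by blast
   then have False using c'(5) by simp
   then show ?thesis ..
  qed
 next
  case B
  note c = conf2D[OF B(1)]
  have S'S: "s \<in> ?S \<union> E" if "s \<in> ?S'" for s
   using corner[OF that] B(2) S'n that unfolding avoids_def by blast
  have pair: "(s \<in> Bm & (t = a1 \<or> t \<in> Am)) \<or> (s = bk & t \<in> Am)" if "s \<in> ?S'" "t \<in> ?S'" "s < t" "w s < w t" for s t
   by (rule conf2_pair[OF B(1,3) S'S[OF that(1)] S'S[OF that(2)] that(3,4)])
  have EE: "a1 < g & g < bk & w am < w g & w g < w b1" if "g \<in> E" for g using B(3) that by (auto simp: center_def)
  have EA: "Am = {am} & Bm = {b1}" if "g \<in> E" for g using B(3) that by auto
  from g' show ?thesis
  proof (cases rule: generic_conf_cases)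
   case 1
   note c' = conf1D[OF 1(1)]
   obtain a' b' where ab: "a' \<in> Am'" "b' \<in> Bm'" using c'(6,7) by auto
   have p: "(b' \<in> Bm & (a' = a1 \<or> a' \<in> Am)) \<or> (b' = bk & a' \<in> Am)"
    using pair[of b' a'] ab c'(3)[OF ab(2,1)] by auto
   have A': "a1' < b'" "w a' < w a1'" using c'(1)[OF ab(2)] c'(2)[OF ab(1)] by auto
   have K': "a' < bk'" "w bk' < w b'" using c'(1)[OF ab(2)] c'(2)[OF ab(1)] by auto
   have bkS: "bk' \<in> ?S \<union> E" "a1' \<in> ?S \<union> E" using S'S by auto
   have low: "w bk <= w s" if "s \<in> ?S \<union> E" for s
    using that c(9)[of s] c(10)[of s] EE[of s] c(5-8) by auto
   from p have False
   proof
    assume "b' = bk & a' \<in> Am"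
    then show False using low[OF bkS(1)] K' by simp
   next
    assume q: "b' \<in> Bm & (a' = a1 \<or> a' \<in> Am)"
    then have "a1' < a1" using A' c(9)[of b'] by auto
    then have a1B: "a1' \<in> Bm" using bkS(2) c(5) c(10)[of a1'] EE[of a1'] by auto
    then have "w a1' <= w b1" using c(9) by auto
    then have "w a' < w b1" using A' by simp
    then have "a' = am" using q c(8) c(10)[of a'] by auto
    then have "am < bk'" using K' by simp
    then show False using bkS(1) c(9)[of bk'] c(10)[of bk'] EE[of bk'] c(5) c(10)[OF c(1)] by auto
   qed
   then show ?thesis ..
  next
   case (2 b1' am')
   note c' = conf2D[OF 2(1)]
   have P1: "(b1' \<in> Bm & (a1' = a1 \<or> a1' \<in> Am)) \<or> (b1' = bk & a1' \<in> Am)"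
    using pair[of b1' a1'] c'(2,8) c'(9)[OF c'(2)] by auto
   have P2: "(bk' \<in> Bm & (am' = a1 \<or> am' \<in> Am)) \<or> (bk' = bk & am' \<in> Am)"
    using pair[of bk' am'] c'(1,6) c'(10)[OF c'(1)] by auto
   have "bk' \<notin> Bm" using P1 c'(5) c(9)[of bk'] c(10)[of a1'] c(5) by auto
   then have bk: "bk' = bk" "am' \<in> Am" using P2 by auto
   then have "a1' \<notin> Am" using c'(5) c(10)[of a1'] by auto
   then have a1: "a1' = a1" "b1' \<in> Bm" using P1 by auto
   have am: "am' = am" using c(10)[OF bk(2)] c(9)[OF a1(2)] c'(7) by auto
   have b1: "b1' = b1" using c(9)[OF a1(2)] c'(7) am by auto
   have BmB: "Bm' \<subseteq> Bm"
   proof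
    fix s assume s: "s \<in> Bm'"
    then have "s \<in> ?S \<union> E" using S'S by auto
    then show "s \<in> Bm" using c'(9)[OF s] a1 c(5) c(10)[of s] EE[of s] by auto
   qed
   have AmA: "Am' \<subseteq> Am"
   proof
    fix s assume s: "s \<in> Am'"
    then have "s \<in> ?S \<union> E" using S'S by auto
    then show "s \<in> Am" using c'(10)[OF s] bk c(5) c(9)[of s] EE[of s] by auto
   qed
   have "Am \<subseteq> Am'"
   proof
    fix s assume s: "s \<in> Am"
    show "s \<in> Am'"
    proof (rule ccontr)
     assume n: "s \<notin> Am'"
     then have sm: "s ~= am" using c'(1) am by auto
     have "s \<notin> ?S'" using s n a1 bk c(10)[OF s] c(5) BmB c(9)[of s] by auto
     then have "~ region w a1' Am' Bm' bk' s (w s)" using 2(2) s Sn c(10)[OF s] bk by (auto simp: avoids_def center_def)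
     moreover have "region w a1' Am' Bm' bk' s (w s)"
      unfolding a1 bk by (rule missing_alpha[OF c0]) (use AmA BmB s n c'(1) am c(10)[OF s] sm c(7) in \<open>auto intro: bexI[of _ am]\<close>)
     ultimately show False by simp
    qed
   qed
   moreover have "Bm \<subseteq> Bm'"
   proof
    fix s assume s: "s \<in> Bm"
    show "s \<in> Bm'"
    proof (rule ccontr)
     assume n: "s \<notin> Bm'"
     then have sm: "s ~= b1" using c'(2) b1 by auto
     have "s \<notin> ?S'" using s n a1 bk c(9)[OF s] c(5) AmA c(10)[of s] by auto
     then have "~ region w a1' Am' Bm' bk' s (w s)" using 2(2) s Sn c(9)[OF s] a1 by (auto simp: avoids_def center_def)
     moreover have "region w a1' Am' Bm' bk' s (w s)"
      unfolding a1 bk by (rule missing_beta[OF c0]) (use AmA BmB s n c'(2) b1 c(9)[OF s] sm c(7) in \<open>auto intro: bexI[of _ b1]\<close>)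
     ultimately show False by simp
    qed
   qed
   ultimately show ?thesis using AmA BmB a1 bk by auto
  qed
 qed
qed

definition generic_singularity :: "nat => (nat => nat) => (nat => nat) => bool" where
 "generic_singularity n x w \<longleftrightarrow> (\<exists>a1 Am Bm bk. generic_conf n w a1 Am Bm bk \<and>
   (\<forall>p q. dif x w p q = of_bool (region w a1 Am Bm bk p q)))"

lemma dif_eq_imp_eq:
 assumes "x permutes {1..n}" "y permutes {1..n}" "\<And>p q. dif x w p q = dif y w p q"
 shows "x = y"
proof (rule bruhat_le_antisym_aux[OF assms(1,2)])
 fix p q show "dif x y p q = 0" using dif_add[of x y p q w] assms(3)[of p q] by simp
qed

lemma generic_conf_perm:
 assumes g: "generic_conf n w a1 Am Bm bk" and wp: "w permutes {1..n}"
 obtains y m \<alpha> k \<beta> where "y permutes {1..n}" "cyc_data n w a1 Am Bm bk m \<alpha> k \<beta>" "cyclic_rearrangement n y w m \<alpha> k \<beta>"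
  "\<And>p q. dif y w p q = of_bool (region w a1 Am Bm bk p q)" "bruhat_le y w" "len n w < tdim n y w"
  "\<And>i. i \<in> {1..n} ==> i \<notin> insert a1 Am \<union> insert bk Bm ==> y i = w i"
proof -
 have c0: "conf0 n w a1 Am Bm bk" using g by (rule generic_conf_conf0)
 obtain m \<alpha> k \<beta> where cd: "cyc_data n w a1 Am Bm bk m \<alpha> k \<beta>" using conf0_cyc_data[OF c0] by blast
 obtain y where y: "y permutes {1..n}" "cyclic_rearrangement n y w m \<alpha> k \<beta>" using cyc_perm[OF c0 cd wp] by blast
 have d: "dif y w p q = of_bool (region w a1 Am Bm bk p q)" for p q by (rule cyc_dif[OF c0 cd y(2,1) wp])
 have o: "y i = w i" if "i \<in> {1..n}" "i \<notin> insert a1 Am \<union> insert bk Bm" for i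
  using y(2) that cyc_data_sets[OF cd] unfolding cyclic_rearrangement_def by auto
 show ?thesis
  by (rule that[OF y(1) cd y(2) d _ conf_singular[OF g cd y(2,1) wp] o]) (use d in \<open>auto simp: bruhat_le_def\<close>)
qed

text \<open>
A singular \<open>x\<close> lies below a rearranged permutation by \<open>singular_conf\<close>, because the indicator of the
region is bounded by \<open>dif x w\<close>; the rearranged ones are singular, and they are maximal since their
regions form an antichain.
\<close>

theorem maximal_singular_iff:
 assumes xp: "x permutes {1..n}" and wp: "w permutes {1..n}"
 shows "bruhat_le x w & tdim n x w ~= len n w \<and>
   (\<forall>v. v permutes {1..n} & bruhat_le x v & bruhat_le v w & tdim n v w ~= len n w --> v = x)
  \<longleftrightarrow> generic_singularity n x w" (is "?L \<longleftrightarrow> ?R")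
proof
 assume ?R
 then obtain a1 Am Bm bk where g: "generic_conf n w a1 Am Bm bk" and dx: "\<And>p q. dif x w p q = of_bool (region w a1 Am Bm bk p q)"
  unfolding generic_singularity_def by blast
 obtain y m \<alpha> k \<beta> where y: "y permutes {1..n}" "\<And>p q. dif y w p q = of_bool (region w a1 Am Bm bk p q)" "len n w < tdim n y w"
  "\<And>i. i \<in> {1..n} ==> i \<notin> insert a1 Am \<union> insert bk Bm ==> y i = w i" "bruhat_le y w"
  using generic_conf_perm[OF g wp] by metis
 have "x = y" by (rule dif_eq_imp_eq[OF xp y(1), of w]) (simp add: dx y(2))
 note y = y[folded this]
 have "v = x" if vp: "v permutes {1..n}" and xv: "bruhat_le x v" and vw: "bruhat_le v w" and s: "tdim n v w ~= len n w" for v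
 proof -
  obtain b1 Bn Cn ck where g': "generic_conf n w b1 Bn Cn ck" and r': "\<And>p q. region w b1 Bn Cn ck p q ==> 1 <= dif v w p q"
   using singular_conf[OF vp wp vw s] by blast
  have le: "dif v w p q <= dif x w p q" for p q
   using dif_add[of x v p q w] xv unfolding bruhat_le_def by (smt (verit))
  have sub: "region w a1 Am Bm bk p q" if "region w b1 Bn Cn ck p q" for p q
  proof (rule ccontr)
   assume "~ ?thesis"
   then show False using r'[OF that] le[of p q] dx[of p q] by simp
  qed
  have eq: "b1 = a1 & Bn = Am & Cn = Bm & ck = bk"
   by (rule conf_antichain[OF xp wp g g' y(4) dx sub])
  show "v = x"
  proof (rule dif_eq_imp_eq[OF vp xp, of w])
   fix p q
   have "0 <= dif v w p q" using vw by (simp add: bruhat_le_def)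
   then show "dif v w p q = dif x w p q"
    using le[of p q] r'[of p q] dx[of p q] eq by (cases "region w a1 Am Bm bk p q") auto
  qed
 qed
 then show ?L using y by auto
next
 assume L: ?L
 then obtain a1 Am Bm bk where g: "generic_conf n w a1 Am Bm bk" and r: "\<And>p q. region w a1 Am Bm bk p q ==> 1 <= dif x w p q"
  using singular_conf[OF xp wp] by blast
 obtain y m \<alpha> k \<beta> where y: "y permutes {1..n}" "\<And>p q. dif y w p q = of_bool (region w a1 Am Bm bk p q)" "len n w < tdim n y w"
  "bruhat_le y w"
  using generic_conf_perm[OF g wp] by metis
 have "bruhat_le x y" unfolding bruhat_le_def
 proof (intro allI)
  fix p q
  have "0 <= dif x w p q" using L by (simp add: bruhat_le_def)
  then show "0 <= dif x y p q" using dif_add[of x y p q w] y(2)[of p q] r[of p q] by (cases "region w a1 Am Bm bk p q") auto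
 qed
 then have "y = x" using L y by auto
 then show ?R unfolding generic_singularity_def using g y(2) by blast
qed

section \<open>Polynomial functions and minors\<close>

abbreviation (input) SLset :: "nat => complex mat set" where
 "SLset n \<equiv> carrier (SL n)"

abbreviation (input) flag_top :: "nat => complex mat set topology" where
 "flag_top n \<equiv> topo (flag_variety n)"

lemma mat_mult_entry:
 "A \<in> carrier_mat n m ==> B \<in> carrier_mat m k ==> i < n ==> j < k ==>
  (A * B) $$ (i, j) = (\<Sum>l<m. A $$ (i, l) * B $$ (l, j))"
 by (auto simp: scalar_prod_def atLeast0LessThan intro!: sum.cong)

lemma poly_funs_sum: "(\<And>i. i \<in> S ==> f i \<in> poly_funs n) ==> (%A. \<Sum>i\<in>S. f i A) \<in> poly_funs n"
proof (induction S rule: infinite_finite_induct)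
 case (insert i S)
 then show ?case using poly_funs.add[of "f i" n "%A. \<Sum>i\<in>S. f i A"] by simp
qed (auto intro: poly_funs.const)

lemma poly_funs_prod: "(\<And>i. i \<in> S ==> f i \<in> poly_funs n) ==> (%A. \<Prod>i\<in>S. f i A) \<in> poly_funs n"
proof (induction S rule: infinite_finite_induct)
 case (insert i S)
 then show ?case using poly_funs.mult[of "f i" n "%A. \<Prod>i\<in>S. f i A"] by simp
qed (auto intro: poly_funs.const)

lemma poly_funs_power: "f \<in> poly_funs n ==> (%A. f A ^ k) \<in> poly_funs n"
 by (induction k) (auto intro: poly_funs.intros)

lemma poly_funs_subst:
 assumes T: "\<forall>i<n. \<forall>j<n. \<exists>g\<in>poly_funs n. \<forall>A\<in>carrier_mat n n. g A = T A $$ (i, j)" and f: "f \<in> poly_funs n"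
 shows "\<exists>g\<in>poly_funs n. \<forall>A\<in>carrier_mat n n. g A = f (T A)"
 using f
proof induction
 case (const a)
 then show ?case by (intro bexI[of _ "%A. a"]) (auto intro: poly_funs.const)
next
 case (entry i j)
 then show ?case using T by simp
next
 case (add f g)
 from add.IH obtain f' g' where f': "f' \<in> poly_funs n" "g' \<in> poly_funs n" and e: "\<forall>A\<in>carrier_mat n n. f' A = f (T A)" "\<forall>A\<in>carrier_mat n n. g' A = g (T A)"
  by (elim bexE) (rule that)
 show ?case by (rule bexI[OF _ poly_funs.add[OF f']]) (use e in simp)
next
 case (mult f g)
 from mult.IH obtain f' g' where f': "f' \<in> poly_funs n" "g' \<in> poly_funs n" and e: "\<forall>A\<in>carrier_mat n n. f' A = f (T A)" "\<forall>A\<in>carrier_mat n n. g' A = g (T A)"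
  by (elim bexE) (rule that)
 show ?case by (rule bexI[OF _ poly_funs.mult[OF f']]) (use e in simp)
qed

lemma poly_funs_left_mult:
 assumes c: "c \<in> carrier_mat n n" and f: "f \<in> poly_funs n"
 shows "\<exists>f'\<in>poly_funs n. \<forall>A\<in>carrier_mat n n. f' A = f (c * A)"
proof (rule poly_funs_subst[OF _ f], intro allI impI)
 fix i j assume ij: "i < n" "j < n"
 have P: "(%A. \<Sum>l<n. c $$ (i, l) * A $$ (l, j)) \<in> poly_funs n"
  by (intro poly_funs_sum poly_funs.mult poly_funs.const poly_funs.entry) (use ij in auto)
 show "\<exists>g\<in>poly_funs n. \<forall>A\<in>carrier_mat n n. g A = (c * A) $$ (i, j)"
  by (rule bexI[OF _ P]) (intro ballI mat_mult_entry[OF c _ ij, symmetric])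
qed

definition minor :: "(nat => nat) => (nat => nat) => nat => complex mat => complex" where
 "minor \<rho> \<kappa> s A = det (mat s s (%(r, c). A $$ (\<rho> r, \<kappa> c)))"

lemma minor_poly_fun:
 assumes "\<And>i. i < s ==> \<rho> i < n" "\<And>i. i < s ==> \<kappa> i < n"
 shows "minor \<rho> \<kappa> s \<in> poly_funs n"
proof -
 have "minor \<rho> \<kappa> s = (%A. \<Sum>p\<in>{p. p permutes {0..<s}}. signof p * (\<Prod>i = 0..<s. A $$ (\<rho> i, \<kappa> (p i))))"
 proof
  fix A
  have "minor \<rho> \<kappa> s A = (\<Sum>p\<in>{p. p permutes {0..<s}}. signof p * (\<Prod>i = 0..<s. mat s s (%(r, c). A $$ (\<rho> r, \<kappa> c)) $$ (i, p i)))"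
   unfolding minor_def by (rule det_def') simp
  also have "\<dots> = (\<Sum>p\<in>{p. p permutes {0..<s}}. signof p * (\<Prod>i = 0..<s. A $$ (\<rho> i, \<kappa> (p i))))"
  proof (intro sum.cong refl arg_cong2[where f = "(*)"] prod.cong)
   fix p i assume "p \<in> {p. p permutes {0..<s}}" "i \<in> {0..<s}"
   then have "i < s" "p i < s" using permutes_in_image[of p "{0..<s}" i] by auto
   then show "mat s s (%(r, c). A $$ (\<rho> r, \<kappa> c)) $$ (i, p i) = A $$ (\<rho> i, \<kappa> (p i))" by simp
  qed
  finally show "minor \<rho> \<kappa> s A = (\<Sum>p\<in>{p. p permutes {0..<s}}. signof p * (\<Prod>i = 0..<s. A $$ (\<rho> i, \<kappa> (p i))))" .
 qed
 moreover have "(%A. \<Sum>p\<in>{p. p permutes {0..<s}}. signof p * (\<Prod>i = 0..<s. A $$ (\<rho> i, \<kappa> (p i)))) \<in> poly_funs n"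
 proof (intro poly_funs_sum poly_funs.mult poly_funs.const poly_funs_prod poly_funs.entry)
  fix p i assume "p \<in> {p. p permutes {0..<s}}" "i \<in> {0..<s}"
  then have "i < s" "p i < s" using permutes_in_image[of p "{0..<s}" i] by auto
  then show "\<rho> i < n" "\<kappa> (p i) < n" using assms by auto
 qed
 ultimately show ?thesis by simp
qed

text \<open>A matrix of products factoring through fewer than \<open>s\<close> indices has rank below \<open>s\<close>.\<close>

lemma det_low_rank:
 fixes u :: "nat => 'a => complex"
 assumes fin: "finite R" and card: "card R < s"
 shows "det (mat s s (%(a, c). \<Sum>i\<in>R. u a i * v i c)) = 0"
proof -
 obtain f where f: "bij_betw f {0..<card R} R" using ex_bij_betw_nat_finite[OF fin] by blast
 define U where "U = mat s s (%(a, t). if t < card R then u a (f t) else 0)"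
 define V where "V = mat s s (%(t, c). if t < card R then v (f t) c else 0)"
 have UV: "U \<in> carrier_mat s s" "V \<in> carrier_mat s s" by (auto simp: U_def V_def)
 have "mat s s (%(a, c). \<Sum>i\<in>R. u a i * v i c) = U * V"
 proof (rule eq_matI)
  fix a c assume "a < dim_row (U * V)" "c < dim_col (U * V)"
  then have ac: "a < s" "c < s" by (auto simp: U_def V_def)
  have "(U * V) $$ (a, c) = (\<Sum>t<s. U $$ (a, t) * V $$ (t, c))"
   using mat_mult_entry[OF UV] ac by simp
  also have "\<dots> = (\<Sum>t<s. if t < card R then u a (f t) * v (f t) c else 0)"
   by (rule sum.cong) (use ac in \<open>auto simp: U_def V_def\<close>)
  also have "\<dots> = (\<Sum>t\<in>{0..<card R}. u a (f t) * v (f t) c)"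
   by (rule sum.mono_neutral_cong_right) (use card in auto)
  also have "\<dots> = (\<Sum>i\<in>R. u a i * v i c)"
   using sum.reindex_bij_betw[OF f, of "%i. u a i * v i c"] by simp
  finally show "mat s s (%(a, c). \<Sum>i\<in>R. u a i * v i c) $$ (a, c) = (U * V) $$ (a, c)" using ac by simp
 qed (auto simp: U_def V_def)
 moreover have "det U = 0"
  unfolding mat_det_left_def[OF UV(1)]
 proof (intro sum.neutral ballI)
  fix p assume "p \<in> {p. p permutes {0..<dim_row U}}"
  then have p: "p permutes {0..<s}" by (simp add: U_def)
  have "p (card R) < s" using permutes_in_image[OF p, of "card R"] card by simp
  then have "U $$ (p (card R), card R) = 0" using card by (simp add: U_def)
  then have "(\<Prod>i = 0..<dim_row U. U $$ (p i, i)) = 0"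
   by (intro prod_zero) (use card in \<open>auto simp: U_def intro!: bexI[of _ "card R"]\<close>)
  then show "signof p * (\<Prod>i = 0..<dim_row U. U $$ (p i, i)) = 0" by simp
 qed
 ultimately show ?thesis using det_mult[OF UV] by simp
qed

section \<open>Cosets of the Borel subgroup\<close>

lemma SL_iff: "A \<in> SLset n \<longleftrightarrow> A \<in> carrier_mat n n & det A = 1"
 by (auto simp: SL_def)

lemma SL_mult: "A \<in> SLset n ==> B \<in> SLset n ==> A * B \<in> SLset n"
 by (auto simp: SL_iff det_mult)

lemma SL_one: "1\<^sub>m n \<in> SLset n"
 by (auto simp: SL_iff)

lemma SL_carrier: "A \<in> SLset n ==> A \<in> carrier_mat n n"
 by (simp add: SL_iff)

lemma SL_adj:
 assumes "A \<in> SLset n"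
 shows "adj_mat A \<in> SLset n" "adj_mat A * A = 1\<^sub>m n" "A * adj_mat A = 1\<^sub>m n"
proof -
 have A: "A \<in> carrier_mat n n" "det A = 1" using assms by (auto simp: SL_iff)
 show 1: "adj_mat A * A = 1\<^sub>m n" "A * adj_mat A = 1\<^sub>m n" using adj_mat[OF A(1)] A(2) by auto
 have "det (adj_mat A) * det A = 1" using det_mult[OF adj_mat(1)[OF A(1)] A(1)] 1 by simp
 then show "adj_mat A \<in> SLset n" using adj_mat(1)[OF A(1)] A by (simp add: SL_iff)
qed

lemma borel_iff: "A \<in> borel_subgroup n \<longleftrightarrow> A \<in> SLset n & (\<forall>i<n. \<forall>j<i. A $$ (i, j) = 0)"
 by (auto simp: borel_subgroup_def upper_triangular_def SL_iff)

lemma borel_SL: "A \<in> borel_subgroup n ==> A \<in> SLset n"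
 by (simp add: borel_iff)

lemma borel_one: "1\<^sub>m n \<in> borel_subgroup n"
 by (auto simp: borel_iff SL_one)

lemma borel_mult:
 assumes "A \<in> borel_subgroup n" "B \<in> borel_subgroup n"
 shows "A * B \<in> borel_subgroup n"
 unfolding borel_iff
proof (intro conjI allI impI)
 show "A * B \<in> SLset n" using assms SL_mult borel_SL by blast
 fix i j assume ij: "i < n" "j < i"
 have "(A * B) $$ (i, j) = (\<Sum>l<n. A $$ (i, l) * B $$ (l, j))"
  by (rule mat_mult_entry[of _ n n _ n]) (use assms ij borel_SL SL_carrier in auto)
 also have "\<dots> = 0"
 proof (rule sum.neutral, rule ballI)
  fix l assume "l \<in> {..<n}"
  then show "A $$ (i, l) * B $$ (l, j) = 0"
   using assms ij by (cases "l < i") (auto simp: borel_iff)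
 qed
 finally show "(A * B) $$ (i, j) = 0" .
qed

lemma borel_diag:
 assumes "A \<in> borel_subgroup n" "i < n"
 shows "A $$ (i, i) ~= 0"
proof -
 have A: "A \<in> carrier_mat n n" "det A = 1" "upper_triangular A" using assms by (auto simp: borel_subgroup_def SL_iff)
 have "det A = prod_list (diag_mat A)" by (rule det_upper_triangular[OF A(3,1)])
 then have "0 \<notin> set (diag_mat A)" using A(2) by (metis prod_list_zero_iff zero_neq_one)
 then show ?thesis using assms A by (auto simp: diag_mat_def)
qed

lemma borel_inverse:
 assumes b: "b \<in> borel_subgroup n"
 shows "adj_mat b \<in> borel_subgroup n"
proof -
 have bS: "b \<in> SLset n" using b by (rule borel_SL)
 let ?c = "adj_mat b"
 have c: "?c \<in> carrier_mat n n" using SL_adj(1)[OF bS] SL_carrier by blast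
 have z: "?c $$ (r, k) = 0" if "r < n" "k < r" for r k
  using that(2)
 proof (induction k rule: less_induct)
  case (less k)
  have kn: "k < n" using less that by simp
  have "(?c * b) $$ (r, k) = (\<Sum>l<n. ?c $$ (r, l) * b $$ (l, k))"
   using mat_mult_entry[OF c SL_carrier[OF bS]] that kn by simp
  also have "\<dots> = (\<Sum>l\<in>{k}. ?c $$ (r, l) * b $$ (l, k))"
  proof (rule sum.mono_neutral_right)
   show "\<forall>l\<in>{..<n} - {k}. ?c $$ (r, l) * b $$ (l, k) = 0"
   proof
    fix l assume l: "l \<in> {..<n} - {k}"
    then consider "l < k" | "k < l" by fastforce
    then show "?c $$ (r, l) * b $$ (l, k) = 0"
    proof cases
     case 1 then show ?thesis using less by auto
    next
     case 2 then show ?thesis using b l by (auto simp: borel_iff)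
    qed
   qed
  qed (use kn in auto)
  finally have "?c $$ (r, k) * b $$ (k, k) = 0"
   using SL_adj(2)[OF bS] that kn less.prems by simp
  then show ?case using borel_diag[OF b kn] by simp
 qed
 then show ?thesis unfolding borel_iff using SL_adj(1)[OF bS] by blast
qed

lemma flag_proj_alt: "flag_proj n g = {g * b | b. b \<in> borel_subgroup n}"
 by (auto simp: l_coset_def SL_def)

lemma SL_assoc: "a \<in> SLset n ==> b \<in> SLset n ==> c \<in> SLset n ==> (a * b) * c = a * (b * c)"
 using assoc_mult_mat SL_carrier by blast

lemma flag_proj_mult:
 assumes g: "g \<in> SLset n" and b: "b \<in> borel_subgroup n"
 shows "flag_proj n (g * b) = flag_proj n g"
proof -
 have bS: "b \<in> SLset n" using b by (rule borel_SL)
 have "g * b * c \<in> flag_proj n g" if "c \<in> borel_subgroup n" for c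
  using SL_assoc[OF g bS borel_SL[OF that]] borel_mult[OF b that] by (auto simp: flag_proj_alt)
 moreover have "g * c \<in> flag_proj n (g * b)" if c: "c \<in> borel_subgroup n" for c
 proof -
  have "g * c = g * b * (adj_mat b * c)"
   using SL_assoc[OF g bS SL_mult[OF SL_adj(1)[OF bS] borel_SL[OF c]]]
    SL_assoc[OF bS SL_adj(1)[OF bS] borel_SL[OF c]] SL_adj(3)[OF bS] SL_carrier[OF borel_SL[OF c]] by simp
  then show ?thesis using borel_mult[OF borel_inverse[OF b] c] by (auto simp: flag_proj_alt)
 qed
 ultimately show ?thesis unfolding flag_proj_alt by blast
qed

lemma flag_proj_self: "g \<in> SLset n ==> g \<in> flag_proj n g"
 unfolding flag_proj_alt using borel_one SL_carrier by (metis (mono_tags, lifting) mem_Collect_eq right_mult_one_mat)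

lemma flag_proj_eq_iff:
 assumes "g \<in> SLset n" "h \<in> SLset n"
 shows "flag_proj n g = flag_proj n h \<longleftrightarrow> (\<exists>b\<in>borel_subgroup n. h = g * b)"
proof
 assume "flag_proj n g = flag_proj n h"
 then have "h \<in> flag_proj n g" using flag_proj_self[OF assms(2)] by simp
 then show "\<exists>b\<in>borel_subgroup n. h = g * b" unfolding flag_proj_alt by blast
qed (use flag_proj_mult[OF assms(1)] in auto)

section \<open>The Zariski topology on flags\<close>

abbreviation flags :: "nat => complex mat set set" where
 "flags n \<equiv> flag_proj n ` SLset n"

lemma topspace_zariski: "topspace (zariski_mat n) = carrier_mat n n"
proof
 show "topspace (zariski_mat n) \<subseteq> carrier_mat n n"
  using openin_topspace[of "zariski_mat n"] unfolding openin_zariski_mat by auto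
 have "openin (zariski_mat n) (carrier_mat n n)"
  unfolding openin_zariski_mat by (rule exI[of _ "{%A. 1}"]) (auto intro: poly_funs.const)
 then show "carrier_mat n n \<subseteq> topspace (zariski_mat n)" by (rule openin_subset)
qed

lemma topspace_flag: "topspace (flag_top n) = flags n"
proof -
 have "topspace (flag_top n) = flag_proj n ` topspace (topo (subspace_on (mat_space n) (SLset n)))"
  unfolding flag_variety_def using quotient_imp_surjective_map[OF quotient_map_quotient_space] by metis
 then show ?thesis by (auto simp: subspace_on_def mat_space_def topspace_zariski SL_iff)
qed

lemma openin_flag: "openin (flag_top n) U \<longleftrightarrow>
 U \<subseteq> flags n & (\<exists>F\<subseteq>poly_funs n. \<forall>a\<in>SLset n. flag_proj n a \<in> U \<longleftrightarrow> (\<exists>f\<in>F. f a ~= 0))"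
proof -
 have sub: "SLset n \<subseteq> carrier_mat n n" by (auto simp: SL_iff)
 have ts: "topspace (topo (subspace_on (mat_space n) (SLset n))) = SLset n"
  using sub by (auto simp: subspace_on_def mat_space_def topspace_zariski)
 have "openin (flag_top n) U \<longleftrightarrow> U \<subseteq> flags n & openin (subtopology (zariski_mat n) (SLset n)) {a \<in> SLset n. flag_proj n a \<in> U}"
  unfolding flag_variety_def openin_quotient_space ts by (simp add: subspace_on_def mat_space_def)
 also have "openin (subtopology (zariski_mat n) (SLset n)) {a \<in> SLset n. flag_proj n a \<in> U} \<longleftrightarrow>
  (\<exists>F\<subseteq>poly_funs n. {a \<in> SLset n. flag_proj n a \<in> U} = {A \<in> carrier_mat n n. \<exists>f\<in>F. f A ~= 0} \<inter> SLset n)"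
  unfolding openin_subtopology openin_zariski_mat by blast
 also have "\<dots> \<longleftrightarrow> (\<exists>F\<subseteq>poly_funs n. \<forall>a\<in>SLset n. flag_proj n a \<in> U \<longleftrightarrow> (\<exists>f\<in>F. f a ~= 0))"
 proof -
  have "({a \<in> SLset n. flag_proj n a \<in> U} = {A \<in> carrier_mat n n. \<exists>f\<in>F. f A ~= 0} \<inter> SLset n) \<longleftrightarrow>
   (\<forall>a\<in>SLset n. flag_proj n a \<in> U \<longleftrightarrow> (\<exists>f\<in>F. f a ~= 0))" (is "?A = ?B \<longleftrightarrow> ?C") for F :: "(complex mat => complex) set"
  proof
   assume e: "?A = ?B"
   show ?C
   proof
    fix a assume a: "a \<in> SLset n"
    have "a \<in> ?A \<longleftrightarrow> a \<in> ?B" by (simp only: e)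
    then show "flag_proj n a \<in> U \<longleftrightarrow> (\<exists>f\<in>F. f a ~= 0)" using a sub by auto
   qed
  qed (use sub in auto)
  then show ?thesis by simp
 qed
 finally show ?thesis .
qed

lemma closedin_flag: "closedin (flag_top n) D \<longleftrightarrow>
 D \<subseteq> flags n & (\<exists>F\<subseteq>poly_funs n. \<forall>a\<in>SLset n. flag_proj n a \<in> D \<longleftrightarrow> (\<forall>f\<in>F. f a = 0))"
proof -
 have "flag_proj n a \<in> flags n - D \<longleftrightarrow> flag_proj n a \<notin> D" if "a \<in> SLset n" for a
  using that by blast
 then have "(\<forall>a\<in>SLset n. flag_proj n a \<in> flags n - D \<longleftrightarrow> (\<exists>f\<in>F. f a ~= 0)) \<longleftrightarrow>
  (\<forall>a\<in>SLset n. flag_proj n a \<in> D \<longleftrightarrow> (\<forall>f\<in>F. f a = 0))" for F :: "(complex mat => complex) set"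
  by (intro ball_cong refl) blast
 moreover have "flags n - D \<subseteq> flags n" by blast
 ultimately show ?thesis unfolding closedin_def topspace_flag openin_flag by simp
qed

lemma closedin_flagE:
 assumes "closedin (flag_top n) D"
 obtains F where "F \<subseteq> poly_funs n" "\<forall>a\<in>SLset n. flag_proj n a \<in> D \<longleftrightarrow> (\<forall>f\<in>F. f a = 0)"
proof -
 from assms have "\<exists>F\<subseteq>poly_funs n. \<forall>a\<in>SLset n. flag_proj n a \<in> D \<longleftrightarrow> (\<forall>f\<in>F. f a = 0)"
  unfolding closedin_flag by (rule conjunct2)
 then show ?thesis by (elim exE conjE) (rule that)
qed

definition poly_curve :: "nat => (complex => complex mat) => bool" where
 "poly_curve n c \<longleftrightarrow> (\<forall>i<n. \<forall>j<n. \<exists>P. \<forall>s. c s $$ (i, j) = poly P s)"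

lemma poly_fun_curve:
 assumes "f \<in> poly_funs n" "poly_curve n c"
 shows "\<exists>P. \<forall>s. f (c s) = poly P s"
 using assms
proof induction
 case (const a) then show ?case by (intro exI[of _ "[:a:]"]) simp
next
 case (entry i j) then show ?case by (auto simp: poly_curve_def)
next
 case (add f g)
 then obtain P Q where "\<forall>s. f (c s) = poly P s" "\<forall>s. g (c s) = poly Q s" by blast
 then show ?case by (intro exI[of _ "P + Q"]) simp
next
 case (mult f g)
 then obtain P Q where "\<forall>s. f (c s) = poly P s" "\<forall>s. g (c s) = poly Q s" by blast
 then show ?case by (intro exI[of _ "P * Q"]) simp
qed

text \<open>A polynomial in one variable with infinitely many zeros vanishes.\<close>

lemma curve_closed:
 assumes c: "poly_curve n c" and cS: "\<And>s. c s \<in> SLset n" and D: "closedin (flag_top n) D"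
  and inf: "infinite {s. flag_proj n (c s) \<in> D}"
 shows "flag_proj n (c s) \<in> D"
proof -
 obtain F where F: "F \<subseteq> poly_funs n" "\<forall>a\<in>SLset n. flag_proj n a \<in> D \<longleftrightarrow> (\<forall>f\<in>F. f a = 0)"
  by (rule closedin_flagE[OF D])
 have "f (c s) = 0" if f: "f \<in> F" for f
 proof -
  from f F(1) have "f \<in> poly_funs n" by (rule rev_subsetD)
  from poly_fun_curve[OF this c] obtain P where P: "\<forall>s. f (c s) = poly P s" ..
  have "{s. flag_proj n (c s) \<in> D} \<subseteq> {s. poly P s = 0}"
  proof (rule Collect_mono, rule impI)
   fix s assume "flag_proj n (c s) \<in> D"
   then have "\<forall>f\<in>F. f (c s) = 0" using bspec[OF F(2) cS] by simp
   then have "f (c s) = 0" using f by (rule bspec)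
   then show "poly P s = 0" using P by simp
  qed
  then have "infinite {s. poly P s = 0}" using inf finite_subset by blast
  then have "P = 0" using poly_roots_finite by blast
  then show ?thesis using P by simp
 qed
 then show ?thesis using bspec[OF F(2) cS[of s]] by simp
qed

text \<open>
If two closed sets cover a polynomial curve, one of them contains infinitely many of its points and
hence the whole curve.
\<close>

lemma irreducible_by_curves:
 assumes ne: "S ~= {}" and sub: "S \<subseteq> flags n"
  and curves: "\<And>p q. p \<in> S ==> q \<in> S ==> \<exists>c. poly_curve n c & (\<forall>s. c s \<in> SLset n & flag_proj n (c s) \<in> S) \<and>
   flag_proj n (c 0) = p & flag_proj n (c 1) = q"
 shows "irreducible_subset (flag_top n) S"
 unfolding irreducible_subset_def topspace_flag
proof (intro conjI allI impI)
 fix C D assume CD: "closedin (flag_top n) C & closedin (flag_top n) D & S \<subseteq> C \<union> D"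
 show "S \<subseteq> C \<or> S \<subseteq> D"
 proof (rule ccontr)
  assume "~ ?thesis"
  then obtain p q where p: "p \<in> S" "p \<notin> C" and q: "q \<in> S" "q \<notin> D" by blast
  from curves[OF p(1) q(1)] obtain c where c: "poly_curve n c" "\<And>s. c s \<in> SLset n" "\<And>s. flag_proj n (c s) \<in> S"
   "flag_proj n (c 0) = p" "flag_proj n (c 1) = q" by (elim exE conjE) metis
  have cC: "closedin (flag_top n) C" and cD: "closedin (flag_top n) D" using CD by auto
  have "finite {s. flag_proj n (c s) \<in> C}"
  proof (rule ccontr)
   assume "infinite {s. flag_proj n (c s) \<in> C}"
   then have "flag_proj n (c 0) \<in> C" by (rule curve_closed[OF c(1,2) cC])
   then show False using p(2) c(4) by simp
  qed
  moreover have "finite {s. flag_proj n (c s) \<in> D}"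
  proof (rule ccontr)
   assume "infinite {s. flag_proj n (c s) \<in> D}"
   then have "flag_proj n (c 1) \<in> D" by (rule curve_closed[OF c(1,2) cD])
   then show False using q(2) c(5) by simp
  qed
  ultimately have "finite ({s. flag_proj n (c s) \<in> C} \<union> {s. flag_proj n (c s) \<in> D})" by simp
  moreover have "{s. flag_proj n (c s) \<in> C} \<union> {s. flag_proj n (c s) \<in> D} = (UNIV :: complex set)"
  proof -
   have "flag_proj n (c s) \<in> C \<or> flag_proj n (c s) \<in> D" for s using c(3)[of s] CD by auto
   then show ?thesis by auto
  qed
  ultimately show False by (simp add: infinite_UNIV_char_0)
 qed
qed (use ne sub in auto)

lemma irreducible_closure:
 assumes "irreducible_subset T S"
 shows "irreducible_subset T (T closure_of S)"
 unfolding irreducible_subset_def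
proof (intro conjI allI impI)
 show "T closure_of S \<subseteq> topspace T" by (rule closure_of_subset_topspace)
 show "T closure_of S ~= {}" using assms closure_of_subset[of S T] by (auto simp: irreducible_subset_def)
 fix C D assume CD: "closedin T C & closedin T D & T closure_of S \<subseteq> C \<union> D"
 have "S \<subseteq> T closure_of S" using assms by (intro closure_of_subset) (simp add: irreducible_subset_def)
 with CD have "closedin T C & closedin T D & S \<subseteq> C \<union> D" by auto
 moreover have "\<forall>C D. closedin T C & closedin T D & S \<subseteq> C \<union> D --> S \<subseteq> C \<or> S \<subseteq> D"
  using assms unfolding irreducible_subset_def by (elim conjE)
 ultimately have "S \<subseteq> C \<or> S \<subseteq> D" by simp
 moreover have "closedin T C" "closedin T D" using CD by simp_all
 ultimately show "T closure_of S \<subseteq> C \<or> T closure_of S \<subseteq> D"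
  using closure_of_minimal[of S C T] closure_of_minimal[of S D T] by metis
qed

section \<open>Elimination and Bruhat cells\<close>

lemma unipotent_det:
 fixes A :: "complex mat"
 assumes "A \<in> carrier_mat n n" "\<forall>i<n. A $$ (i, i) = 1"
  and "(\<forall>i<n. \<forall>j<i. A $$ (i, j) = 0) \<or> (\<forall>j<n. \<forall>i<j. A $$ (i, j) = 0)"
 shows "A \<in> SLset n"
proof -
 have "prod_list (diag_mat A) = 1"
  unfolding prod_list_diag_prod using assms(1,2) by (intro prod.neutral) auto
 moreover have "det A = prod_list (diag_mat A)"
  using assms(3)
 proof
  assume "\<forall>i<n. \<forall>j<i. A $$ (i, j) = 0"
  then show ?thesis using assms(1) by (intro det_upper_triangular) (auto simp: upper_triangular_def)
 next
  assume "\<forall>j<n. \<forall>i<j. A $$ (i, j) = 0"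
  then show ?thesis using assms(1) by (intro det_lower_triangular) auto
 qed
 ultimately show ?thesis using assms(1) by (simp add: SL_iff)
qed

lemma SL_column_nonzero:
 assumes A: "A \<in> SLset n" and c: "c < n"
 shows "\<exists>r<n. A $$ (r, c) ~= 0"
proof (rule ccontr)
 assume h: "~ ?thesis"
 have "(adj_mat A * A) $$ (c, c) = (\<Sum>l<n. adj_mat A $$ (c, l) * A $$ (l, c))"
  using mat_mult_entry[OF SL_carrier[OF SL_adj(1)[OF A]] SL_carrier[OF A]] c by simp
 also have "\<dots> = 0" using h by (intro sum.neutral) auto
 finally show False using SL_adj(2)[OF A] c by simp
qed

text \<open>
Elimination by column operations, where \<open>\<kappa>\<close> orders the rows and \<open>L l c\<close> allows adding multiples of
column \<open>l\<close> to column \<open>c\<close>. Each column is replaced by a combination whose \<open>\<kappa>\<close>-last nonzero row comes as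
early as possible; if two columns related by \<open>L\<close> had the same pivot row, one of them could be improved.
With the rows in natural order this yields the decomposition into Bruhat cells, with the rows reversed
(\<open>\<kappa> r = n - r\<close>) the coordinates of a cell and the LU decomposition.
\<close>

lemma column_pivots:
 assumes A: "A \<in> SLset n" and inj: "inj_on (\<kappa> :: nat => nat) {..<n}"
  and L: "\<forall>a b. L a b --> a < b" and tr: "\<forall>a b c. L a b --> L b c --> L a c"
 shows "\<exists>R \<rho>. R \<in> borel_subgroup n & (\<forall>i<n. R $$ (i, i) = 1) \<and>
   (\<forall>i<n. \<forall>j<n. i ~= j --> ~ L i j --> R $$ (i, j) = 0) \<and>
   (\<forall>c<n. \<rho> c < n & (A * R) $$ (\<rho> c, c) ~= 0 & (\<forall>r<n. \<kappa> (\<rho> c) < \<kappa> r --> (A * R) $$ (r, c) = 0)) \<and>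
   (\<forall>c<n. \<forall>c'<n. L c' c --> \<rho> c' ~= \<rho> c)"
proof -
 define Av where "Av f r = (\<Sum>l<n. A $$ (r, l) * f l)" for f :: "nat => complex" and r
 define ok where "ok c f \<longleftrightarrow> f c = 1 & (\<forall>l<n. l ~= c --> ~ L l c --> f l = 0)" for c and f :: "nat => complex"
 define lev where "lev f s \<longleftrightarrow> (\<forall>r<n. s <= \<kappa> r --> Av f r = 0)" for f s
 define S where "S c = (LEAST s. \<exists>f. ok c f & lev f s)" for c
 have "\<exists>s f. ok c f & lev f s" for c
 proof -
  have "ok c (%l. if l = c then 1 else 0)" by (simp add: ok_def)
  moreover have "lev (%l. if l = c then 1 else 0) (Suc (\<Sum>r<n. \<kappa> r))"
   unfolding lev_def
  proof (intro allI impI)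
   fix r assume r: "r < n" "Suc (\<Sum>r<n. \<kappa> r) <= \<kappa> r"
   have "\<kappa> r <= (\<Sum>r<n. \<kappa> r)" using r by (intro member_le_sum) auto
   then show "Av (%l. if l = c then 1 else 0) r = 0" using r by linarith
  qed
  ultimately show ?thesis by blast
 qed
 then have "\<exists>f. ok c f & lev f (S c)" for c unfolding S_def by (rule LeastI_ex)
 then obtain F where F: "\<forall>c. ok c (F c) & lev (F c) (S c)" by metis
 have F1: "F c c = 1" for c using spec[OF F, of c] by (simp add: ok_def)
 have F0: "F c l = 0" if "l < n" "l ~= c" "~ L l c" for c l
  using spec[OF F, of c] that by (simp add: ok_def)
 have FL: "lev (F c) (S c)" for c using spec[OF F, of c] by simp
 define R where "R = mat n n (%(l, c). F c l)"
 have Rc: "R \<in> carrier_mat n n" by (simp add: R_def)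
 have R1: "\<forall>i<n. R $$ (i, i) = 1" by (simp add: R_def F1)
 have R0: "\<forall>i<n. \<forall>j<n. i ~= j --> ~ L i j --> R $$ (i, j) = 0" by (simp add: R_def F0)
 have up: "\<forall>i<n. \<forall>j<i. R $$ (i, j) = 0"
 proof (intro allI impI)
  fix i j assume "i < n" "j < i"
  then show "R $$ (i, j) = 0" using R0 L by (metis less_asym less_trans nat_neq_iff)
 qed
 have RSL: "R \<in> SLset n" by (rule unipotent_det[OF Rc R1]) (use up in blast)
 then have RB: "R \<in> borel_subgroup n" using up by (simp add: borel_iff)
 have ent: "(A * R) $$ (r, c) = Av (F c) r" if "r < n" "c < n" for r c
  unfolding mat_mult_entry[OF SL_carrier[OF A] Rc that] Av_def
  by (rule sum.cong) (use that in \<open>auto simp: R_def\<close>)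
 have "\<exists>p<n. (A * R) $$ (p, c) ~= 0 & (\<forall>r<n. \<kappa> p < \<kappa> r --> (A * R) $$ (r, c) = 0)" if c: "c < n" for c
 proof -
  let ?P = "%r. r < n & (A * R) $$ (r, c) ~= 0"
  obtain r0 where r0: "?P r0" using SL_column_nonzero[OF SL_mult[OF A RSL] c] by blast
  have bd: "\<forall>r. ?P r --> \<kappa> r < Suc (\<Sum>r<n. \<kappa> r)"
  proof (intro allI impI)
   fix r assume "?P r"
   then have "\<kappa> r <= (\<Sum>r<n. \<kappa> r)" by (intro member_le_sum) auto
   then show "\<kappa> r < Suc (\<Sum>r<n. \<kappa> r)" by simp
  qed
  from ex_has_greatest_nat[of ?P r0 \<kappa>, OF r0] bd
  obtain p where "?P p" "\<forall>r. ?P r --> \<kappa> r <= \<kappa> p" by (metis less_imp_le)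
  then show ?thesis by (metis not_le)
 qed
 then obtain \<rho> where \<rho>: "\<forall>c<n. \<rho> c < n & (A * R) $$ (\<rho> c, c) ~= 0 & (\<forall>r<n. \<kappa> (\<rho> c) < \<kappa> r --> (A * R) $$ (r, c) = 0)"
  by metis
 have "\<rho> c' ~= \<rho> c" if c: "c < n" "c' < n" "L c' c" for c c'
 proof
  assume e: "\<rho> c' = \<rho> c"
  define p where "p = \<rho> c"
  have p: "p < n" "Av (F c) p ~= 0" "Av (F c') p ~= 0" using \<rho> c ent e by (auto simp: p_def)
  have z: "Av (F c) r = 0" "Av (F c') r = 0" if "r < n" "\<kappa> p < \<kappa> r" for r
   using \<rho> c ent e that by (auto simp: p_def)
  define t where "t = Av (F c) p / Av (F c') p"
  define G where "G l = F c l - t * F c' l" for l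
  have AG: "Av G r = Av (F c) r - t * Av (F c') r" for r
   unfolding Av_def G_def by (simp add: algebra_simps sum_subtractf sum_distrib_left)
  have cc: "c' < c" using L c by blast
  have "ok c G"
   unfolding ok_def G_def
  proof (intro conjI allI impI)
   have "~ L c c'" using L cc by (meson less_asym)
   then have "F c' c = 0" using cc by (intro F0 c) simp_all
   then show "F c c - t * F c' c = 1" by (simp add: F1)
  next
   fix l assume l: "l < n" "l ~= c" "~ L l c"
   have "F c l = 0" by (rule F0[OF l])
   moreover have "l ~= c'" using l c by metis
   moreover have "~ L l c'" using l c tr by metis
   ultimately have "F c l = 0" "F c' l = 0" using F0[OF l(1)] by simp_all
   then show "F c l - t * F c' l = 0" by simp
  qed
  moreover have "lev G (\<kappa> p)"
   unfolding lev_def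
  proof (intro allI impI)
   fix r assume r: "r < n" "\<kappa> p <= \<kappa> r"
   show "Av G r = 0"
   proof (cases "\<kappa> p = \<kappa> r")
    case True
    then have "p = r" using inj_onD[OF inj True] p r by simp
    then show ?thesis using AG p by (simp add: t_def)
   next
    case False
    then show ?thesis using z[OF r(1)] r AG by simp
   qed
  qed
  ultimately have "\<exists>f. ok c f & lev f (\<kappa> p)" by blast
  then have "S c <= \<kappa> p" unfolding S_def by (rule Least_le)
  then have "Av (F c) p = 0" using FL[of c] p(1) unfolding lev_def by simp
  then show False using p by simp
 qed
 then show ?thesis using RB R1 R0 \<rho> by blast
qed

text \<open>The sign that \<open>perm_rep\<close> puts into the first column.\<close>

definition eps :: "(nat => nat) => nat => complex" where
 "eps w c = (if c = 0 then of_int (sign w) else 1)"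

lemma eps_square: "eps w c * eps w c = 1"
 by (simp add: eps_def sign_def)

lemma eps_nonzero: "eps w c ~= 0"
 using eps_square[of w c] by auto

lemma perm_index:
 assumes "w permutes {1..n}" "c < n"
 shows "w (Suc c) - 1 < n" "Suc (w (Suc c) - 1) = w (Suc c)"
 using permutes_in_image[OF assms(1), of "Suc c"] assms(2) by auto

lemma perm_rep_entry:
 assumes "w permutes {1..n}" "r < n" "c < n"
 shows "perm_rep n w $$ (r, c) = (if r = w (Suc c) - 1 then eps w c else 0)"
 using perm_index[OF assms(1,3)] assms(2,3) by (auto simp: perm_rep_def eps_def)

lemma perm_rep_carrier: "perm_rep n w \<in> carrier_mat n n"
 by (simp add: perm_rep_def)

lemma mult_perm_rep:
 assumes w: "w permutes {1..n}" and A: "A \<in> carrier_mat n n" and rc: "r < n" "c < n"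
 shows "(A * perm_rep n w) $$ (r, c) = A $$ (r, w (Suc c) - 1) * eps w c"
proof -
 have "(A * perm_rep n w) $$ (r, c) = (\<Sum>l<n. A $$ (r, l) * perm_rep n w $$ (l, c))"
  by (rule mat_mult_entry[OF A perm_rep_carrier rc])
 also have "\<dots> = (\<Sum>l<n. if l = w (Suc c) - 1 then A $$ (r, l) * eps w c else 0)"
  by (rule sum.cong) (use rc perm_rep_entry[OF w] in auto)
 also have "\<dots> = A $$ (r, w (Suc c) - 1) * eps w c"
  using perm_index[OF w rc(2)] by simp
 finally show ?thesis .
qed

lemma perm_rep_mult:
 assumes w: "w permutes {1..n}" and A: "A \<in> carrier_mat n n" and rc: "i < n" "c < n"
 shows "(perm_rep n w * A) $$ (w (Suc i) - 1, c) = eps w i * A $$ (i, c)"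
proof -
 have wi: "w (Suc i) - 1 < n" by (rule perm_index[OF w rc(1)])
 have e: "w (Suc i) - 1 = w (Suc l) - 1 \<longleftrightarrow> l = i" if "l < n" for l
  using perm_index(2)[OF w rc(1)] perm_index(2)[OF w that] permutes_inj[OF w]
  by (metis Suc_inject injD)
 have "(perm_rep n w * A) $$ (w (Suc i) - 1, c) = (\<Sum>l<n. perm_rep n w $$ (w (Suc i) - 1, l) * A $$ (l, c))"
  by (rule mat_mult_entry[OF perm_rep_carrier A wi rc(2)])
 also have "\<dots> = (\<Sum>l<n. if l = i then eps w i * A $$ (i, c) else 0)"
  by (rule sum.cong) (use e perm_rep_entry[OF w wi] in auto)
 also have "\<dots> = eps w i * A $$ (i, c)" using rc by simp
 finally show ?thesis .
qed

lemma perm_row_surj: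
 assumes "w permutes {1..n}" "r < n"
 obtains i where "i < n" "r = w (Suc i) - 1"
proof -
 have "Suc r \<in> w ` {1..n}" using permutes_image[OF assms(1)] assms(2) by simp
 then obtain j where j: "j \<in> {1..n}" "Suc r = w j" by blast
 show ?thesis by (rule that[of "j - 1"]) (use j in auto)
qed

text \<open>The support condition says that \<open>N\<close> times the inverse of the permutation matrix is upper triangular.\<close>

lemma cellI:
 assumes w: "w permutes {1..n}" and N: "N \<in> SLset n"
  and supp: "\<forall>r<n. \<forall>c<n. N $$ (r, c) ~= 0 --> Suc r <= w (Suc c)"
 shows "\<exists>b\<in>borel_subgroup n. N = b * perm_rep n w"
proof -
 define b where "b = N * adj_mat (perm_rep n w)"
 have P: "perm_rep n w \<in> SLset n" by (rule perm_rep_SL[OF w])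
 have bS: "b \<in> SLset n" unfolding b_def by (rule SL_mult[OF N SL_adj(1)[OF P]])
 have N_eq: "N = b * perm_rep n w"
  unfolding b_def SL_assoc[OF N SL_adj(1)[OF P] P] SL_adj(2)[OF P]
  using SL_carrier[OF N] by simp
 have "b $$ (r, k) = 0" if rk: "r < n" "k < r" for r k
 proof -
  obtain c where c: "c < n" "k = w (Suc c) - 1" using perm_row_surj[OF w, of k] rk by auto
  have "N $$ (r, c) = b $$ (r, k) * eps w c"
   using mult_perm_rep[OF w SL_carrier[OF bS] rk(1) c(1)] N_eq c(2) by simp
  moreover have "~ Suc r <= w (Suc c)" using perm_index(2)[OF w c(1)] c rk by simp
  then have "N $$ (r, c) = 0" using supp rk(1) c(1) by blast
  ultimately show ?thesis using eps_nonzero[of w c] by simp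
 qed
 then have "b \<in> borel_subgroup n" using bS by (simp add: borel_iff)
 then show ?thesis using N_eq by blast
qed

lemma borel_perm_support:
 assumes w: "w permutes {1..n}" and b: "b \<in> borel_subgroup n" and rc: "r < n" "c < n"
  and nz: "(b * perm_rep n w) $$ (r, c) ~= 0"
 shows "Suc r <= w (Suc c)"
proof (rule ccontr)
 assume "~ ?thesis"
 then have "w (Suc c) - 1 < r" using perm_index(2)[OF w rc(2)] by simp
 then have "b $$ (r, w (Suc c) - 1) = 0" using b rc by (simp add: borel_iff)
 then show False using nz mult_perm_rep[OF w SL_carrier[OF borel_SL[OF b]] rc] by simp
qed

lemma cell_in: "b \<in> borel_subgroup n ==> flag_proj n (b * perm_rep n w) \<in> schubert_cell n w"
 by (auto simp: schubert_cell_def)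

lemma cellE:
 assumes "p \<in> schubert_cell n w"
 obtains b where "b \<in> borel_subgroup n" "p = flag_proj n (b * perm_rep n w)"
 using assms by (auto simp: schubert_cell_def)

lemma flags_in_cell:
 assumes A: "A \<in> SLset n"
 shows "\<exists>w. w permutes {1..n} & flag_proj n A \<in> schubert_cell n w"
proof -
 obtain R \<rho> where R: "R \<in> borel_subgroup n"
  and \<rho>: "\<forall>c<n. \<rho> c < n & (A * R) $$ (\<rho> c, c) ~= 0 & (\<forall>r<n. \<rho> c < r --> (A * R) $$ (r, c) = 0)"
  and d: "\<forall>c<n. \<forall>c'<n. c' < c --> \<rho> c' ~= \<rho> c"
  using column_pivots[OF A, of "%r. r" "(<)"] by auto
 define w where "w i = (if i \<in> {1..n} then Suc (\<rho> (i - 1)) else i)" for i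
 have inj: "inj_on w {1..n}"
 proof (rule inj_onI)
  fix i j assume ij: "i \<in> {1..n}" "j \<in> {1..n}" "w i = w j"
  then have "\<rho> (i - 1) = \<rho> (j - 1)" by (simp add: w_def)
  moreover have "i - 1 < n" "j - 1 < n" using ij by auto
  ultimately have "i - 1 = j - 1" using d by (metis linorder_neqE_nat)
  then show "i = j" using ij by auto
 qed
 have "w ` {1..n} \<subseteq> {1..n}"
 proof
  fix y assume "y \<in> w ` {1..n}"
  then obtain i where i: "i \<in> {1..n}" "y = w i" by blast
  then have "i - 1 < n" by auto
  then have "\<rho> (i - 1) < n" using \<rho> by blast
  then show "y \<in> {1..n}" using i by (auto simp: w_def)
 qed
 then have "w ` {1..n} = {1..n}" by (intro endo_inj_surj inj) auto
 then have wp: "w permutes {1..n}" using inj by (intro bij_imp_permutes) (auto simp: bij_betw_def w_def)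
 have AR: "A * R \<in> SLset n" by (rule SL_mult[OF A borel_SL[OF R]])
 obtain b where b: "b \<in> borel_subgroup n" "A * R = b * perm_rep n w"
 proof -
  have "\<forall>r<n. \<forall>c<n. (A * R) $$ (r, c) ~= 0 --> Suc r <= w (Suc c)"
  proof (intro allI impI)
   fix r c assume rc: "r < n" "c < n" "(A * R) $$ (r, c) ~= 0"
   then have "~ \<rho> c < r" using \<rho> by blast
   then show "Suc r <= w (Suc c)" using rc by (simp add: w_def)
  qed
  from cellI[OF wp AR this] show ?thesis using that by blast
 qed
 have "flag_proj n A = flag_proj n (A * R)" using flag_proj_mult[OF A R] by simp
 then have "flag_proj n A \<in> schubert_cell n w" using cell_in[OF b(1), of w] b(2) by simp
 then show ?thesis using wp by (intro exI conjI)
qed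

section \<open>Schubert varieties as unions of cells\<close>

lemma poly_funs_right_mult:
 assumes c: "c \<in> carrier_mat n n" and f: "f \<in> poly_funs n"
 shows "\<exists>f'\<in>poly_funs n. \<forall>A\<in>carrier_mat n n. f' A = f (A * c)"
proof (rule poly_funs_subst[OF _ f], intro allI impI)
 fix i j assume ij: "i < n" "j < n"
 have P: "(%A. \<Sum>l<n. A $$ (i, l) * c $$ (l, j)) \<in> poly_funs n"
  by (intro poly_funs_sum poly_funs.mult poly_funs.const poly_funs.entry) (use ij in auto)
 show "\<exists>g\<in>poly_funs n. \<forall>A\<in>carrier_mat n n. g A = (A * c) $$ (i, j)"
  by (rule bexI[OF _ P]) (intro ballI mat_mult_entry[OF _ c ij, symmetric])
qed

definition vanishing :: "nat => complex mat set set => (complex mat => complex) set" where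
 "vanishing n S = {f \<in> poly_funs n. \<forall>a\<in>SLset n. flag_proj n a \<in> S --> f a = 0}"

lemma flag_projE:
 assumes "flag_proj n a = flag_proj n a'" "a \<in> SLset n" "a' \<in> SLset n"
 obtains b where "b \<in> borel_subgroup n" "a' = a * b"
 using assms(1) unfolding flag_proj_eq_iff[OF assms(2,3)] by (elim bexE) (rule that)

text \<open>
The common zeros of the vanishing polynomials are closed and contain \<open>S\<close>. They form a union of cosets,
since right translation by the Borel subgroup preserves the vanishing polynomials.
\<close>

lemma closure_flag_iff:
 assumes S: "S \<subseteq> flags n" and a: "a \<in> SLset n"
 shows "flag_proj n a \<in> flag_top n closure_of S \<longleftrightarrow> (\<forall>f\<in>vanishing n S. f a = 0)"
proof
 define Z where "Z = {flag_proj n a | a. a \<in> SLset n & (\<forall>f\<in>vanishing n S. f a = 0)}"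
 have Z: "flag_proj n a \<in> Z \<longleftrightarrow> (\<forall>f\<in>vanishing n S. f a = 0)" if a: "a \<in> SLset n" for a
 proof
  assume "flag_proj n a \<in> Z"
  then obtain a' where a': "flag_proj n a' = flag_proj n a" "a' \<in> SLset n" "\<forall>f\<in>vanishing n S. f a' = 0"
   unfolding Z_def mem_Collect_eq by metis
  obtain b where b: "b \<in> borel_subgroup n" "a = a' * b" by (rule flag_projE[OF a'(1,2) a])
  have bS: "b \<in> SLset n" by (rule borel_SL[OF b(1)])
  show "\<forall>f\<in>vanishing n S. f a = 0"
  proof
   fix f assume f: "f \<in> vanishing n S"
   then have "f \<in> poly_funs n" by (simp add: vanishing_def)
   from poly_funs_right_mult[OF SL_carrier[OF bS] this]
   obtain f' where f': "f' \<in> poly_funs n" "\<forall>A\<in>carrier_mat n n. f' A = f (A * b)" by (elim bexE)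
   have "f' \<in> vanishing n S"
    unfolding vanishing_def mem_Collect_eq
   proof (intro conjI ballI impI f'(1))
    fix c assume c: "c \<in> SLset n" "flag_proj n c \<in> S"
    have "flag_proj n (c * b) \<in> S" using flag_proj_mult[OF c(1) b(1)] c(2) by simp
    then have "f (c * b) = 0" using f SL_mult[OF c(1) bS] unfolding vanishing_def by simp
    then show "f' c = 0" using f'(2) SL_carrier[OF c(1)] by simp
   qed
   then have "f' a' = 0" by (rule bspec[OF a'(3)])
   then show "f a = 0" using f'(2) SL_carrier[OF a'(2)] b(2) by simp
  qed
 next
  assume "\<forall>f\<in>vanishing n S. f a = 0"
  then show "flag_proj n a \<in> Z" unfolding Z_def using a by (intro CollectI exI conjI) (rule refl)
 qed
 have "closedin (flag_top n) Z"
  unfolding closedin_flag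
 proof (intro conjI exI[of _ "vanishing n S"] ballI)
  show "Z \<subseteq> flags n" unfolding Z_def by auto
  show "vanishing n S \<subseteq> poly_funs n" unfolding vanishing_def by auto
 qed (rule Z)
 moreover have "S \<subseteq> Z"
 proof
  fix p assume p: "p \<in> S"
  then obtain c where c: "c \<in> SLset n" "p = flag_proj n c" using S by auto
  have "\<forall>f\<in>vanishing n S. f c = 0" using c p unfolding vanishing_def by simp
  then show "p \<in> Z" using Z[OF c(1)] c(2) by simp
 qed
 ultimately have sub: "flag_top n closure_of S \<subseteq> Z" by (intro closure_of_minimal)
 {
  assume "flag_proj n a \<in> flag_top n closure_of S"
  then have "flag_proj n a \<in> Z" using sub by (rule subsetD[rotated])
  then show "\<forall>f\<in>vanishing n S. f a = 0" using Z[OF a] by simp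
 }
 assume h: "\<forall>f\<in>vanishing n S. f a = 0"
 obtain F where F: "F \<subseteq> poly_funs n" "\<forall>c\<in>SLset n. flag_proj n c \<in> flag_top n closure_of S \<longleftrightarrow> (\<forall>f\<in>F. f c = 0)"
  by (rule closedin_flagE[OF closedin_closure_of[of "flag_top n" S]])
 have SC: "S \<subseteq> flag_top n closure_of S" by (rule closure_of_subset) (simp add: topspace_flag S)
 have "F \<subseteq> vanishing n S"
 proof
  fix f assume f: "f \<in> F"
  show "f \<in> vanishing n S"
   unfolding vanishing_def mem_Collect_eq
  proof (intro conjI ballI impI)
   show "f \<in> poly_funs n" using F(1) f by (rule subsetD)
   fix c assume c: "c \<in> SLset n" "flag_proj n c \<in> S"
   then have "\<forall>f\<in>F. f c = 0" using bspec[OF F(2) c(1)] subsetD[OF SC c(2)] by simp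
   then show "f c = 0" using f by (rule bspec)
  qed
 qed
 then have "\<forall>f\<in>F. f a = 0" using h by (meson bspec subsetD)
 then show "flag_proj n a \<in> flag_top n closure_of S" using bspec[OF F(2) a] by simp
qed

lemma borel_perm_SL:
 assumes "w permutes {1..n}" "b \<in> borel_subgroup n"
 shows "b * perm_rep n w \<in> SLset n"
 by (rule SL_mult[OF borel_SL[OF assms(2)] perm_rep_SL[OF assms(1)]])

lemma cell_flags:
 assumes "w permutes {1..n}"
 shows "schubert_cell n w \<subseteq> flags n"
 using borel_perm_SL[OF assms] by (auto simp: schubert_cell_def)

lemma cell_coset:
 assumes w: "w permutes {1..n}" and a: "a \<in> SLset n" and c: "flag_proj n a \<in> schubert_cell n w"
 obtains b b' where "b \<in> borel_subgroup n" "b' \<in> borel_subgroup n" "a = b * perm_rep n w * b'"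
proof -
 obtain b where b: "b \<in> borel_subgroup n" "flag_proj n a = flag_proj n (b * perm_rep n w)" by (rule cellE[OF c])
 obtain b' where "b' \<in> borel_subgroup n" "a = b * perm_rep n w * b'"
  by (rule flag_projE[OF b(2)[symmetric] borel_perm_SL[OF w b(1)] a])
 then show ?thesis by (rule that[OF b(1)])
qed

lemma schubert_iff:
 assumes "w permutes {1..n}" "a \<in> SLset n"
 shows "flag_proj n a \<in> schubert_variety n w \<longleftrightarrow> (\<forall>f\<in>vanishing n (schubert_cell n w). f a = 0)"
 unfolding schubert_variety_def by (rule closure_flag_iff[OF cell_flags[OF assms(1)] assms(2)])

lemma schubert_closed: "closedin (flag_top n) (schubert_variety n w)"
 unfolding schubert_variety_def by (rule closedin_closure_of)

lemma cell_subset_schubert: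
 assumes "w permutes {1..n}"
 shows "schubert_cell n w \<subseteq> schubert_variety n w"
 unfolding schubert_variety_def by (rule closure_of_subset) (simp add: topspace_flag cell_flags[OF assms])

lemma schubert_flags: "schubert_variety n w \<subseteq> flags n"
 unfolding schubert_variety_def using closure_of_subset_topspace[of "flag_top n"] by (simp add: topspace_flag)

lemma cell_borel_stable:
 assumes w: "w permutes {1..n}" and b: "b \<in> borel_subgroup n" and a: "a \<in> SLset n"
  and c: "flag_proj n a \<in> schubert_cell n w"
 shows "flag_proj n (b * a) \<in> schubert_cell n w"
proof -
 obtain d d' where d: "d \<in> borel_subgroup n" "d' \<in> borel_subgroup n" "a = d * perm_rep n w * d'"
  by (rule cell_coset[OF w a c])
 have P: "perm_rep n w \<in> SLset n" by (rule perm_rep_SL[OF w])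
 have bS: "b \<in> SLset n" and dS: "d \<in> SLset n" and d'S: "d' \<in> SLset n" using b d borel_SL by auto
 have "b * a = (b * d) * perm_rep n w * d'"
  using SL_assoc[OF bS SL_mult[OF dS P] d'S] SL_assoc[OF bS dS P] d(3) by simp
 then have "flag_proj n (b * a) = flag_proj n (b * d * perm_rep n w)"
  using flag_proj_mult[OF SL_mult[OF SL_mult[OF bS dS] P] d(2)] by simp
 then show ?thesis using cell_in[OF borel_mult[OF b d(1)]] by simp
qed

lemma schubert_borel_stable:
 assumes w: "w permutes {1..n}" and b: "b \<in> borel_subgroup n" and a: "a \<in> SLset n"
  and c: "flag_proj n a \<in> schubert_variety n w"
 shows "flag_proj n (b * a) \<in> schubert_variety n w"
 unfolding schubert_iff[OF w SL_mult[OF borel_SL[OF b] a]]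
proof
 fix f assume f: "f \<in> vanishing n (schubert_cell n w)"
 have bS: "b \<in> SLset n" by (rule borel_SL[OF b])
 from f have "f \<in> poly_funs n" by (simp add: vanishing_def)
 from poly_funs_left_mult[OF SL_carrier[OF bS] this]
 obtain f' where f': "f' \<in> poly_funs n" "\<forall>A\<in>carrier_mat n n. f' A = f (b * A)" by (elim bexE)
 have "f' \<in> vanishing n (schubert_cell n w)"
  unfolding vanishing_def mem_Collect_eq
 proof (intro conjI ballI impI f'(1))
  fix c assume c: "c \<in> SLset n" "flag_proj n c \<in> schubert_cell n w"
  have "f (b * c) = 0"
   using f SL_mult[OF bS c(1)] cell_borel_stable[OF w b c] unfolding vanishing_def by simp
  then show "f' c = 0" using f'(2) SL_carrier[OF c(1)] by simp
 qed
 then have "f' a = 0" using c unfolding schubert_iff[OF w a] by simp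
 then show "f (b * a) = 0" using f'(2) SL_carrier[OF a] by simp
qed

lemma cell_mult_support:
 assumes v: "v permutes {1..n}" and w: "w permutes {1..n}" and b: "b \<in> borel_subgroup n" and N: "N \<in> SLset n"
  and supp: "\<forall>k<n. \<forall>l<n. N $$ (k, l) ~= 0 --> v (Suc k) <= w (Suc l)"
 shows "flag_proj n (b * perm_rep n v * N) \<in> schubert_cell n w"
proof -
 have P: "perm_rep n v \<in> SLset n" by (rule perm_rep_SL[OF v])
 have bS: "b \<in> SLset n" by (rule borel_SL[OF b])
 have PN: "perm_rep n v * N \<in> SLset n" by (rule SL_mult[OF P N])
 have "\<forall>r<n. \<forall>c<n. (perm_rep n v * N) $$ (r, c) ~= 0 --> Suc r <= w (Suc c)"
 proof (intro allI impI)
  fix r c assume rc: "r < n" "c < n" "(perm_rep n v * N) $$ (r, c) ~= 0"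
  obtain i where i: "i < n" "r = v (Suc i) - 1" by (rule perm_row_surj[OF v rc(1)])
  have "N $$ (i, c) ~= 0" using rc perm_rep_mult[OF v SL_carrier[OF N] i(1) rc(2)] i(2) by auto
  then have "v (Suc i) <= w (Suc c)" using supp i(1) rc(2) by simp
  then show "Suc r <= w (Suc c)" using perm_index(2)[OF v i(1)] i(2) by simp
 qed
 from cellI[OF w PN this] obtain d where d: "d \<in> borel_subgroup n" "perm_rep n v * N = d * perm_rep n w" by (elim bexE)
 have "b * perm_rep n v * N = (b * d) * perm_rep n w"
  using SL_assoc[OF bS P N] SL_assoc[OF bS borel_SL[OF d(1)] perm_rep_SL[OF w]] d(2) by simp
 then show ?thesis using cell_in[OF borel_mult[OF b d(1)]] by simp
qed

text \<open>
The points of the one-parameter subgroup of the root at row \<open>r\<close> and column \<open>c\<close>; the curves that span the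
tangent spaces are translates of these.
\<close>

definition root_elem :: "nat => nat => nat => complex => complex mat" where
 "root_elem n r c s = mat n n (%(k, l). if k = l then 1 else if k = r & l = c then s else 0)"

lemma root_elem_carrier: "root_elem n r c s \<in> carrier_mat n n"
 by (simp add: root_elem_def)

lemma root_elem_entry: "k < n ==> l < n ==> root_elem n r c s $$ (k, l) = (if k = l then 1 else if k = r & l = c then s else 0)"
 by (simp add: root_elem_def)

lemma root_elem_SL: "root_elem n r c s \<in> SLset n"
proof (rule unipotent_det[OF root_elem_carrier])
 show "(\<forall>i<n. \<forall>j<i. root_elem n r c s $$ (i, j) = 0) \<or> (\<forall>j<n. \<forall>i<j. root_elem n r c s $$ (i, j) = 0)"
  by (cases "r < c") (auto simp: root_elem_def)
qed (simp add: root_elem_entry)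

lemma root_elem_borel: "r < c ==> root_elem n r c s \<in> borel_subgroup n"
 using root_elem_SL by (auto simp: borel_iff root_elem_def)

lemma root_elem_zero: "root_elem n r c 0 = 1\<^sub>m n"
 by (rule eq_matI) (auto simp: root_elem_def)

lemma mult_root_elem:
 assumes A: "A \<in> carrier_mat n n" and kl: "k < n" "l < n" and rc: "r < n" "r ~= c"
 shows "(A * root_elem n r c s) $$ (k, l) = A $$ (k, l) + (if l = c then A $$ (k, r) * s else 0)"
proof -
 have "(A * root_elem n r c s) $$ (k, l) = (\<Sum>m<n. A $$ (k, m) * root_elem n r c s $$ (m, l))"
  by (rule mat_mult_entry[OF A root_elem_carrier kl])
 also have "\<dots> = (\<Sum>m<n. (if m = l then A $$ (k, l) else 0) + (if m = r then (if l = c then A $$ (k, r) * s else 0) else 0))"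
  by (rule sum.cong) (use kl rc in \<open>auto simp: root_elem_entry\<close>)
 also have "\<dots> = A $$ (k, l) + (if l = c then A $$ (k, r) * s else 0)"
  unfolding sum.distrib using kl rc by simp
 finally show ?thesis .
qed

lemma curve_in_cell:
 assumes v: "v permutes {1..n}" and b: "b \<in> borel_subgroup n" and ij: "i < j" "j < n"
  and s: "v (Suc j) < v (Suc i) \<or> s = 0"
 shows "flag_proj n (b * perm_rep n v * root_elem n j i s) \<in> schubert_cell n v"
 by (rule cell_mult_support[OF v v b root_elem_SL]) (use ij s in \<open>auto simp: root_elem_entry less_imp_le\<close>)

text \<open>
For \<open>s ~= 0\<close> the matrix \<open>1 + s E\<^sub>j\<^sub>i\<close> times the upper triangular \<open>1 - s\<^sup>-\<^sup>1 E\<^sub>i\<^sub>j\<close> has a zero at \<open>(j, j)\<close> and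
is thereby supported as the transposition of \<open>i\<close> and \<open>j\<close> requires.
\<close>

lemma curve_in_larger_cell:
 assumes v: "v permutes {1..n}" and b: "b \<in> borel_subgroup n" and ij: "i < j" "j < n"
  and s: "v (Suc i) < v (Suc j)" "s ~= 0"
 shows "flag_proj n (b * perm_rep n v * root_elem n j i s) \<in> schubert_cell n (v \<circ> transpose (Suc i) (Suc j))"
proof -
 let ?w = "v \<circ> transpose (Suc i) (Suc j)" and ?E = "root_elem n j i s" and ?R = "root_elem n i j (- 1 / s)"
 have w: "?w permutes {1..n}" using ij by (intro permutes_compose[OF permutes_swap_id v]) auto
 have P: "perm_rep n v \<in> SLset n" by (rule perm_rep_SL[OF v])
 have bP: "b * perm_rep n v \<in> SLset n" by (rule borel_perm_SL[OF v b])
 have "flag_proj n (b * perm_rep n v * (?E * ?R)) \<in> schubert_cell n ?w"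
 proof (rule cell_mult_support[OF v w b SL_mult[OF root_elem_SL root_elem_SL]], intro allI impI)
  fix k l assume kl: "k < n" "l < n" and nz: "(?E * ?R) $$ (k, l) ~= 0"
  have N: "(?E * ?R) $$ (k, l) = ?E $$ (k, l) + (if l = j then ?E $$ (k, i) * (- 1 / s) else 0)"
   by (rule mult_root_elem[OF root_elem_carrier kl]) (use ij in auto)
  consider "l = j" | "l = i" | "l ~= i" "l ~= j" by blast
  then show "v (Suc k) <= ?w (Suc l)"
  proof cases
   case 1
   then have "k = i" using nz N ij kl s by (auto simp: root_elem_entry split: if_splits)
   then show ?thesis using 1 by simp
  next
   case 2
   then have "k = i \<or> k = j" using nz N ij kl by (auto simp: root_elem_entry split: if_splits)
   then show ?thesis using 2 s by auto
  next
   case 3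
   then have "k = l" using nz N ij kl by (auto simp: root_elem_entry split: if_splits)
   then show ?thesis using 3 by (simp add: transpose_def)
  qed
 qed
 moreover have "flag_proj n (b * perm_rep n v * (?E * ?R)) = flag_proj n (b * perm_rep n v * ?E)"
  using flag_proj_mult[OF SL_mult[OF bP root_elem_SL[of n j i s]] root_elem_borel[OF ij(1), of n "- 1 / s"]]
   SL_assoc[OF bP root_elem_SL[of n j i s] root_elem_SL[of n i j "- 1 / s"]] by simp
 ultimately show ?thesis by simp
qed

lemma poly_curve_root_elem:
 assumes g: "g \<in> carrier_mat n n" and rc: "r < n" "r ~= c"
 shows "poly_curve n (%s. g * root_elem n r c s)"
 unfolding poly_curve_def
proof (intro allI impI)
 fix i j assume ij: "i < n" "j < n"
 have "\<forall>s. (g * root_elem n r c s) $$ (i, j) = poly [:g $$ (i, j), (if j = c then g $$ (i, r) else 0):] s"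
  using mult_root_elem[OF g ij rc] by auto
 then show "\<exists>P. \<forall>s. (g * root_elem n r c s) $$ (i, j) = poly P s" by (rule exI)
qed

text \<open>Every point of the smaller cell is the limit for \<open>s = 0\<close> of such a curve in the larger cell.\<close>

lemma cell_subset_if_bruhat:
 assumes v: "v permutes {1..n}" and w: "w permutes {1..n}" and vw: "bruhat_le v w"
 shows "schubert_cell n v \<subseteq> schubert_variety n w"
 using v w vw
proof (induction rule: bruhat_induct)
 case top
 then show ?case by (rule cell_subset_schubert[OF w])
next
 case (cover v a b)
 show ?case
 proof
  fix p assume "p \<in> schubert_cell n v"
  then obtain g where g: "g \<in> borel_subgroup n" "p = flag_proj n (g * perm_rep n v)" by (rule cellE)
  have ab: "1 <= a" "a < b" "v a < v b" using first_cover_is_cover[OF cover(4)] by (auto simp: is_cover_def)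
  define i j where "i = a - 1" and "j = b - 1"
  have ij: "a = Suc i" "b = Suc j" "i < j" "j < n" using ab cover(5) by (auto simp: i_def j_def)
  have gP: "g * perm_rep n v \<in> SLset n" by (rule borel_perm_SL[OF cover(1) g(1)])
  let ?c = "%s. g * perm_rep n v * root_elem n j i s"
  have "flag_proj n (?c s) \<in> schubert_variety n w" if "s ~= 0" for s
  proof (rule subsetD[OF cover(9)])
   have "v (Suc i) < v (Suc j)" using ab(3) ij(1,2) by simp
   from curve_in_larger_cell[OF cover(1) g(1) ij(3,4) this that]
   show "flag_proj n (?c s) \<in> schubert_cell n (v \<circ> transpose a b)" unfolding ij(1,2) .
  qed
  then have "UNIV - {0} \<subseteq> {s. flag_proj n (?c s) \<in> schubert_variety n w}" by auto
  then have "infinite {s. flag_proj n (?c s) \<in> schubert_variety n w}"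
   using infinite_UNIV_char_0[where 'a = complex] by (meson finite.emptyI finite_insert finite_Diff2 finite_subset)
  then have "flag_proj n (?c 0) \<in> schubert_variety n w"
   using curve_closed[OF poly_curve_root_elem[OF SL_carrier[OF gP], of j i] SL_mult[OF gP root_elem_SL] schubert_closed] ij by simp
  then show "p \<in> schubert_variety n w" using g(2) right_mult_one_mat[OF SL_carrier[OF gP]] by (simp add: root_elem_zero)
 qed
qed

definition rnk :: "(nat => nat) => nat => nat => nat set" where
 "rnk w p q = {l. l < p & q <= w (Suc l)}"

lemma finite_rnk: "finite (rnk w p q)"
 by (simp add: rnk_def)

lemma dif_rnk: "dif x w p q = int (card (rnk w p q)) - int (card (rnk x p q))"
proof -
 have "(\<Sum>i\<in>{1..p}. of_bool (q <= f i)) = int (card (rnk f p q))" for f :: "nat => nat"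
 proof -
  have "(\<Sum>i\<in>{1..p}. of_bool (q <= f i)) = (\<Sum>l<p. of_bool (q <= f (Suc l)) :: int)"
   by (rule sum.reindex_bij_witness[of _ Suc "%i. i - 1"]) auto
  also have "\<dots> = int (card (rnk f p q))"
   by (simp add: rnk_def sum.If_cases of_bool_def Int_def lessThan_def)
  finally show ?thesis .
 qed
 then show ?thesis unfolding dif_def sum_subtractf by simp
qed

text \<open>
On the cell of \<open>w\<close> the block of rows from \<open>q\<close> on and columns before \<open>p\<close> has rank at most the number of
points of \<open>w\<close> there.
\<close>

lemma minor_vanishes:
 assumes w: "w permutes {1..n}" and p: "p <= n"
  and \<kappa>: "\<forall>c<s. \<kappa> c < p" and \<rho>: "\<forall>r<s. \<rho> r < n & q <= Suc (\<rho> r)" and card: "card (rnk w p q) < s"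
  and a: "a \<in> SLset n" "flag_proj n a \<in> schubert_variety n w"
 shows "minor \<rho> \<kappa> s a = 0"
proof -
 have "minor \<rho> \<kappa> s \<in> vanishing n (schubert_cell n w)"
  unfolding vanishing_def mem_Collect_eq
 proof (intro conjI ballI impI)
  show "minor \<rho> \<kappa> s \<in> poly_funs n" by (rule minor_poly_fun) (use \<kappa> \<rho> p in fastforce)+
  fix a assume a: "a \<in> SLset n" "flag_proj n a \<in> schubert_cell n w"
  obtain b b' where b: "b \<in> borel_subgroup n" "b' \<in> borel_subgroup n" "a = b * perm_rep n w * b'"
   by (rule cell_coset[OF w a])
  have bP: "b * perm_rep n w \<in> carrier_mat n n" using borel_perm_SL[OF w b(1)] by (rule SL_carrier)
  have b'c: "b' \<in> carrier_mat n n" using borel_SL[OF b(2)] by (rule SL_carrier)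
  have "mat s s (%(r, c). a $$ (\<rho> r, \<kappa> c)) =
    mat s s (%(r, c). \<Sum>l\<in>rnk w p q. (b * perm_rep n w) $$ (\<rho> r, l) * b' $$ (l, \<kappa> c))"
  proof (rule cong_mat[OF refl refl], unfold prod.case)
   fix r c assume rc: "r < s" "c < s"
   have \<rho>r: "\<rho> r < n" "q <= Suc (\<rho> r)" and \<kappa>c: "\<kappa> c < p" "\<kappa> c < n" using \<rho> \<kappa> rc p by auto
   have "a $$ (\<rho> r, \<kappa> c) = (\<Sum>l<n. (b * perm_rep n w) $$ (\<rho> r, l) * b' $$ (l, \<kappa> c))"
    unfolding b(3) by (rule mat_mult_entry[OF bP b'c \<rho>r(1) \<kappa>c(2)])
   also have "\<dots> = (\<Sum>l\<in>rnk w p q. (b * perm_rep n w) $$ (\<rho> r, l) * b' $$ (l, \<kappa> c))"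
   proof (rule sum.mono_neutral_right)
    show "rnk w p q \<subseteq> {..<n}" using p by (auto simp: rnk_def)
    show "\<forall>l\<in>{..<n} - rnk w p q. (b * perm_rep n w) $$ (\<rho> r, l) * b' $$ (l, \<kappa> c) = 0"
    proof
     fix l assume l: "l \<in> {..<n} - rnk w p q"
     then have ln: "l < n" by simp
     from l consider "p <= l" | "w (Suc l) < q" by (auto simp: rnk_def)
     then show "(b * perm_rep n w) $$ (\<rho> r, l) * b' $$ (l, \<kappa> c) = 0"
     proof cases
      case 1
      then have "b' $$ (l, \<kappa> c) = 0" using b(2) ln \<kappa>c by (simp add: borel_iff)
      then show ?thesis by simp
     next
      case 2
      then have "(b * perm_rep n w) $$ (\<rho> r, l) = 0"
       using borel_perm_support[OF w b(1) \<rho>r(1) ln] \<rho>r(2) by fastforce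
      then show ?thesis by simp
     qed
    qed
   qed simp
   finally show "a $$ (\<rho> r, \<kappa> c) = (\<Sum>l\<in>rnk w p q. (b * perm_rep n w) $$ (\<rho> r, l) * b' $$ (l, \<kappa> c))" .
  qed
  then show "minor \<rho> \<kappa> s a = 0"
   unfolding minor_def
   using det_low_rank[OF finite_rnk card, of "%r l. (b * perm_rep n w) $$ (\<rho> r, l)" "%l c. b' $$ (l, \<kappa> c)"] by simp
 qed
 then show ?thesis using a(2) unfolding schubert_iff[OF w a(1)] by simp
qed

lemma det_diagonal:
 fixes d :: "nat => complex"
 shows "det (mat s s (%(r, c). if r = c then d r else 0)) = (\<Prod>r<s. d r)"
proof -
 have "det (mat s s (%(r, c). if r = c then d r else 0)) = prod_list (diag_mat (mat s s (%(r, c). if r = c then d r else 0)))"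
  by (rule det_upper_triangular[where n = s]) (auto simp: upper_triangular_def)
 also have "\<dots> = (\<Prod>r<s. d r)" by (simp add: prod_list_diag_prod atLeast0LessThan)
 finally show ?thesis .
qed

text \<open>
If \<open>v\<close> has more points than \<open>w\<close> in a block, the minor on the points of \<open>v\<close> does not vanish at the
permutation matrix of \<open>v\<close>.
\<close>

lemma fixed_point_bruhat:
 assumes v: "v permutes {1..n}" and w: "w permutes {1..n}"
  and e: "flag_proj n (perm_rep n v) \<in> schubert_variety n w"
 shows "bruhat_le v w"
 unfolding bruhat_le_def
proof (intro allI)
 fix p q
 show "0 <= dif v w p q"
 proof (cases "p <= n")
  case False
  then show ?thesis using dif_outside[OF v w] by simp
 next
  case True
  show ?thesis
  proof (rule ccontr)
   assume "~ ?thesis"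
   then have lt: "card (rnk w p q) < card (rnk v p q)" by (simp add: dif_rnk)
   define s where "s = card (rnk v p q)"
   obtain f where f: "bij_betw f {0..<s} (rnk v p q)"
    using ex_bij_betw_nat_finite[OF finite_rnk, of v p q] by (auto simp: s_def)
   have fr: "f r < p" "q <= v (Suc (f r))" "f r < n" if "r < s" for r
    using bspec[OF bij_betwE[OF f], of r] that True by (auto simp: rnk_def)
   define \<rho> where "\<rho> r = v (Suc (f r)) - 1" for r
   have "minor \<rho> f s (perm_rep n v) = 0"
   proof (rule minor_vanishes[OF w True _ _ _ perm_rep_SL[OF v] e])
    show "\<forall>r<s. \<rho> r < n & q <= Suc (\<rho> r)"
    proof (intro allI impI)
     fix r assume "r < s"
     from perm_index[OF v fr(3)[OF this]] fr(2)[OF this] show "\<rho> r < n & q <= Suc (\<rho> r)"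
      by (simp add: \<rho>_def)
    qed
    show "\<forall>c<s. f c < p" by (intro allI impI fr(1))
    show "card (rnk w p q) < s" using lt by (simp add: s_def)
   qed
   moreover have "minor \<rho> f s (perm_rep n v) = (\<Prod>r<s. eps v (f r))"
   proof -
    have "mat s s (%(r, c). perm_rep n v $$ (\<rho> r, f c)) = mat s s (%(r, c). if r = c then eps v (f r) else 0)"
    proof (rule cong_mat[OF refl refl], unfold prod.case)
     fix r c assume rc: "r < s" "c < s"
     have "\<rho> r = v (Suc (f c)) - 1 \<longleftrightarrow> r = c"
     proof
      assume h: "\<rho> r = v (Suc (f c)) - 1"
      have "v (Suc (f r)) = Suc (\<rho> r)" unfolding \<rho>_def by (rule perm_index(2)[OF v fr(3)[OF rc(1)], symmetric])
      also have "\<dots> = v (Suc (f c))" unfolding h by (rule perm_index(2)[OF v fr(3)[OF rc(2)]])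
      finally have "f r = f c" using permutes_inj[OF v] by (auto dest: injD)
      then show "r = c" using inj_onD[OF bij_betw_imp_inj_on[OF f], of r c] rc by simp
     qed (simp add: \<rho>_def)
     moreover have "\<rho> r < n" using perm_index(1)[OF v fr(3)[OF rc(1)]] by (simp add: \<rho>_def)
     ultimately show "perm_rep n v $$ (\<rho> r, f c) = (if r = c then eps v (f r) else 0)"
      using perm_rep_entry[OF v _ fr(3)[OF rc(2)], of "\<rho> r"] by simp
    qed
    then show ?thesis unfolding minor_def by (simp add: det_diagonal)
   qed
   ultimately show False by (simp add: eps_nonzero)
  qed
 qed
qed

lemma cell_meets_schubert:
 assumes v: "v permutes {1..n}" and w: "w permutes {1..n}"
  and p: "p \<in> schubert_cell n v" "p \<in> schubert_variety n w"
 shows "bruhat_le v w"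
proof -
 obtain b where b: "b \<in> borel_subgroup n" "p = flag_proj n (b * perm_rep n v)" by (rule cellE[OF p(1)])
 have bS: "b \<in> SLset n" by (rule borel_SL[OF b(1)])
 have P: "perm_rep n v \<in> SLset n" by (rule perm_rep_SL[OF v])
 have "flag_proj n (adj_mat b * (b * perm_rep n v)) \<in> schubert_variety n w"
  by (rule schubert_borel_stable[OF w borel_inverse[OF b(1)] SL_mult[OF bS P]]) (use p(2) b(2) in simp)
 then have "flag_proj n (perm_rep n v) \<in> schubert_variety n w"
  using SL_assoc[OF SL_adj(1)[OF bS] bS P] SL_adj(2)[OF bS] SL_carrier[OF P] by simp
 then show ?thesis by (rule fixed_point_bruhat[OF v w])
qed

lemma schubert_in_cell:
 assumes w: "w permutes {1..n}" and p: "p \<in> schubert_variety n w"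
 obtains v where "v permutes {1..n}" "bruhat_le v w" "p \<in> schubert_cell n v"
proof -
 obtain a where a: "a \<in> SLset n" "p = flag_proj n a" using subsetD[OF schubert_flags p] by auto
 from flags_in_cell[OF a(1)] obtain v where v: "v permutes {1..n}" "p \<in> schubert_cell n v" unfolding a(2) by (elim exE conjE)
 show ?thesis by (rule that[OF v(1) cell_meets_schubert[OF v(1) w v(2) p] v(2)])
qed

lemma schubert_mono:
 assumes v: "v permutes {1..n}" and w: "w permutes {1..n}"
 shows "schubert_variety n v \<subseteq> schubert_variety n w \<longleftrightarrow> bruhat_le v w"
proof
 assume "schubert_variety n v \<subseteq> schubert_variety n w"
 moreover have e: "flag_proj n (1\<^sub>m n * perm_rep n v) \<in> schubert_cell n v" by (rule cell_in[OF borel_one])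
 moreover have "flag_proj n (1\<^sub>m n * perm_rep n v) \<in> schubert_variety n v"
  by (rule subsetD[OF cell_subset_schubert[OF v] e])
 ultimately have "flag_proj n (1\<^sub>m n * perm_rep n v) \<in> schubert_variety n w" by (elim subsetD)
 then show "bruhat_le v w" by (rule cell_meets_schubert[OF v w e])
next
 assume "bruhat_le v w"
 then show "schubert_variety n v \<subseteq> schubert_variety n w"
  using cell_subset_if_bruhat[OF v w] schubert_closed[of n w] unfolding schubert_variety_def[of n v]
  by (intro closure_of_minimal)
qed

section \<open>Coordinates on a cell\<close>

lemma SL_one_mult: "A \<in> SLset n ==> 1\<^sub>m n * A = A" "A \<in> SLset n ==> A * 1\<^sub>m n = A"
 using left_mult_one_mat[of A n n] right_mult_one_mat[of A n n] SL_carrier[of A n] by blast+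

lemma SL_adj_cancel:
 assumes g: "g \<in> SLset n" and a: "a \<in> SLset n"
 shows "g * (adj_mat g * a) = a" "adj_mat g * (g * a) = a" "(a * g) * adj_mat g = a"
 using SL_assoc[OF g SL_adj(1)[OF g] a] SL_assoc[OF SL_adj(1)[OF g] g a] SL_assoc[OF a g SL_adj(1)[OF g]]
  SL_adj(2,3)[OF g] SL_one_mult[OF a] by simp_all

lemma lower_normalize:
 assumes N: "N \<in> SLset n" and low: "\<forall>c<n. \<forall>i<c. N $$ (i, c) = 0"
 shows "\<exists>D\<in>borel_subgroup n. \<forall>i<n. \<forall>c<n. (N * D) $$ (i, c) = N $$ (i, c) / N $$ (c, c)"
  and "c < n ==> N $$ (c, c) ~= 0"
proof -
 have Nc: "N \<in> carrier_mat n n" using N by (rule SL_carrier)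
 have "det N = prod_list (diag_mat N)" by (rule det_lower_triangular[OF _ Nc]) (use low in auto)
 then have d: "(\<Prod>c<n. N $$ (c, c)) = 1" using N Nc by (simp add: SL_iff prod_list_diag_prod atLeast0LessThan)
 show nz: "N $$ (c, c) ~= 0" if "c < n" for c
 proof
  assume "N $$ (c, c) = 0"
  then have "(\<Prod>c<n. N $$ (c, c)) = 0" using that by (intro prod_zero) auto
  then show False using d by simp
 qed
 define D where "D = mat n n (%(r, c). if r = c then 1 / N $$ (r, r) else 0)"
 have Dc: "D \<in> carrier_mat n n" by (simp add: D_def)
 have "det D = (\<Prod>c<n. 1 / N $$ (c, c))" unfolding D_def by (rule det_diagonal)
 also have "\<dots> = 1" using d by (simp add: prod_dividef)
 finally have "D \<in> borel_subgroup n" using Dc by (auto simp: borel_iff SL_iff D_def)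
 moreover have "(N * D) $$ (i, c) = N $$ (i, c) / N $$ (c, c)" if ic: "i < n" "c < n" for i c
 proof -
  have "(N * D) $$ (i, c) = (\<Sum>l<n. N $$ (i, l) * D $$ (l, c))" by (rule mat_mult_entry[OF Nc Dc ic])
  also have "\<dots> = (\<Sum>l<n. if l = c then N $$ (i, c) / N $$ (c, c) else 0)"
   by (rule sum.cong) (use ic in \<open>auto simp: D_def\<close>)
  finally show ?thesis using ic by simp
 qed
 ultimately show "\<exists>D\<in>borel_subgroup n. \<forall>i<n. \<forall>c<n. (N * D) $$ (i, c) = N $$ (i, c) / N $$ (c, c)" by auto
qed

definition lowuni :: "nat => complex mat set" where
 "lowuni n = {u \<in> carrier_mat n n. (\<forall>i<n. u $$ (i, i) = 1) & (\<forall>j<n. \<forall>i<j. u $$ (i, j) = 0)}"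

lemma lowuni_SL: "u \<in> lowuni n ==> u \<in> SLset n"
 by (rule unipotent_det) (auto simp: lowuni_def)

lemma root_elem_lowuni: "c < r ==> root_elem n r c s \<in> lowuni n"
 by (auto simp: lowuni_def root_elem_carrier root_elem_entry)

lemma one_lowuni: "1\<^sub>m n \<in> lowuni n"
 by (auto simp: lowuni_def)

text \<open>The free entries are those below the diagonal at inversions of \<open>w\<close>; their number is \<open>len n w\<close>.\<close>

definition cell_coords :: "nat => (nat => nat) => complex mat set" where
 "cell_coords n w = {y \<in> lowuni n. \<forall>k<n. \<forall>l<n. k ~= l --> y $$ (k, l) ~= 0 --> w (Suc k) < w (Suc l)}"

lemma cell_coords_in_cell:
 assumes w: "w permutes {1..n}" and y: "y \<in> cell_coords n w"
 shows "flag_proj n (perm_rep n w * y) \<in> schubert_cell n w"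
proof -
 have yS: "y \<in> SLset n" using y by (auto simp: cell_coords_def intro: lowuni_SL)
 have "\<forall>k<n. \<forall>l<n. y $$ (k, l) ~= 0 --> w (Suc k) <= w (Suc l)"
 proof (intro allI impI)
  fix k l assume "k < n" "l < n" "y $$ (k, l) ~= 0"
  then show "w (Suc k) <= w (Suc l)" using y by (cases "k = l") (auto simp: cell_coords_def less_imp_le)
 qed
 from cell_mult_support[OF w w borel_one yS this] show ?thesis
  using SL_one_mult(1)[OF perm_rep_SL[OF w]] by simp
qed

text \<open>
Elimination is restricted to columns that form a non-inversion of \<open>w\<close>. These operations preserve the
support condition of the cell, and the pivots end up on the diagonal.
\<close>

lemma cell_param:
 assumes w: "w permutes {1..n}" and p: "p \<in> schubert_cell n w"
 shows "\<exists>y\<in>cell_coords n w. p = flag_proj n (perm_rep n w * y)"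
proof -
 obtain b where b: "b \<in> borel_subgroup n" "p = flag_proj n (b * perm_rep n w)" by (rule cellE[OF p])
 have P: "perm_rep n w \<in> SLset n" by (rule perm_rep_SL[OF w])
 have bP: "b * perm_rep n w \<in> SLset n" by (rule borel_perm_SL[OF w b(1)])
 define M where "M = adj_mat (perm_rep n w) * (b * perm_rep n w)"
 have M: "M \<in> SLset n" unfolding M_def by (rule SL_mult[OF SL_adj(1)[OF P] bP])
 have PM: "perm_rep n w * M = b * perm_rep n w"
  unfolding M_def by (rule SL_adj_cancel(1)[OF P bP])
 have Ment: "eps w i * M $$ (i, c) = (b * perm_rep n w) $$ (w (Suc i) - 1, c)" if "i < n" "c < n" for i c
  using perm_rep_mult[OF w SL_carrier[OF M] that] PM by simp
 have Msupp: "w (Suc i) <= w (Suc c)" if ic: "i < n" "c < n" "M $$ (i, c) ~= 0" for i c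
 proof -
  have "(b * perm_rep n w) $$ (w (Suc i) - 1, c) ~= 0" using Ment[OF ic(1,2)] ic(3) eps_nonzero[of w i] by auto
  from borel_perm_support[OF w b(1) perm_index(1)[OF w ic(1)] ic(2) this]
  show ?thesis unfolding perm_index(2)[OF w ic(1)] .
 qed
 have Mdiag: "M $$ (c, c) ~= 0" if c: "c < n" for c
 proof -
  have "eps w c * M $$ (c, c) = b $$ (w (Suc c) - 1, w (Suc c) - 1) * eps w c"
   unfolding Ment[OF c c] by (rule mult_perm_rep[OF w SL_carrier[OF borel_SL[OF b(1)]] perm_index(1)[OF w c] c])
  then show ?thesis using borel_diag[OF b(1) perm_index(1)[OF w c]] eps_nonzero[of w c] by auto
 qed
 define L where "L a c \<longleftrightarrow> a < c & w (Suc a) < w (Suc c)" for a c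
 have inj: "inj_on (%r. n - r) {..<n}" by (auto simp: inj_on_def)
 have L1: "\<forall>a b. L a b --> a < b" and L2: "\<forall>a b c. L a b --> L b c --> L a c" by (auto simp: L_def)
 obtain R \<rho> where R: "R \<in> borel_subgroup n" and R1: "\<forall>i<n. R $$ (i, i) = 1"
   and R0: "\<forall>i<n. \<forall>j<n. i ~= j --> ~ L i j --> R $$ (i, j) = 0"
   and \<rho>: "\<forall>c<n. \<rho> c < n & (M * R) $$ (\<rho> c, c) ~= 0 & (\<forall>r<n. n - \<rho> c < n - r --> (M * R) $$ (r, c) = 0)"
   and d: "\<forall>c<n. \<forall>c'<n. L c' c --> \<rho> c' ~= \<rho> c"
  using column_pivots[OF M inj L1 L2] by (elim exE conjE)
 define N where "N = M * R"
 have N: "N \<in> SLset n" unfolding N_def by (rule SL_mult[OF M borel_SL[OF R]])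
 have Nent: "N $$ (i, c) = (\<Sum>l<n. M $$ (i, l) * R $$ (l, c))" if "i < n" "c < n" for i c
  unfolding N_def by (rule mat_mult_entry[OF SL_carrier[OF M] SL_carrier[OF borel_SL[OF R]] that])
 have Nsupp: "w (Suc i) <= w (Suc c)" if ic: "i < n" "c < n" "N $$ (i, c) ~= 0" for i c
 proof (rule ccontr)
  assume h: "~ ?thesis"
  have "M $$ (i, l) * R $$ (l, c) = 0" if l: "l < n" for l
  proof (rule ccontr)
   assume "M $$ (i, l) * R $$ (l, c) ~= 0"
   then have m: "M $$ (i, l) ~= 0" and r: "R $$ (l, c) ~= 0" by auto
   have "w (Suc i) <= w (Suc l)" by (rule Msupp[OF ic(1) l m])
   moreover have "l = c \<or> L l c" using R0 l ic(2) r by blast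
   ultimately show False using h by (auto simp: L_def)
  qed
  then have "N $$ (i, c) = 0" unfolding Nent[OF ic(1,2)] by (intro sum.neutral) simp
  then show False using ic by simp
 qed
 have Ndiag: "N $$ (c, c) ~= 0" if c: "c < n" for c
 proof -
  have "N $$ (c, c) = (\<Sum>l<n. if l = c then M $$ (c, c) else 0)"
   unfolding Nent[OF c c]
  proof (rule sum.cong[OF refl])
   fix l assume "l \<in> {..<n}"
   then have l: "l < n" by simp
   show "M $$ (c, l) * R $$ (l, c) = (if l = c then M $$ (c, c) else 0)"
   proof (cases "l = c")
    case True then show ?thesis using R1 c by simp
   next
    case False
    have "M $$ (c, l) * R $$ (l, c) = 0"
    proof (rule ccontr)
     assume "M $$ (c, l) * R $$ (l, c) ~= 0"
     then have m: "M $$ (c, l) ~= 0" and r: "R $$ (l, c) ~= 0" by auto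
     have "L l c" using R0 l c r False by blast
     then show False using Msupp[OF c l m] by (simp add: L_def)
    qed
    then show ?thesis using False by simp
   qed
  qed
  then show ?thesis using Mdiag[OF c] c by simp
 qed
 have piv: "\<rho> c = c" if "c < n" for c
  using that
 proof (induction c rule: less_induct)
  case (less c)
  have r: "\<rho> c < n" "N $$ (\<rho> c, c) ~= 0" using \<rho> less.prems by (auto simp: N_def)
  have "~ n - \<rho> c < n - c" using \<rho> less.prems Ndiag[OF less.prems] by (auto simp: N_def)
  then have le: "\<rho> c <= c" using r less.prems by linarith
  show ?case
  proof (rule ccontr)
   assume ne: "\<rho> c ~= c"
   have "w (Suc (\<rho> c)) <= w (Suc c)" by (rule Nsupp[OF r(1) less.prems r(2)])
   moreover have "w (Suc (\<rho> c)) ~= w (Suc c)" using permutes_inj[OF w] ne by (auto dest: injD)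
   ultimately have "L (\<rho> c) c" using le ne by (simp add: L_def)
   moreover have "\<rho> (\<rho> c) = \<rho> c" using less.IH[of "\<rho> c"] le ne r(1) by simp
   ultimately show False using d less.prems r(1) by blast
  qed
 qed
 have low: "\<forall>c<n. \<forall>i<c. N $$ (i, c) = 0"
 proof (intro allI impI)
  fix c i assume ci: "c < n" "i < c"
  then have "n - \<rho> c < n - i" using piv[OF ci(1)] by simp
  then show "N $$ (i, c) = 0" using \<rho> ci by (auto simp: N_def)
 qed
 obtain D where D: "D \<in> borel_subgroup n" "\<forall>i<n. \<forall>c<n. (N * D) $$ (i, c) = N $$ (i, c) / N $$ (c, c)"
  using lower_normalize(1)[OF N low] by (elim bexE)
 define y where "y = N * D"
 have yc: "y \<in> carrier_mat n n" unfolding y_def by (rule SL_carrier[OF SL_mult[OF N borel_SL[OF D(1)]]])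
 have yent: "y $$ (i, c) = N $$ (i, c) / N $$ (c, c)" if "i < n" "c < n" for i c
  using D(2) that by (simp add: y_def)
 have "y \<in> cell_coords n w"
  unfolding cell_coords_def lowuni_def mem_Collect_eq
 proof (intro conjI allI impI yc)
  fix i assume "i < n" then show "y $$ (i, i) = 1" using yent Ndiag by simp
 next
  fix j i assume "j < n" "i < j" then show "y $$ (i, j) = 0" using yent low by simp
 next
  fix k l assume kl: "k < n" "l < n" "k ~= l" "y $$ (k, l) ~= 0"
  then have "w (Suc k) <= w (Suc l)" using Nsupp yent by auto
  moreover have "w (Suc k) ~= w (Suc l)" using permutes_inj[OF w] kl(3) by (auto dest: injD)
  ultimately show "w (Suc k) < w (Suc l)" by simp
 qed
 moreover have "p = flag_proj n (perm_rep n w * y)"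
 proof -
  have "perm_rep n w * y = b * perm_rep n w * (R * D)"
   unfolding y_def N_def PM[symmetric]
   using SL_assoc[OF M borel_SL[OF R] borel_SL[OF D(1)]] SL_assoc[OF P M borel_SL[OF borel_mult[OF R D(1)]]] by simp
  then show ?thesis using flag_proj_mult[OF bP borel_mult[OF R D(1)]] b(2) by simp
 qed
 ultimately show ?thesis by blast
qed

text \<open>Two points of the cell are joined by a line in its coordinates.\<close>

lemma schubert_irreducible:
 assumes w: "w permutes {1..n}"
 shows "irreducible_subset (flag_top n) (schubert_variety n w)"
 unfolding schubert_variety_def
proof (rule irreducible_closure, rule irreducible_by_curves)
 show "schubert_cell n w ~= {}" using cell_in[OF borel_one, of n w] by auto
 show "schubert_cell n w \<subseteq> flags n" by (rule cell_flags[OF w])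
 fix p q assume "p \<in> schubert_cell n w" "q \<in> schubert_cell n w"
 then obtain y z where y: "y \<in> cell_coords n w" "p = flag_proj n (perm_rep n w * y)"
  and z: "z \<in> cell_coords n w" "q = flag_proj n (perm_rep n w * z)"
  using cell_param[OF w] by meson
 have yc: "y \<in> carrier_mat n n" and zc: "z \<in> carrier_mat n n" using y z by (auto simp: cell_coords_def lowuni_def)
 define l where "l s = mat n n (%(i, j). y $$ (i, j) + s * (z $$ (i, j) - y $$ (i, j)))" for s
 have lc: "l s \<in> cell_coords n w" for s
  unfolding cell_coords_def lowuni_def mem_Collect_eq
 proof (intro conjI allI impI)
  show "l s \<in> carrier_mat n n" by (simp add: l_def)
 next
  fix i assume "i < n" then show "l s $$ (i, i) = 1" using y(1) z(1) by (simp add: l_def cell_coords_def lowuni_def)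
 next
  fix j i assume "j < n" "i < j" then show "l s $$ (i, j) = 0" using y(1) z(1) by (simp add: l_def cell_coords_def lowuni_def)
 next
  fix i j assume ij: "i < n" "j < n" "i ~= j" "l s $$ (i, j) ~= 0"
  then have "y $$ (i, j) ~= 0 \<or> z $$ (i, j) ~= 0" by (auto simp: l_def)
  then show "w (Suc i) < w (Suc j)" using y(1) z(1) ij by (auto simp: cell_coords_def)
 qed
 have lS: "l s \<in> SLset n" for s using lc[of s] lowuni_SL by (auto simp: cell_coords_def)
 have l0: "l 0 = y" and l1: "l 1 = z" using yc zc by (auto simp: l_def)
 have "poly_curve n (%s. perm_rep n w * l s)"
  unfolding poly_curve_def
 proof (intro allI impI)
  fix i j assume ij: "i < n" "j < n"
  let ?P = "perm_rep n w"
  have "(?P * l s) $$ (i, j) = poly [:\<Sum>k<n. ?P $$ (i, k) * y $$ (k, j), \<Sum>k<n. ?P $$ (i, k) * (z $$ (k, j) - y $$ (k, j)):] s" for s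
  proof -
   have "(?P * l s) $$ (i, j) = (\<Sum>k<n. ?P $$ (i, k) * l s $$ (k, j))"
    by (rule mat_mult_entry[OF perm_rep_carrier SL_carrier[OF lS] ij])
   also have "\<dots> = (\<Sum>k<n. ?P $$ (i, k) * y $$ (k, j) + s * (?P $$ (i, k) * (z $$ (k, j) - y $$ (k, j))))"
    by (rule sum.cong) (use ij in \<open>simp_all add: l_def algebra_simps\<close>)
   also have "\<dots> = poly [:\<Sum>k<n. ?P $$ (i, k) * y $$ (k, j), \<Sum>k<n. ?P $$ (i, k) * (z $$ (k, j) - y $$ (k, j)):] s"
    by (simp add: sum.distrib sum_distrib_left)
   finally show ?thesis .
  qed
  then show "\<exists>Q. \<forall>s. (?P * l s) $$ (i, j) = poly Q s" by blast
 qed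
 moreover have "\<forall>s. perm_rep n w * l s \<in> SLset n & flag_proj n (perm_rep n w * l s) \<in> schubert_cell n w"
  using SL_mult[OF perm_rep_SL[OF w] lS] cell_coords_in_cell[OF w lc] by simp
 ultimately show "\<exists>c. poly_curve n c & (\<forall>s. c s \<in> SLset n & flag_proj n (c s) \<in> schubert_cell n w) \<and>
   flag_proj n (c 0) = p & flag_proj n (c 1) = q"
  by (intro exI[of _ "%s. perm_rep n w * l s"] conjI) (simp_all add: l0 l1 y z)
qed

section \<open>The chart of lower unipotent matrices\<close>

abbreviation lead :: "nat => complex mat => complex" where
 "lead \<equiv> minor (%i. i) (%i. i)"

definition leads :: "nat => complex mat => complex" where
 "leads n A = (\<Prod>j<n. lead (Suc j) A)"

abbreviation low_minor :: "nat => nat => complex mat => complex" where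
 "low_minor i j \<equiv> minor (%a. if a < j then a else i) (%c. c) (Suc j)"

text \<open>
The factor \<open>u\<close> of \<open>A = u b\<close> with \<open>u\<close> lower unipotent and \<open>b\<close> upper triangular, given by quotients of
minors. This formula makes the coordinates of the chart rational functions.
\<close>

definition lower_part :: "nat => complex mat => complex mat" where
 "lower_part n A = mat n n (%(i, j). if j <= i then low_minor i j A / lead (Suc j) A else 0)"

text \<open>
Minors on the first columns change by a factor independent of the rows, so their quotients only depend
on the flag.
\<close>

lemma minor_mult_borel:
 assumes A: "A \<in> carrier_mat n n" and b: "b \<in> borel_subgroup n" and \<rho>: "\<forall>r<s. \<rho> r < n" and s: "s <= n"
 shows "minor \<rho> (%c. c) s (A * b) = minor \<rho> (%c. c) s A * (\<Prod>k<s. b $$ (k, k))"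
proof -
 let ?A = "mat s s (%(r, c). A $$ (\<rho> r, c))" and ?b = "mat s s (%(r, c). b $$ (r, c))"
 have bc: "b \<in> carrier_mat n n" by (rule SL_carrier[OF borel_SL[OF b]])
 have "mat s s (%(r, c). (A * b) $$ (\<rho> r, c)) = ?A * ?b"
 proof (rule eq_matI)
  fix r c assume "r < dim_row (?A * ?b)" "c < dim_col (?A * ?b)"
  then have rc: "r < s" "c < s" by auto
  have "(A * b) $$ (\<rho> r, c) = (\<Sum>l<n. A $$ (\<rho> r, l) * b $$ (l, c))"
   by (rule mat_mult_entry[OF A bc]) (use \<rho> rc s in auto)
  also have "\<dots> = (\<Sum>l<s. A $$ (\<rho> r, l) * b $$ (l, c))"
  proof (rule sum.mono_neutral_right)
   show "\<forall>l\<in>{..<n} - {..<s}. A $$ (\<rho> r, l) * b $$ (l, c) = 0" using b rc by (auto simp: borel_iff)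
  qed (use s in auto)
  also have "\<dots> = (\<Sum>l<s. ?A $$ (r, l) * ?b $$ (l, c))" by (rule sum.cong) (use rc in auto)
  also have "\<dots> = (?A * ?b) $$ (r, c)" by (rule mat_mult_entry[symmetric]) (use rc in auto)
  finally show "mat s s (%(r, c). (A * b) $$ (\<rho> r, c)) $$ (r, c) = (?A * ?b) $$ (r, c)" using rc by simp
 qed auto
 moreover have "det ?b = (\<Prod>k<s. b $$ (k, k))"
 proof -
  have "det ?b = prod_list (diag_mat ?b)"
   by (rule det_upper_triangular[where n = s]) (use b s in \<open>auto simp: upper_triangular_def borel_iff\<close>)
  then show ?thesis by (simp add: prod_list_diag_prod atLeast0LessThan)
 qed
 ultimately show ?thesis unfolding minor_def using det_mult[of ?A s ?b] by simp
qed

lemma lower_part_mult_borel: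
 assumes A: "A \<in> carrier_mat n n" and b: "b \<in> borel_subgroup n"
 shows "lower_part n (A * b) = lower_part n A" "leads n (A * b) ~= 0 \<longleftrightarrow> leads n A ~= 0"
proof -
 define \<beta> where "\<beta> j = (\<Prod>k<j. b $$ (k, k))" for j
 have \<beta>: "\<beta> j ~= 0" if "j <= n" for j using borel_diag[OF b] that by (simp add: \<beta>_def)
 have l: "lead j (A * b) = lead j A * \<beta> j" if "j <= n" for j
  unfolding \<beta>_def by (rule minor_mult_borel[OF A b]) (use that in auto)
 have m: "low_minor i j (A * b) = low_minor i j A * \<beta> (Suc j)" if "j < n" "i < n" for i j
  unfolding \<beta>_def by (rule minor_mult_borel[OF A b]) (use that in auto)
 show "lower_part n (A * b) = lower_part n A"
  unfolding lower_part_def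
  by (rule cong_mat[OF refl refl]) (use l m \<beta> in simp)
 show "leads n (A * b) ~= 0 \<longleftrightarrow> leads n A ~= 0"
  unfolding leads_def using l \<beta> by (simp add: Suc_le_eq)
qed

lemma det_lowuni_minor:
 assumes u: "u \<in> lowuni n" and ij: "j <= i" "i < n"
 shows "low_minor i j u = u $$ (i, j)"
proof -
 let ?M = "mat (Suc j) (Suc j) (%(r, c). u $$ (if r < j then r else i, c))"
 have "det ?M = prod_list (diag_mat ?M)"
  by (rule det_lower_triangular[where n = "Suc j"]) (use u ij in \<open>auto simp: lowuni_def\<close>)
 also have "\<dots> = (\<Prod>r<Suc j. ?M $$ (r, r))" by (simp add: prod_list_diag_prod atLeast0LessThan)
 also have "\<dots> = (\<Prod>r<j. ?M $$ (r, r)) * u $$ (i, j)" by simp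
 also have "(\<Prod>r<j. ?M $$ (r, r)) = 1" by (rule prod.neutral) (use u ij in \<open>auto simp: lowuni_def\<close>)
 finally show ?thesis by (simp add: minor_def)
qed

lemma lead_lowuni:
 assumes u: "u \<in> lowuni n" and j: "j < n"
 shows "lead (Suc j) u = 1"
proof -
 have "lead (Suc j) u = low_minor j j u"
  unfolding minor_def by (rule arg_cong[where f = det], rule cong_mat) (auto simp: less_Suc_eq)
 also have "\<dots> = 1" unfolding det_lowuni_minor[OF u order_refl j] using u j by (simp add: lowuni_def)
 finally show ?thesis .
qed

lemma leads_lowuni: "u \<in> lowuni n ==> leads n u = 1"
 unfolding leads_def by (rule prod.neutral) (simp add: lead_lowuni)

lemma lower_part_lowuni:
 assumes u: "u \<in> lowuni n"
 shows "lower_part n u = u"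
proof (rule eq_matI)
 show "dim_row (lower_part n u) = dim_row u" "dim_col (lower_part n u) = dim_col u"
  using u by (auto simp: lower_part_def lowuni_def)
 fix i j assume "i < dim_row u" "j < dim_col u"
 then have ij: "i < n" "j < n" using u by (auto simp: lowuni_def)
 then show "lower_part n u $$ (i, j) = u $$ (i, j)"
  using det_lowuni_minor[OF u, of j i] lead_lowuni[OF u, of j] u by (auto simp: lower_part_def lowuni_def)
qed

lemma LU_decomposition:
 assumes A: "A \<in> SLset n" and nz: "leads n A ~= 0"
 shows "\<exists>u\<in>lowuni n. \<exists>b\<in>borel_subgroup n. A = u * b"
proof -
 have inj: "inj_on (%r. n - r) {..<n}" by (auto simp: inj_on_def)
 obtain R \<rho> where R: "R \<in> borel_subgroup n"
   and \<rho>: "\<forall>c<n. \<rho> c < n & (A * R) $$ (\<rho> c, c) ~= 0 & (\<forall>r<n. n - \<rho> c < n - r --> (A * R) $$ (r, c) = 0)"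
   and d: "\<forall>c<n. \<forall>c'<n. c' < c --> \<rho> c' ~= \<rho> c"
  using column_pivots[OF A inj, of "(<)"] by auto
 define N where "N = A * R"
 have N: "N \<in> SLset n" unfolding N_def by (rule SL_mult[OF A borel_SL[OF R]])
 have "leads n N ~= 0" using lower_part_mult_borel(2)[OF SL_carrier[OF A] R] nz by (simp add: N_def)
 then have Nlead: "lead (Suc c) N ~= 0" if "c < n" for c using that by (auto simp: leads_def)
 have piv: "\<rho> c = c" if "c < n" for c
  using that
 proof (induction c rule: less_induct)
  case (less c)
  have r: "\<rho> c < n" using \<rho> less.prems by simp
  have ge: "c <= \<rho> c"
  proof (rule ccontr)
   assume h: "~ ?thesis"
   then have "\<rho> (\<rho> c) = \<rho> c" using less.IH[of "\<rho> c"] r by simp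
   then show False using d less.prems r h by (metis not_le)
  qed
  show ?case
  proof (rule ccontr)
   assume ne: "\<rho> c ~= c"
   let ?M = "mat (Suc c) (Suc c) (%(i, j). N $$ (i, j))"
   have z: "N $$ (i, c) = 0" if "i < Suc c" for i
   proof -
    have "i < n" "n - \<rho> c < n - i" using that ge ne r less.prems by linarith+
    then show ?thesis using \<rho> less.prems by (simp add: N_def)
   qed
   have "det ?M = (\<Sum>i<Suc c. ?M $$ (i, c) * cofactor ?M i c)"
    by (rule laplace_expansion_column) auto
   also have "\<dots> = 0" by (rule sum.neutral) (use z in auto)
   finally show False using Nlead[OF less.prems] by (simp add: minor_def)
  qed
 qed
 have low: "\<forall>c<n. \<forall>i<c. N $$ (i, c) = 0"
 proof (intro allI impI)
  fix c i assume ci: "c < n" "i < c"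
  then have "n - \<rho> c < n - i" using piv[OF ci(1)] by simp
  then show "N $$ (i, c) = 0" using \<rho> ci by (auto simp: N_def)
 qed
 obtain D where D: "D \<in> borel_subgroup n" "\<forall>i<n. \<forall>c<n. (N * D) $$ (i, c) = N $$ (i, c) / N $$ (c, c)"
  using lower_normalize(1)[OF N low] by (elim bexE)
 have "N * D \<in> lowuni n"
  unfolding lowuni_def using SL_carrier[OF SL_mult[OF N borel_SL[OF D(1)]]] D(2) low lower_normalize(2)[OF N low] by simp
 moreover have "A = (N * D) * adj_mat (R * D)"
 proof -
  have RD: "R * D \<in> SLset n" by (rule borel_SL[OF borel_mult[OF R D(1)]])
  have "N * D = A * (R * D)" unfolding N_def by (rule SL_assoc[OF A borel_SL[OF R] borel_SL[OF D(1)]])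
  then show ?thesis using SL_adj_cancel(3)[OF RD A] by simp
 qed
 ultimately show ?thesis using borel_inverse[OF borel_mult[OF R D(1)]] by blast
qed

lemma lower_part_decomposition:
 assumes A: "A \<in> SLset n" and nz: "leads n A ~= 0"
 shows "lower_part n A \<in> lowuni n" "\<exists>b\<in>borel_subgroup n. A = lower_part n A * b"
proof -
 obtain u b where u: "u \<in> lowuni n" "b \<in> borel_subgroup n" "A = u * b" using LU_decomposition[OF A nz] by (elim bexE)
 have "lower_part n A = u"
  unfolding u(3) lower_part_mult_borel(1)[OF SL_carrier[OF lowuni_SL[OF u(1)]] u(2)] by (rule lower_part_lowuni[OF u(1)])
 then show "lower_part n A \<in> lowuni n" "\<exists>b\<in>borel_subgroup n. A = lower_part n A * b" using u by auto
qed

lemma leads_poly_fun: "leads n \<in> poly_funs n"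
 unfolding leads_def by (intro poly_funs_prod minor_poly_fun) auto

lemma poly_fun_lower_part:
 assumes g: "g \<in> carrier_mat n n" and f: "f \<in> poly_funs n"
 shows "\<exists>h\<in>poly_funs n. \<exists>k. \<forall>A\<in>carrier_mat n n. leads n A ~= 0 --> h A = leads n A ^ k * f (g * lower_part n A)"
 using f
proof induction
 case (const a)
 then show ?case by (intro bexI[of _ "%A. a"] exI[of _ 0]) (auto intro: poly_funs.const)
next
 case (entry i j)
 define h where "h A = (\<Sum>l<n. g $$ (i, l) * (if j <= l then low_minor l j A * (\<Prod>m\<in>{..<n}-{j}. lead (Suc m) A) else 0))" for A
 have "h \<in> poly_funs n"
  unfolding h_def
 proof (intro poly_funs_sum poly_funs.mult poly_funs.const)
  fix l assume l: "l \<in> {..<n}"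
  show "(%A. if j <= l then low_minor l j A * (\<Prod>m\<in>{..<n}-{j}. lead (Suc m) A) else 0) \<in> poly_funs n"
  proof (cases "j <= l")
   case True
   have "(%A. low_minor l j A * (\<Prod>m\<in>{..<n}-{j}. lead (Suc m) A)) \<in> poly_funs n"
    by (intro poly_funs.mult minor_poly_fun poly_funs_prod) (use entry l in auto)
   then show ?thesis using True by simp
  qed (simp add: poly_funs.const)
 qed
 moreover have "h A = leads n A ^ 1 * (g * lower_part n A) $$ (i, j)" if A: "A \<in> carrier_mat n n" and nz: "leads n A ~= 0" for A
 proof -
  have split: "leads n A = lead (Suc j) A * (\<Prod>m\<in>{..<n}-{j}. lead (Suc m) A)"
   unfolding leads_def by (rule prod.remove) (use entry in auto)
  have nz': "lead (Suc j) A ~= 0" using nz split by auto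
  have "(g * lower_part n A) $$ (i, j) = (\<Sum>l<n. g $$ (i, l) * lower_part n A $$ (l, j))"
   by (rule mat_mult_entry[OF g]) (use entry in \<open>auto simp: lower_part_def\<close>)
  then have "leads n A ^ 1 * (g * lower_part n A) $$ (i, j) = (\<Sum>l<n. g $$ (i, l) * (leads n A * lower_part n A $$ (l, j)))"
   by (simp add: sum_distrib_left algebra_simps)
  also have "\<dots> = h A"
   unfolding h_def by (rule sum.cong[OF refl]) (use entry split nz' in \<open>auto simp: lower_part_def\<close>)
  finally show ?thesis by simp
 qed
 ultimately show ?case by blast
next
 case (add f1 f2)
 obtain h1 k1 where h1: "h1 \<in> poly_funs n" "\<forall>A\<in>carrier_mat n n. leads n A ~= 0 --> h1 A = leads n A ^ k1 * f1 (g * lower_part n A)"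
  using add.IH(1) by (elim bexE exE)
 obtain h2 k2 where h2: "h2 \<in> poly_funs n" "\<forall>A\<in>carrier_mat n n. leads n A ~= 0 --> h2 A = leads n A ^ k2 * f2 (g * lower_part n A)"
  using add.IH(2) by (elim bexE exE)
 show ?case
 proof (intro bexI[of _ "%A. leads n A ^ k2 * h1 A + leads n A ^ k1 * h2 A"] exI[of _ "k1 + k2"] ballI impI)
  show "(%A. leads n A ^ k2 * h1 A + leads n A ^ k1 * h2 A) \<in> poly_funs n"
   by (intro poly_funs.add poly_funs.mult poly_funs_power leads_poly_fun h1(1) h2(1))
  fix A assume "A \<in> carrier_mat n n" "leads n A ~= 0"
  then show "leads n A ^ k2 * h1 A + leads n A ^ k1 * h2 A = leads n A ^ (k1 + k2) * (f1 (g * lower_part n A) + f2 (g * lower_part n A))"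
   using h1(2) h2(2) by (simp add: algebra_simps power_add)
 qed
next
 case (mult f1 f2)
 obtain h1 k1 where h1: "h1 \<in> poly_funs n" "\<forall>A\<in>carrier_mat n n. leads n A ~= 0 --> h1 A = leads n A ^ k1 * f1 (g * lower_part n A)"
  using mult.IH(1) by (elim bexE exE)
 obtain h2 k2 where h2: "h2 \<in> poly_funs n" "\<forall>A\<in>carrier_mat n n. leads n A ~= 0 --> h2 A = leads n A ^ k2 * f2 (g * lower_part n A)"
  using mult.IH(2) by (elim bexE exE)
 show ?case
 proof (intro bexI[of _ "%A. h1 A * h2 A"] exI[of _ "k1 + k2"] ballI impI)
  show "(%A. h1 A * h2 A) \<in> poly_funs n"
   by (intro poly_funs.mult h1(1) h2(1))
  fix A assume "A \<in> carrier_mat n n" "leads n A ~= 0"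
  then show "h1 A * h2 A = leads n A ^ (k1 + k2) * (f1 (g * lower_part n A) * f2 (g * lower_part n A))"
   using h1(2) h2(2) by (simp add: algebra_simps power_add)
 qed
qed

text \<open>
The chart around \<open>g B\<close> consists of the flags \<open>g u B\<close> with \<open>u\<close> lower unipotent; it is the open set where
\<open>chart_fun n g\<close> does not vanish, and \<open>chart n g\<close> is a section of the projection over it.
\<close>

definition chart_fun :: "nat => complex mat => complex mat => complex" where
 "chart_fun n g a = leads n (adj_mat g * a)"

definition chart :: "nat => complex mat => complex mat => complex mat" where
 "chart n g a = g * lower_part n (adj_mat g * a)"

lemma chart_mult_borel:
 assumes g: "g \<in> SLset n" and a: "a \<in> SLset n" and b: "b \<in> borel_subgroup n"
 shows "chart n g (a * b) = chart n g a" "chart_fun n g (a * b) ~= 0 \<longleftrightarrow> chart_fun n g a ~= 0"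
 using lower_part_mult_borel[OF SL_carrier[OF SL_mult[OF SL_adj(1)[OF g] a]] b]
  SL_assoc[OF SL_adj(1)[OF g] a borel_SL[OF b]]
 by (auto simp: chart_def chart_fun_def)

lemma chart_cong:
 assumes g: "g \<in> SLset n" and a: "a \<in> SLset n" "a' \<in> SLset n" and e: "flag_proj n a = flag_proj n a'"
 shows "chart n g a' = chart n g a" "chart_fun n g a' ~= 0 \<longleftrightarrow> chart_fun n g a ~= 0"
proof -
 obtain b where b: "b \<in> borel_subgroup n" "a' = a * b" by (rule flag_projE[OF e a])
 show "chart n g a' = chart n g a" "chart_fun n g a' ~= 0 \<longleftrightarrow> chart_fun n g a ~= 0"
  unfolding b(2) by (rule chart_mult_borel[OF g a(1) b(1)])+
qed

lemma chart_section:
 assumes g: "g \<in> SLset n" and a: "a \<in> SLset n" and nz: "chart_fun n g a ~= 0"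
 obtains u where "u \<in> lowuni n" "chart n g a = g * u" "flag_proj n (g * u) = flag_proj n a"
proof -
 let ?h = "adj_mat g * a"
 have h: "?h \<in> SLset n" by (rule SL_mult[OF SL_adj(1)[OF g] a])
 note D = lower_part_decomposition[OF h nz[unfolded chart_fun_def]]
 obtain b where b: "b \<in> borel_subgroup n" "?h = lower_part n ?h * b" using D(2) by (elim bexE)
 have uS: "lower_part n ?h \<in> SLset n" by (rule lowuni_SL[OF D(1)])
 have "a = g * ?h" by (rule SL_adj_cancel(1)[OF g a, symmetric])
 also have "\<dots> = g * (lower_part n ?h * b)" by (rule arg_cong[OF b(2)])
 also have "\<dots> = (g * lower_part n ?h) * b" by (rule SL_assoc[OF g uS borel_SL[OF b(1)], symmetric])
 finally have "flag_proj n a = flag_proj n ((g * lower_part n ?h) * b)" by simp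
 also have "\<dots> = flag_proj n (g * lower_part n ?h)" by (rule flag_proj_mult[OF SL_mult[OF g uS] b(1)])
 finally show ?thesis by (intro that[OF D(1)]) (simp_all add: chart_def)
qed

lemma chart_lowuni:
 assumes g: "g \<in> SLset n" and u: "u \<in> lowuni n"
 shows "chart n g (g * u) = g * u" "chart_fun n g (g * u) = 1"
proof -
 have "adj_mat g * (g * u) = u" by (rule SL_adj_cancel(2)[OF g lowuni_SL[OF u]])
 then show "chart n g (g * u) = g * u" "chart_fun n g (g * u) = 1"
  by (simp_all add: chart_def chart_fun_def lower_part_lowuni[OF u] leads_lowuni[OF u])
qed

lemma chart_fun_poly:
 assumes g: "g \<in> SLset n"
 obtains D where "D \<in> poly_funs n" "\<forall>A\<in>carrier_mat n n. D A = chart_fun n g A"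
proof -
 obtain D where "D \<in> poly_funs n" "\<forall>A\<in>carrier_mat n n. D A = leads n (adj_mat g * A)"
  using poly_funs_left_mult[OF SL_carrier[OF SL_adj(1)[OF g]] leads_poly_fun] by (elim bexE)
 then show ?thesis by (intro that) (simp_all add: chart_fun_def)
qed

section \<open>Regular functions near a flag\<close>

lemma regular_flag_local:
 assumes r: "regular_on (flag_variety n) V g" and a: "a \<in> SLset n" "flag_proj n a \<in> V"
 shows "\<exists>P\<in>poly_funs n. \<exists>Q\<in>poly_funs n. Q a ~= 0 \<and>
  (\<forall>c\<in>SLset n. Q c ~= 0 --> flag_proj n c \<in> V --> g (flag_proj n c) = P c / Q c)"
proof -
 let ?S = "subspace_on (mat_space n) (SLset n)"
 have ts: "topspace (topo ?S) = SLset n"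
  by (auto simp: subspace_on_def mat_space_def topspace_zariski SL_iff)
 define U where "U = {c \<in> SLset n. flag_proj n c \<in> V}"
 have "regular_on ?S U (g \<circ> flag_proj n)"
  using r unfolding flag_variety_def quotient_space_def Let_def U_def ts by simp
 then have loc: "\<forall>a\<in>U. \<exists>V h. openin (zariski_mat n) V & a \<in> V & regular_on (mat_space n) V h & (\<forall>b \<in> V \<inter> U. (g \<circ> flag_proj n) b = h b)"
  unfolding subspace_on_def by (simp add: mat_space_def)
 have aU: "a \<in> U" using a by (simp add: U_def)
 from bspec[OF loc aU] obtain V' h where V': "openin (zariski_mat n) V'" "a \<in> V'" "regular_on (mat_space n) V' h"
  "\<forall>b \<in> V' \<inter> U. (g \<circ> flag_proj n) b = h b" by (elim exE conjE)
 have "\<forall>A\<in>V'. \<exists>V p q. openin (zariski_mat n) V & A \<in> V & p \<in> poly_funs n & q \<in> poly_funs n \<and>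
     (\<forall>C \<in> V \<inter> V'. q C ~= 0 & h C = p C / q C)"
  using V'(3) by (simp add: mat_space_def)
 from bspec[OF this V'(2)] obtain W p q where W: "openin (zariski_mat n) W" "a \<in> W" "p \<in> poly_funs n" "q \<in> poly_funs n"
  "\<forall>C \<in> W \<inter> V'. q C ~= 0 & h C = p C / q C" by (elim exE conjE)
 have "openin (zariski_mat n) (W \<inter> V')" using W(1) V'(1) by (rule openin_Int)
 then obtain F where F: "F \<subseteq> poly_funs n" "W \<inter> V' = {A \<in> carrier_mat n n. \<exists>f\<in>F. f A ~= 0}"
  unfolding openin_zariski_mat by (elim exE conjE)
 have "a \<in> W \<inter> V'" using W(2) V'(2) by simp
 then obtain f where f: "f \<in> F" "f a ~= 0" unfolding F(2) by auto
 have fp: "f \<in> poly_funs n" using F(1) f(1) by (rule subsetD)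
 have in_WV: "c \<in> W \<inter> V'" if "c \<in> SLset n" "f c ~= 0" for c
  unfolding F(2) using that f(1) SL_carrier by blast
 show ?thesis
 proof (rule bexI[of _ "%A. p A * f A"], rule bexI[of _ "%A. q A * f A"], intro conjI ballI impI)
  show "(%A. p A * f A) \<in> poly_funs n" "(%A. q A * f A) \<in> poly_funs n"
   by (intro poly_funs.mult W(3,4) fp)+
  show "q a * f a ~= 0" using W(5) in_WV[OF a(1) f(2)] f(2) by simp
  fix c assume c: "c \<in> SLset n" "q c * f c ~= 0" "flag_proj n c \<in> V"
  have cW: "c \<in> W \<inter> V'" by (rule in_WV[OF c(1)]) (use c(2) in auto)
  then have "g (flag_proj n c) = h c" using V'(4) c(1,3) by (simp add: U_def)
  also have "\<dots> = p c / q c" using W(5) cW by blast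
  also have "\<dots> = p c * f c / (q c * f c)" using c(2) by simp
  finally show "g (flag_proj n c) = p c * f c / (q c * f c)" .
 qed
qed

lemma regular_flagI:
 assumes V: "openin (flag_top n) V" and PQ: "P \<in> poly_funs n" "Q \<in> poly_funs n"
  and e: "\<forall>a\<in>SLset n. flag_proj n a \<in> V --> Q a ~= 0 & g (flag_proj n a) = P a / Q a"
 shows "regular_on (flag_variety n) V g"
proof -
 let ?S = "subspace_on (mat_space n) (SLset n)"
 have ts: "topspace (topo ?S) = SLset n"
  by (auto simp: subspace_on_def mat_space_def topspace_zariski SL_iff)
 define U where "U = {c \<in> SLset n. flag_proj n c \<in> V}"
 define W where "W = {A \<in> carrier_mat n n. Q A ~= 0}"
 have W: "openin (zariski_mat n) W"
  unfolding openin_zariski_mat W_def by (rule exI[of _ "{Q}"]) (use PQ in auto)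
 have rW: "regular_on (mat_space n) W (%A. P A / Q A)"
 proof -
  have "\<exists>V p q. openin (zariski_mat n) V & A \<in> V & p \<in> poly_funs n & q \<in> poly_funs n \<and>
     (\<forall>C \<in> V \<inter> W. q C ~= 0 & P C / Q C = p C / q C)" if "A \<in> W" for A
   by (rule exI[of _ W], rule exI[of _ P], rule exI[of _ Q]) (use W PQ that in \<open>auto simp: W_def\<close>)
  then show ?thesis using W by (simp add: mat_space_def)
 qed
 have oU: "openin (topo ?S) U"
  using V unfolding flag_variety_def openin_quotient_space ts U_def by (rule conjunct2)
 have "\<exists>V h. openin (zariski_mat n) V & a \<in> V & regular_on (mat_space n) V h & (\<forall>b \<in> V \<inter> U. (g \<circ> flag_proj n) b = h b)"
  if a: "a \<in> U" for a
  by (rule exI[of _ W], rule exI[of _ "%A. P A / Q A"])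
   (use W rW a e SL_carrier in \<open>auto simp: U_def W_def\<close>)
 then have "regular_on ?S U (g \<circ> flag_proj n)"
  using oU unfolding subspace_on_def by (simp add: mat_space_def)
 then show ?thesis
  using V unfolding flag_variety_def quotient_space_def Let_def U_def ts by simp
qed

text \<open>A set of flags \<open>X\<close> seen from the chart around one of its points.\<close>

locale flag_chart =
 fixes n :: nat and X :: "complex mat set set" and g :: "complex mat"
 assumes X: "X \<subseteq> flags n" and g: "g \<in> SLset n" and gX: "flag_proj n g \<in> X"
begin

abbreviation S where "S \<equiv> subspace_on (flag_variety n) X"

abbreviation pt where "pt \<equiv> flag_proj n g"

text \<open>A representative is chosen; by \<open>lower_coords_proj\<close> the result only depends on the flag.\<close>

definition lower_coords :: "complex mat set => complex mat" where
 "lower_coords q = lower_part n (adj_mat g * (SOME a. a \<in> SLset n & flag_proj n a = q))"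

lemma lower_coords_proj:
 assumes a: "a \<in> SLset n"
 shows "lower_coords (flag_proj n a) = lower_part n (adj_mat g * a)"
proof -
 let ?a = "SOME a'. a' \<in> SLset n & flag_proj n a' = flag_proj n a"
 have "?a \<in> SLset n & flag_proj n ?a = flag_proj n a"
  by (rule someI[of _ a]) (use a in simp)
 then have s: "?a \<in> SLset n" "flag_proj n a = flag_proj n ?a" by auto
 obtain b where b: "b \<in> borel_subgroup n" "?a = a * b" by (rule flag_projE[OF s(2) a s(1)])
 have "adj_mat g * ?a = (adj_mat g * a) * b"
  unfolding b(2) by (rule SL_assoc[OF SL_adj(1)[OF g] a borel_SL[OF b(1)], symmetric])
 then show ?thesis
  unfolding lower_coords_def using lower_part_mult_borel(1)[OF SL_carrier[OF SL_mult[OF SL_adj(1)[OF g] a]] b(1)] by simp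
qed

lemma lower_coords_chart:
 assumes u: "u \<in> lowuni n"
 shows "lower_coords (flag_proj n (g * u)) = u"
 unfolding lower_coords_proj[OF SL_mult[OF g lowuni_SL[OF u]]] SL_adj_cancel(2)[OF g lowuni_SL[OF u]]
 by (rule lower_part_lowuni[OF u])

lemma lower_coords_pt: "lower_coords pt = 1\<^sub>m n"
 using lower_coords_chart[OF one_lowuni] SL_one_mult(2)[OF g] by simp

lemma coord_numerator:
 assumes f: "f \<in> poly_funs n"
 obtains h k where "h \<in> poly_funs n"
  "\<forall>a\<in>SLset n. chart_fun n g a ~= 0 --> h a = chart_fun n g a ^ k * f (lower_part n (adj_mat g * a))"
proof -
 obtain h k where h: "h \<in> poly_funs n" "\<forall>A\<in>carrier_mat n n. leads n A ~= 0 --> h A = leads n A ^ k * f (1\<^sub>m n * lower_part n A)"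
  using poly_fun_lower_part[OF one_carrier_mat f] by (elim bexE exE)
 obtain h' where h': "h' \<in> poly_funs n" "\<forall>A\<in>carrier_mat n n. h' A = h (adj_mat g * A)"
  using poly_funs_left_mult[OF SL_carrier[OF SL_adj(1)[OF g]] h(1)] by (elim bexE)
 show ?thesis
 proof (rule that[OF h'(1)], intro ballI impI)
  fix a assume a: "a \<in> SLset n" "chart_fun n g a ~= 0"
  have c: "adj_mat g * a \<in> carrier_mat n n" by (rule SL_carrier[OF SL_mult[OF SL_adj(1)[OF g] a(1)]])
  then have "h (adj_mat g * a) = leads n (adj_mat g * a) ^ k * f (1\<^sub>m n * lower_part n (adj_mat g * a))"
   using h(2) a(2) unfolding chart_fun_def by simp
  moreover have "1\<^sub>m n * lower_part n (adj_mat g * a) = lower_part n (adj_mat g * a)"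
   by (rule left_mult_one_mat[of _ n n]) (simp add: lower_part_def)
  ultimately show "h' a = chart_fun n g a ^ k * f (lower_part n (adj_mat g * a))"
   using h'(2) SL_carrier[OF a(1)] by (simp add: chart_fun_def)
 qed
qed

definition chart_nbhd :: "(complex mat => complex) => complex mat set set" where
 "chart_nbhd Q = {flag_proj n a | a. a \<in> SLset n & chart_fun n g a ~= 0 & Q (lower_part n (adj_mat g * a)) ~= 0}"

lemma chart_nbhd_proj:
 assumes a: "a \<in> SLset n"
 shows "flag_proj n a \<in> chart_nbhd Q \<longleftrightarrow> chart_fun n g a ~= 0 & Q (lower_part n (adj_mat g * a)) ~= 0"
proof
 assume "flag_proj n a \<in> chart_nbhd Q"
 then obtain a' where a': "flag_proj n a' = flag_proj n a" "a' \<in> SLset n" "chart_fun n g a' ~= 0" "Q (lower_part n (adj_mat g * a')) ~= 0"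
  unfolding chart_nbhd_def mem_Collect_eq by metis
 have "lower_part n (adj_mat g * a') = lower_part n (adj_mat g * a)"
  using lower_coords_proj[OF a] lower_coords_proj[OF a'(2)] a'(1) by simp
 then show "chart_fun n g a ~= 0 & Q (lower_part n (adj_mat g * a)) ~= 0"
  using a' chart_cong(2)[OF g a'(2) a a'(1)] by simp
next
 assume "chart_fun n g a ~= 0 & Q (lower_part n (adj_mat g * a)) ~= 0"
 then have h: "chart_fun n g a ~= 0" "Q (lower_part n (adj_mat g * a)) ~= 0" by (rule conjunct1, rule conjunct2)
 show "flag_proj n a \<in> chart_nbhd Q" unfolding chart_nbhd_def by (rule CollectI, rule exI[of _ a]) (simp add: a h)
qed

lemma chart_nbhd_open:
 assumes Q: "Q \<in> poly_funs n"
 shows "openin (flag_top n) (chart_nbhd Q)"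
proof -
 obtain h k where h: "h \<in> poly_funs n"
  "\<forall>a\<in>SLset n. chart_fun n g a ~= 0 --> h a = chart_fun n g a ^ k * Q (lower_part n (adj_mat g * a))"
  by (rule coord_numerator[OF Q])
 obtain D where D: "D \<in> poly_funs n" "\<forall>A\<in>carrier_mat n n. D A = chart_fun n g A" by (rule chart_fun_poly[OF g])
 show ?thesis
  unfolding openin_flag
 proof (intro conjI exI[of _ "{%A. D A * h A}"] ballI)
  show "chart_nbhd Q \<subseteq> flags n" by (auto simp: chart_nbhd_def)
  show "{%A. D A * h A} \<subseteq> poly_funs n" using poly_funs.mult[OF D(1) h(1)] by simp
  fix a assume a: "a \<in> SLset n"
  have "D a = chart_fun n g a" using D(2) SL_carrier[OF a] by simp
  then show "flag_proj n a \<in> chart_nbhd Q \<longleftrightarrow> (\<exists>f\<in>{%A. D A * h A}. f a ~= 0)"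
   unfolding chart_nbhd_proj[OF a] using h(2) a by auto
 qed
qed

lemma chart_nbhd_pt:
 assumes "Q (1\<^sub>m n) ~= 0"
 shows "pt \<in> chart_nbhd Q"
 unfolding chart_nbhd_proj[OF g]
 using chart_lowuni(2)[OF g one_lowuni] SL_one_mult(2)[OF g] SL_adj(2)[OF g] lower_part_lowuni[OF one_lowuni] assms by simp

lemma chart_nbhdE:
 assumes "q \<in> chart_nbhd Q"
 obtains u where "u \<in> lowuni n" "q = flag_proj n (g * u)" "Q u ~= 0"
proof -
 obtain a where a: "q = flag_proj n a" "a \<in> SLset n" "chart_fun n g a ~= 0" "Q (lower_part n (adj_mat g * a)) ~= 0"
  using assms unfolding chart_nbhd_def by auto
 obtain u where u: "u \<in> lowuni n" "chart n g a = g * u" "flag_proj n (g * u) = flag_proj n a" by (rule chart_section[OF g a(2,3)])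
 have "lower_part n (adj_mat g * a) = u"
  using lower_coords_proj[OF a(2)] lower_coords_chart[OF u(1)] u(3) by simp
 then show ?thesis using that u a by simp
qed

lemma chart_nbhd_germ:
 assumes Q: "Q \<in> poly_funs n" "Q (1\<^sub>m n) ~= 0"
 shows "openin (topo S) (chart_nbhd Q \<inter> X)" "pt \<in> chart_nbhd Q \<inter> X"
 using chart_nbhd_open[OF Q(1)] chart_nbhd_pt[of Q, OF Q(2)] gX
 by (auto simp: subspace_on_def openin_subtopology)

lemma open_nbhd_chart:
 assumes U: "openin (topo S) U" and p: "pt \<in> U"
 obtains f where "f \<in> poly_funs n" "f (1\<^sub>m n) ~= 0"
  "\<forall>u\<in>lowuni n. f u ~= 0 --> flag_proj n (g * u) \<in> X --> flag_proj n (g * u) \<in> U"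
proof -
 obtain T where T: "openin (flag_top n) T" "U = T \<inter> X"
  using U by (auto simp: subspace_on_def openin_subtopology)
 then obtain F where F: "F \<subseteq> poly_funs n" "\<forall>a\<in>SLset n. flag_proj n a \<in> T \<longleftrightarrow> (\<exists>f\<in>F. f a ~= 0)"
  unfolding openin_flag by (elim exE conjE)
 have "\<exists>f\<in>F. f g ~= 0" using bspec[OF F(2) g] p T(2) by simp
 then obtain f where f: "f \<in> F" "f g ~= 0" by (elim bexE)
 have fp: "f \<in> poly_funs n" using F(1) f(1) by (rule subsetD)
 obtain h where h: "h \<in> poly_funs n" "\<forall>A\<in>carrier_mat n n. h A = f (g * A)"
  using poly_funs_left_mult[OF SL_carrier[OF g] fp] by (elim bexE)
 show ?thesis
 proof (rule that[OF h(1)])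
  show "h (1\<^sub>m n) ~= 0" using h(2) f(2) SL_one_mult(2)[OF g] by simp
  show "\<forall>u\<in>lowuni n. h u ~= 0 --> flag_proj n (g * u) \<in> X --> flag_proj n (g * u) \<in> U"
  proof (intro ballI impI)
   fix u assume u: "u \<in> lowuni n" "h u ~= 0" "flag_proj n (g * u) \<in> X"
   have uS: "u \<in> SLset n" by (rule lowuni_SL[OF u(1)])
   have "f (g * u) ~= 0" using h(2) SL_carrier[OF uS] u(2) by simp
   then have "flag_proj n (g * u) \<in> T" using bspec[OF F(2) SL_mult[OF g uS]] f(1) by blast
   then show "flag_proj n (g * u) \<in> U" using T(2) u(3) by simp
  qed
 qed
qed

definition fraction_near :: "(complex mat set => complex) => (complex mat => complex) => (complex mat => complex) => bool" where
 "fraction_near f P Q \<longleftrightarrow> P \<in> poly_funs n & Q \<in> poly_funs n & Q (1\<^sub>m n) ~= 0 \<and>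
  (\<forall>u\<in>lowuni n. Q u ~= 0 --> flag_proj n (g * u) \<in> X --> f (flag_proj n (g * u)) = P u / Q u)"

lemma fraction_nearD:
 assumes "fraction_near f P Q"
 shows "P \<in> poly_funs n" "Q \<in> poly_funs n" "Q (1\<^sub>m n) ~= 0"
  "\<forall>u\<in>lowuni n. Q u ~= 0 --> flag_proj n (g * u) \<in> X --> f (flag_proj n (g * u)) = P u / Q u"
 using assms unfolding fraction_near_def by simp_all

text \<open>
Germs of regular functions are fractions of polynomials in the chart coordinates. In one direction a local
fraction on the group is pulled back along the section, in the other the denominators of the coordinates
are cleared by powers of \<open>chart_fun\<close>.
\<close>

lemma regular_at_iff:
 "regular_at S pt f \<longleftrightarrow> (\<exists>P Q. fraction_near f P Q)"
proof
 assume "regular_at S pt f"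
 then obtain U where U: "openin (topo S) U" "pt \<in> U" "regular_on S U f" unfolding regular_at_def by (elim exE conjE)
 have "\<forall>a\<in>U. \<exists>V g. openin (flag_top n) V & a \<in> V & regular_on (flag_variety n) V g & (\<forall>b \<in> V \<inter> U. f b = g b)"
  using U(3) by (simp add: subspace_on_def)
 from bspec[OF this U(2)] obtain V k where V: "openin (flag_top n) V" "pt \<in> V" "regular_on (flag_variety n) V k"
  "\<forall>b \<in> V \<inter> U. f b = k b" by (elim exE conjE)
 obtain P Q where PQ: "P \<in> poly_funs n" "Q \<in> poly_funs n" "Q g ~= 0"
   "\<forall>c\<in>SLset n. Q c ~= 0 --> flag_proj n c \<in> V --> k (flag_proj n c) = P c / Q c"
  using regular_flag_local[OF V(3) g V(2)] by (elim bexE conjE)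
 obtain P' where P': "P' \<in> poly_funs n" "\<forall>A\<in>carrier_mat n n. P' A = P (g * A)"
  using poly_funs_left_mult[OF SL_carrier[OF g] PQ(1)] by (elim bexE)
 obtain Q' where Q': "Q' \<in> poly_funs n" "\<forall>A\<in>carrier_mat n n. Q' A = Q (g * A)"
  using poly_funs_left_mult[OF SL_carrier[OF g] PQ(2)] by (elim bexE)
 have "openin (topo S) U" by (rule U(1))
 moreover have "openin (topo S) (V \<inter> X)" using V(1) by (auto simp: subspace_on_def openin_subtopology)
 ultimately have "openin (topo S) (U \<inter> (V \<inter> X))" by (rule openin_Int)
 then obtain h where h: "h \<in> poly_funs n" "h (1\<^sub>m n) ~= 0"
  "\<forall>u\<in>lowuni n. h u ~= 0 --> flag_proj n (g * u) \<in> X --> flag_proj n (g * u) \<in> U \<inter> (V \<inter> X)"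
  by (rule open_nbhd_chart) (use U(2) V(2) gX in simp)
 show "\<exists>P Q. fraction_near f P Q"
  unfolding fraction_near_def
 proof (rule exI[of _ "%A. P' A * h A"], rule exI[of _ "%A. Q' A * h A"], intro conjI ballI impI)
  show "(%A. P' A * h A) \<in> poly_funs n" "(%A. Q' A * h A) \<in> poly_funs n"
   by (intro poly_funs.mult P' Q' h)+
  show "Q' (1\<^sub>m n) * h (1\<^sub>m n) ~= 0" using Q'(2) PQ(3) h(2) SL_one_mult(2)[OF g] by simp
  fix u assume u: "u \<in> lowuni n" "Q' u * h u ~= 0" "flag_proj n (g * u) \<in> X"
  have uS: "u \<in> SLset n" by (rule lowuni_SL[OF u(1)])
  have nz: "Q' u ~= 0" "h u ~= 0" using u(2) by auto
  have i: "flag_proj n (g * u) \<in> U \<inter> (V \<inter> X)" using h(3) u(1,3) nz(2) by simp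
  then have "f (flag_proj n (g * u)) = k (flag_proj n (g * u))" using V(4) by simp
  also have "\<dots> = P (g * u) / Q (g * u)"
   using PQ(4) SL_mult[OF g uS] i nz(1) Q'(2) SL_carrier[OF uS] by simp
  also have "\<dots> = P' u / Q' u" using P'(2) Q'(2) SL_carrier[OF uS] by simp
  finally show "f (flag_proj n (g * u)) = P' u * h u / (Q' u * h u)" using nz by simp
 qed
next
 assume "\<exists>P Q. fraction_near f P Q"
 then obtain P Q where "fraction_near f P Q" by (elim exE)
 note fr = fraction_nearD[OF this]
 note P = fr(1) and Q = fr(2,3) and e = fr(4)
 obtain hP kP where hP: "hP \<in> poly_funs n"
  "\<forall>a\<in>SLset n. chart_fun n g a ~= 0 --> hP a = chart_fun n g a ^ kP * P (lower_part n (adj_mat g * a))"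
  by (rule coord_numerator[OF P])
 obtain hQ kQ where hQ: "hQ \<in> poly_funs n"
  "\<forall>a\<in>SLset n. chart_fun n g a ~= 0 --> hQ a = chart_fun n g a ^ kQ * Q (lower_part n (adj_mat g * a))"
  by (rule coord_numerator[OF Q(1)])
 obtain D where D: "D \<in> poly_funs n" "\<forall>A\<in>carrier_mat n n. D A = chart_fun n g A" by (rule chart_fun_poly[OF g])
 define k where "k q = P (lower_coords q) / Q (lower_coords q)" for q
 have rk: "regular_on (flag_variety n) (chart_nbhd Q) k"
 proof (rule regular_flagI[OF chart_nbhd_open[OF Q(1)], of "%A. D A ^ kQ * hP A" "%A. D A ^ kP * hQ A"])
  show "(%A. D A ^ kQ * hP A) \<in> poly_funs n" "(%A. D A ^ kP * hQ A) \<in> poly_funs n"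
   by (intro poly_funs.mult poly_funs_power D hP hQ)+
  show "\<forall>a\<in>SLset n. flag_proj n a \<in> chart_nbhd Q --> D a ^ kP * hQ a ~= 0 & k (flag_proj n a) = D a ^ kQ * hP a / (D a ^ kP * hQ a)"
  proof (intro ballI impI)
   fix a assume a: "a \<in> SLset n" "flag_proj n a \<in> chart_nbhd Q"
   have nz: "chart_fun n g a ~= 0" "Q (lower_part n (adj_mat g * a)) ~= 0" using a(2) unfolding chart_nbhd_proj[OF a(1)] by auto
   have Da: "D a = chart_fun n g a" using D(2) SL_carrier[OF a(1)] by simp
   show "D a ^ kP * hQ a ~= 0 & k (flag_proj n a) = D a ^ kQ * hP a / (D a ^ kP * hQ a)"
    unfolding k_def lower_coords_proj[OF a(1)] Da using hP(2) hQ(2) a(1) nz by (simp add: field_simps)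
  qed
 qed
 let ?U = "chart_nbhd Q \<inter> X"
 have U: "openin (topo S) ?U" "pt \<in> ?U" by (rule chart_nbhd_germ[OF Q])+
 have fk: "f q = k q" if q: "q \<in> ?U" for q
 proof -
  from q have "q \<in> chart_nbhd Q" by simp
  then obtain u where u: "u \<in> lowuni n" "q = flag_proj n (g * u)" "Q u ~= 0" by (rule chart_nbhdE)
  then show ?thesis using e q by (simp add: k_def lower_coords_chart)
 qed
 have "regular_on S ?U f"
  unfolding subspace_on_def fun_space.simps
 proof (intro conjI ballI)
  show "openin (subtopology (flag_top n) X) ?U" using U(1) by (simp add: subspace_on_def)
  fix a assume "a \<in> ?U"
  then show "\<exists>V g. openin (flag_top n) V & a \<in> V & regular_on (flag_variety n) V g & (\<forall>b \<in> V \<inter> ?U. f b = g b)"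
   using chart_nbhd_open[OF Q(1)] rk fk by (intro exI[of _ "chart_nbhd Q"] exI[of _ k]) simp
 qed
 then show "regular_at S pt f" unfolding regular_at_def using U by (intro exI[of _ ?U] conjI)
qed

lemma regular_at_poly:
 assumes P: "P \<in> poly_funs n"
 shows "regular_at S pt (%q. P (lower_coords q))"
 unfolding regular_at_iff fraction_near_def
 by (rule exI[of _ P], rule exI[of _ "%A. 1"]) (simp add: lower_coords_chart P poly_funs.const)

lemma regular_at_add_mult:
 assumes f: "regular_at S pt f" and h: "regular_at S pt h"
 shows "regular_at S pt (%a. f a + h a)" "regular_at S pt (%a. f a * h a)"
proof -
 obtain P Q where "fraction_near f P Q" using f unfolding regular_at_iff by (elim exE)
 note PQ = fraction_nearD[OF this]
 obtain P' Q' where "fraction_near h P' Q'" using h unfolding regular_at_iff by (elim exE)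
 note PQ' = fraction_nearD[OF this]
 have e: "f (flag_proj n (g * u)) = P u / Q u" "h (flag_proj n (g * u)) = P' u / Q' u" "Q u ~= 0" "Q' u ~= 0"
  if "u \<in> lowuni n" "Q u * Q' u ~= 0" "flag_proj n (g * u) \<in> X" for u
  using PQ(4) PQ'(4) that by simp_all
 have "fraction_near (%a. f a + h a) (%A. P A * Q' A + P' A * Q A) (%A. Q A * Q' A)"
  unfolding fraction_near_def
 proof (intro conjI ballI impI poly_funs.add poly_funs.mult PQ(1,2) PQ'(1,2))
  show "Q (1\<^sub>m n) * Q' (1\<^sub>m n) ~= 0" using PQ(3) PQ'(3) by simp
  fix u assume "u \<in> lowuni n" "Q u * Q' u ~= 0" "flag_proj n (g * u) \<in> X"
  from e[OF this] show "f (flag_proj n (g * u)) + h (flag_proj n (g * u)) = (P u * Q' u + P' u * Q u) / (Q u * Q' u)"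
   by (simp add: field_simps)
 qed
 then show "regular_at S pt (%a. f a + h a)" unfolding regular_at_iff by (intro exI)
 have "fraction_near (%a. f a * h a) (%A. P A * P' A) (%A. Q A * Q' A)"
  unfolding fraction_near_def
 proof (intro conjI ballI impI poly_funs.mult PQ(1,2) PQ'(1,2))
  show "Q (1\<^sub>m n) * Q' (1\<^sub>m n) ~= 0" using PQ(3) PQ'(3) by simp
  fix u assume "u \<in> lowuni n" "Q u * Q' u ~= 0" "flag_proj n (g * u) \<in> X"
  from e[OF this] show "f (flag_proj n (g * u)) * h (flag_proj n (g * u)) = (P u * P' u) / (Q u * Q' u)" by simp
 qed
 then show "regular_at S pt (%a. f a * h a)" unfolding regular_at_iff by (intro exI)
qed

lemma regular_at_const: "regular_at S pt (%a. c)"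
 using regular_at_poly[OF poly_funs.const] .

end

section \<open>Derivations along one-parameter curves\<close>

definition lowpairs :: "nat => (nat \<times> nat) set" where
 "lowpairs n = {(r, c). c < r & r < n}"

abbreviation partials :: "nat => (complex mat => complex) => (nat \<times> nat => complex) => bool" where
 "partials n P d \<equiv> \<forall>(r, c)\<in>lowpairs n. ((%s. P (root_elem n r c s)) has_field_derivative d (r, c)) (at 0)"

lemma finite_lowpairs: "finite (lowpairs n)"
 by (rule finite_subset[of _ "{..<n} \<times> {..<n}"]) (auto simp: lowpairs_def)

lemma poly_fun_root_elem:
 assumes f: "f \<in> poly_funs n"
 shows "\<exists>P. \<forall>s. f (root_elem n r c s) = poly P s"
proof (rule poly_fun_curve[OF f])
 show "poly_curve n (root_elem n r c)"
  unfolding poly_curve_def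
 proof (intro allI impI)
  fix i j assume ij: "i < n" "j < n"
  have "\<forall>s. root_elem n r c s $$ (i, j) = poly (if i = j then [:1:] else if i = r & j = c then [:0, 1:] else 0) s"
   using ij by (auto simp: root_elem_entry)
  then show "\<exists>P. \<forall>s. root_elem n r c s $$ (i, j) = poly P s" by (rule exI)
 qed
qed

lemma eventually_root_elem:
 assumes f: "f \<in> poly_funs n" and nz: "f (1\<^sub>m n) ~= 0"
 shows "eventually (%s. f (root_elem n r c s) ~= 0) (nhds 0)"
proof -
 obtain P where P: "\<forall>s. f (root_elem n r c s) = poly P s" using poly_fun_root_elem[OF f] ..
 have P0: "poly P 0 ~= 0" using spec[OF P, of 0] nz by (simp add: root_elem_zero)
 then have "finite {s. poly P s = 0}" by (intro poly_roots_finite) auto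
 then have "open (- {s. poly P s = 0})" by (intro open_Compl finite_imp_closed)
 then have "eventually (%s. s \<in> - {s. poly P s = 0}) (nhds 0)" by (rule eventually_nhds_in_open) (use P0 in simp)
 then show ?thesis by (rule eventually_mono) (use P in simp)
qed

lemma DERIV_root_elem:
 assumes f: "f \<in> poly_funs n"
 shows "\<exists>d. ((%s. f (root_elem n r c s)) has_field_derivative d) (at 0)"
proof -
 obtain P where P: "\<forall>s. f (root_elem n r c s) = poly P s" using poly_fun_root_elem[OF f] ..
 then have eq: "(%s. f (root_elem n r c s)) = poly P" by auto
 show ?thesis unfolding eq by (rule exI, rule poly_DERIV)
qed

lemma tangentD:
 assumes "D \<in> tangent_space S p"
 shows "regular_at S p f ==> regular_at S p h ==> D (%a. f a + h a) = D f + D h"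
  and "regular_at S p f ==> regular_at S p h ==> D (%a. f a * h a) = f p * D h + D f * h p"
  and "regular_at S p f ==> D (%a. c * f a) = c * D f"
  and "regular_at S p f ==> regular_at S p h ==> openin (topo S) U ==> p \<in> U ==> \<forall>a\<in>U. f a = h a ==> D f = D h"
  and "~ regular_at S p f ==> D f = 0"
proof -
 note all = assms[unfolded tangent_space_def mem_Collect_eq]
 note 1 = all[THEN conjunct1] and 2 = all[THEN conjunct2, THEN conjunct1]
  and 3 = all[THEN conjunct2, THEN conjunct2, THEN conjunct1] and 4 = all[THEN conjunct2, THEN conjunct2, THEN conjunct2]
 show "regular_at S p f ==> regular_at S p h ==> D (%a. f a + h a) = D f + D h"
  "regular_at S p f ==> regular_at S p h ==> D (%a. f a * h a) = f p * D h + D f * h p"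
  using spec[OF spec[OF 1, of f], of h] by simp_all
 show "regular_at S p f ==> D (%a. c * f a) = c * D f" using spec[OF spec[OF 2, of c], of f] by simp
 show "~ regular_at S p f ==> D f = 0" using spec[OF 4, of f] by simp
 show "regular_at S p f ==> regular_at S p h ==> openin (topo S) U ==> p \<in> U ==> \<forall>a\<in>U. f a = h a ==> D f = D h"
  using spec[OF spec[OF 3, of f], of h] by metis
qed

lemma sum_functional_apply: "(\<Sum>t\<in>A. F t) f = (\<Sum>t\<in>A. (F t f :: complex))"
 by (induction A rule: infinite_finite_induct) simp_all

context flag_chart
begin

abbreviation coordinate :: "nat \<times> nat => complex mat set => complex" where
 "coordinate t q \<equiv> lower_coords q $$ t"

lemma regular_at_coordinate: "r < n ==> c < n ==> regular_at S pt (coordinate (r, c))"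
 using regular_at_poly[OF poly_funs.entry] by simp

lemma tangent_chart_cong:
 assumes D: "D \<in> tangent_space S pt" and f: "regular_at S pt f" and h: "regular_at S pt h"
  and Q: "Q \<in> poly_funs n" "Q (1\<^sub>m n) ~= 0"
  and e: "\<forall>u\<in>lowuni n. Q u ~= 0 --> flag_proj n (g * u) \<in> X --> f (flag_proj n (g * u)) = h (flag_proj n (g * u))"
 shows "D f = D h"
proof (rule tangentD(4)[OF D f h chart_nbhd_germ[OF Q]], rule ballI)
 fix a assume a: "a \<in> chart_nbhd Q \<inter> X"
 then have "a \<in> chart_nbhd Q" by simp
 then obtain u where "u \<in> lowuni n" "a = flag_proj n (g * u)" "Q u ~= 0" by (rule chart_nbhdE)
 then show "f a = h a" using e a by simp
qed

lemma tangent_const: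
 assumes D: "D \<in> tangent_space S pt"
 shows "D (%a. c) = 0"
proof -
 have "D (%a. 1 * 1) = 1 * D (%a. 1) + D (%a. 1) * 1"
  by (rule tangentD(2)[OF D regular_at_const regular_at_const])
 then have "D (%a. 1) = 0" by simp
 moreover have "D (%a. c * 1) = c * D (%a. 1)" by (rule tangentD(3)[OF D regular_at_const])
 ultimately show ?thesis by simp
qed

text \<open>
A derivation is determined by its values on the coordinates, the coefficients being the partial
derivatives; \<open>d (r, c)\<close> is expressed as a derivative along a curve.
\<close>

lemma tangent_poly:
 assumes D: "D \<in> tangent_space S pt" and P: "P \<in> poly_funs n"
 shows "\<exists>d. partials n P d \<and>
  D (%q. P (lower_coords q)) = (\<Sum>t\<in>lowpairs n. D (coordinate t) * d t)"
 using P
proof induction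
 case (const a)
 then show ?case by (intro exI[of _ "%t. 0"]) (simp add: tangent_const[OF D])
next
 case (entry i j)
 show ?case
 proof (cases "j < i")
  case True
  then have m: "(i, j) \<in> lowpairs n" using entry by (simp add: lowpairs_def)
  show ?thesis
  proof (intro exI[of _ "%t. if t = (i, j) then 1 else 0"] conjI)
   show "\<forall>(r, c)\<in>lowpairs n. ((%s. root_elem n r c s $$ (i, j)) has_field_derivative (if (r, c) = (i, j) then 1 else 0)) (at 0)"
    using entry True by (auto simp: root_elem_entry)
   show "D (coordinate (i, j)) = (\<Sum>t\<in>lowpairs n. D (coordinate t) * (if t = (i, j) then 1 else 0))"
    using m finite_lowpairs[of n] by (simp add: if_distrib[of "%x. _ * x"] cong: if_cong)
  qed
 next
  case False
  have "D (coordinate (i, j)) = D (%q. if i = j then 1 else 0)"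
   by (rule tangent_chart_cong[OF D regular_at_coordinate[OF entry] regular_at_const poly_funs.const[of 1]])
    (use entry False in \<open>auto simp: lower_coords_chart lowuni_def\<close>)
  also have "\<dots> = 0" by (rule tangent_const[OF D])
  finally have z: "D (coordinate (i, j)) = 0" .
  show ?thesis
  proof (intro exI[of _ "%t. 0"] conjI)
   show "\<forall>(r, c)\<in>lowpairs n. ((%s. root_elem n r c s $$ (i, j)) has_field_derivative 0) (at 0)"
   proof (rule ballI, clarify)
    fix r c assume "(r, c) \<in> lowpairs n"
    then have "(%s. root_elem n r c s $$ (i, j)) = (%s. if i = j then 1 else 0)"
     using entry False by (auto simp: root_elem_entry lowpairs_def)
    then show "((%s. root_elem n r c s $$ (i, j)) has_field_derivative 0) (at 0)" by simp
   qed
  qed (simp add: z)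
 qed
next
 case (add f h)
 obtain d where d: "partials n f d"
  "D (%q. f (lower_coords q)) = (\<Sum>t\<in>lowpairs n. D (coordinate t) * d t)" using add.IH(1) by (elim exE conjE)
 obtain e where e: "partials n h e"
  "D (%q. h (lower_coords q)) = (\<Sum>t\<in>lowpairs n. D (coordinate t) * e t)" using add.IH(2) by (elim exE conjE)
 show ?case
 proof (intro exI[of _ "%t. d t + e t"] conjI)
  show "\<forall>(r, c)\<in>lowpairs n. ((%s. f (root_elem n r c s) + h (root_elem n r c s)) has_field_derivative d (r, c) + e (r, c)) (at 0)"
   using d(1) e(1) by (auto intro!: DERIV_add)
  show "D (%q. f (lower_coords q) + h (lower_coords q)) = (\<Sum>t\<in>lowpairs n. D (coordinate t) * (d t + e t))"
   unfolding tangentD(1)[OF D regular_at_poly[OF add.hyps(1)] regular_at_poly[OF add.hyps(2)]] d(2) e(2)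
   by (simp add: algebra_simps sum.distrib)
 qed
next
 case (mult f h)
 obtain d where d: "partials n f d"
  "D (%q. f (lower_coords q)) = (\<Sum>t\<in>lowpairs n. D (coordinate t) * d t)" using mult.IH(1) by (elim exE conjE)
 obtain e where e: "partials n h e"
  "D (%q. h (lower_coords q)) = (\<Sum>t\<in>lowpairs n. D (coordinate t) * e t)" using mult.IH(2) by (elim exE conjE)
 show ?case
 proof (intro exI[of _ "%t. d t * h (1\<^sub>m n) + e t * f (1\<^sub>m n)"] conjI)
  show "\<forall>(r, c)\<in>lowpairs n. ((%s. f (root_elem n r c s) * h (root_elem n r c s)) has_field_derivative
    d (r, c) * h (1\<^sub>m n) + e (r, c) * f (1\<^sub>m n)) (at 0)"
  proof (rule ballI, clarify)
   fix r c assume "(r, c) \<in> lowpairs n"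
   then have "((%s. f (root_elem n r c s)) has_field_derivative d (r, c)) (at 0)"
     "((%s. h (root_elem n r c s)) has_field_derivative e (r, c)) (at 0)" using d(1) e(1) by auto
   from DERIV_mult[OF this]
   show "((%s. f (root_elem n r c s) * h (root_elem n r c s)) has_field_derivative d (r, c) * h (1\<^sub>m n) + e (r, c) * f (1\<^sub>m n)) (at 0)"
    by (simp add: root_elem_zero algebra_simps)
  qed
  show "D (%q. f (lower_coords q) * h (lower_coords q)) = (\<Sum>t\<in>lowpairs n. D (coordinate t) * (d t * h (1\<^sub>m n) + e t * f (1\<^sub>m n)))"
   unfolding tangentD(2)[OF D regular_at_poly[OF mult.hyps(1)] regular_at_poly[OF mult.hyps(2)]] d(2) e(2) lower_coords_pt
   by (simp add: algebra_simps sum.distrib sum_distrib_left)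
 qed
qed

definition curve_derivation :: "nat \<times> nat => (complex mat set => complex) => complex" where
 "curve_derivation t f = (if regular_at S pt f
   then (THE d. ((%s. f (flag_proj n (g * root_elem n (fst t) (snd t) s))) has_field_derivative d) (at 0)) else 0)"

lemma curve_fun_eventually:
 assumes rc: "c < r" and inX: "\<forall>s. flag_proj n (g * root_elem n r c s) \<in> X"
  and Q: "Q \<in> poly_funs n" "Q (1\<^sub>m n) ~= 0"
  and e: "\<forall>u\<in>lowuni n. Q u ~= 0 --> flag_proj n (g * u) \<in> X --> B u"
 shows "eventually (%s. Q (root_elem n r c s) ~= 0 & B (root_elem n r c s)) (nhds 0)"
 by (rule eventually_mono[OF eventually_root_elem[OF Q, of r c]]) (use e inX root_elem_lowuni[OF rc] in simp)

lemma curve_derivation: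
 assumes rc: "c < r" and inX: "\<forall>s. flag_proj n (g * root_elem n r c s) \<in> X" and f: "regular_at S pt f"
 shows "((%s. f (flag_proj n (g * root_elem n r c s))) has_field_derivative curve_derivation (r, c) f) (at 0)"
proof -
 obtain P Q where "fraction_near f P Q" using f unfolding regular_at_iff by (elim exE)
 note PQ = fraction_nearD[OF this]
 obtain p q where p: "((%s. P (root_elem n r c s)) has_field_derivative p) (at 0)"
  and q: "((%s. Q (root_elem n r c s)) has_field_derivative q) (at 0)"
  using DERIV_root_elem[OF PQ(1)] DERIV_root_elem[OF PQ(2)] by blast
 have Q0: "Q (root_elem n r c 0) ~= 0" using PQ(3) by (simp add: root_elem_zero)
 note dq = DERIV_quotient[OF p q Q0]
 have "eventually (%s. Q (root_elem n r c s) ~= 0 & f (flag_proj n (g * root_elem n r c s)) = P (root_elem n r c s) / Q (root_elem n r c s)) (nhds 0)"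
  by (rule curve_fun_eventually[OF rc inX PQ(2-4)])
 then have "eventually (%s. f (flag_proj n (g * root_elem n r c s)) = P (root_elem n r c s) / Q (root_elem n r c s)) (nhds 0)"
  by (rule eventually_mono) simp
 from DERIV_cong_ev[OF refl this refl] dq
 obtain d where d: "((%s. f (flag_proj n (g * root_elem n r c s))) has_field_derivative d) (at 0)" by blast
 have "(THE d. ((%s. f (flag_proj n (g * root_elem n r c s))) has_field_derivative d) (at 0)) = d"
  by (rule the_equality[of "%d. ((%s. f (flag_proj n (g * root_elem n r c s))) has_field_derivative d) (at 0)", OF d])
   (rule DERIV_unique[OF _ d])
 then show ?thesis using d f by (simp add: curve_derivation_def)
qed

lemma curve_derivation_unique:
 assumes "c < r" "\<forall>s. flag_proj n (g * root_elem n r c s) \<in> X" "regular_at S pt f"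
  and "((%s. f (flag_proj n (g * root_elem n r c s))) has_field_derivative d) (at 0)"
 shows "curve_derivation (r, c) f = d"
 by (rule DERIV_unique[OF curve_derivation[OF assms(1-3)] assms(4)])

text \<open>If the whole curve stays in \<open>X\<close>, differentiation along it is a point derivation of \<open>X\<close>.\<close>

lemma curve_derivation_tangent:
 assumes rc: "c < r" and inX: "\<forall>s. flag_proj n (g * root_elem n r c s) \<in> X"
 shows "curve_derivation (r, c) \<in> tangent_space S pt"
 unfolding tangent_space_def mem_Collect_eq
proof (intro conjI allI impI; (elim conjE)?)
 have z: "flag_proj n (g * root_elem n r c 0) = pt" using SL_one_mult(2)[OF g] by (simp add: root_elem_zero)
 {
  fix f h assume f: "regular_at S pt f" and h: "regular_at S pt h"
  show "curve_derivation (r, c) (%a. f a + h a) = curve_derivation (r, c) f + curve_derivation (r, c) h"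
   by (rule curve_derivation_unique[OF rc inX regular_at_add_mult(1)[OF f h]])
    (rule DERIV_add[OF curve_derivation[OF rc inX f] curve_derivation[OF rc inX h]])
  show "curve_derivation (r, c) (%a. f a * h a) = f pt * curve_derivation (r, c) h + curve_derivation (r, c) f * h pt"
   using curve_derivation_unique[OF rc inX regular_at_add_mult(2)[OF f h]
     DERIV_mult[OF curve_derivation[OF rc inX f] curve_derivation[OF rc inX h]]]
   by (simp add: z algebra_simps)
 }
 {
  fix k f assume f: "regular_at S pt f"
  show "curve_derivation (r, c) (%a. k * f a) = k * curve_derivation (r, c) f"
   by (rule curve_derivation_unique[OF rc inX regular_at_add_mult(2)[OF regular_at_const f]])
    (rule DERIV_cmult[OF curve_derivation[OF rc inX f]])
 }
 {
  fix f h assume f: "regular_at S pt f" and h: "regular_at S pt h"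
   and "\<exists>U. openin (topo S) U & pt \<in> U & (\<forall>a\<in>U. f a = h a)"
  then obtain U where U: "openin (topo S) U" "pt \<in> U" "\<forall>a\<in>U. f a = h a" by (elim exE conjE)
  obtain k where k: "k \<in> poly_funs n" "k (1\<^sub>m n) ~= 0"
   "\<forall>u\<in>lowuni n. k u ~= 0 --> flag_proj n (g * u) \<in> X --> flag_proj n (g * u) \<in> U"
   by (rule open_nbhd_chart[OF U(1,2)])
  have "eventually (%s. f (flag_proj n (g * root_elem n r c s)) = h (flag_proj n (g * root_elem n r c s))) (nhds 0)"
   by (rule eventually_mono[OF curve_fun_eventually[OF rc inX k]]) (use U(3) in simp)
  from DERIV_cong_ev[OF refl this refl] curve_derivation[OF rc inX h]
  have "((%s. f (flag_proj n (g * root_elem n r c s))) has_field_derivative curve_derivation (r, c) h) (at 0)" by simp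
  then show "curve_derivation (r, c) f = curve_derivation (r, c) h"
   by (rule curve_derivation_unique[OF rc inX f])
 }
 {
  fix f assume "~ regular_at S pt f"
  then show "curve_derivation (r, c) f = 0" by (simp add: curve_derivation_def)
 }
qed

lemma curve_derivation_coordinate:
 assumes rc: "c < r" "r < n" and inX: "\<forall>s. flag_proj n (g * root_elem n r c s) \<in> X" and ij: "j < i" "i < n"
 shows "curve_derivation (r, c) (coordinate (i, j)) = (if (i, j) = (r, c) then 1 else 0)"
proof (rule curve_derivation_unique[OF rc(1) inX regular_at_coordinate])
 have "(%s. coordinate (i, j) (flag_proj n (g * root_elem n r c s))) = (%s. if (i, j) = (r, c) then s else 0)"
  using lower_coords_chart[OF root_elem_lowuni[OF rc(1)]] ij rc by (auto simp: root_elem_entry)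
 then show "((%s. coordinate (i, j) (flag_proj n (g * root_elem n r c s))) has_field_derivative (if (i, j) = (r, c) then 1 else 0)) (at 0)"
  by (cases "(i, j) = (r, c)") (simp_all del: prod.inject)
qed (use ij in auto)

lemma tangent_expansion:
 assumes D: "D \<in> tangent_space S pt" and f: "regular_at S pt f"
  and G: "G \<subseteq> lowpairs n" "\<forall>t\<in>lowpairs n - G. D (coordinate t) = 0"
  and inX: "\<forall>(r, c)\<in>G. \<forall>s. flag_proj n (g * root_elem n r c s) \<in> X"
 shows "D f = (\<Sum>t\<in>G. D (coordinate t) * curve_derivation t f)"
proof -
 obtain P Q where "fraction_near f P Q" using f unfolding regular_at_iff by (elim exE)
 note PQ = fraction_nearD[OF this]
 obtain p where p: "partials n P p"
  "D (%q. P (lower_coords q)) = (\<Sum>t\<in>lowpairs n. D (coordinate t) * p t)"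
  using tangent_poly[OF D PQ(1)] by (elim exE conjE)
 obtain q where q: "partials n Q q"
  "D (%z. Q (lower_coords z)) = (\<Sum>t\<in>lowpairs n. D (coordinate t) * q t)"
  using tangent_poly[OF D PQ(2)] by (elim exE conjE)
 have restrict: "(\<Sum>t\<in>lowpairs n. D (coordinate t) * d t) = (\<Sum>t\<in>G. D (coordinate t) * d t)" for d
  by (rule sum.mono_neutral_right) (use G finite_lowpairs in auto)
 have eq: "D (%a. f a * Q (lower_coords a)) = D (%a. P (lower_coords a))"
  by (rule tangent_chart_cong[OF D regular_at_add_mult(2)[OF f regular_at_poly[OF PQ(2)]] regular_at_poly[OF PQ(1)] PQ(2,3)])
   (use PQ(4) in \<open>simp add: lower_coords_chart\<close>)
 have "D (%a. f a * Q (lower_coords a)) = f pt * D (%a. Q (lower_coords a)) + D f * Q (1\<^sub>m n)"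
  using tangentD(2)[OF D f regular_at_poly[OF PQ(2)]] by (simp add: lower_coords_pt)
 then have 1: "D f * Q (1\<^sub>m n) = (\<Sum>t\<in>G. D (coordinate t) * p t) - f pt * (\<Sum>t\<in>G. D (coordinate t) * q t)"
  using eq p(2) q(2) restrict by (simp add: algebra_simps)
 have 2: "curve_derivation t f * Q (1\<^sub>m n) = p t - f pt * q t" if t: "t \<in> G" for t
 proof -
  obtain r c where rc: "t = (r, c)" by (cases t)
  have cr: "c < r" using t G(1) rc by (auto simp: lowpairs_def)
  have iX: "\<forall>s. flag_proj n (g * root_elem n r c s) \<in> X" using inX t rc by blast
  have dp: "((%s. P (root_elem n r c s)) has_field_derivative p t) (at 0)" and dq: "((%s. Q (root_elem n r c s)) has_field_derivative q t) (at 0)"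
   using p(1) q(1) t G(1) rc by auto
  have "eventually (%s. Q (root_elem n r c s) ~= 0 & f (flag_proj n (g * root_elem n r c s)) = P (root_elem n r c s) / Q (root_elem n r c s)) (nhds 0)"
   by (rule curve_fun_eventually[OF cr iX PQ(2-4)])
  then have "eventually (%s. f (flag_proj n (g * root_elem n r c s)) * Q (root_elem n r c s) = P (root_elem n r c s)) (nhds 0)"
   by (rule eventually_mono) simp
  from DERIV_cong_ev[OF refl this refl] dp
  have "((%s. f (flag_proj n (g * root_elem n r c s)) * Q (root_elem n r c s)) has_field_derivative p t) (at 0)" by simp
  from DERIV_unique[OF this DERIV_mult[OF curve_derivation[OF cr iX f] dq]]
  show ?thesis using SL_one_mult(2)[OF g] by (simp add: rc root_elem_zero algebra_simps)
 qed
 have "(\<Sum>t\<in>G. D (coordinate t) * curve_derivation t f) * Q (1\<^sub>m n) = (\<Sum>t\<in>G. D (coordinate t) * (curve_derivation t f * Q (1\<^sub>m n)))"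
  by (simp add: sum_distrib_right mult.assoc)
 also have "\<dots> = (\<Sum>t\<in>G. D (coordinate t) * (p t - f pt * q t))" by (rule sum.cong) (simp_all add: 2)
 also have "\<dots> = D f * Q (1\<^sub>m n)" unfolding 1 by (simp add: algebra_simps sum_subtractf sum_distrib_left)
 finally show ?thesis using PQ(3) by simp
qed

text \<open>
The curves staying in \<open>X\<close> give independent derivations, dual to their coordinates. They span if every
derivation kills the remaining coordinates.
\<close>

lemma tangent_dim:
 assumes G: "G \<subseteq> lowpairs n" and z: "\<forall>D\<in>tangent_space S pt. \<forall>t\<in>lowpairs n - G. D (coordinate t) = 0"
  and inX: "\<forall>(r, c)\<in>G. \<forall>s. flag_proj n (g * root_elem n r c s) \<in> X"
 shows "vector_space.dim scale_functional (tangent_space S pt) = card G"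
proof -
 interpret V: vector_space "scale_functional :: complex => ((complex mat set => complex) => complex) => _"
  by (rule vector_space_scale_functional)
 have fin: "finite G" by (rule finite_subset[OF G finite_lowpairs])
 have T: "curve_derivation t \<in> tangent_space S pt" if "t \<in> G" for t
 proof -
  obtain r c where rc: "t = (r, c)" by (cases t)
  show ?thesis unfolding rc by (rule curve_derivation_tangent) (use that rc G inX in \<open>auto simp: lowpairs_def\<close>)
 qed
 have \<delta>: "curve_derivation t (coordinate t') = (if t' = t then 1 else 0)" if "t \<in> G" "t' \<in> G" for t t'
 proof -
  obtain r c where rc: "t = (r, c)" by (cases t)
  obtain i j where ij: "t' = (i, j)" by (cases t')
  show ?thesis unfolding rc ij by (rule curve_derivation_coordinate) (use that rc ij G inX in \<open>auto simp: lowpairs_def\<close>)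
 qed
 have inj: "inj_on curve_derivation G"
 proof (rule inj_onI)
  fix t t' assume "t \<in> G" "t' \<in> G" "curve_derivation t = curve_derivation t'"
  then show "t = t'" using \<delta>[of t t] \<delta>[of t' t] by (metis zero_neq_one)
 qed
 show ?thesis
 proof (rule V.dim_unique)
  show "curve_derivation ` G \<subseteq> tangent_space S pt" using T by blast
  show "tangent_space S pt \<subseteq> V.span (curve_derivation ` G)"
  proof
   fix D assume D: "D \<in> tangent_space S pt"
   have "D = (\<Sum>t\<in>G. scale_functional (D (coordinate t)) (curve_derivation t))"
   proof
    fix f show "D f = (\<Sum>t\<in>G. scale_functional (D (coordinate t)) (curve_derivation t)) f"
    proof (cases "regular_at S pt f")
     case True
     show ?thesis unfolding sum_functional_apply
      by (rule tangent_expansion[OF D True G _ inX]) (use z D in blast)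
    next
     case False
     then show ?thesis unfolding sum_functional_apply using tangentD(5)[OF D] by (simp add: curve_derivation_def)
    qed
   qed
   moreover have "(\<Sum>t\<in>G. scale_functional (D (coordinate t)) (curve_derivation t)) \<in> V.span (curve_derivation ` G)"
    by (intro V.span_sum V.span_scale V.span_base) simp
   ultimately show "D \<in> V.span (curve_derivation ` G)" by simp
  qed
  show "V.independent (curve_derivation ` G)"
  proof -
   have ind: "\<forall>E\<in>curve_derivation ` G. a E = 0"
    if s: "(\<Sum>E\<in>curve_derivation ` G. scale_functional (a E) E) = 0" for a
   proof
    fix E assume "E \<in> curve_derivation ` G"
    then obtain t where t: "t \<in> G" "E = curve_derivation t" by blast
    have "0 = (\<Sum>E\<in>curve_derivation ` G. scale_functional (a E) E) (coordinate t)" unfolding s by simp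
    also have "\<dots> = (\<Sum>t'\<in>G. a (curve_derivation t') * curve_derivation t' (coordinate t))"
     unfolding sum_functional_apply sum.reindex[OF inj] by simp
    also have "\<dots> = (\<Sum>t'\<in>G. if t' = t then a E else 0)" by (rule sum.cong) (use \<delta> t in auto)
    also have "\<dots> = a E" using t fin by simp
    finally show "a E = 0" by simp
   qed
   have finI: "finite (curve_derivation ` G)" using fin by simp
   show ?thesis
    apply (rule V.independent_if_scalars_zero[OF finI])
    subgoal for a E by (rule bspec[OF ind[of a]])
    done
  qed
  show "card (curve_derivation ` G) = card G" by (rule card_image[OF inj])
 qed
qed

end

section \<open>Tangent spaces of Schubert varieties\<close>

lemma det_zero_row:
 fixes A :: "complex mat"
 assumes "A \<in> carrier_mat s s" "i < s" "\<forall>j<s. A $$ (i, j) = 0"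
 shows "det A = 0"
 unfolding laplace_expansion_row[OF assms(1,2)] by (rule sum.neutral) (use assms(3) in simp)

lemma det_zero_column:
 fixes A :: "complex mat"
 assumes "A \<in> carrier_mat s s" "j < s" "\<forall>i<s. A $$ (i, j) = 0"
 shows "det A = 0"
 unfolding laplace_expansion_column[OF assms(1,2)] by (rule sum.neutral) (use assms(3) in simp)

lemma minor_perm_rep_mult:
 assumes v: "v permutes {1..n}" and A: "A \<in> carrier_mat n n" and \<rho>: "\<forall>i<s. \<rho> i < n" and \<kappa>: "\<forall>j<s. \<kappa> j < n"
 shows "minor (%i. v (Suc (\<rho> i)) - 1) \<kappa> s (perm_rep n v * A) = det (mat s s (%(i, j). eps v (\<rho> i) * A $$ (\<rho> i, \<kappa> j)))"
 unfolding minor_def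
 by (rule arg_cong[where f = det], rule cong_mat[OF refl refl]) (use perm_rep_mult[OF v A] \<rho> \<kappa> in simp)

text \<open>
For a good pair the curve through the point stays in \<open>X\<^sub>w\<close>. For a bad pair there is a block \<open>(p, q)\<close> in
its rectangle where \<open>v\<close> and \<open>w\<close> have equally many points \<open>k\<close>. The minor of size \<open>k + 1\<close> on the points of
\<open>v\<close> and on the entry \<open>(r, c)\<close> vanishes on \<open>X\<^sub>w\<close>, but its partial derivative at the point is nonzero for
the coordinate \<open>(r, c)\<close> and zero for all others; so every derivation kills this coordinate.
\<close>

lemma schubert_tangent_dim:
 assumes v: "v permutes {1..n}" and w: "w permutes {1..n}" and vw: "bruhat_le v w" and p: "p \<in> schubert_cell n v"
 shows "vector_space.dim scale_functional (tangent_space (subspace_on (flag_variety n) (schubert_variety n w)) p) = tdim n v w"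
proof -
 obtain b where b: "b \<in> borel_subgroup n" "p = flag_proj n (b * perm_rep n v)" by (rule cellE[OF p])
 have bS: "b \<in> SLset n" by (rule borel_SL[OF b(1)])
 have PS: "perm_rep n v \<in> SLset n" by (rule perm_rep_SL[OF v])
 define g where "g = b * perm_rep n v"
 have g: "g \<in> SLset n" unfolding g_def by (rule borel_perm_SL[OF v b(1)])
 have CX: "schubert_cell n v \<subseteq> schubert_variety n w" by (rule cell_subset_if_bruhat[OF v w vw])
 have pg: "p = flag_proj n g" using b(2) by (simp add: g_def)
 interpret flag_chart n "schubert_variety n w" g
  by (unfold_locales, rule schubert_flags, rule g) (use CX p pg in auto)
 define G where "G = {(r, c). (r, c) \<in> lowpairs n & good v w (Suc c) (Suc r)}"
 have inj: "v i = v j \<longleftrightarrow> i = j" for i j using permutes_inj[OF v] by (auto dest: injD)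
 have "vector_space.dim scale_functional (tangent_space S pt) = card G"
 proof (rule tangent_dim)
  show "G \<subseteq> lowpairs n" by (auto simp: G_def)
  show "\<forall>(r, c)\<in>G. \<forall>s. flag_proj n (g * root_elem n r c s) \<in> schubert_variety n w"
  proof (rule ballI, clarify)
   fix r c s assume "(r, c) \<in> G"
   then have rc: "c < r" "r < n" and gd: "good v w (Suc c) (Suc r)" by (auto simp: G_def lowpairs_def)
   show "flag_proj n (g * root_elem n r c s) \<in> schubert_variety n w"
   proof (cases "v (Suc r) < v (Suc c) \<or> s = 0")
    case True
    then show ?thesis unfolding g_def by (intro subsetD[OF CX] curve_in_cell[OF v b(1) rc])
   next
    case False
    then have lt: "v (Suc c) < v (Suc r)" "s ~= 0" using inj[of "Suc c" "Suc r"] rc by auto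
    have "v \<circ> transpose (Suc c) (Suc r) permutes {1..n}"
     using rc by (intro permutes_compose[OF permutes_swap_id v]) auto
    from cell_subset_if_bruhat[OF this w gd[unfolded good_def]]
    show ?thesis unfolding g_def by (rule subsetD) (rule curve_in_larger_cell[OF v b(1) rc lt])
   qed
  qed
  show "\<forall>D\<in>tangent_space S pt. \<forall>t\<in>lowpairs n - G. D (coordinate t) = 0"
  proof (intro ballI)
   fix D t assume D: "D \<in> tangent_space S pt" and t: "t \<in> lowpairs n - G"
   obtain r c where rct: "t = (r, c)" by (cases t)
   have rc: "c < r" "r < n" and bad: "~ good v w (Suc c) (Suc r)" using t rct by (auto simp: G_def lowpairs_def)
   have lt: "v (Suc c) < v (Suc r)"
   proof (rule ccontr)
    assume "~ ?thesis"
    then have "v (Suc r) < v (Suc c)" using inj[of "Suc c" "Suc r"] rc by auto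
    then show False using good_inversion[OF vw, of "Suc c" "Suc r"] rc bad by simp
   qed
   obtain p q where pq: "dif (v \<circ> transpose (Suc c) (Suc r)) w p q < 0"
    using bad unfolding good_def bruhat_le_def by (auto simp: not_le)
   have "dif (v \<circ> transpose (Suc c) (Suc r)) w p q = dif v w p q - of_bool (Suc c <= p & p < Suc r & v (Suc c) < q & q <= v (Suc r))"
    by (rule dif_transpose_left) (use rc lt in auto)
   moreover have "0 <= dif v w p q" using vw by (simp add: bruhat_le_def)
   ultimately have cond: "c < p" "p <= r" "v (Suc c) < q" "q <= v (Suc r)" and d0: "dif v w p q = 0"
    using pq by (auto split: if_splits simp: of_bool_def)
   \<comment> \<open>Rows \<open>\<rho>\<close> and columns \<open>\<kappa>\<close> of the minor: the \<open>k\<close> points of \<open>v\<close> in the block, then row \<open>v (r + 1)\<close> and column \<open>c\<close>.\<close>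
   define k where "k = card (rnk v p q)"
   have kw: "card (rnk w p q) = k" using d0 by (simp add: dif_rnk k_def)
   obtain f where f: "bij_betw f {0..<k} (rnk v p q)"
    using ex_bij_betw_nat_finite[OF finite_rnk, of v p q] by (auto simp: k_def)
   have fR: "f l < p" "q <= v (Suc (f l))" if "l < k" for l
    using bspec[OF bij_betwE[OF f], of l] that by (auto simp: rnk_def)
   have fne: "f l ~= c" "f l ~= r" "c ~= f l" "r ~= f l" if "l < k" for l using fR[OF that] cond by auto
   have finj: "f l = f l' \<longleftrightarrow> l = l'" if "l < k" "l' < k" for l l'
    using inj_onD[OF bij_betw_imp_inj_on[OF f], of l l'] that by auto
   define \<kappa> where "\<kappa> l = (if l < k then f l else c)" for l
   define ra where "ra l = (if l < k then f l else r)" for l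
   have \<kappa>p: "\<kappa> l < p" for l using fR(1) cond by (simp add: \<kappa>_def)
   have pn: "p <= n" using cond rc by simp
   have ra: "ra l < n" for l using order_less_le_trans[OF fR(1) pn, of l] rc by (simp add: ra_def)
   have \<kappa>n: "\<kappa> l < n" for l using \<kappa>p[of l] pn by simp
   define \<rho> where "\<rho> l = v (Suc (ra l)) - 1" for l
   have \<rho>: "\<rho> l < n" "q <= Suc (\<rho> l)" for l
   proof -
    show "\<rho> l < n" unfolding \<rho>_def by (rule perm_index(1)[OF v ra])
    have "q <= v (Suc (ra l))" using fR(2)[of l] cond by (simp add: ra_def)
    then show "q <= Suc (\<rho> l)" unfolding \<rho>_def perm_index(2)[OF v ra] .
   qed
   have mp: "minor \<rho> \<kappa> (Suc k) \<in> poly_funs n" by (rule minor_poly_fun[OF \<rho>(1) \<kappa>n])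
   obtain P where P: "P \<in> poly_funs n" "\<forall>A\<in>carrier_mat n n. P A = minor \<rho> \<kappa> (Suc k) (perm_rep n v * A)"
    using poly_funs_left_mult[OF perm_rep_carrier[of n v] mp] by (elim bexE)
   have "D (%q. P (lower_coords q)) = D (%q. 0)"
   proof (rule tangent_chart_cong[OF D regular_at_poly[OF P(1)] regular_at_const poly_funs.const[of 1]])
    show "\<forall>u\<in>lowuni n. (1::complex) ~= 0 --> flag_proj n (g * u) \<in> schubert_variety n w --> P (lower_coords (flag_proj n (g * u))) = 0"
    proof (intro ballI impI)
     fix u assume u: "u \<in> lowuni n" and X: "flag_proj n (g * u) \<in> schubert_variety n w"
     have uS: "u \<in> SLset n" by (rule lowuni_SL[OF u])
     have Pu: "perm_rep n v * u \<in> SLset n" by (rule SL_mult[OF PS uS])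
     have "g * u = b * (perm_rep n v * u)" unfolding g_def by (rule SL_assoc[OF bS PS uS])
     then have "adj_mat b * (g * u) = perm_rep n v * u" using SL_adj_cancel(2)[OF bS Pu] by simp
     then have "flag_proj n (perm_rep n v * u) \<in> schubert_variety n w"
      using schubert_borel_stable[OF w borel_inverse[OF b(1)] SL_mult[OF g uS] X] by simp
     then have "minor \<rho> \<kappa> (Suc k) (perm_rep n v * u) = 0"
      by (intro minor_vanishes[OF w pn _ _ _ Pu, where q = q]) (use \<kappa>p \<rho> kw in simp_all)
     then show "P (lower_coords (flag_proj n (g * u))) = 0"
      using P(2) SL_carrier[OF uS] by (simp add: lower_coords_chart[OF u])
    qed
   qed simp
   also have "\<dots> = 0" by (rule tangent_const[OF D])
   finally have D0: "D (%q. P (lower_coords q)) = 0" .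
   obtain d where d: "partials n P d"
    "D (%q. P (lower_coords q)) = (\<Sum>t\<in>lowpairs n. D (coordinate t) * d t)"
    using tangent_poly[OF D P(1)] by (elim exE conjE)
   let ?M = "%r' c' s. mat (Suc k) (Suc k) (%(i, j). eps v (ra i) * root_elem n r' c' s $$ (ra i, \<kappa> j))"
   have PM: "P (root_elem n r' c' s) = det (?M r' c' s)" for r' c' s
   proof -
    have "P (root_elem n r' c' s) = minor \<rho> \<kappa> (Suc k) (perm_rep n v * root_elem n r' c' s)"
     by (rule bspec[OF P(2) root_elem_carrier])
    also have "\<dots> = det (?M r' c' s)" unfolding \<rho>_def
     by (rule minor_perm_rep_mult[OF v root_elem_carrier]) (use ra \<kappa>n in auto)
    finally show ?thesis .
   qed
   have other: "d (r', c') = 0" if t': "(r', c') \<in> lowpairs n" "(r', c') ~= (r, c)" for r' c'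
   proof -
    have "det (?M r' c' s) = 0" for s
    proof (cases "r' = r")
     case False
     show ?thesis
      by (rule det_zero_row[of _ "Suc k" k])
       (use False fne ra \<kappa>n rc in \<open>auto simp: root_elem_entry ra_def \<kappa>_def\<close>)
    next
     case True
     then have "c' ~= c" using t'(2) by simp
     then show ?thesis
      by (intro det_zero_column[of _ "Suc k" k])
       (use fne ra \<kappa>n rc in \<open>auto simp: root_elem_entry ra_def \<kappa>_def\<close>)
    qed
    then have e: "(%s. P (root_elem n r' c' s)) = (%s. 0)" by (simp add: PM)
    have "((%s. P (root_elem n r' c' s)) has_field_derivative d (r', c')) (at 0)" using d(1) t'(1) by blast
    then have "((%s. 0) has_field_derivative d (r', c')) (at 0)" unfolding e .
    then show ?thesis by (rule DERIV_unique) simp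
   qed
   have dne: "d (r, c) ~= 0"
   proof -
    define a where "a = (\<Prod>i<k. eps v (f i)) * eps v r"
    have a0: "a ~= 0" by (simp add: a_def eps_nonzero)
    have "det (?M r c s) = a * s" for s
    proof -
     have "?M r c s = mat (Suc k) (Suc k) (%(i, j). if i = j then (if i < k then eps v (f i) else eps v r * s) else 0)"
     proof (rule cong_mat[OF refl refl], unfold prod.case)
      fix i j assume ij: "i < Suc k" "j < Suc k"
      show "eps v (ra i) * root_elem n r c s $$ (ra i, \<kappa> j) = (if i = j then (if i < k then eps v (f i) else eps v r * s) else 0)"
       unfolding root_elem_entry[OF ra \<kappa>n]
       using ij finj fne rc by (auto simp: ra_def \<kappa>_def less_Suc_eq)
     qed
     then have "det (?M r c s) = (\<Prod>i<Suc k. if i < k then eps v (f i) else eps v r * s)" by (simp only: det_diagonal)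
     also have "\<dots> = a * s" by (simp add: a_def)
     finally show ?thesis .
    qed
    then have e: "(%s. P (root_elem n r c s)) = (%s. a * s)" by (simp add: PM)
    have "((%s. P (root_elem n r c s)) has_field_derivative d (r, c)) (at 0)" using d(1) rc by (auto simp: lowpairs_def)
    then have "((%s. a * s) has_field_derivative d (r, c)) (at 0)" unfolding e .
    moreover have "((%s. a * s) has_field_derivative a * 1) (at 0)" by (intro DERIV_cmult DERIV_ident)
    ultimately have "d (r, c) = a * 1" by (rule DERIV_unique)
    then show ?thesis using a0 by simp
   qed
   have m: "(r, c) \<in> lowpairs n" using rc by (simp add: lowpairs_def)
   have "(\<Sum>t\<in>lowpairs n. D (coordinate t) * d t) = D (coordinate (r, c)) * d (r, c) + (\<Sum>t\<in>lowpairs n - {(r, c)}. D (coordinate t) * d t)"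
    by (rule sum.remove[OF finite_lowpairs m])
   also have "(\<Sum>t\<in>lowpairs n - {(r, c)}. D (coordinate t) * d t) = 0"
   proof (rule sum.neutral, rule ballI)
    fix t assume t: "t \<in> lowpairs n - {(r, c)}"
    obtain r' c' where "t = (r', c')" by (cases t)
    then show "D (coordinate t) * d t = 0" using other[of r' c'] t by simp
   qed
   finally have "D (coordinate (r, c)) * d (r, c) = 0" using D0 d(2) by simp
   then show "D (coordinate t) = 0" using dne rct by simp
  qed
 qed
 also have "card G = tdim n v w"
  unfolding tdim_def npairs_def
 proof (rule bij_betw_same_card[of "%(r, c). (Suc c, Suc r)"])
  show "bij_betw (%(r, c). (Suc c, Suc r)) G {(i, j). 1 <= i & i < j & j <= n & good v w i j}"
   by (rule bij_betwI[where g = "%(i, j). (j - 1, i - 1)"]) (auto simp: G_def lowpairs_def)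
 qed
 finally show ?thesis unfolding pg .
qed

section \<open>Independent functions along a chain of irreducible sets\<close>

lemma irreducible_subsetD:
 assumes "irreducible_subset T Z" "closedin T C" "closedin T D" "Z \<subseteq> C \<union> D"
 shows "Z \<subseteq> C \<or> Z \<subseteq> D"
 using assms(1) unfolding irreducible_subset_def by (elim conjE) (simp add: assms(2-4))

lemma irreducible_subtopology:
 assumes ZX: "Z \<subseteq> X"
 shows "irreducible_subset (subtopology T X) Z \<longleftrightarrow> irreducible_subset T Z"
proof
 assume h: "irreducible_subset (subtopology T X) Z"
 show "irreducible_subset T Z"
  unfolding irreducible_subset_def
 proof (intro conjI allI impI)
  show "Z \<subseteq> topspace T" "Z ~= {}" using h by (auto simp: irreducible_subset_def)
  fix C D assume CD: "closedin T C & closedin T D & Z \<subseteq> C \<union> D"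
  have "closedin (subtopology T X) (C \<inter> X)" "closedin (subtopology T X) (D \<inter> X)" "Z \<subseteq> (C \<inter> X) \<union> (D \<inter> X)"
   using CD ZX by (auto simp: closedin_subtopology)
  then have "Z \<subseteq> C \<inter> X \<or> Z \<subseteq> D \<inter> X" by (rule irreducible_subsetD[OF h])
  then show "Z \<subseteq> C \<or> Z \<subseteq> D" by blast
 qed
next
 assume h: "irreducible_subset T Z"
 show "irreducible_subset (subtopology T X) Z"
  unfolding irreducible_subset_def
 proof (intro conjI allI impI)
  show "Z \<subseteq> topspace (subtopology T X)" "Z ~= {}" using h ZX by (auto simp: irreducible_subset_def)
  fix C D assume CD: "closedin (subtopology T X) C & closedin (subtopology T X) D & Z \<subseteq> C \<union> D"
  then obtain C' D' where C': "closedin T C'" "C = C' \<inter> X" and D': "closedin T D'" "D = D' \<inter> X"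
   unfolding closedin_subtopology by (elim conjE exE)
  have "Z \<subseteq> C' \<union> D'" using CD C' D' by auto
  then have "Z \<subseteq> C' \<or> Z \<subseteq> D'" by (rule irreducible_subsetD[OF h C'(1) D'(1)])
  then show "Z \<subseteq> C \<or> Z \<subseteq> D" using ZX C' D' by blast
 qed
qed

text \<open>
The product of the \<open>F\<^sub>i\<close> with the digits of \<open>N\<close> in base \<open>d + 1\<close> as exponents; for \<open>N < (d + 1)\<^sup>m\<close> this
lists all monomials with exponents up to \<open>d\<close>.
\<close>

fun digit_monomial :: "nat => (nat => 'a => complex) => nat => nat => 'a => complex" where
 "digit_monomial d F 0 N u = 1"
| "digit_monomial d F (Suc m) N u = F m u ^ (N div (d + 1) ^ m) * digit_monomial d F m (N mod (d + 1) ^ m) u"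

lemma digit_monomial_poly:
 assumes "\<forall>i<m. F i \<in> poly_funs n"
 shows "digit_monomial d F m N \<in> poly_funs n"
 using assms
proof (induction m arbitrary: N)
 case 0
 have "digit_monomial d F 0 N = (%A. 1)" by (rule ext) simp
 then show ?case using poly_funs.const[of 1 n] by simp
next
 case (Suc m)
 have "(%u. F m u ^ (N div (d + 1) ^ m) * digit_monomial d F m (N mod (d + 1) ^ m) u) \<in> poly_funs n"
  using Suc by (intro poly_funs.mult poly_funs_power) auto
 moreover have "digit_monomial d F (Suc m) N = (%u. F m u ^ (N div (d + 1) ^ m) * digit_monomial d F m (N mod (d + 1) ^ m) u)"
  by (rule ext) (rule digit_monomial.simps(2))
 ultimately show ?case by (simp only:)
qed

context flag_chart
begin

abbreviation zero_on :: "complex mat set set => (complex mat => complex) => bool" where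
 "zero_on Z F \<equiv> \<forall>u\<in>lowuni n. flag_proj n (g * u) \<in> Z --> F u = 0"

lemma chart_nbhd_lowuni:
 assumes u: "u \<in> lowuni n"
 shows "flag_proj n (g * u) \<in> chart_nbhd f \<longleftrightarrow> f u ~= 0"
 unfolding chart_nbhd_proj[OF SL_mult[OF g lowuni_SL[OF u]]]
 using chart_lowuni(2)[OF g u] SL_adj_cancel(2)[OF g lowuni_SL[OF u]] lower_part_lowuni[OF u] by simp

text \<open>The polynomials vanishing on the part of \<open>Z\<close> in the chart form a prime ideal.\<close>

lemma chart_prime:
 assumes Z: "irreducible_subset (flag_top n) Z"
  and f: "f \<in> poly_funs n" and h: "h \<in> poly_funs n"
  and 0: "\<forall>u\<in>lowuni n. flag_proj n (g * u) \<in> Z --> f u * h u = 0"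
 shows "zero_on Z f \<or> zero_on Z h"
proof -
 let ?T = "flag_top n"
 define C where "C k = topspace ?T - chart_nbhd k" for k
 have c: "closedin ?T (C k)" if "k \<in> poly_funs n" for k
  unfolding C_def by (rule closedin_diff[OF closedin_topspace chart_nbhd_open[OF that]])
 have ZT: "Z \<subseteq> topspace ?T" using Z by (simp add: irreducible_subset_def)
 have "Z \<subseteq> C f \<union> C h"
 proof
  fix q assume q: "q \<in> Z"
  show "q \<in> C f \<union> C h"
  proof (rule ccontr)
   assume "q \<notin> C f \<union> C h"
   then have m: "q \<in> chart_nbhd f" "q \<in> chart_nbhd h" using q ZT by (auto simp: C_def)
   obtain u where u: "u \<in> lowuni n" "q = flag_proj n (g * u)" "f u ~= 0" by (rule chart_nbhdE[OF m(1)])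
   have "h u ~= 0" using m(2) chart_nbhd_lowuni[OF u(1)] u(2) by simp
   then show False using bspec[OF 0 u(1)] u(2,3) q by simp
  qed
 qed
 then have "Z \<subseteq> C f \<or> Z \<subseteq> C h" by (rule irreducible_subsetD[OF Z c[OF f] c[OF h]])
 moreover have "zero_on Z k" if ZC: "Z \<subseteq> C k" for k
 proof (intro ballI impI)
  fix u assume u: "u \<in> lowuni n" "flag_proj n (g * u) \<in> Z"
  then have "flag_proj n (g * u) \<notin> chart_nbhd k" using ZC by (auto simp: C_def)
  then show "k u = 0" using chart_nbhd_lowuni[OF u(1)] by simp
 qed
 ultimately show ?thesis by metis
qed

lemma chart_separation:
 assumes Z: "irreducible_subset (flag_top n) Z" and Z': "closedin (flag_top n) Z'"
  and lt: "Z' \<subset> Z" and pt: "pt \<in> Z'"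
 shows "\<exists>F\<in>poly_funs n. zero_on Z' F \<and>
  (\<exists>u\<in>lowuni n. flag_proj n (g * u) \<in> Z & F u ~= 0)"
proof -
 let ?T = "flag_top n" and ?one = "%A :: complex mat. 1 :: complex"
 have one: "?one \<in> poly_funs n" by (rule poly_funs.const)
 have ZT: "Z \<subseteq> topspace ?T" using Z by (simp add: irreducible_subset_def)
 have "\<exists>q\<in>Z. q \<in> chart_nbhd ?one & q \<notin> Z'"
 proof (rule ccontr)
  assume "~ ?thesis"
  then have "Z \<subseteq> Z' \<union> (topspace ?T - chart_nbhd ?one)" using ZT by blast
  then have "Z \<subseteq> Z' \<or> Z \<subseteq> topspace ?T - chart_nbhd ?one"
   by (rule irreducible_subsetD[OF Z Z' closedin_diff[OF closedin_topspace chart_nbhd_open[OF one]]])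
  moreover have "pt \<in> chart_nbhd ?one" by (rule chart_nbhd_pt) simp
  ultimately show False using lt pt by blast
 qed
 then obtain q where q: "q \<in> Z" "q \<in> chart_nbhd ?one" "q \<notin> Z'" by blast
 obtain u where u: "u \<in> lowuni n" "q = flag_proj n (g * u)" by (rule chart_nbhdE[OF q(2)])
 have uS: "u \<in> SLset n" by (rule lowuni_SL[OF u(1)])
 obtain FF where FF: "FF \<subseteq> poly_funs n" "\<forall>a\<in>SLset n. flag_proj n a \<in> Z' \<longleftrightarrow> (\<forall>f\<in>FF. f a = 0)"
  by (rule closedin_flagE[OF Z'])
 have "~ (\<forall>f\<in>FF. f (g * u) = 0)" using bspec[OF FF(2) SL_mult[OF g uS]] q(3) u(2) by simp
 then obtain f where f: "f \<in> FF" "f (g * u) ~= 0" by blast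
 have fp: "f \<in> poly_funs n" using FF(1) f(1) by (rule subsetD)
 obtain F where F: "F \<in> poly_funs n" "\<forall>A\<in>carrier_mat n n. F A = f (g * A)"
  using poly_funs_left_mult[OF SL_carrier[OF g] fp] by (elim bexE)
 show ?thesis
 proof (rule bexI[OF _ F(1)], intro conjI ballI impI)
  fix x assume x: "x \<in> lowuni n" "flag_proj n (g * x) \<in> Z'"
  have xS: "x \<in> SLset n" by (rule lowuni_SL[OF x(1)])
  have "\<forall>f\<in>FF. f (g * x) = 0" using bspec[OF FF(2) SL_mult[OF g xS]] x(2) by simp
  then show "F x = 0" using F(2) SL_carrier[OF xS] f(1) by simp
 next
  show "\<exists>u\<in>lowuni n. flag_proj n (g * u) \<in> Z & F u ~= 0"
   using u q(1) F(2) SL_carrier[OF uS] f(2) by (intro bexI[of _ u]) simp_all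
 qed
qed

text \<open>
This bounds lengths of chains without dimension theory. Since \<open>F\<^sub>i\<close> vanishes on \<open>Z\<^sub>i\<close> but not on
\<open>Z\<^sub>i\<^sub>+\<^sub>1\<close>, a relation on \<open>Z\<^sub>m\<^sub>+\<^sub>1\<close> may be divided by the lowest power of \<open>F\<^sub>m\<close> in it and restricted to
\<open>Z\<^sub>m\<close>, where only the coefficient of that power survives; it is a shorter relation.
\<close>

lemma digit_monomials_independent:
 assumes Z: "\<forall>i\<le>m. irreducible_subset (flag_top n) (Z i) & pt \<in> Z i" and sub: "\<forall>i<m. Z i \<subseteq> Z (Suc i)"
  and F: "\<forall>i<m. F i \<in> poly_funs n & zero_on (Z i) (F i) \<and>
   (\<exists>u\<in>lowuni n. flag_proj n (g * u) \<in> Z (Suc i) & F i u ~= 0)"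
  and 0: "\<forall>u\<in>lowuni n. flag_proj n (g * u) \<in> Z m --> (\<Sum>N<(d + 1) ^ m. a N * digit_monomial d F m N u) = 0"
 shows "\<forall>N<(d + 1) ^ m. a N = 0"
 using assms
proof (induction m arbitrary: a)
 case 0
 have "flag_proj n (g * 1\<^sub>m n) \<in> Z 0" using 0(1) SL_one_mult(2)[OF g] by simp
 then have "a 0 = 0" using bspec[OF 0(4) one_lowuni] by simp
 then show ?case by simp
next
 case (Suc m)
 define B where "B = (d + 1) ^ m"
 have B: "B > 0" by (simp add: B_def)
 define H where "H k u = (\<Sum>N<B. a (k * B + N) * digit_monomial d F m N u)" for k u
 have Fp: "F m \<in> poly_funs n" and F0: "zero_on (Z m) (F m)"
  and F1: "\<exists>u\<in>lowuni n. flag_proj n (g * u) \<in> Z (Suc m) & F m u ~= 0"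
  using Suc.prems(3) by auto
 have Hp: "H k \<in> poly_funs n" for k
  unfolding H_def by (intro poly_funs_sum poly_funs.mult poly_funs.const digit_monomial_poly) (use Suc.prems(3) in auto)
 have split: "(\<Sum>N<(d + 1) ^ Suc m. a N * digit_monomial d F (Suc m) N u) = (\<Sum>k<d + 1. F m u ^ k * H k u)" for u
 proof -
  have "(\<Sum>N<(d + 1) ^ Suc m. a N * digit_monomial d F (Suc m) N u) = (\<Sum>N<(d + 1) * B. a N * digit_monomial d F (Suc m) N u)"
   by (simp add: B_def)
  also have "\<dots> = (\<Sum>k<d + 1. \<Sum>N = k * B..<k * B + B. a N * digit_monomial d F (Suc m) N u)"
   by (rule sum.nat_group[symmetric])
  also have "\<dots> = (\<Sum>k<d + 1. F m u ^ k * H k u)"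
  proof (rule sum.cong[OF refl])
   fix k
   have "(\<Sum>N = k * B..<k * B + B. a N * digit_monomial d F (Suc m) N u) =
    (\<Sum>N<B. a (k * B + N) * digit_monomial d F (Suc m) (k * B + N) u)"
    by (rule sum.reindex_bij_witness[of _ "%N. k * B + N" "%N. N - k * B"]) auto
   also have "\<dots> = (\<Sum>N<B. F m u ^ k * (a (k * B + N) * digit_monomial d F m N u))"
   proof (rule sum.cong[OF refl])
    fix N assume "N \<in> {..<B}"
    then have "(k * B + N) div (d + 1) ^ m = k" "(k * B + N) mod (d + 1) ^ m = N" by (simp_all add: B_def)
    then show "a (k * B + N) * digit_monomial d F (Suc m) (k * B + N) u = F m u ^ k * (a (k * B + N) * digit_monomial d F m N u)"
     by (simp del: add_Suc_right)
   qed
   also have "\<dots> = F m u ^ k * H k u" by (simp add: H_def sum_distrib_left)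
   finally show "(\<Sum>N = k * B..<k * B + B. a N * digit_monomial d F (Suc m) N u) = F m u ^ k * H k u" .
  qed
  finally show ?thesis .
 qed
 have coeff: "\<forall>N<B. a (k * B + N) = 0" if "k <= d" for k
  using that
 proof (induction k rule: less_induct)
  case (less k)
  have Hz: "H j u = 0" if "j < k" for j u
   using less.IH[OF that] less.prems that by (simp add: H_def)
  define K where "K u = (\<Sum>j\<in>{k..d}. F m u ^ (j - k) * H j u)" for u
  have Kp: "K \<in> poly_funs n" unfolding K_def by (intro poly_funs_sum poly_funs.mult poly_funs_power Fp Hp)
  have "\<forall>u\<in>lowuni n. flag_proj n (g * u) \<in> Z (Suc m) --> F m u ^ k * K u = 0"
  proof (intro ballI impI)
   fix u assume u: "u \<in> lowuni n" "flag_proj n (g * u) \<in> Z (Suc m)"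
   have "F m u ^ k * K u = (\<Sum>j\<in>{k..d}. F m u ^ j * H j u)"
    unfolding K_def sum_distrib_left
    by (rule sum.cong[OF refl]) (simp add: mult.assoc[symmetric] power_add[symmetric])
   also have "\<dots> = (\<Sum>j<d + 1. F m u ^ j * H j u)"
    by (rule sum.mono_neutral_left) (auto simp: Hz)
   also have "\<dots> = 0" using Suc.prems(4) u split by simp
   finally show "F m u ^ k * K u = 0" .
  qed
  from chart_prime[OF _ poly_funs_power[OF Fp] Kp this] Suc.prems(1)
  have "(\<forall>u\<in>lowuni n. flag_proj n (g * u) \<in> Z (Suc m) --> F m u ^ k = 0) \<or> zero_on (Z (Suc m)) K"
   by simp
  moreover have "~ (\<forall>u\<in>lowuni n. flag_proj n (g * u) \<in> Z (Suc m) --> F m u ^ k = 0)" using F1 by auto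
  ultimately have K0: "zero_on (Z (Suc m)) K" by argo
  have ZS: "Z m \<subseteq> Z (Suc m)" using Suc.prems(2) by simp
  have "\<forall>u\<in>lowuni n. flag_proj n (g * u) \<in> Z m --> (\<Sum>N<(d + 1) ^ m. a (k * B + N) * digit_monomial d F m N u) = 0"
  proof (intro ballI impI)
   fix u assume u: "u \<in> lowuni n" "flag_proj n (g * u) \<in> Z m"
   have "0 = K u" using K0 u ZS by auto
   also have "\<dots> = (\<Sum>j\<in>{k..d}. if j = k then H k u else 0)"
    unfolding K_def by (rule sum.cong[OF refl]) (use F0 u in auto)
   also have "\<dots> = H k u" using less.prems by simp
   finally show "(\<Sum>N<(d + 1) ^ m. a (k * B + N) * digit_monomial d F m N u) = 0" by (simp add: H_def B_def)
  qed
  from Suc.IH[OF _ _ _ this] Suc.prems(1-3)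
  show ?case by (simp add: B_def)
 qed
 show ?case
 proof (intro allI impI)
  fix N assume "N < (d + 1) ^ Suc m"
  then have "N < (d + 1) * B" by (simp add: B_def)
  then have "N div B < d + 1" using B by (simp add: div_less_iff_less_mult)
  then have "\<forall>L<B. a (N div B * B + L) = 0" by (intro coeff) simp
  moreover have "N mod B < B" using B by simp
  ultimately have "a (N div B * B + N mod B) = 0" by (elim allE impE)
  then show "a N = 0" by simp
 qed
qed

end

section \<open>Counting monomials\<close>

definition box_monomials :: "'t set => nat => (('t => complex) => complex) set" where
 "box_monomials I D = (%e \<eta>. \<Prod>t\<in>I. \<eta> t ^ e t) ` (I \<rightarrow>\<^sub>E {..D})"

text \<open>Polynomial functions of degree at most \<open>D\<close> in each variable.\<close>

definition box_polys :: "'t set => nat => (('t => complex) => complex) set" where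
 "box_polys I D = module.span scale_functional (box_monomials I D)"

lemma box_monomials_finite:
 assumes "finite I"
 shows "finite (box_monomials I D)" "card (box_monomials I D) <= (D + 1) ^ card I"
proof -
 have fin: "finite (I \<rightarrow>\<^sub>E {..D})" using assms by (intro finite_PiE) auto
 then show "finite (box_monomials I D)" by (simp add: box_monomials_def)
 have "card (box_monomials I D) <= card (I \<rightarrow>\<^sub>E {..D})" unfolding box_monomials_def by (rule card_image_le[OF fin])
 also have "\<dots> = (D + 1) ^ card I" by (simp add: card_PiE[OF assms])
 finally show "card (box_monomials I D) <= (D + 1) ^ card I" .
qed

context
 fixes I :: "'t set"
 assumes I: "finite I"
begin

interpretation V: vector_space "scale_functional :: complex => (('t => complex) => complex) => _"
 by (rule vector_space_scale_functional)

lemma box_polys_mono: "D <= D' ==> p \<in> box_polys I D ==> p \<in> box_polys I D'"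
proof -
 assume D: "D <= D'" and p: "p \<in> box_polys I D"
 have "I \<rightarrow>\<^sub>E {..D} \<subseteq> I \<rightarrow>\<^sub>E {..D'}" by (rule PiE_mono) (use D in auto)
 then have "box_monomials I D \<subseteq> box_monomials I D'" unfolding box_monomials_def by (rule image_mono)
 then show "p \<in> box_polys I D'" using p V.span_mono unfolding box_polys_def by blast
qed

lemma box_polys_const: "(%\<eta>. c) \<in> box_polys I D"
proof -
 have "(%\<eta>. \<Prod>t\<in>I. \<eta> t ^ (restrict (%t. 0) I) t) \<in> box_monomials I D"
  unfolding box_monomials_def by (rule imageI) auto
 moreover have "(%\<eta> :: 't => complex. \<Prod>t\<in>I. \<eta> t ^ (restrict (%t. 0) I) t) = (%\<eta>. 1)"
  by (rule ext, rule prod.neutral) simp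
 ultimately have "(%\<eta>. 1) \<in> box_monomials I D" by simp
 then have "scale_functional c (%\<eta>. 1) \<in> V.span (box_monomials I D)" by (intro V.span_scale V.span_base)
 then show ?thesis by (simp add: box_polys_def)
qed

lemma box_polys_var:
 assumes t: "t \<in> I"
 shows "(%\<eta>. \<eta> t) \<in> box_polys I 1"
proof -
 let ?e = "restrict (%s. if s = t then 1 else 0 :: nat) I"
 have "(%\<eta>. \<Prod>s\<in>I. \<eta> s ^ ?e s) \<in> box_monomials I 1"
  unfolding box_monomials_def by (rule imageI) auto
 moreover have "(\<Prod>s\<in>I. \<eta> s ^ ?e s) = \<eta> t" for \<eta> :: "'t => complex"
 proof -
  have "(\<Prod>s\<in>I. \<eta> s ^ ?e s) = (\<Prod>s\<in>I. if s = t then \<eta> t else 1)" by (rule prod.cong) auto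
  then show ?thesis using t I by simp
 qed
 ultimately have "(%\<eta>. \<eta> t) \<in> box_monomials I 1" by simp
 then show ?thesis unfolding box_polys_def by (rule V.span_base)
qed

lemma box_polys_add: "p \<in> box_polys I D ==> q \<in> box_polys I D ==> (%\<eta>. p \<eta> + q \<eta>) \<in> box_polys I D"
 using V.span_add[of p "box_monomials I D" q] by (simp add: box_polys_def plus_fun_def)

lemma box_polys_sum: "(\<And>x. x \<in> A ==> p x \<in> box_polys I D) ==> (%\<eta>. \<Sum>x\<in>A. p x \<eta>) \<in> box_polys I D"
proof (induction A rule: infinite_finite_induct)
 case (insert x A)
 then show ?case using box_polys_add[of "p x" D "%\<eta>. \<Sum>x\<in>A. p x \<eta>"] by simp
qed (auto simp: box_polys_const)

lemma box_monomials_mult: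
 assumes p: "p \<in> box_monomials I D" and q: "q \<in> box_monomials I D'"
 shows "(%\<eta>. p \<eta> * q \<eta>) \<in> box_monomials I (D + D')"
proof -
 obtain e e' where e: "e \<in> I \<rightarrow>\<^sub>E {..D}" "p = (%\<eta>. \<Prod>t\<in>I. \<eta> t ^ e t)" and e': "e' \<in> I \<rightarrow>\<^sub>E {..D'}" "q = (%\<eta>. \<Prod>t\<in>I. \<eta> t ^ e' t)"
  using p q by (auto simp: box_monomials_def)
 let ?e = "restrict (%t. e t + e' t) I"
 have "?e \<in> I \<rightarrow>\<^sub>E {..D + D'}"
 proof (rule restrict_PiE_iff[THEN iffD2], rule ballI)
  fix t assume "t \<in> I"
  then have "e t <= D" "e' t <= D'" using PiE_mem[OF e(1)] PiE_mem[OF e'(1)] by auto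
  then show "e t + e' t \<in> {..D + D'}" by simp
 qed
 moreover have "(%\<eta>. p \<eta> * q \<eta>) = (%\<eta>. \<Prod>t\<in>I. \<eta> t ^ ?e t)"
 proof
  fix \<eta> :: "'t => complex"
  show "p \<eta> * q \<eta> = (\<Prod>t\<in>I. \<eta> t ^ ?e t)"
   unfolding e(2) e'(2) prod.distrib[symmetric] by (rule prod.cong) (simp_all add: power_add)
 qed
 ultimately show ?thesis unfolding box_monomials_def by (intro image_eqI)
qed

lemma box_polys_mult:
 assumes p: "p \<in> box_polys I D" and q: "q \<in> box_polys I D'"
 shows "(%\<eta>. p \<eta> * q \<eta>) \<in> box_polys I (D + D')"
proof -
 have sub: "V.subspace {q. (%\<eta>. p \<eta> * q \<eta>) \<in> box_polys I E}" (is "V.subspace ?Q") for p E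
 proof (rule V.subspaceI)
  show "0 \<in> ?Q" using box_polys_const[of 0] by simp
 next
  fix x y assume "x \<in> ?Q" "y \<in> ?Q"
  then show "x + y \<in> ?Q"
   using box_polys_add[of "%\<eta>. p \<eta> * x \<eta>" _ "%\<eta>. p \<eta> * y \<eta>"] by (simp add: algebra_simps)
 next
  fix c x assume "x \<in> ?Q"
  then show "scale_functional c x \<in> ?Q"
   using V.span_scale[of "%\<eta>. p \<eta> * x \<eta>" _ c] by (simp add: box_polys_def mult.left_commute)
 qed
 have 1: "(%\<eta>. p \<eta> * q \<eta>) \<in> box_polys I (D + D')" if p: "p \<in> box_monomials I D" for p
  using q unfolding box_polys_def[of I D']
 proof (rule V.span_induct[OF _ sub])
  fix q assume "q \<in> box_monomials I D'"
  then show "(%\<eta>. p \<eta> * q \<eta>) \<in> box_polys I (D + D')"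
   unfolding box_polys_def by (intro V.span_base box_monomials_mult[OF p])
 qed
 have "(%\<eta>. q \<eta> * p \<eta>) \<in> box_polys I (D + D')"
  using p unfolding box_polys_def[of I D]
 proof (rule V.span_induct[OF _ sub])
  fix p assume "p \<in> box_monomials I D"
  then show "(%\<eta>. q \<eta> * p \<eta>) \<in> box_polys I (D + D')" using 1[of p] by (simp add: mult.commute)
 qed
 then show ?thesis by (simp add: mult.commute)
qed

lemma box_polys_power: "p \<in> box_polys I D ==> (%\<eta>. p \<eta> ^ k) \<in> box_polys I (D * k)"
proof (induction k)
 case (Suc k)
 then show ?case using box_polys_mult[of p D "%\<eta>. p \<eta> ^ k" "D * k"] by simp
qed (simp add: box_polys_const)

lemma box_polys_dependent:
 assumes \<phi>: "\<forall>N<M. \<phi> N \<in> box_polys I D" and M: "(D + 1) ^ card I < M"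
 shows "\<exists>a. (\<exists>N<M. a N ~= 0) & (\<forall>\<eta>. (\<Sum>N<M. a N * \<phi> N \<eta>) = 0)"
proof (cases "inj_on \<phi> {..<M}")
 case False
 then obtain N N' where N: "N < M" "N' < M" "N ~= N'" "\<phi> N = \<phi> N'" by (auto simp: inj_on_def)
 define a where "a L = (if L = N then 1 else if L = N' then - 1 else 0 :: complex)" for L
 have "(\<Sum>L<M. a L * \<phi> L \<eta>) = 0" for \<eta>
 proof -
  have "(\<Sum>L<M. a L * \<phi> L \<eta>) = (\<Sum>L<M. (if L = N then \<phi> N \<eta> else 0) + (if L = N' then - \<phi> N' \<eta> else 0))"
   by (rule sum.cong[OF refl]) (use N in \<open>auto simp: a_def\<close>)
  also have "\<dots> = \<phi> N \<eta> - \<phi> N' \<eta>" unfolding sum.distrib using N(1,2) by simp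
  finally show ?thesis using N(4) by simp
 qed
 moreover have "\<exists>L<M. a L ~= 0" using N(1) by (intro exI[of _ N]) (simp add: a_def)
 ultimately show ?thesis by blast
next
 case True
 have "~ V.independent (\<phi> ` {..<M})"
 proof
  assume "V.independent (\<phi> ` {..<M})"
  moreover have "\<phi> ` {..<M} \<subseteq> V.span (box_monomials I D)" using \<phi> by (auto simp: box_polys_def)
  ultimately have "card (\<phi> ` {..<M}) <= card (box_monomials I D)"
   using V.independent_span_bound[OF box_monomials_finite(1)[OF I]] by blast
  then show False using card_image[OF True] box_monomials_finite(2)[OF I, of D] M by simp
 qed
 then obtain c v where c: "v \<in> \<phi> ` {..<M}" "c v ~= 0" "(\<Sum>v\<in>\<phi> ` {..<M}. scale_functional (c v) v) = 0"
  using V.dependent_finite[of "\<phi> ` {..<M}"] by auto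
 obtain N where N: "N < M" "v = \<phi> N" using c(1) by auto
 have "(\<Sum>N<M. c (\<phi> N) * \<phi> N \<eta>) = 0" for \<eta>
 proof -
  have "(\<Sum>v\<in>\<phi> ` {..<M}. scale_functional (c v) v) \<eta> = 0" unfolding c(3) by simp
  then show ?thesis unfolding sum_functional_apply sum.reindex[OF True] by simp
 qed
 then show ?thesis using N c(2) by (intro exI[of _ "%N. c (\<phi> N)"]) auto
qed

end

section \<open>The dimension of a Schubert variety\<close>

definition cell_index :: "nat => (nat => nat) => (nat \<times> nat) set" where
 "cell_index n w = {(k, l) \<in> lowpairs n. w (Suc k) < w (Suc l)}"

definition cell_matrix :: "nat => (nat => nat) => (nat \<times> nat => complex) => complex mat" where
 "cell_matrix n w \<eta> = mat n n (%(k, l). if k = l then 1 else if (k, l) \<in> cell_index n w then \<eta> (k, l) else 0)"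

lemma finite_cell_index: "finite (cell_index n w)"
 by (rule finite_subset[OF _ finite_lowpairs]) (auto simp: cell_index_def)

lemma card_cell_index: "card (cell_index n w) = len n w"
 unfolding len_def npairs_def
proof (rule bij_betw_same_card[of "%(k, l). (Suc l, Suc k)"])
 show "bij_betw (%(k, l). (Suc l, Suc k)) (cell_index n w) {(i, j). 1 <= i & i < j & j <= n & inversion w i j}"
  by (rule bij_betwI[where g = "%(i, j). (j - 1, i - 1)"]) (auto simp: cell_index_def lowpairs_def inversion_def)
qed

lemma cell_matrix_coords: "cell_matrix n w \<eta> \<in> cell_coords n w"
 by (auto simp: cell_coords_def lowuni_def cell_matrix_def cell_index_def lowpairs_def)

lemma cell_matrix_surj:
 assumes y: "y \<in> cell_coords n w"
 shows "\<exists>\<eta>. y = cell_matrix n w \<eta>"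
proof (rule exI[of _ "%(k, l). y $$ (k, l)"], rule eq_matI)
 fix i j assume "i < dim_row (cell_matrix n w (%(k, l). y $$ (k, l)))" "j < dim_col (cell_matrix n w (%(k, l). y $$ (k, l)))"
 then have ij: "i < n" "j < n" by (auto simp: cell_matrix_def)
 have "y $$ (i, j) = 0" if "i ~= j" "(i, j) \<notin> cell_index n w"
 proof (cases "i < j")
  case True then show ?thesis using y ij by (auto simp: cell_coords_def lowuni_def)
 next
  case False
  then have "~ w (Suc i) < w (Suc j)" using that ij by (auto simp: cell_index_def lowpairs_def)
  moreover have "\<forall>k<n. \<forall>l<n. k ~= l --> y $$ (k, l) ~= 0 --> w (Suc k) < w (Suc l)"
   using y by (simp add: cell_coords_def)
  ultimately show ?thesis using ij that(1) by blast
 qed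
 moreover have "y $$ (i, i) = 1" using y ij by (auto simp: cell_coords_def lowuni_def)
 ultimately show "y $$ (i, j) = cell_matrix n w (%(k, l). y $$ (k, l)) $$ (i, j)"
  using ij by (auto simp: cell_matrix_def)
qed (use y in \<open>auto simp: cell_matrix_def cell_coords_def lowuni_def\<close>)

lemma cell_matrix_SL: "cell_matrix n w \<eta> \<in> SLset n"
 using cell_matrix_coords[of n w \<eta>] lowuni_SL by (auto simp: cell_coords_def)

lemma poly_fun_cell:
 assumes w: "w permutes {1..n}" and f: "f \<in> poly_funs n"
 shows "\<exists>C. (%\<eta>. f (perm_rep n w * cell_matrix n w \<eta>)) \<in> box_polys (cell_index n w) C"
 using f
proof induction
 case (const a)
 show ?case by (rule exI, rule box_polys_const[OF finite_cell_index])
next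
 case (entry i j)
 let ?P = "perm_rep n w"
 have e: "(?P * cell_matrix n w \<eta>) $$ (i, j) = (\<Sum>k<n. ?P $$ (i, k) * cell_matrix n w \<eta> $$ (k, j))" for \<eta>
  by (rule mat_mult_entry[OF perm_rep_carrier SL_carrier[OF cell_matrix_SL] entry])
 have c: "(%\<eta>. cell_matrix n w \<eta> $$ (k, j)) \<in> box_polys (cell_index n w) 1" if k: "k < n" for k
 proof -
  consider "k = j" | "k ~= j" "(k, j) \<in> cell_index n w" | "k ~= j" "(k, j) \<notin> cell_index n w" by blast
  then show ?thesis
  proof cases
   case 1 then show ?thesis using box_polys_const[OF finite_cell_index] k by (simp add: cell_matrix_def)
  next
   case 2 then show ?thesis using box_polys_var[OF finite_cell_index 2(2)] k entry by (simp add: cell_matrix_def)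
  next
   case 3 then show ?thesis using box_polys_const[OF finite_cell_index] k entry by (simp add: cell_matrix_def)
  qed
 qed
 have "(%\<eta>. \<Sum>k<n. ?P $$ (i, k) * cell_matrix n w \<eta> $$ (k, j)) \<in> box_polys (cell_index n w) (0 + 1)"
  by (intro box_polys_sum[OF finite_cell_index] box_polys_mult[OF finite_cell_index] box_polys_const[OF finite_cell_index] c) simp
 then show ?case unfolding e by (rule exI)
next
 case (add f h)
 then obtain C C' where C: "(%\<eta>. f (perm_rep n w * cell_matrix n w \<eta>)) \<in> box_polys (cell_index n w) C"
  "(%\<eta>. h (perm_rep n w * cell_matrix n w \<eta>)) \<in> box_polys (cell_index n w) C'" by blast
 show ?case
  by (rule exI[of _ "max C C'"], rule box_polys_add[OF finite_cell_index])
   (rule box_polys_mono[OF finite_cell_index _ C(1)], simp, rule box_polys_mono[OF finite_cell_index _ C(2)], simp)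
next
 case (mult f h)
 then obtain C C' where C: "(%\<eta>. f (perm_rep n w * cell_matrix n w \<eta>)) \<in> box_polys (cell_index n w) C"
  "(%\<eta>. h (perm_rep n w * cell_matrix n w \<eta>)) \<in> box_polys (cell_index n w) C'" by blast
 show ?case by (rule exI, rule box_polys_mult[OF finite_cell_index C])
qed

definition (in flag_chart) cleared_monomial ::
  "(nat => nat) => (nat => complex mat => complex) => nat => nat => nat => nat => nat => (complex mat => complex) => bool" where
 "cleared_monomial w F m d N e D G \<longleftrightarrow> G \<in> poly_funs n & (\<forall>a\<in>SLset n. chart_fun n g a ~= 0 -->
    G a = chart_fun n g a ^ e * digit_monomial d F m N (lower_part n (adj_mat g * a))) \<and>
  (%\<eta>. G (perm_rep n w * cell_matrix n w \<eta>)) \<in> box_polys (cell_index n w) D"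

text \<open>
Monomials in the \<open>F\<^sub>i\<close> become polynomials on the group after multiplication with the same power of
\<open>chart_fun\<close>. In the coordinates of the cell their degrees are at most linear in \<open>d\<close>, which the counting
argument needs.
\<close>

lemma (in flag_chart) digit_monomial_numerator:
 assumes w: "w permutes {1..n}" and F: "\<forall>i<m. F i \<in> poly_funs n"
 shows "\<exists>C \<kappa>. \<forall>d N. N < (d + 1) ^ m --> (\<exists>G. cleared_monomial w F m d N (\<kappa> * d) (C * d) G)"
 using F
proof (induction m)
 case 0
 show ?case
  by (intro exI[of _ 0] allI impI exI[of _ "%A. 1"])
   (simp_all add: cleared_monomial_def poly_funs.const box_polys_const[OF finite_cell_index])
next
 case (Suc m)
 let ?I = "cell_index n w"
 note bp = box_polys_mult[OF finite_cell_index, of _ n w] box_polys_power[OF finite_cell_index, of _ n w]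
 have "\<forall>i<m. F i \<in> poly_funs n" using Suc.prems by simp
 from Suc.IH[OF this] obtain C \<kappa> where IH: "\<forall>d N. N < (d + 1) ^ m --> (\<exists>G. cleared_monomial w F m d N (\<kappa> * d) (C * d) G)" by (elim exE)
 have "F m \<in> poly_funs n" using Suc.prems by simp
 from coord_numerator[OF this] obtain h k where h: "h \<in> poly_funs n"
  "\<forall>a\<in>SLset n. chart_fun n g a ~= 0 --> h a = chart_fun n g a ^ k * F m (lower_part n (adj_mat g * a))" by blast
 obtain D where D: "D \<in> poly_funs n" "\<forall>A\<in>carrier_mat n n. D A = chart_fun n g A" by (rule chart_fun_poly[OF g])
 obtain Ch where Ch: "(%\<eta>. h (perm_rep n w * cell_matrix n w \<eta>)) \<in> box_polys ?I Ch" using poly_fun_cell[OF w h(1)] ..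
 obtain CD where CD: "(%\<eta>. D (perm_rep n w * cell_matrix n w \<eta>)) \<in> box_polys ?I CD" using poly_fun_cell[OF w D(1)] ..
 show ?case
 proof (rule exI[of _ "Ch + CD * k + C"], rule exI[of _ "k + \<kappa>"], intro allI impI)
  fix d N :: nat assume N: "N < (d + 1) ^ Suc m"
  define B where "B = (d + 1) ^ m"
  have B: "B > 0" by (simp add: B_def)
  define e where "e = N div B"
  have "N < (d + 1) * B" using N by (simp add: B_def)
  then have "e < d + 1" using B by (simp add: e_def div_less_iff_less_mult)
  then have e: "e <= d" by simp
  have "N mod B < (d + 1) ^ m" using B by (simp add: B_def)
  with IH obtain G where G: "G \<in> poly_funs n"
   "\<forall>a\<in>SLset n. chart_fun n g a ~= 0 -->
     G a = chart_fun n g a ^ (\<kappa> * d) * digit_monomial d F m (N mod B) (lower_part n (adj_mat g * a))"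
   "(%\<eta>. G (perm_rep n w * cell_matrix n w \<eta>)) \<in> box_polys ?I (C * d)" unfolding cleared_monomial_def by blast
  show "\<exists>G. cleared_monomial w F (Suc m) d N ((k + \<kappa>) * d) ((Ch + CD * k + C) * d) G"
   unfolding cleared_monomial_def
  \<comment> \<open>The factor \<open>(D\<^sup>k)\<^sup>d\<^sup>-\<^sup>e\<close> makes the power of \<open>chart_fun\<close> independent of the digit \<open>e\<close>.\<close>
  proof (rule exI[of _ "%A. h A ^ e * (D A ^ k) ^ (d - e) * G A"], intro conjI ballI impI)
   show "(%A. h A ^ e * (D A ^ k) ^ (d - e) * G A) \<in> poly_funs n"
    by (intro poly_funs.mult poly_funs_power h(1) D(1) G(1))
   fix a assume a: "a \<in> SLset n" "chart_fun n g a ~= 0"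
   let ?\<chi> = "chart_fun n g a" and ?u = "lower_part n (adj_mat g * a)"
   have Da: "D a = ?\<chi>" using D(2) SL_carrier[OF a(1)] by simp
   have ha: "h a = ?\<chi> ^ k * F m ?u" using h(2) a by simp
   have Ga: "G a = ?\<chi> ^ (\<kappa> * d) * digit_monomial d F m (N mod B) ?u" using G(2) a by simp
   have "(?\<chi> ^ k) ^ e * (?\<chi> ^ k) ^ (d - e) = (?\<chi> ^ k) ^ d" using e by (simp add: power_add[symmetric])
   then have "h a ^ e * (D a ^ k) ^ (d - e) * G a = (?\<chi> ^ k) ^ d * ?\<chi> ^ (\<kappa> * d) * (F m ?u ^ e * digit_monomial d F m (N mod B) ?u)"
    unfolding Da ha Ga by (simp add: power_mult_distrib algebra_simps)
   also have "(?\<chi> ^ k) ^ d * ?\<chi> ^ (\<kappa> * d) = ?\<chi> ^ ((k + \<kappa>) * d)"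
    by (simp add: power_mult[symmetric] power_add[symmetric] algebra_simps)
   also have "F m ?u ^ e * digit_monomial d F m (N mod B) ?u = digit_monomial d F (Suc m) N ?u"
    by (simp add: e_def B_def)
   finally show "h a ^ e * (D a ^ k) ^ (d - e) * G a = ?\<chi> ^ ((k + \<kappa>) * d) * digit_monomial d F (Suc m) N ?u" .
  next
   let ?y = "%\<eta>. perm_rep n w * cell_matrix n w \<eta>"
   have "(%\<eta>. h (?y \<eta>) ^ e) \<in> box_polys ?I (Ch * d)"
    by (rule box_polys_mono[OF finite_cell_index _ bp(2)[OF Ch]]) (use e in simp)
   moreover have "(%\<eta>. (D (?y \<eta>) ^ k) ^ (d - e)) \<in> box_polys ?I (CD * k * d)"
    by (rule box_polys_mono[OF finite_cell_index _ bp(2)[OF bp(2)[OF CD]]]) simp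
   ultimately have "(%\<eta>. h (?y \<eta>) ^ e * (D (?y \<eta>) ^ k) ^ (d - e) * G (?y \<eta>)) \<in> box_polys ?I (Ch * d + CD * k * d + C * d)"
    by (intro bp(1) G(3))
   then show "(%\<eta>. h (?y \<eta>) ^ e * (D (?y \<eta>) ^ k) ^ (d - e) * G (?y \<eta>)) \<in> box_polys ?I ((Ch + CD * k + C) * d)"
    by (simp add: algebra_simps)
  qed
 qed
qed

lemma growth:
 fixes C l m :: nat
 assumes "l < m"
 shows "\<exists>d. (C * d + 1) ^ l < (d + 1) ^ m"
proof
 \<comment> \<open>Then \<open>(C d + 1)\<^sup>l \<le> d (d + 1)\<^sup>l\<close>, and one factor \<open>d + 1\<close> is to spare.\<close>
 define d where "d = (C + 1) ^ l"
 have "(C * d + 1) ^ l <= ((C + 1) * (d + 1)) ^ l" by (rule power_mono) auto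
 also have "\<dots> = d * (d + 1) ^ l" by (simp only: power_mult_distrib d_def)
 also have "\<dots> < (d + 1) * (d + 1) ^ l" by (intro mult_strict_right_mono) auto
 also have "\<dots> = (d + 1) ^ Suc l" by simp
 also have "\<dots> <= (d + 1) ^ m" by (rule power_increasing) (use assms in auto)
 finally show "(C * d + 1) ^ l < (d + 1) ^ m" .
qed

text \<open>
A chain of length \<open>m\<close> gives functions \<open>F\<^sub>0, \<dots>, F\<^sub>m\<^sub>-\<^sub>1\<close> on a chart around a point of \<open>Z\<^sub>0\<close>. Their
\<open>(d + 1)\<^sup>m\<close> monomials are independent on \<open>Z\<^sub>m\<close>, but on the cell of \<open>w\<close> they are, up to a common
factor, polynomials in \<open>len n w\<close> variables of degree at most \<open>C d\<close> in each. If \<open>m > len n w\<close>, there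
are more of them than monomials for large \<open>d\<close>, hence a relation on the cell, and so on its closure.
\<close>

lemma schubert_chain_length:
 assumes w: "w permutes {1..n}"
  and Z: "\<forall>i\<le>m. closedin (flag_top n) (Z i) & irreducible_subset (flag_top n) (Z i)"
  and lt: "\<forall>i<m. Z i \<subset> Z (Suc i)" and ZX: "Z m \<subseteq> schubert_variety n w"
 shows "m <= len n w"
proof (rule ccontr)
 assume "~ ?thesis"
 then have lm: "card (cell_index n w) < m" by (simp add: card_cell_index)
 have mono: "Z i \<subseteq> Z j" if "i <= j" "j <= m" for i j
  using that
 proof (induction j rule: dec_induct)
  case (step j) then show ?case using lt by (meson Suc_le_lessD less_imp_le order_trans psubset_imp_subset)
 qed simp
 have "Z 0 ~= {}" using Z by (auto simp: irreducible_subset_def)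
 then obtain p where p: "p \<in> Z 0" by blast
 have pm: "p \<in> Z i" if "i <= m" for i using mono[of 0 i] that p by auto
 have pX: "p \<in> schubert_variety n w" using pm[of m] ZX by auto
 obtain g where gp: "g \<in> SLset n" "p = flag_proj n g" using subsetD[OF schubert_flags pX] by auto
 interpret flag_chart n "schubert_variety n w" g
  by unfold_locales (use schubert_flags gp pX in auto)
 have "\<exists>F. \<forall>i. i < m --> F i \<in> poly_funs n & zero_on (Z i) (F i) \<and>
   (\<exists>u\<in>lowuni n. flag_proj n (g * u) \<in> Z (Suc i) & F i u ~= 0)"
 proof (rule choice, rule allI)
  fix i
  show "\<exists>f. i < m --> f \<in> poly_funs n & zero_on (Z i) f \<and>
   (\<exists>u\<in>lowuni n. flag_proj n (g * u) \<in> Z (Suc i) & f u ~= 0)"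
  proof (cases "i < m")
   case True
   then have "irreducible_subset (flag_top n) (Z (Suc i))" "closedin (flag_top n) (Z i)" "Z i \<subset> Z (Suc i)" "pt \<in> Z i"
    using Z lt pm[of i] gp(2) by simp_all
   from chart_separation[OF this] show ?thesis by blast
  qed simp
 qed
 then obtain F where F: "\<forall>i<m. F i \<in> poly_funs n & zero_on (Z i) (F i) \<and>
   (\<exists>u\<in>lowuni n. flag_proj n (g * u) \<in> Z (Suc i) & F i u ~= 0)" by (elim exE)
 then have Fp: "\<forall>i<m. F i \<in> poly_funs n" by simp
 obtain C \<kappa> where num: "\<forall>d N. N < (d + 1) ^ m --> (\<exists>G. cleared_monomial w F m d N (\<kappa> * d) (C * d) G)"
  using digit_monomial_numerator[OF w Fp] by (elim exE)
 obtain d where d: "(C * d + 1) ^ card (cell_index n w) < (d + 1) ^ m" using growth[OF lm] ..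
 have "\<exists>G. \<forall>N. N < (d + 1) ^ m --> cleared_monomial w F m d N (\<kappa> * d) (C * d) (G N)"
  by (rule choice) (use num in blast)
 then obtain G where G: "\<forall>N<(d + 1) ^ m. cleared_monomial w F m d N (\<kappa> * d) (C * d) (G N)" by (elim exE)
 note G = G[unfolded cleared_monomial_def]
 have "\<forall>N<(d + 1) ^ m. (%\<eta>. G N (perm_rep n w * cell_matrix n w \<eta>)) \<in> box_polys (cell_index n w) (C * d)" using G by simp
 from box_polys_dependent[OF finite_cell_index this d]
 obtain a where a: "\<exists>N<(d + 1) ^ m. a N ~= 0"
  "\<forall>\<eta>. (\<Sum>N<(d + 1) ^ m. a N * G N (perm_rep n w * cell_matrix n w \<eta>)) = 0"
  by - (erule exE, erule conjE, rule that)
 obtain D where D: "D \<in> poly_funs n" "\<forall>A\<in>carrier_mat n n. D A = chart_fun n g A" by (rule chart_fun_poly[OF gp(1)])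
 \<comment> \<open>The factor \<open>D\<close> makes the relation hold on the whole cell, also outside the chart.\<close>
 define E where "E A = D A * (\<Sum>N<(d + 1) ^ m. a N * G N A)" for A
 define M where "M u = (\<Sum>N<(d + 1) ^ m. a N * digit_monomial d F m N u)" for u
 have EM: "E A = chart_fun n g A * chart_fun n g A ^ (\<kappa> * d) * M (lower_part n (adj_mat g * A))"
  if A: "A \<in> SLset n" "chart_fun n g A ~= 0" for A
 proof -
  have "(\<Sum>N<(d + 1) ^ m. a N * G N A) = (\<Sum>N<(d + 1) ^ m. chart_fun n g A ^ (\<kappa> * d) * (a N * digit_monomial d F m N (lower_part n (adj_mat g * A))))"
  proof (rule sum.cong[OF refl])
   fix N assume "N \<in> {..<(d + 1) ^ m}"
   then have "G N A = chart_fun n g A ^ (\<kappa> * d) * digit_monomial d F m N (lower_part n (adj_mat g * A))" using G A by simp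
   then show "a N * G N A = chart_fun n g A ^ (\<kappa> * d) * (a N * digit_monomial d F m N (lower_part n (adj_mat g * A)))" by simp
  qed
  then show ?thesis using D(2) SL_carrier[OF A(1)] by (simp add: E_def M_def sum_distrib_left mult.assoc)
 qed
 have "E \<in> vanishing n (schubert_cell n w)"
  unfolding vanishing_def mem_Collect_eq
 proof (intro conjI ballI impI)
  show "E \<in> poly_funs n" unfolding E_def by (intro poly_funs.mult D(1) poly_funs_sum poly_funs.const) (use G in simp)
  fix c assume c: "c \<in> SLset n" "flag_proj n c \<in> schubert_cell n w"
  show "E c = 0"
  proof (cases "chart_fun n g c = 0")
   case True
   then show ?thesis using D(2) SL_carrier[OF c(1)] by (simp add: E_def)
  next
   case False
   obtain y where y: "y \<in> cell_coords n w" "flag_proj n c = flag_proj n (perm_rep n w * y)" using cell_param[OF w c(2)] by (elim bexE)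
   obtain \<eta> where \<eta>: "y = cell_matrix n w \<eta>" using cell_matrix_surj[OF y(1)] ..
   define y' where "y' = perm_rep n w * cell_matrix n w \<eta>"
   have y': "y' \<in> SLset n" unfolding y'_def by (rule SL_mult[OF perm_rep_SL[OF w] cell_matrix_SL])
   have e: "flag_proj n c = flag_proj n y'" using y(2) \<eta> by (simp add: y'_def)
   have nz: "chart_fun n g y' ~= 0" using chart_cong(2)[OF gp(1) c(1) y' e] False by simp
   have l: "lower_part n (adj_mat g * y') = lower_part n (adj_mat g * c)"
    using lower_coords_proj[OF c(1)] lower_coords_proj[OF y'] e by simp
   have "E y' = 0" unfolding E_def y'_def using a(2) by simp
   then have "M (lower_part n (adj_mat g * c)) = 0" using EM[OF y' nz] nz l by simp
   then show ?thesis using EM[OF c(1) False] by simp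
  qed
 qed
 then have EX: "E c = 0" if "c \<in> SLset n" "flag_proj n c \<in> schubert_variety n w" for c
  using that schubert_iff[OF w that(1)] by simp
 have "\<forall>u\<in>lowuni n. flag_proj n (g * u) \<in> Z m --> (\<Sum>N<(d + 1) ^ m. a N * digit_monomial d F m N u) = 0"
 proof (intro ballI impI)
  fix u assume u: "u \<in> lowuni n" "flag_proj n (g * u) \<in> Z m"
  have uS: "u \<in> SLset n" by (rule lowuni_SL[OF u(1)])
  have "E (g * u) = 0" by (rule EX[OF SL_mult[OF gp(1) uS]]) (rule subsetD[OF ZX u(2)])
  then have "M u = 0"
   using EM[OF SL_mult[OF gp(1) uS]] chart_lowuni(2)[OF gp(1) u(1)] SL_adj_cancel(2)[OF gp(1) uS] lower_part_lowuni[OF u(1)] by simp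
  then show "(\<Sum>N<(d + 1) ^ m. a N * digit_monomial d F m N u) = 0" by (simp add: M_def)
 qed
 from digit_monomials_independent[OF _ _ F this] have "\<forall>N<(d + 1) ^ m. a N = 0"
  using Z pm gp(2) lt by auto
 then show False using a(1) by blast
qed

lemma schubert_krull_dim:
 assumes w: "w permutes {1..n}"
 shows "krull_dim (subtopology (flag_top n) (schubert_variety n w)) = enat (len n w)"
proof -
 let ?T = "flag_top n" and ?X = "schubert_variety n w"
 let ?A = "{enat m | m. \<exists>Z :: nat => complex mat set set.
   (\<forall>i\<le>m. closedin (subtopology ?T ?X) (Z i) & irreducible_subset (subtopology ?T ?X) (Z i)) & (\<forall>i<m. Z i \<subset> Z (Suc i))}"
 have c: "closedin (subtopology ?T ?X) Y \<longleftrightarrow> closedin ?T Y & Y \<subseteq> ?X" for Y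
  by (rule closedin_closed_subtopology[OF schubert_closed])
 have "Sup ?A = enat (len n w)"
 proof (rule antisym)
  show "Sup ?A <= enat (len n w)"
  proof (rule Sup_least)
   fix e assume "e \<in> ?A"
   then obtain m Z where e: "e = enat m"
    and Z: "\<forall>i\<le>m. closedin (subtopology ?T ?X) (Z i) & irreducible_subset (subtopology ?T ?X) (Z i)" "\<forall>i<m. Z i \<subset> Z (Suc i)"
    by blast
   have ZX: "Z i \<subseteq> ?X" if "i <= m" for i using Z(1) that c by simp
   have "m <= len n w"
   proof (rule schubert_chain_length[OF w _ Z(2) ZX[OF order_refl]], intro allI impI conjI)
    fix i assume i: "i <= m"
    then show "closedin ?T (Z i)" using Z(1) c by simp
    show "irreducible_subset ?T (Z i)" using Z(1) i irreducible_subtopology[OF ZX[OF i], of ?T] by simp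
   qed
   then show "e <= enat (len n w)" by (simp add: e)
  qed
  have idp: "id permutes {1..n}" by (rule permutes_id)
  obtain f where f: "f 0 = id" "f (len n w) = w" "\<forall>i \<le> len n w. f i permutes {1..n}"
   "\<forall>i < len n w. bruhat_le (f i) (f (Suc i)) & f i ~= f (Suc i)"
   using bruhat_chain[OF idp w bruhat_le_id[OF w]] unfolding len_id diff_zero by (elim exE conjE)
  have up: "bruhat_le (f i) w" if "i <= len n w" for i
   using that
  proof (induction i rule: inc_induct)
   case base then show ?case using f(2) bruhat_le_refl by simp
  next
   case (step i) then show ?case using f(4) bruhat_le_trans by blast
  qed
  have "enat (len n w) \<in> ?A"
  proof (intro CollectI exI[of _ "len n w"] conjI exI[of _ "%i. schubert_variety n (f i)"] allI impI, rule refl)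
   fix i assume i: "i <= len n w"
   have fp: "f i permutes {1..n}" using f(3) i by simp
   have sub: "schubert_variety n (f i) \<subseteq> ?X" using schubert_mono[OF fp w] up[OF i] by simp
   show "closedin (subtopology ?T ?X) (schubert_variety n (f i))" using c sub schubert_closed by simp
   show "irreducible_subset (subtopology ?T ?X) (schubert_variety n (f i))"
    unfolding irreducible_subtopology[OF sub] by (rule schubert_irreducible[OF fp])
  next
   fix i assume i: "i < len n w"
   have fp: "f i permutes {1..n}" "f (Suc i) permutes {1..n}" using f(3) i by simp_all
   have le: "bruhat_le (f i) (f (Suc i))" and ne: "f i ~= f (Suc i)" using f(4) i by simp_all
   have "~ bruhat_le (f (Suc i)) (f i)" using bruhat_le_antisym[OF fp le] ne by blast
   then show "schubert_variety n (f i) \<subset> schubert_variety n (f (Suc i))"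
    using schubert_mono[OF fp] schubert_mono[OF fp(2,1)] le by blast
  qed
  then show "enat (len n w) <= Sup ?A" by (rule Sup_upper)
 qed
 then show ?thesis unfolding krull_dim_def .
qed

section \<open>Components of the singular locus\<close>

lemma singular_locus_cell:
 assumes v: "v permutes {1..n}" and w: "w permutes {1..n}" and p: "p \<in> schubert_cell n v" and vw: "bruhat_le v w"
 shows "p \<in> singular_locus (subspace_on (flag_variety n) (schubert_variety n w)) \<longleftrightarrow> tdim n v w ~= len n w"
proof -
 let ?S = "subspace_on (flag_variety n) (schubert_variety n w)"
 have t: "topo ?S = subtopology (flag_top n) (schubert_variety n w)" by (simp add: subspace_on_def)
 have "p \<in> schubert_variety n w" by (rule subsetD[OF cell_subset_if_bruhat[OF v w vw] p])
 then have "p \<in> topspace (topo ?S)" unfolding t using schubert_flags[of n w] by (auto simp: topspace_flag)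
 then show ?thesis
  unfolding singular_locus_def mem_Collect_eq schubert_tangent_dim[OF v w vw p] t schubert_krull_dim[OF w] by simp
qed

lemma irreducible_finite_union:
 assumes Z: "irreducible_subset T Z" and I: "finite I" and c: "\<forall>i\<in>I. closedin T (X i)" and sub: "Z \<subseteq> (\<Union>i\<in>I. X i)"
 shows "\<exists>i\<in>I. Z \<subseteq> X i"
 using I c sub
proof (induction I)
 case empty
 then show ?case using Z by (auto simp: irreducible_subset_def)
next
 case (insert i I)
 have "closedin T (\<Union>i\<in>I. X i)" using insert by (intro closedin_Union) auto
 then have "Z \<subseteq> X i \<or> Z \<subseteq> (\<Union>i\<in>I. X i)"
  using insert.prems by (intro irreducible_subsetD[OF Z]) auto
 then show ?case using insert by auto
qed

text \<open>
The singular locus is a union of cells, closed downwards because the tangent count is antitone. So it is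
a finite union of Schubert varieties, and its components are the maximal ones.
\<close>

theorem schubert_component_iff:
 assumes x: "x permutes {1..n}" and w: "w permutes {1..n}"
 shows "schubert_variety n x \<in> irreducible_components (flag_top n)
   (singular_locus (subspace_on (flag_variety n) (schubert_variety n w))) \<longleftrightarrow>
  bruhat_le x w & tdim n x w ~= len n w \<and>
   (\<forall>v. v permutes {1..n} & bruhat_le x v & bruhat_le v w & tdim n v w ~= len n w --> v = x)"
proof -
 let ?T = "flag_top n"
 define S where "S = singular_locus (subspace_on (flag_variety n) (schubert_variety n w))"
 define V where "V = {v. v permutes {1..n} & bruhat_le v w & tdim n v w ~= len n w}"
 have SX: "S \<subseteq> schubert_variety n w" by (auto simp: S_def singular_locus_def subspace_on_def)
 have cell_in_S: "p \<in> S \<longleftrightarrow> v \<in> V" if "v permutes {1..n}" "bruhat_le v w" "p \<in> schubert_cell n v" for v p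
  using singular_locus_cell[OF that(1) w that(3,2)] that by (simp add: S_def V_def)
 have down: "u \<in> V" if v: "v \<in> V" and u: "u permutes {1..n}" "bruhat_le u v" for u v
 proof -
  have "v permutes {1..n}" "bruhat_le v w" "tdim n v w ~= len n w" using v by (auto simp: V_def)
  moreover from this have "len n w <= tdim n v w" "tdim n v w <= tdim n u w" using len_le_tdim w tdim_antimono u by blast+
  moreover have "bruhat_le u w" using u(2) calculation(2) by (rule bruhat_le_trans)
  ultimately show ?thesis using u by (simp add: V_def)
 qed
 have XS: "schubert_variety n v \<subseteq> S" if v: "v \<in> V" for v
 proof
  fix p assume p: "p \<in> schubert_variety n v"
  have vp: "v permutes {1..n}" "bruhat_le v w" using v by (auto simp: V_def)
  obtain u where u: "u permutes {1..n}" "bruhat_le u v" "p \<in> schubert_cell n u" by (rule schubert_in_cell[OF vp(1) p])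
  show "p \<in> S" using cell_in_S[OF u(1) bruhat_le_trans[OF u(2) vp(2)] u(3)] down[OF v u(1,2)] by simp
 qed
 have SV: "S \<subseteq> (\<Union>v\<in>V. schubert_variety n v)"
 proof
  fix p assume p: "p \<in> S"
  obtain v where v: "v permutes {1..n}" "bruhat_le v w" "p \<in> schubert_cell n v" by (rule schubert_in_cell[OF w subsetD[OF SX p]])
  have "v \<in> V" using cell_in_S[OF v] p by simp
  then show "p \<in> (\<Union>v\<in>V. schubert_variety n v)" using subsetD[OF cell_subset_schubert[OF v(1)] v(3)] by blast
 qed
 have finV: "finite V" by (rule finite_subset[OF _ finite_permutations[of "{1..n}"]]) (auto simp: V_def)
 have xV: "x \<in> V" if "schubert_variety n x \<subseteq> S"
 proof -
  have e: "flag_proj n (1\<^sub>m n * perm_rep n x) \<in> schubert_cell n x" by (rule cell_in[OF borel_one])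
  have m: "flag_proj n (1\<^sub>m n * perm_rep n x) \<in> S" by (rule subsetD[OF that subsetD[OF cell_subset_schubert[OF x] e]])
  have "bruhat_le x w" by (rule cell_meets_schubert[OF x w e subsetD[OF SX m]])
  then show ?thesis using cell_in_S[OF x _ e] m by simp
 qed
 have "schubert_variety n x \<in> irreducible_components ?T S \<longleftrightarrow> x \<in> V & (\<forall>v\<in>V. bruhat_le x v --> v = x)"
 proof
  assume "schubert_variety n x \<in> irreducible_components ?T S"
  then have sub: "schubert_variety n x \<subseteq> S" and
   max: "\<forall>Z'. Z' \<subseteq> S & irreducible_subset ?T Z' & schubert_variety n x \<subseteq> Z' --> Z' = schubert_variety n x"
   by (simp_all add: irreducible_components_def)
  have "v = x" if v: "v \<in> V" "bruhat_le x v" for v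
  proof -
   have vp: "v permutes {1..n}" using v by (simp add: V_def)
   have "schubert_variety n x \<subseteq> schubert_variety n v" using schubert_mono[OF x vp] v(2) by simp
   then have "schubert_variety n v = schubert_variety n x"
    using max XS[OF v(1)] schubert_irreducible[OF vp] by blast
   then have "bruhat_le v x" using schubert_mono[OF vp x] by simp
   then show "v = x" by (rule bruhat_le_antisym[OF vp x _ v(2)])
  qed
  then show "x \<in> V & (\<forall>v\<in>V. bruhat_le x v --> v = x)" using xV[OF sub] by blast
 next
  assume h: "x \<in> V & (\<forall>v\<in>V. bruhat_le x v --> v = x)"
  have "Z' = schubert_variety n x" if Z': "Z' \<subseteq> S" "irreducible_subset ?T Z'" "schubert_variety n x \<subseteq> Z'" for Z'
  proof -
   have "\<exists>v\<in>V. Z' \<subseteq> schubert_variety n v"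
    by (rule irreducible_finite_union[OF Z'(2) finV]) (use schubert_closed Z'(1) SV in auto)
   then obtain v where v: "v \<in> V" "Z' \<subseteq> schubert_variety n v" by (elim bexE)
   have vp: "v permutes {1..n}" using v by (simp add: V_def)
   have "bruhat_le x v" using schubert_mono[OF x vp] order_trans[OF Z'(3) v(2)] by simp
   then have "v = x" using h v(1) by blast
   then show ?thesis using v(2) Z'(3) by simp
  qed
  then show "schubert_variety n x \<in> irreducible_components ?T S"
   unfolding irreducible_components_def mem_Collect_eq
   using XS h schubert_irreducible[OF x] by blast
 qed
 then show ?thesis unfolding S_def V_def using x by auto
qed

theorem schubert_component_generic:
 assumes x: "x permutes {1..n}" and w: "w permutes {1..n}"
 shows "schubert_variety n x \<in> irreducible_components (flag_top n)
   (singular_locus (subspace_on (flag_variety n) (schubert_variety n w))) \<longleftrightarrow> generic_singularity n x w"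
 unfolding schubert_component_iff[OF x w] by (rule maximal_singular_iff[OF x w])

section \<open>Interior of the shaded region\<close>

lemma rank_diff_dif:
 assumes "0 <= p" "nat \<lfloor>p\<rfloor> <= n"
 shows "rank_diff n x w p q = dif x w (nat \<lfloor>p\<rfloor>) (nat \<lceil>q\<rceil>)"
proof -
 have "int (rank_fun n f p q) = (\<Sum>i\<in>{1..nat \<lfloor>p\<rfloor>}. of_bool (nat \<lceil>q\<rceil> <= f i))" for f
 proof -
  have "{i \<in> {1..n}. real i <= p & q <= real (f i)} = {i \<in> {1..nat \<lfloor>p\<rfloor>}. nat \<lceil>q\<rceil> <= f i}"
  proof (rule Collect_cong)
   fix i
   have "real i <= p \<longleftrightarrow> i <= nat \<lfloor>p\<rfloor>" using assms(1) by (simp add: le_nat_iff le_floor_iff)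
   moreover have "q <= real (f i) \<longleftrightarrow> nat \<lceil>q\<rceil> <= f i" by (simp add: nat_le_iff ceiling_le_iff)
   ultimately show "i \<in> {1..n} & real i <= p & q <= real (f i) \<longleftrightarrow> i \<in> {1..nat \<lfloor>p\<rfloor>} & nat \<lceil>q\<rceil> <= f i"
    using assms(2) by auto
  qed
  then have "int (rank_fun n f p q) = int (card {i \<in> {1..nat \<lfloor>p\<rfloor>}. nat \<lceil>q\<rceil> <= f i})"
   by (simp add: rank_fun_def)
  also have "\<dots> = (\<Sum>i\<in>{1..nat \<lfloor>p\<rfloor>}. of_bool (nat \<lceil>q\<rceil> <= f i))"
   by (simp add: sum.If_cases of_bool_def Int_def)
  finally show ?thesis .
 qed
 then show ?thesis unfolding rank_diff_def dif_def sum_subtractf by simp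
qed

definition unit_box :: "nat => nat => (real \<times> real) set" where
 "unit_box i j = {real i - 1<..<real i + 1} \<times> {real j - 1<..<real j + 1}"

text \<open>
The open box of side 2 around a common point of \<open>x\<close> and \<open>w\<close> only meets the four cells next to the
point, on which \<open>dif\<close> is constant. Thus a shaded common point is an interior point.
\<close>

lemma unit_box_shaded:
 assumes x: "x permutes {1..n}" and w: "w permutes {1..n}" and i: "i \<in> {1..n}" and e: "x i = w i"
  and d: "1 <= dif x w i (w i)"
 shows "unit_box i (w i) \<subseteq> shaded_region n x w"
proof
 fix z assume "z \<in> unit_box i (w i)"
 then obtain p q where z: "z = (p, q)" and p: "real i - 1 < p" "p < real i + 1" and q: "real (w i) - 1 < q" "q < real (w i) + 1"
  by (auto simp: unit_box_def)
 have i1: "1 <= i" "i <= n" using i by auto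
 have p0: "0 <= p" using p i1 by linarith
 have "\<lfloor>p\<rfloor> = int i - 1 \<or> \<lfloor>p\<rfloor> = int i" using p by linarith
 then have P: "nat \<lfloor>p\<rfloor> = i - 1 \<or> nat \<lfloor>p\<rfloor> = i" by auto
 have "\<lceil>q\<rceil> = int (w i) \<or> \<lceil>q\<rceil> = int (w i) + 1" using q by linarith
 then have Q: "nat \<lceil>q\<rceil> = w i \<or> nat \<lceil>q\<rceil> = Suc (w i)" by auto
 have "dif x w (i - 1) (Suc (w i)) = dif x w i (w i)" by (rule dif_common_point(1)[OF x w i1(1) e])
 moreover have "dif x w (i - 1) r = dif x w i r" for r by (rule dif_common_point(2)[OF x w i1(1) e])
 ultimately have "dif x w (nat \<lfloor>p\<rfloor>) (nat \<lceil>q\<rceil>) = dif x w i (w i)" using P Q by metis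
 then have "1 <= rank_diff n x w p q" using rank_diff_dif[OF p0, of n x w q] P i1 d by auto
 then show "z \<in> shaded_region n x w" by (simp add: z shaded_region_def)
qed

text \<open>
The removed rectangle has its edges on lines through points of \<open>w\<close>, so that it misses the box around a
point outside it; \<open>R = {}\<close> covers the cases without a rectangle.
\<close>

lemma interior_minus_iff:
 assumes x: "x permutes {1..n}" and w: "w permutes {1..n}" and i: "i \<in> {1..n}" and e: "x i = w i"
  and R: "(real i, real (w i)) \<notin> R --> unit_box i (w i) \<inter> R = {}"
 shows "(real i, real (w i)) \<in> interior (shaded_region n x w - R) \<longleftrightarrow> 1 <= dif x w i (w i) & (real i, real (w i)) \<notin> R"
proof
 assume "(real i, real (w i)) \<in> interior (shaded_region n x w - R)"
 then have "(real i, real (w i)) \<in> shaded_region n x w - R" using interior_subset by blast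
 then have m: "1 <= rank_diff n x w (real i) (real (w i))" "(real i, real (w i)) \<notin> R" by (auto simp: shaded_region_def)
 have "rank_diff n x w (real i) (real (w i)) = dif x w i (w i)" using rank_diff_dif[of "real i" n x w "real (w i)"] i by simp
 then show "1 <= dif x w i (w i) & (real i, real (w i)) \<notin> R" using m by simp
next
 assume h: "1 <= dif x w i (w i) & (real i, real (w i)) \<notin> R"
 show "(real i, real (w i)) \<in> interior (shaded_region n x w - R)"
 proof (rule interiorI)
  show "open (unit_box i (w i))" unfolding unit_box_def by (intro open_Times open_greaterThanLessThan)
  show "(real i, real (w i)) \<in> unit_box i (w i)" by (simp add: unit_box_def)
  show "unit_box i (w i) \<subseteq> shaded_region n x w - R"
   using unit_box_shaded[OF x w i e] h R by blast
 qed
qed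

lemma interior_avoids_iff:
 assumes x: "x permutes {1..n}" and w: "w permutes {1..n}" and cr: "cyclic_rearrangement n x w m \<alpha> k \<beta>"
  and s: "\<alpha> ` {1..m} = insert a1 Am" "\<beta> ` {1..k} = insert bk Bm"
  and d: "\<forall>p q. dif x w p q = of_bool (region w a1 Am Bm bk p q)"
 shows "interior_avoids n w m \<alpha> k \<beta> (shaded_region n x w) \<longleftrightarrow> avoids n w a1 Am Bm bk {}"
  and "a1 \<in> \<alpha> ` {1..m} \<union> \<beta> ` {1..k} ==> am \<in> \<alpha> ` {1..m} \<union> \<beta> ` {1..k} ==> bk \<in> \<alpha> ` {1..m} \<union> \<beta> ` {1..k} ==> b1 \<in> \<alpha> ` {1..m} \<union> \<beta> ` {1..k} ==>
   interior_avoids n w m \<alpha> k \<beta> (shaded_region n x w - open_rectangle a1 bk (w am) (w b1)) \<longleftrightarrow>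
   avoids n w a1 Am Bm bk (center w a1 bk b1 am)"
proof -
 let ?S = "\<alpha> ` {1..m} \<union> \<beta> ` {1..k}"
 have e: "x i = w i" if "i \<in> {1..n} - ?S" for i using cr that unfolding cyclic_rearrangement_def by blast
 have d1: "1 <= dif x w i (w i) \<longleftrightarrow> region w a1 Am Bm bk i (w i)" for i using d by (simp add: of_bool_def)
 have "(real i, real (w i)) \<notin> interior (shaded_region n x w) \<longleftrightarrow> ~ region w a1 Am Bm bk i (w i)" if "i \<in> {1..n} - ?S" for i
  using interior_minus_iff[OF x w _ e[OF that], of "{}"] that d1 by simp
 then show "interior_avoids n w m \<alpha> k \<beta> (shaded_region n x w) \<longleftrightarrow> avoids n w a1 Am Bm bk {}"
  unfolding interior_avoids_def avoids_def s[symmetric] by (simp only: Diff_empty cong: ball_cong)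
 assume m: "a1 \<in> ?S" "am \<in> ?S" "bk \<in> ?S" "b1 \<in> ?S"
 let ?R = "open_rectangle a1 bk (w am) (w b1)"
 have c: "(real i, real (w i)) \<in> ?R \<longleftrightarrow> i \<in> center w a1 bk b1 am" for i
  by (auto simp: open_rectangle_def center_def)
 have wi: "w i = w j \<longleftrightarrow> i = j" for i j using permutes_inj[OF w] by (auto dest: injD)
 have "(real i, real (w i)) \<notin> interior (shaded_region n x w - ?R) \<longleftrightarrow> (i \<notin> center w a1 bk b1 am --> ~ region w a1 Am Bm bk i (w i))"
  if i: "i \<in> {1..n} - ?S" for i
 proof -
  have ne: "i ~= a1" "i ~= bk" "w i ~= w am" "w i ~= w b1" using i m wi by blast+
  have "(real i, real (w i)) \<notin> ?R --> unit_box i (w i) \<inter> ?R = {}"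
  proof
   assume "(real i, real (w i)) \<notin> ?R"
   then have "i <= a1 \<or> bk <= i \<or> w i <= w am \<or> w b1 <= w i" by (auto simp: open_rectangle_def)
   then have "real i + 1 <= real a1 \<or> real bk <= real i - 1 \<or> real (w i) + 1 <= real (w am) \<or> real (w b1) <= real (w i) - 1"
    using ne by linarith
   then show "unit_box i (w i) \<inter> ?R = {}" by (auto simp: unit_box_def open_rectangle_def)
  qed
  from interior_minus_iff[OF x w _ e[OF i] this] show ?thesis using i d1[of i] c[of i] by auto
 qed
 then show "interior_avoids n w m \<alpha> k \<beta> (shaded_region n x w - ?R) \<longleftrightarrow> avoids n w a1 Am Bm bk (center w a1 bk b1 am)"
  unfolding interior_avoids_def avoids_def s[symmetric] by (auto cong: ball_cong)
qed

lemma antimono_on_iff_decr: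
 assumes "strict_mono_on {1..m} \<alpha>"
 shows "strict_antimono_on {1..m} (w \<circ> \<alpha>) \<longleftrightarrow> decr w (\<alpha> ` {1..m::nat})"
proof
 assume h: "strict_antimono_on {1..m} (w \<circ> \<alpha>)"
 show "decr w (\<alpha> ` {1..m})"
  unfolding decr_def
 proof (intro ballI impI)
  fix i j assume "i \<in> \<alpha> ` {1..m}" "j \<in> \<alpha> ` {1..m}" "i < j"
  then obtain a b where ab: "a \<in> {1..m}" "b \<in> {1..m}" "i = \<alpha> a" "j = \<alpha> b" "\<alpha> a < \<alpha> b" by blast
  have "a < b" using strict_mono_on_less[OF assms ab(1,2)] ab(5) by simp
  then show "w j < w i" using monotone_onD[OF h ab(1,2)] ab(3,4) by simp
 qed
next
 assume h: "decr w (\<alpha> ` {1..m})"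
 show "strict_antimono_on {1..m} (w \<circ> \<alpha>)"
 proof (rule monotone_onI)
  fix a b assume "a \<in> {1..m}" "b \<in> {1..m}" "a < b"
  then show "(w \<circ> \<alpha>) b < (w \<circ> \<alpha>) a" using h strict_mono_onD[OF assms, of a b] unfolding decr_def by simp
 qed
qed

lemma increasing_decreasing_iff:
 "increasing_positions_decreasing_values n w m \<alpha> \<longleftrightarrow> \<alpha> ` {1..m} \<subseteq> {1..n} & strict_mono_on {1..m} \<alpha> & decr w (\<alpha> ` {1..m})"
 unfolding increasing_positions_decreasing_values_def using antimono_on_iff_decr by blast

lemma cyc_dataI:
 assumes "2 <= m" "2 <= k" "strict_mono_on {1..m} \<alpha>" "strict_mono_on {1..k} \<beta>"
 shows "cyc_data n w (\<alpha> 1) (\<alpha> ` {2..m}) (\<beta> ` {1..k-1}) (\<beta> k) m \<alpha> k \<beta>"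
 using assms by (simp add: cyc_data_def)

lemma cyc_sequences:
 assumes c0: "conf0 n w a1 Am Bm bk" and cd: "cyc_data n w a1 Am Bm bk m \<alpha> k \<beta>"
  and dis: "insert a1 Am \<inter> insert bk Bm = {}"
 shows "increasing_positions_decreasing_values n w m \<alpha>" "increasing_positions_decreasing_values n w k \<beta>"
  "\<alpha> ` {1..m} \<inter> \<beta> ` {1..k} = {}"
proof -
 note s = cyc_data_sets[OF cd]
 note c = conf0D[OF c0]
 have a: "insert a1 Am \<subseteq> {1..n}" using c(5,9,12) by fastforce
 have b: "insert bk Bm \<subseteq> {1..n}" using c(6,8,13) by fastforce
 have "decr w (insert a1 Am)" using c(3,9) unfolding decr_def by (metis insert_iff less_asym)
 then show "increasing_positions_decreasing_values n w m \<alpha>"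
  unfolding increasing_decreasing_iff s using a cd by (simp add: cyc_data_def)
 have "decr w (insert bk Bm)" using c(4,8) unfolding decr_def by (metis insert_iff less_asym)
 then show "increasing_positions_decreasing_values n w k \<beta>"
  unfolding increasing_decreasing_iff s using b cd by (simp add: cyc_data_def)
 show "\<alpha> ` {1..m} \<inter> \<beta> ` {1..k} = {}" unfolding s by (rule dis)
qed

section \<open>Configurations as pairs of sequences\<close>

lemma decr_subset:
 assumes "decr w S" "T \<subseteq> S"
 shows "decr w T"
 unfolding decr_def
proof (intro ballI impI)
 fix i j assume "i \<in> T" "j \<in> T" "i < j"
 then show "w j < w i" using assms(1) subsetD[OF assms(2)] unfolding decr_def by simp
qed

lemma decreasing_sequenceD:
 assumes "increasing_positions_decreasing_values n w m \<alpha>"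
 shows "\<alpha> ` {1..m} \<subseteq> {1..n}" "strict_mono_on {1..m} \<alpha>" "I \<subseteq> {1..m} ==> decr w (\<alpha> ` I)"
  "1 <= i ==> i < j ==> j <= m ==> w (\<alpha> j) < w (\<alpha> i)" "1 <= i ==> i < j ==> j <= m ==> \<alpha> i < \<alpha> j"
proof -
 have d: "\<alpha> ` {1..m} \<subseteq> {1..n}" "strict_mono_on {1..m} \<alpha>" "decr w (\<alpha> ` {1..m})" "strict_antimono_on {1..m} (w \<circ> \<alpha>)"
  using assms increasing_decreasing_iff[of n w m \<alpha>] by (auto simp: increasing_positions_decreasing_values_def)
 show "\<alpha> ` {1..m} \<subseteq> {1..n}" "strict_mono_on {1..m} \<alpha>" by fact+
 show "decr w (\<alpha> ` I)" if "I \<subseteq> {1..m}" by (rule decr_subset[OF d(3) image_mono[OF that]])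
 show "w (\<alpha> j) < w (\<alpha> i)" "\<alpha> i < \<alpha> j" if "1 <= i" "i < j" "j <= m"
  using monotone_onD[OF d(4), of i j] monotone_onD[OF d(2), of i j] that by simp_all
qed

lemma conf1_case:
 assumes c: "conf1 n w a1 Am Bm bk" and cd: "cyc_data n w a1 Am Bm bk m \<alpha> k \<beta>"
 shows "case_4231 w m \<alpha> k \<beta>"
proof -
 note D = conf1D[OF c]
 have e: "2 <= m" "2 <= k" "\<alpha> 1 = a1" "\<beta> k = bk" "\<alpha> ` {2..m} = Am" "\<beta> ` {1..k-1} = Bm" using cd by (auto simp: cyc_data_def)
 have A: "\<alpha> i \<in> Am" if "i \<in> {2..m}" for i using e(5) that by blast
 have B: "\<beta> j \<in> Bm" if "j \<in> {1..k-1}" for j using e(6) that by blast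
 show "case_4231 w m \<alpha> k \<beta>"
  unfolding case_4231_def
 proof (intro conjI ballI)
  fix j i assume "j \<in> {1..k-1}" "i \<in> {2..m}"
  then show "\<beta> j < \<alpha> i" using D(3)[OF B A] by simp
 next
  fix j assume "j \<in> {1..k-1}" then show "\<alpha> 1 < \<beta> j" using D(1)[OF B] e(3) by simp
 next
  fix i assume "i \<in> {2..m}" then show "\<alpha> i < \<beta> k" using D(2)[OF A] e(4) by simp
 next
  show "w (\<beta> 1) < w (\<alpha> m)" using D(3)[OF B[of 1] A[of m]] e(1,2) by simp
 qed (use e in auto)
qed

lemma case_conf1:
 assumes a: "increasing_positions_decreasing_values n w m \<alpha>" and b: "increasing_positions_decreasing_values n w k \<beta>"
  and c: "case_4231 w m \<alpha> k \<beta>"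
 shows "conf1 n w (\<alpha> 1) (\<alpha> ` {2..m}) (\<beta> ` {1..k-1}) (\<beta> k)"
proof -
 note c' = c[unfolded case_4231_def]
 have mk: "2 <= k" "2 <= m" and wm: "w (\<beta> 1) < w (\<alpha> m)" using c' by simp_all
 have bj: "\<alpha> 1 < \<beta> j" "i \<in> {2..m} ==> \<beta> j < \<alpha> i" if "j \<in> {1..k-1}" for i j using c' that by blast+
 have ai: "\<alpha> i < \<beta> k" if "i \<in> {2..m}" for i using c' that by blast
 note ia = decreasing_sequenceD[OF a] and ib = decreasing_sequenceD[OF b]
 note wa = ia(4,5) and wb = ib(4,5)
 show ?thesis
  unfolding conf1_def
 proof (intro conjI ballI)
  show "\<alpha> ` {2..m} ~= {}" "\<beta> ` {1..k-1} ~= {}" using mk by auto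
  show "decr w (\<alpha> ` {2..m})" by (rule ia(3)) auto
  show "decr w (\<beta> ` {1..k-1})" by (rule ib(3)) auto
  have "\<alpha> 1 \<in> {1..n}" by (rule subsetD[OF ia(1)], rule imageI) (use mk in simp)
  then show "1 <= \<alpha> 1" by simp
  have "\<beta> k \<in> {1..n}" by (rule subsetD[OF ib(1)], rule imageI) (use mk in simp)
  then show "\<beta> k <= n" by simp
 next
  fix z assume "z \<in> \<beta> ` {1..k-1}"
  then obtain j where j: "j \<in> {1..k-1}" "z = \<beta> j" by blast
  then have jk: "1 <= j" "j < k" by auto
  then show "\<alpha> 1 < z" "z < \<beta> k" "w (\<beta> k) < w z" using bj(1)[OF j(1)] wb[of j k] j(2) by auto
  fix y assume "y \<in> \<alpha> ` {2..m}"
  then obtain i where i: "i \<in> {2..m}" "y = \<alpha> i" by blast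
  show "z < y" using bj(2)[OF j(1) i(1)] i j by simp
  have "w (\<beta> j) <= w (\<beta> 1)" using wb(1)[of 1 j] jk by (cases "j = 1") auto
  moreover have "w (\<alpha> m) <= w (\<alpha> i)" using wa(1)[of i m] i(1) by (cases "i = m") auto
  ultimately show "w z < w y" using wm i j by simp
 next
  fix y assume "y \<in> \<alpha> ` {2..m}"
  then obtain i where i: "i \<in> {2..m}" "y = \<alpha> i" by blast
  show "\<alpha> 1 < y" "y < \<beta> k" "w y < w (\<alpha> 1)" using wa[of 1 i] ai[OF i(1)] i by auto
 qed
qed

lemma conf2_case:
 assumes c: "conf2 n w a1 Am Bm bk b1 am" and cd: "cyc_data n w a1 Am Bm bk m \<alpha> k \<beta>"
 shows "case_3412 w m \<alpha> k \<beta>" "\<beta> 1 = b1" "\<alpha> m = am"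
proof -
 note D = conf2D[OF c]
 have e: "2 <= m" "2 <= k" "\<alpha> 1 = a1" "\<beta> k = bk" "\<alpha> ` {2..m} = Am" "\<beta> ` {1..k-1} = Bm"
  "strict_mono_on {1..m} \<alpha>" "strict_mono_on {1..k} \<beta>" using cd by (auto simp: cyc_data_def)
 have A: "\<alpha> i \<in> Am" if "i \<in> {2..m}" for i using e(5) that by blast
 have B: "\<beta> j \<in> Bm" if "j \<in> {1..k-1}" for j using e(6) that by blast
 show b1: "\<beta> 1 = b1"
 proof -
  obtain j where j: "j \<in> {1..k-1}" "b1 = \<beta> j" using D(2) e(6) by blast
  have "b1 <= \<beta> 1" using D(9)[OF B[of 1]] e(2) by simp
  moreover have "\<beta> 1 < \<beta> j" if "j ~= 1" using strict_mono_onD[OF e(8), of 1 j] j that by auto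
  ultimately show ?thesis using j(2) by fastforce
 qed
 show am: "\<alpha> m = am"
 proof -
  obtain i where i: "i \<in> {2..m}" "am = \<alpha> i" using D(1) e(5) by blast
  have "\<alpha> m <= am" using D(10)[OF A[of m]] e(1) by simp
  moreover have "\<alpha> i < \<alpha> m" if "i ~= m" using strict_mono_onD[OF e(7), of i m] i that by auto
  ultimately show ?thesis using i(2) by fastforce
 qed
 show "case_3412 w m \<alpha> k \<beta>"
  unfolding case_3412_def
 proof (intro conjI ballI)
  fix j assume "j \<in> {1..k-1}" then show "\<beta> j < \<alpha> 1" using D(9)[OF B] e(3) by simp
 next
  fix i assume "i \<in> {2..m}" then show "\<beta> k < \<alpha> i" using D(10)[OF A] e(4) by simp
 next
  show "w (\<beta> 1) < w (\<alpha> (m - 1))"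
  proof (cases "m = 2")
   case True then show ?thesis using D(8) e(3) b1 by simp
  next
   case False
   then have "\<alpha> (m - 1) \<in> Am" using A[of "m - 1"] e(1) by auto
   moreover have "\<alpha> (m - 1) < \<alpha> m" by (rule strict_mono_onD[OF e(7)]) (use e(1) in auto)
   then have "\<alpha> (m - 1) ~= am" using am by simp
   ultimately show ?thesis using D(10)[of "\<alpha> (m - 1)"] b1 by simp
  qed
  show "w (\<beta> 2) < w (\<alpha> m)"
  proof (cases "k = 2")
   case True then show ?thesis using D(6) e(4) am by simp
  next
   case False
   then have "\<beta> 2 \<in> Bm" using B[of 2] e(2) by auto
   moreover have "\<beta> 1 < \<beta> 2" by (rule strict_mono_onD[OF e(8)]) (use e(2) in auto)
   then have "\<beta> 2 ~= b1" using b1 by simp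
   ultimately show ?thesis using D(9)[of "\<beta> 2"] am by simp
  qed
  show "w (\<alpha> m) < w (\<beta> 1)" using D(7) b1 am by simp
 qed (use e D(5) in auto)
qed

lemma case_conf2:
 assumes a: "increasing_positions_decreasing_values n w m \<alpha>" and b: "increasing_positions_decreasing_values n w k \<beta>"
  and c: "case_3412 w m \<alpha> k \<beta>"
 shows "conf2 n w (\<alpha> 1) (\<alpha> ` {2..m}) (\<beta> ` {1..k-1}) (\<beta> k) (\<beta> 1) (\<alpha> m)"
proof -
 note c' = c[unfolded case_3412_def]
 have mk: "2 <= k" "2 <= m" and ab: "\<alpha> 1 < \<beta> k"
  and wm: "w (\<beta> 1) < w (\<alpha> (m - 1))" "w (\<alpha> m) < w (\<beta> 1)" "w (\<beta> 2) < w (\<alpha> m)" using c' by simp_all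
 have bj: "\<beta> j < \<alpha> 1" if "j \<in> {1..k-1}" for j using c' that by blast
 have ai: "\<beta> k < \<alpha> i" if "i \<in> {2..m}" for i using c' that by blast
 note ia = decreasing_sequenceD[OF a] and ib = decreasing_sequenceD[OF b]
 note wa = ia(4,5) and wb = ib(4,5)
 have wa1: "w (\<alpha> (m - 1)) <= w (\<alpha> i)" if "1 <= i" "i < m" for i
 proof (cases "i = m - 1")
  case False
  then have "i < m - 1" using that by simp
  then show ?thesis using wa(1)[of i "m - 1"] that by simp
 qed simp
 have wb2: "w (\<beta> j) <= w (\<beta> 2)" if "2 <= j" "j <= k" for j
  using wb(1)[of 2 j] that by (cases "j = 2") auto
 show ?thesis
  unfolding conf2_def
 proof (intro conjI ballI)
  show "\<alpha> m \<in> \<alpha> ` {2..m}" "\<beta> 1 \<in> \<beta> ` {1..k-1}" using mk by auto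
  show "decr w (\<alpha> ` {2..m})" by (rule ia(3)) auto
  show "decr w (\<beta> ` {1..k-1})" by (rule ib(3)) auto
  show "\<alpha> 1 < \<beta> k" by (rule ab)
  show "w (\<beta> k) < w (\<alpha> m)" using wb2[of k] wm(3) mk by simp
  show "w (\<alpha> m) < w (\<beta> 1)" by (rule wm(2))
  show "w (\<beta> 1) < w (\<alpha> 1)" using wa1[of 1] wm(1) mk by simp
 next
  fix z assume "z \<in> \<beta> ` {1..k-1}"
  then obtain j where j: "j \<in> {1..k-1}" "z = \<beta> j" by blast
  then have jk: "1 <= j" "j < k" by auto
  then show "z < \<alpha> 1" "w (\<beta> k) < w z" using bj(1)[OF j(1)] wb[of j k] j(2) by auto
  have "\<beta> j \<in> {1..n}" by (rule subsetD[OF ib(1)], rule imageI) (use \<open>1 \<le> j\<close> \<open>j < k\<close> in simp)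
  then show "1 <= z" using j by simp
 next
  fix y assume "y \<in> \<alpha> ` {2..m}"
  then obtain i where i: "i \<in> {2..m}" "y = \<alpha> i" by blast
  show "\<beta> k < y" "w y < w (\<alpha> 1)" using wa[of 1 i] ai[OF i(1)] i by auto
  have "\<alpha> i \<in> {1..n}" by (rule subsetD[OF ia(1)], rule imageI) (use i(1) in simp)
  then show "y <= n" using i by simp
 next
  fix y assume y: "y \<in> \<alpha> ` {2..m} - {\<alpha> m}"
  then obtain i where i: "i \<in> {2..m}" "y = \<alpha> i" by blast
  have "i ~= m" using y i(2) by auto
  then have "1 <= i" "i < m" using i by auto
  then show "w (\<beta> 1) < w y" using wa1[of i] i(2) wm(1) by simp
 next
  fix z assume z: "z \<in> \<beta> ` {1..k-1} - {\<beta> 1}"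
  then obtain j where j: "j \<in> {1..k-1}" "z = \<beta> j" by blast
  have "j ~= 1" using z j(2) by auto
  then have "2 <= j" "j <= k" using j by auto
  then show "w z < w (\<alpha> m)" using wb2[of j] wm(3) j(2) by simp
 qed
qed

lemma case_45312_iff:
 "case_45312 n w m \<alpha> k \<beta> \<longleftrightarrow> m = 2 & k = 2 & case_3412 w 2 \<alpha> 2 \<beta> \<and>
  (\<forall>i\<in>{1..n}. \<forall>j\<in>{1..n}. i \<in> center w (\<alpha> 1) (\<beta> 2) (\<beta> 1) (\<alpha> 2) & j \<in> center w (\<alpha> 1) (\<beta> 2) (\<beta> 1) (\<alpha> 2) & i < j --> w j < w i)"
 unfolding case_45312_def case_3412_def center_def open_rectangle_def by auto

theorem generic_singularity_iff:
 assumes x: "x permutes {1..n}" and w: "w permutes {1..n}"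
 shows "generic_singularity n x w \<longleftrightarrow>
  (\<exists>m k \<alpha> \<beta>.
    m \<ge> 1 & k \<ge> 1 \<and>
    increasing_positions_decreasing_values n w m \<alpha> \<and>
    increasing_positions_decreasing_values n w k \<beta> \<and>
    \<alpha> ` {1..m} \<inter> \<beta> ` {1..k} = {} \<and>
    cyclic_rearrangement n x w m \<alpha> k \<beta> \<and>
    ((case_4231 w m \<alpha> k \<beta> \<and>
      interior_avoids n w m \<alpha> k \<beta> (shaded_region n x w)) \<or>
    (case_3412 w m \<alpha> k \<beta> \<and>
      interior_avoids n w m \<alpha> k \<beta> (shaded_region n x w)) \<or>
    (case_45312 n w m \<alpha> k \<beta> \<and>
      interior_avoids n w m \<alpha> k \<beta> (shaded_region n x w - rectangle_45312 w \<alpha> \<beta>))))" (is "_ \<longleftrightarrow> ?R" is "_ \<longleftrightarrow> (\<exists>m k \<alpha> \<beta>. _ & _ & _ & _ & _ & _ & ?C m k \<alpha> \<beta>)")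
proof
 assume "generic_singularity n x w"
 then obtain a1 Am Bm bk where g: "generic_conf n w a1 Am Bm bk" and d: "\<forall>p q. dif x w p q = of_bool (region w a1 Am Bm bk p q)"
  unfolding generic_singularity_def by (elim exE conjE)
 obtain y m \<alpha> k \<beta> where y: "y permutes {1..n}" "cyc_data n w a1 Am Bm bk m \<alpha> k \<beta>" "cyclic_rearrangement n y w m \<alpha> k \<beta>"
  "\<And>p q. dif y w p q = of_bool (region w a1 Am Bm bk p q)"
  by (rule generic_conf_perm[OF g w]) (rule that)
 have "x = y" by (rule dif_eq_imp_eq[OF x y(1), of w]) (simp add: d y(4))
 then have cr: "cyclic_rearrangement n x w m \<alpha> k \<beta>" using y(3) by simp
 note cd = y(2)
 note s = cyc_data_sets[OF cd]
 note av = interior_avoids_iff[OF x w cr s d]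
 have c0: "conf0 n w a1 Am Bm bk" by (rule generic_conf_conf0[OF g])
 have mk: "2 <= m" "2 <= k" using cd by (simp_all add: cyc_data_def)
 consider "conf1 n w a1 Am Bm bk" "avoids n w a1 Am Bm bk {}"
  | b1 am where "conf2 n w a1 Am Bm bk b1 am" "avoids n w a1 Am Bm bk {}"
  | b1 am where "conf2 n w a1 Am Bm bk b1 am" "Am = {am}" "Bm = {b1}" "decr w (center w a1 bk b1 am)" "avoids n w a1 Am Bm bk (center w a1 bk b1 am)"
  using g unfolding generic_conf_def by blast
 then have "?C m k \<alpha> \<beta>"
 proof cases
  case 1
  then show ?thesis using conf1_case[OF 1(1) cd] av(1) by simp
 next
  case 2
  then show ?thesis using conf2_case(1)[OF 2(1) cd] av(1) by simp
 next
  case 3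
  note D = conf2_case[OF 3(1) cd]
  have \<alpha>m: "\<alpha> 1 = a1" "\<beta> k = bk" "\<alpha> ` {2..m} = {am}" "\<beta> ` {1..k-1} = {b1}" "strict_mono_on {1..m} \<alpha>" "strict_mono_on {1..k} \<beta>"
   using cd 3(2,3) by (simp_all add: cyc_data_def)
  have m2: "m = 2"
  proof (rule ccontr)
   assume "m ~= 2"
   then have "2 \<in> {2..m}" "m \<in> {2..m}" "2 < m" using mk by auto
   then have "\<alpha> 2 \<in> \<alpha> ` {2..m}" "\<alpha> m \<in> \<alpha> ` {2..m}" by blast+
   then have "\<alpha> 2 = \<alpha> m" unfolding \<alpha>m(3) by simp
   then show False using strict_mono_onD[OF \<alpha>m(5), of 2 m] \<open>2 < m\<close> by simp
  qed
  have k2: "k = 2"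
  proof (rule ccontr)
   assume "k ~= 2"
   then have "1 \<in> {1..k-1}" "2 \<in> {1..k-1}" using mk by auto
   then have "\<beta> 1 \<in> \<beta> ` {1..k-1}" "\<beta> 2 \<in> \<beta> ` {1..k-1}" by blast+
   then have "\<beta> 1 = \<beta> 2" unfolding \<alpha>m(4) by simp
   then show False using strict_mono_onD[OF \<alpha>m(6), of 1 2] mk by simp
  qed
  have "case_45312 n w m \<alpha> k \<beta>"
   unfolding case_45312_iff
   using D 3(4) \<alpha>m m2 k2 by (simp add: decr_def)
  moreover have "interior_avoids n w m \<alpha> k \<beta> (shaded_region n x w - rectangle_45312 w \<alpha> \<beta>)"
  proof -
   have "interior_avoids n w m \<alpha> k \<beta> (shaded_region n x w - open_rectangle a1 bk (w am) (w b1))"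
    using av(2)[of am b1] 3(2,3,5) s by blast
   then show ?thesis using D(2,3) \<alpha>m(1,2) m2 k2 by simp
  qed
  ultimately show ?thesis by blast
 qed
 moreover note cyc_sequences[OF c0 cd conf0_support(2)[OF c0]]
 ultimately show ?R
  using cr mk by (intro exI[of _ m] exI[of _ k] exI[of _ \<alpha>] exI[of _ \<beta>] conjI) simp_all
next
 assume ?R
 then obtain m k \<alpha> \<beta> where a: "increasing_positions_decreasing_values n w m \<alpha>" and b: "increasing_positions_decreasing_values n w k \<beta>"
  and cr: "cyclic_rearrangement n x w m \<alpha> k \<beta>"
  and cases: "?C m k \<alpha> \<beta>"
  by (elim exE conjE)
 have mono: "strict_mono_on {1..m} \<alpha>" "strict_mono_on {1..k} \<beta>"
  using a b by (simp_all add: increasing_positions_decreasing_values_def)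
 have mk: "2 <= m" "2 <= k" using cases by (auto simp: case_4231_def case_3412_def case_45312_def)
 let ?A = "\<alpha> ` {2..m}" and ?B = "\<beta> ` {1..k-1}"
 have cd: "cyc_data n w (\<alpha> 1) ?A ?B (\<beta> k) m \<alpha> k \<beta>" by (rule cyc_dataI[OF mk mono])
 note s = cyc_data_sets[OF cd]
 have fin: "generic_singularity n x w" if c0: "conf0 n w (\<alpha> 1) ?A ?B (\<beta> k)"
  and g: "(\<forall>p q. dif x w p q = of_bool (region w (\<alpha> 1) ?A ?B (\<beta> k) p q)) ==> generic_conf n w (\<alpha> 1) ?A ?B (\<beta> k)"
 proof -
  have d: "\<forall>p q. dif x w p q = of_bool (region w (\<alpha> 1) ?A ?B (\<beta> k) p q)"
   using cyc_dif[OF c0 cd cr x w] by blast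
  show ?thesis unfolding generic_singularity_def using g[OF d] d by blast
 qed
 from cases consider "case_4231 w m \<alpha> k \<beta>" "interior_avoids n w m \<alpha> k \<beta> (shaded_region n x w)"
  | "case_3412 w m \<alpha> k \<beta>" "interior_avoids n w m \<alpha> k \<beta> (shaded_region n x w)"
  | "case_45312 n w m \<alpha> k \<beta>" "interior_avoids n w m \<alpha> k \<beta> (shaded_region n x w - rectangle_45312 w \<alpha> \<beta>)" by blast
 then show "generic_singularity n x w"
 proof cases
  case 1
  have c: "conf1 n w (\<alpha> 1) ?A ?B (\<beta> k)" by (rule case_conf1[OF a b 1(1)])
  show ?thesis
  proof (rule fin[OF conf1_conf0[OF c]])
   assume d: "\<forall>p q. dif x w p q = of_bool (region w (\<alpha> 1) ?A ?B (\<beta> k) p q)"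
   show "generic_conf n w (\<alpha> 1) ?A ?B (\<beta> k)"
    unfolding generic_conf_def using c interior_avoids_iff(1)[OF x w cr s d] 1(2) by simp
  qed
 next
  case 2
  have c: "conf2 n w (\<alpha> 1) ?A ?B (\<beta> k) (\<beta> 1) (\<alpha> m)" by (rule case_conf2[OF a b 2(1)])
  show ?thesis
  proof (rule fin[OF conf2_conf0[OF c]])
   assume d: "\<forall>p q. dif x w p q = of_bool (region w (\<alpha> 1) ?A ?B (\<beta> k) p q)"
   have "avoids n w (\<alpha> 1) ?A ?B (\<beta> k) {}" using interior_avoids_iff(1)[OF x w cr s d] 2(2) by simp
   then show "generic_conf n w (\<alpha> 1) ?A ?B (\<beta> k)"
    unfolding generic_conf_def using c by blast
  qed
 next
  case 3
  have m2: "m = 2" "k = 2" and c3: "case_3412 w m \<alpha> k \<beta>"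
   and dc: "\<forall>i\<in>{1..n}. \<forall>j\<in>{1..n}. i \<in> center w (\<alpha> 1) (\<beta> 2) (\<beta> 1) (\<alpha> 2) & j \<in> center w (\<alpha> 1) (\<beta> 2) (\<beta> 1) (\<alpha> 2) & i < j --> w j < w i"
   using 3(1) unfolding case_45312_iff by blast+
  have c: "conf2 n w (\<alpha> 1) ?A ?B (\<beta> k) (\<beta> 1) (\<alpha> m)" by (rule case_conf2[OF a b c3])
  have AB: "?A = {\<alpha> m}" "?B = {\<beta> 1}" using m2 by auto
  have "\<beta> ` {1..k} \<subseteq> {1..n}" using b by (simp add: increasing_positions_decreasing_values_def)
  then have "\<beta> 2 \<in> {1..n}" by (rule subsetD) (rule imageI, use m2 in simp)
  then have "center w (\<alpha> 1) (\<beta> 2) (\<beta> 1) (\<alpha> 2) \<subseteq> {1..n}"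
   by (auto simp: center_def)
  then have dd: "decr w (center w (\<alpha> 1) (\<beta> k) (\<beta> 1) (\<alpha> m))"
   unfolding decr_def m2 using dc by blast
  show ?thesis
  proof (rule fin[OF conf2_conf0[OF c]])
   assume d: "\<forall>p q. dif x w p q = of_bool (region w (\<alpha> 1) ?A ?B (\<beta> k) p q)"
   have "avoids n w (\<alpha> 1) ?A ?B (\<beta> k) (center w (\<alpha> 1) (\<beta> k) (\<beta> 1) (\<alpha> m))"
   proof (rule interior_avoids_iff(2)[OF x w cr s d, THEN iffD1])
    show "interior_avoids n w m \<alpha> k \<beta> (shaded_region n x w - open_rectangle (\<alpha> 1) (\<beta> k) (w (\<alpha> m)) (w (\<beta> 1)))"
     using 3(2) m2 by simp
   qed (use mk in auto)
   then show "generic_conf n w (\<alpha> 1) ?A ?B (\<beta> k)"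
    unfolding generic_conf_def using c AB dd by blast
  qed
 qed
qed

theorem theorem1:
  fixes n :: nat and x w :: "nat \<Rightarrow> nat"
  assumes "x permutes {1..n}" and "w permutes {1..n}"
  shows "schubert_variety n x \<in>
           irreducible_components (topo (flag_variety n))
             (singular_locus (subspace_on (flag_variety n) (schubert_variety n w)))
    \<longleftrightarrow>
    (\<exists>m k \<alpha> \<beta>.
       m \<ge> 1 \<and> k \<ge> 1 \<and>
       increasing_positions_decreasing_values n w m \<alpha> \<and>
       increasing_positions_decreasing_values n w k \<beta> \<and>
       \<alpha> ` {1..m} \<inter> \<beta> ` {1..k} = {} \<and>
       cyclic_rearrangement n x w m \<alpha> k \<beta> \<and>
       ((case_4231 w m \<alpha> k \<beta> \<and>
           interior_avoids n w m \<alpha> k \<beta> (shaded_region n x w)) \<or>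
        (case_3412 w m \<alpha> k \<beta> \<and>
           interior_avoids n w m \<alpha> k \<beta> (shaded_region n x w)) \<or>
        (case_45312 n w m \<alpha> k \<beta> \<and>
           interior_avoids n w m \<alpha> k \<beta> (shaded_region n x w - rectangle_45312 w \<alpha> \<beta>))))"
  unfolding schubert_component_generic[OF assms] by (rule generic_singularity_iff[OF assms])

end
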